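(* Let $1\le p,q<\infty$ and $1\le r\le\infty$. Either let $X_n=H^p_n(H^q_n)$ for all $n\in\mathbb N$, or let $X_n=H^p_n(H^q_n)^*$ for all $n\in\mathbb N$, and put $X^{(r)}=\big(\sum_{n\in\mathbb N}X_n\big)_r$. Then for every $\eta>0$ and every bounded linear operator $T:X^{(r)}\to X^{(r)}$ there exist bounded linear operators $R,S:X^{(r)}\to X^{(r)}$ such that, for $H=T$ or for $H=\mathrm{Id}-T$, $$\mathrm{Id}_{X^{(r)}}=R\,H\,S\qquad\text{and}\qquad \|R\|\,\|S\|\le 2+\eta .$$
   Context: $\mathscr D=\{[k2^{-n},(k+1)2^{-n}):n,k\in\mathbb N_0,\ 0\le k\le 2^n-1\}$ is the set of dyadic intervals in $[0,1)$ and $\mathscr D^{n}=\{I\in\mathscr D:|I|\ge 2^{-n}\}$. For $I\in\mathscr D$, $h_I$ is the $L^\infty$-normalized Haar function: $+1$ on the left half of $I$, $-1$ on the right half, $0$ elsewhere; $h_{I\times J}(x,y)=h_I(x)h_J(y)$. For $1\le p,q<\infty$ and a finite sum $f=\sum_{I\times J}a_{I\times J}h_{I\times J}$ put $$\|f\|_{H^p(H^q)}=\bigg(\int_0^1\Big(\int_0^1\big(\sum_{I\times J}|a_{I\times J}|^2h_{I\times J}^2(x,y)\big)^{q/2}dy\Big)^{p/q}dx\bigg)^{1/p}.$$ $H^p_n(H^q_n)$ is the finite dimensional space $\mathrm{span}\{h_{I\times J}:I,J\in\mathscr D^n\}$ with this norm, and $H^p_n(H^q_n)^*$ is its dual space with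 the dual norm. For Banach spaces $X_n$, $\big(\sum_{n}X_n\big)_r$ is the space of sequences $(f_n)$ with $f_n\in X_n$ and finite norm $\big(\sum_n\|f_n\|^r\big)^{1/r}$ if $r<\infty$, respectively $\sup_n\|f_n\|$ if $r=\infty$. *)

theory Defs
  imports "HOL-Analysis.Analysis" "HOL-Library.Function_Algebras"
begin

section \<open>Normed spaces given by a carrier and a norm\<close>

text \<open>Pointwise scalar multiplication; addition and subtraction of functions are also pointwise.
  Hence functions on the square, functionals and sequences all live in vector spaces.\<close>

instantiation "fun" :: (type, real_vector) real_vector
begin

definition scaleR_fun_def: "c *\<^sub>R f = (\<lambda>x. c *\<^sub>R f x)"

instance
  by standard (simp_all add: scaleR_fun_def fun_eq_iff scaleR_add_right scaleR_add_left)

end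

lemma scaleR_fun_apply [simp]: "(c *\<^sub>R f) x = c *\<^sub>R f x"
  by (simp add: scaleR_fun_def)

text \<open>The spaces depend on the parameters \<open>n\<close>, \<open>p\<close>, \<open>q\<close>, \<open>r\<close>, so they are described by a carrier
  and a norm inside an ambient vector space. Values outside the carrier are irrelevant.\<close>

record 'v nspace =
  vecs :: "'v set"
  nrm :: "'v \<Rightarrow> real"

definition bounded_op ::
  "'v::real_vector nspace \<Rightarrow> 'w::real_vector nspace \<Rightarrow> ('v \<Rightarrow> 'w) \<Rightarrow> bool" where
  "bounded_op X Y T \<longleftrightarrow>
     (\<forall>x\<in>vecs X. T x \<in> vecs Y) \<and>
     (\<forall>x\<in>vecs X. \<forall>y\<in>vecs X. T (x + y) = T x + T y) \<and>
     (\<forall>c. \<forall>x\<in>vecs X. T (c *\<^sub>R x) = c *\<^sub>R T x) \<and>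
     (\<exists>B. \<forall>x\<in>vecs X. nrm Y (T x) \<le> B * nrm X x)"

definition op_norm :: "'v nspace \<Rightarrow> 'w nspace \<Rightarrow> ('v \<Rightarrow> 'w) \<Rightarrow> real" where
  "op_norm X Y T = (SUP x\<in>{x \<in> vecs X. nrm X x \<le> 1}. nrm Y (T x))"

definition real_line :: "real nspace" where
  "real_line = \<lparr>vecs = UNIV, nrm = abs\<rparr>"

text \<open>Functionals are normalised to vanish off the carrier, so that two functionals agreeing on the
  space are equal.\<close>

definition dual_space :: "'v::real_vector nspace \<Rightarrow> ('v \<Rightarrow> real) nspace" where
  "dual_space X =
     \<lparr>vecs = {\<phi>. bounded_op X real_line \<phi> \<and> (\<forall>x. x \<notin> vecs X \<longrightarrow> \<phi> x = 0)},
      nrm = op_norm X real_line\<rparr>"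

text \<open>Sequences are indexed from \<open>0\<close>: a family \<open>X\<^sub>1, X\<^sub>2, \<dots>\<close> enters as
  \<open>\<lambda>n. X (Suc n)\<close>.\<close>

definition lr_sum :: "ereal \<Rightarrow> (nat \<Rightarrow> 'v nspace) \<Rightarrow> (nat \<Rightarrow> 'v) nspace" where
  "lr_sum r X =
     \<lparr>vecs = {f. (\<forall>n. f n \<in> vecs (X n)) \<and>
                 (if r = \<infinity> then bdd_above (range (\<lambda>n. nrm (X n) (f n)))
                  else summable (\<lambda>n. nrm (X n) (f n) powr real_of_ereal r))},
      nrm = (\<lambda>f. if r = \<infinity> then (SUP n. nrm (X n) (f n))
                 else (\<Sum>n. nrm (X n) (f n) powr real_of_ereal r) powr (1 / real_of_ereal r))\<rparr>"


section \<open>The biparameter Haar system\<close>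

definition dyadic :: "real set set" where
  "dyadic = {{real k / 2 ^ n ..< (real k + 1) / 2 ^ n} | k n. k < 2 ^ n}"

definition dyadic_upto :: "nat \<Rightarrow> real set set" where
  "dyadic_upto n = {I \<in> dyadic. measure lborel I \<ge> 1 / 2 ^ n}"

text \<open>For an interval \<open>I\<close>, \<open>(Inf I + Sup I) / 2\<close> is its midpoint.\<close>

definition haar :: "real set \<Rightarrow> real \<Rightarrow> real" where
  "haar I x = (if x \<in> I then (if x < (Inf I + Sup I) / 2 then 1 else - 1) else 0)"

definition haar2 :: "real set \<Rightarrow> real set \<Rightarrow> real \<Rightarrow> real \<Rightarrow> real" where
  "haar2 I J = (\<lambda>x y. haar I x * haar J y)"

definition haar_system :: "(real \<Rightarrow> real \<Rightarrow> real) set" where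
  "haar_system = {haar2 I J | I J. I \<in> dyadic \<and> J \<in> dyadic}"

text \<open>The coefficient \<open>a\<^bsub>I\<times>J\<^esub>\<close> of a finite sum; the system is linearly independent, see
  \<open>independent_haar_system\<close> and \<open>hardy_norm_sum\<close> below.\<close>

definition haar_coeff :: "(real \<Rightarrow> real \<Rightarrow> real) \<Rightarrow> real set \<Rightarrow> real set \<Rightarrow> real" where
  "haar_coeff f I J = representation haar_system f (haar2 I J)"

definition hardy_norm :: "real \<Rightarrow> real \<Rightarrow> (real \<Rightarrow> real \<Rightarrow> real) \<Rightarrow> real" where
  "hardy_norm p q f =
     (LINT x:{0..1}|lborel.
        (LINT y:{0..1}|lborel.
           (\<Sum>(I, J) | I \<in> dyadic \<and> J \<in> dyadic \<and> haar_coeff f I J \<noteq> 0.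
              \<bar>haar_coeff f I J\<bar>\<^sup>2 * (haar2 I J x y)\<^sup>2) powr (q / 2)) powr (p / q)) powr (1 / p)"

definition hardy_space :: "real \<Rightarrow> real \<Rightarrow> nat \<Rightarrow> (real \<Rightarrow> real \<Rightarrow> real) nspace" where
  "hardy_space p q n =
     \<lparr>vecs = span {haar2 I J | I J. I \<in> dyadic_upto n \<and> J \<in> dyadic_upto n},
      nrm = hardy_norm p q\<rparr>"


section \<open>Well-definedness of the Haar coefficients\<close>

lemma haar_dyadic_floor:
  fixes l m :: nat
  shows "haar {real l / 2 ^ m ..< (real l + 1) / 2 ^ m} x =
    (if \<lfloor>2 ^ Suc m * x\<rfloor> = 2 * int l then 1
     else if \<lfloor>2 ^ Suc m * x\<rfloor> = 2 * int l + 1 then - 1 else 0)"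
proof -
  have lt: "real l / 2 ^ m < (real l + 1) / 2 ^ m"
    by (simp add: divide_strict_right_mono)
  have mid: "(real l / 2 ^ m + (real l + 1) / 2 ^ m) / 2 = (2 * real l + 1) / 2 ^ Suc m"
    by (simp add: field_simps)
  have e1: "real l / 2 ^ m \<le> x \<longleftrightarrow> 2 * real l \<le> 2 ^ Suc m * x"
    by (simp add: field_simps)
  have e2: "x < (real l + 1) / 2 ^ m \<longleftrightarrow> 2 ^ Suc m * x < 2 * real l + 2"
  proof -
    have "x < (real l + 1) / 2 ^ m \<longleftrightarrow> x * 2 ^ m < real l + 1"
      by (simp add: pos_less_divide_eq)
    also have "\<dots> \<longleftrightarrow> 2 ^ Suc m * x < 2 * real l + 2"
      by (auto simp: mult_ac)
    finally show ?thesis .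
  qed
  have e3: "x < (2 * real l + 1) / 2 ^ Suc m \<longleftrightarrow> 2 ^ Suc m * x < 2 * real l + 1"
    by (simp add: field_simps)
  show ?thesis
    using lt unfolding haar_def
    by (simp only: cInf_atLeastLessThan cSup_atLeastLessThan mid e3 atLeastLessThan_iff e1 e2 floor_eq_iff)
       auto
qed

lemma dyadic_measure:
  "measure lborel {real k / 2 ^ n ..< (real k + 1) / 2 ^ n} = 1 / 2 ^ n"
proof -
  have "real k / 2 ^ n \<le> (real k + 1) / 2 ^ n"
    by (intro divide_right_mono) auto
  then have "measure lborel {real k / 2 ^ n ..< (real k + 1) / 2 ^ n}
      = (real k + 1) / 2 ^ n - real k / 2 ^ n"
    by simp
  also have "\<dots> = 1 / 2 ^ n"
    unfolding add_divide_distrib by simp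
  finally show ?thesis .
qed

lemma haar_const_on_smaller:
  assumes K: "K \<in> dyadic" and I: "I \<in> dyadic" and "K \<noteq> I"
    and le: "measure lborel I \<le> measure lborel K" and x: "x \<in> I" and x': "x' \<in> I"
  shows "haar K x = haar K x'"
proof -
  obtain k n where I_eq: "I = {real k / 2 ^ n ..< (real k + 1) / 2 ^ n}"
    using I unfolding dyadic_def by blast
  obtain l m where K_eq: "K = {real l / 2 ^ m ..< (real l + 1) / 2 ^ m}"
    using K unfolding dyadic_def by blast
  have "(1::real) / 2 ^ n \<le> 1 / 2 ^ m"
    using le unfolding I_eq K_eq dyadic_measure .
  then have "(2::real) ^ m \<le> 2 ^ n"
    by (simp add: field_simps)
  then have mn: "m \<le> n"
    by simp
  have fl: "\<lfloor>2 ^ n * z\<rfloor> = int k" if "z \<in> I" for z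
    using that unfolding I_eq floor_eq_iff by (simp add: field_simps)
  show ?thesis
  proof (cases "m = n")
    case True
    then have "l \<noteq> k"
      using \<open>K \<noteq> I\<close> I_eq K_eq by auto
    have "z \<notin> K" if "z \<in> I" for z
    proof
      assume "z \<in> K"
      then have "\<lfloor>2 ^ n * z\<rfloor> = int l"
        unfolding K_eq floor_eq_iff True by (simp add: field_simps)
      then show False
        using fl[OF that] \<open>l \<noteq> k\<close> by simp
    qed
    then show ?thesis
      using x x' by (simp add: haar_def)
  next
    case False
    then obtain j where j: "n = Suc m + j"
      using mn by (metis le_neq_implies_less less_iff_Suc_add add_Suc)
    have "\<lfloor>2 ^ Suc m * z\<rfloor> = int k div 2 ^ j" if "z \<in> I" for z
    proof -
      have "2 ^ Suc m * z = 2 ^ n * z / real_of_int (2 ^ j)"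
        unfolding j power_add by simp
      then have "\<lfloor>2 ^ Suc m * z\<rfloor> = \<lfloor>2 ^ n * z\<rfloor> div 2 ^ j"
        using floor_divide_real_eq_div[of "2 ^ j" "2 ^ n * z"] by simp
      then show ?thesis
        using fl[OF that] by simp
    qed
    then show ?thesis
      using x x' unfolding K_eq haar_dyadic_floor by simp
  qed
qed

lemma haar_independent_1:
  assumes "finite A" and A: "A \<subseteq> dyadic" and zero: "\<And>x. (\<Sum>I\<in>A. c I * haar I x) = 0"
    and "I \<in> A"
  shows "c I = 0"
proof (rule ccontr)
  assume "c I \<noteq> 0"
  define B where "B = {I \<in> A. c I \<noteq> 0}"
  have "finite B" "B \<noteq> {}"
    using assms(1) \<open>I \<in> A\<close> \<open>c I \<noteq> 0\<close> by (auto simp: B_def)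
  then obtain I0 where I0: "I0 \<in> B" and min: "\<And>K. K \<in> B \<Longrightarrow> measure lborel I0 \<le> measure lborel K"
    using arg_min_if_finite(1)[of B "measure lborel"] arg_min_least[of B _ "measure lborel"] by metis
  obtain k n where I0_eq: "I0 = {real k / 2 ^ n ..< (real k + 1) / 2 ^ n}"
    using I0 A unfolding B_def dyadic_def by blast
  define x where "x = real k / 2 ^ n"
  define x' where "x' = (2 * real k + 1) / 2 ^ Suc n"
  have fx: "\<lfloor>2 ^ Suc n * x\<rfloor> = 2 * int k" "\<lfloor>2 ^ Suc n * x'\<rfloor> = 2 * int k + 1"
    unfolding x_def x'_def floor_eq_iff by (simp_all add: field_simps)
  have h: "haar I0 x = 1" "haar I0 x' = - 1"
    using fx unfolding I0_eq haar_dyadic_floor by simp_all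
  then have mem: "x \<in> I0" "x' \<in> I0"
    unfolding haar_def by (metis zero_neq_one neg_equal_0_iff_equal)+
  have "(\<Sum>I\<in>A. c I * (haar I x - haar I x')) = 0"
    using zero[of x] zero[of x'] by (simp add: right_diff_distrib sum_subtractf)
  moreover have "(\<Sum>I\<in>A. c I * (haar I x - haar I x')) = (\<Sum>I\<in>A. if I = I0 then 2 * c I0 else 0)"
  proof (rule sum.cong [OF refl])
    fix K assume "K \<in> A"
    show "c K * (haar K x - haar K x') = (if K = I0 then 2 * c I0 else 0)"
    proof (cases "K = I0 \<or> c K = 0")
      case True
      then show ?thesis
        using h I0 by (auto simp: B_def)
    next
      case False
      then have "haar K x = haar K x'"
        using \<open>K \<in> A\<close> A I0 mem min[of K]
        by (intro haar_const_on_smaller[of K I0]) (auto simp: B_def)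
      then show ?thesis
        using False by simp
    qed
  qed
  ultimately have "c I0 = 0"
    using I0 \<open>finite A\<close> by (simp add: B_def)
  then show False
    using I0 by (simp add: B_def)
qed

lemma haar_independent_2:
  assumes "finite A" and A: "A \<subseteq> dyadic \<times> dyadic"
    and zero: "\<And>x y. (\<Sum>(I, J)\<in>A. c I J * haar2 I J x y) = 0" and "(I, J) \<in> A"
  shows "c I J = 0"
proof -
  define F where "F = fst ` A"
  define G where "G = snd ` A"
  define d where "d I J = (if (I, J) \<in> A then c I J else 0)" for I J
  have fin: "finite F" "finite G" and sub: "F \<subseteq> dyadic" "G \<subseteq> dyadic" "A \<subseteq> F \<times> G"
    and IJ: "I \<in> F" "J \<in> G"
    using assms(1) A \<open>(I, J) \<in> A\<close> by (force simp: F_def G_def)+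
  have "(\<Sum>I\<in>F. (\<Sum>J\<in>G. d I J * haar J y) * haar I x) = 0" for x y
  proof -
    have "(\<Sum>I\<in>F. (\<Sum>J\<in>G. d I J * haar J y) * haar I x)
        = (\<Sum>(I, J)\<in>F \<times> G. d I J * haar2 I J x y)"
      by (simp add: sum.cartesian_product [symmetric] sum_distrib_right sum_distrib_left haar2_def mult_ac)
    also have "\<dots> = (\<Sum>(I, J)\<in>A. c I J * haar2 I J x y)"
      using fin sub by (intro sum.mono_neutral_cong_right) (auto simp: d_def)
    finally show ?thesis
      using zero by simp
  qed
  then have "(\<Sum>J\<in>G. d I J * haar J y) = 0" for y
    using haar_independent_1[where c = "\<lambda>I. \<Sum>J\<in>G. d I J * haar J y", OF fin(1) sub(1) _ IJ(1)]
    by blast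
  then have "d I J = 0"
    using haar_independent_1[where c = "d I", OF fin(2) sub(2) _ IJ(2)] by blast
  then show ?thesis
    using \<open>(I, J) \<in> A\<close> by (simp add: d_def)
qed

lemma haar2_inj:
  assumes "I \<in> dyadic" "J \<in> dyadic" "I' \<in> dyadic" "J' \<in> dyadic" and eq: "haar2 I J = haar2 I' J'"
  shows "I = I' \<and> J = J'"
proof (rule ccontr)
  assume ne: "\<not> ?thesis"
  define c :: "real set \<Rightarrow> real set \<Rightarrow> real"
    where "c = (\<lambda>K L. if K = I \<and> L = J then 1 else - 1)"
  have c: "c I J = 1" "c I' J' = - 1"
    using ne by (auto simp: c_def)
  have sum0: "(\<Sum>(K, L)\<in>{(I, J), (I', J')}. c K L * haar2 K L x y) = 0" for x y
  proof -
    have "(\<Sum>(K, L)\<in>{(I, J), (I', J')}. c K L * haar2 K L x y)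
        = c I J * haar2 I J x y + c I' J' * haar2 I' J' x y"
      using ne by (subst sum.insert) auto
    also have "\<dots> = 0"
      unfolding c eq by simp
    finally show ?thesis .
  qed
  have "c I J = 0"
    by (rule haar_independent_2[OF _ _ sum0]) (use assms in auto)
  then show False
    using c by simp
qed

lemma sum_fun_apply: "(\<Sum>i\<in>A. f i) x = (\<Sum>i\<in>A. f i x)"
  by (induction A rule: infinite_finite_induct) auto

lemma independent_haar_system: "independent haar_system"
proof
  assume "dependent haar_system"
  then obtain t u b where t: "finite t" "t \<subseteq> haar_system"
    and zero: "(\<Sum>v\<in>t. u v *\<^sub>R v) = 0" and b: "b \<in> t" "u b \<noteq> 0"
    unfolding real_vector.dependent_explicit by blast
  have "\<forall>v\<in>t. \<exists>IJ. IJ \<in> dyadic \<times> dyadic \<and> haar2 (fst IJ) (snd IJ) = v"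
    using t(2) by (fastforce simp: haar_system_def)
  then obtain g where g: "\<And>v. v \<in> t \<Longrightarrow> g v \<in> dyadic \<times> dyadic"
    "\<And>v. v \<in> t \<Longrightarrow> haar2 (fst (g v)) (snd (g v)) = v"
    by metis
  have inj: "inj_on g t"
    by (metis g(2) inj_onI)
  have sum0: "(\<Sum>(I, J)\<in>g ` t. u (haar2 I J) * haar2 I J x y) = 0" for x y
  proof -
    have "(\<Sum>(I, J)\<in>g ` t. u (haar2 I J) * haar2 I J x y) = (\<Sum>v\<in>t. u v * v x y)"
      unfolding sum.reindex[OF inj] by (rule sum.cong) (auto simp: case_prod_unfold g)
    also have "\<dots> = (\<Sum>v\<in>t. u v *\<^sub>R v) x y"
      by (simp add: sum_fun_apply)
    finally show ?thesis
      by (simp add: zero)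
  qed
  have fin: "finite (g ` t)" and sub: "g ` t \<subseteq> dyadic \<times> dyadic"
    and mem: "(fst (g b), snd (g b)) \<in> g ` t"
    using t(1) b by (simp_all add: image_subset_iff g(1))
  have "u (haar2 (fst (g b)) (snd (g b))) = 0"
    by (rule haar_independent_2[where c = "\<lambda>I J. u (haar2 I J)", OF fin sub sum0 mem])
  then show False
    using b by (simp add: g(2)[OF b(1)])
qed

lemma haar_coeff_sum:
  assumes "finite A" and A: "A \<subseteq> dyadic \<times> dyadic" and I: "I \<in> dyadic" and J: "J \<in> dyadic"
  shows "haar_coeff (\<Sum>(K, L)\<in>A. a K L *\<^sub>R haar2 K L) I J = (if (I, J) \<in> A then a I J else 0)"
proof -
  have mem: "haar2 K L \<in> haar_system" if "(K, L) \<in> A" for K L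
    using that A by (auto simp: haar_system_def)
  have "haar_coeff (\<Sum>(K, L)\<in>A. a K L *\<^sub>R haar2 K L) I J
      = (\<Sum>i\<in>A. representation haar_system (a (fst i) (snd i) *\<^sub>R haar2 (fst i) (snd i)) (haar2 I J))"
    unfolding haar_coeff_def case_prod_unfold
    by (subst real_vector.representation_sum [OF independent_haar_system])
       (auto simp: mem span_base span_scale)
  also have "\<dots> = (\<Sum>i\<in>A. if i = (I, J) then a I J else 0)"
  proof (rule sum.cong [OF refl])
    fix i assume i: "i \<in> A"
    obtain K L where KL: "i = (K, L)" by force
    have "K \<in> dyadic" "L \<in> dyadic"
      using i KL A by auto
    then have "haar2 K L = haar2 I J \<longleftrightarrow> i = (I, J)"
      using haar2_inj[of K L I J] I J KL by auto
    then show "representation haar_system (a (fst i) (snd i) *\<^sub>R haar2 (fst i) (snd i)) (haar2 I J)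
        = (if i = (I, J) then a I J else 0)"
      using mem[of K L] i KL
      by (auto simp: real_vector.representation_scale [OF independent_haar_system] span_base
            real_vector.representation_basis [OF independent_haar_system])
  qed
  also have "\<dots> = (if (I, J) \<in> A then a I J else 0)"
    using assms(1) by simp
  finally show ?thesis .
qed

lemma hardy_norm_sum:
  assumes "finite A" and A: "A \<subseteq> dyadic \<times> dyadic"
  shows "hardy_norm p q (\<Sum>(I, J)\<in>A. a I J *\<^sub>R haar2 I J) =
     (LINT x:{0..1}|lborel.
        (LINT y:{0..1}|lborel.
           (\<Sum>(I, J)\<in>A. \<bar>a I J\<bar>\<^sup>2 * (haar2 I J x y)\<^sup>2) powr (q / 2)) powr (p / q)) powr (1 / p)"
proof -
  let ?c = "haar_coeff (\<Sum>(I, J)\<in>A. a I J *\<^sub>R haar2 I J)"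
  have c: "?c I J = (if (I, J) \<in> A then a I J else 0)" if "I \<in> dyadic" "J \<in> dyadic" for I J
    using haar_coeff_sum[OF assms that] .
  have "(\<Sum>(I, J) | I \<in> dyadic \<and> J \<in> dyadic \<and> ?c I J \<noteq> 0. \<bar>?c I J\<bar>\<^sup>2 * (haar2 I J x y)\<^sup>2)
      = (\<Sum>(I, J)\<in>A. \<bar>a I J\<bar>\<^sup>2 * (haar2 I J x y)\<^sup>2)" for x y
    using assms by (intro sum.mono_neutral_cong_left) (auto simp: c split: if_splits)
  then show ?thesis
    unfolding hardy_norm_def by simp
qed

end

theory Submission
  imports Defs "HOL-Library.Diagonal_Subsequence"
begin

text \<open>Expand everything in the Haar basis. A faithful block basis of Haar functions in each variable
  spans an isometric copy of the small space inside the large one, and averaging over the blocks is a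
  norm one projection that is adjoint to the embedding. Distinct blocks consisting of functions of
  many different levels are almost annihilated by a fixed functional, and equalising means over levels
  makes the diagonal almost constant. So a bilinear form on \<open>X\<^sub>N \<times> X\<^sub>N\<^sup>*\<close> with \<open>N\<close> large is, on a
  suitable copy of \<open>X\<^sub>n \<times> X\<^sub>n\<^sup>*\<close>, almost a multiple \<open>l\<close> of the duality pairing. This
  is symmetric under duality, hence \<open>T\<close> is locally almost \<open>l Id\<close> in both cases of the theorem.
  In the infinite sum choose such copies inductively with negligible interaction. For infinitely many of
  them \<open>l \<ge> 1/2\<close>, or for infinitely many \<open>1 - l \<ge> 1/2\<close>; on these \<open>T\<close> or
  \<open>Id - T\<close> is inverted by a Neumann series at the cost of a factor \<open>2 + \<eta>\<close>.\<close>

section \<open>Summable norms\<close>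

text \<open>The exponents \<open>p\<close> and \<open>q\<close> enter the diagonalisation through
  one computation only. If two functions have square functions bounded by constants and supported in
  a common rectangle, the norm of one and the dual norm of the other carry the powers 1/p and 1 -
  1/p of one side, 1/q and 1 - 1/q of the other. The product is the measure of the rectangle. So a
  bounded form obeys an estimate free of \<open>p\<close> and \<open>q\<close>, the value 1
  included, and what follows is combinatorics of binary trees. A diagonal limit would not suffice:
  the alternative l \<ge> 1/2 or 1 - l \<ge> 1/2 is what decides between T and Id - T, hence one
  scalar per copy is needed. This alternative is also the source of the constant 2, because all
  local embeddings and projections have norm one. In the sum the obstacle is
  \<open>r = \<infinity>\<close>: finitely supported sequences are not dense there, so T is not
  determined by its values on single summands. The remedy is an infinite set of coordinates on which
  T sends tails to something small in every component.\<close>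

lemma convex_on_powr_nonneg:
  fixes r :: real
  assumes "1 \<le> r"
  shows "convex_on {0..} (\<lambda>x. x powr r)"
proof (rule convex_onI)
  fix t x y :: real
  assume t: "0 < t" "t < 1" and x: "x \<in> {0..}" and y: "y \<in> {0..}"
  \<comment> \<open>If one of the points is 0 the claim reduces to this: the factor t^r in front of
    the other term must not exceed t.\<close>
  have le: "s powr r \<le> s" if "0 < s" "s < 1" for s :: real
    using powr_mono'[of 1 r s] that assms by simp
  consider "x = 0" | "y = 0" | "0 < x" "0 < y"
    using x y by force
  then show "((1 - t) *\<^sub>R x + t *\<^sub>R y) powr r \<le> (1 - t) * x powr r + t * y powr r"
  proof cases
    case 1
    then show ?thesis
      using le[of t] t y by (simp add: powr_mult mult_right_mono)
  next
    case 2
    then show ?thesis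
      using le[of "1 - t"] t x by (simp add: powr_mult mult_right_mono)
  next
    case 3
    then show ?thesis
      using convex_onD[OF powr_convex[OF assms], of t x y] t by simp
  qed
qed simp

text \<open>Normalise and use convexity: (a + b) / (A + B) is the convex combination of a / A and b
  / B with weights A / (A + B) and B / (A + B). Upper bounds \<open>A\<close>, \<open>B\<close>
  stand in place of the norms themselves; a zero bound forces the corresponding terms to vanish.
  Weight 1 serves the \<open>l^r\<close> sums, weight 1 / card the means over leaves.\<close>

lemma minkowski_weighted:
  fixes w a b :: "'i \<Rightarrow> real"
  assumes "finite F" "1 \<le> r"
    and w: "\<And>i. i \<in> F \<Longrightarrow> 0 \<le> w i" and a: "\<And>i. i \<in> F \<Longrightarrow> 0 \<le> a i" and b: "\<And>i. i \<in> F \<Longrightarrow> 0 \<le> b i"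
    and A: "(\<Sum>i\<in>F. w i * a i powr r) \<le> A powr r" "0 \<le> A"
    and B: "(\<Sum>i\<in>F. w i * b i powr r) \<le> B powr r" "0 \<le> B"
  shows "(\<Sum>i\<in>F. w i * (a i + b i) powr r) \<le> (A + B) powr r"
proof -
  have zero: "(\<Sum>i\<in>F. w i * (u i + v i) powr r) = (\<Sum>i\<in>F. w i * v i powr r)"
    if "(\<Sum>i\<in>F. w i * u i powr r) \<le> 0 powr r" "\<And>i. i \<in> F \<Longrightarrow> 0 \<le> u i" for u v :: "'i \<Rightarrow> real"
  proof -
    have "(\<Sum>i\<in>F. w i * u i powr r) = 0"
      using that w assms(2) by (intro antisym sum_nonneg) auto
    then have "\<forall>i\<in>F. w i * u i powr r = 0"
      using w by (subst (asm) sum_nonneg_eq_0_iff) (auto simp: assms(1))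
    then show ?thesis
      by (intro sum.cong) auto
  qed
  consider "A = 0" | "B = 0" | "0 < A" "0 < B"
    using A B by force
  then show ?thesis
  proof cases
    case 1
    then show ?thesis
      using zero[of a b] A B a by simp
  next
    case 2
    then show ?thesis
      using zero[of b a] A B b by (simp add: add.commute)
  next
    case 3
    define t where "t = B / (A + B)"
    have t: "0 < t" "t < 1" "1 - t = A / (A + B)"
      using 3 by (auto simp: t_def field_simps)
    have pt: "(a i + b i) powr r \<le> (A + B) powr r * ((1 - t) * (a i powr r / A powr r) + t * (b i powr r / B powr r))"
      if "i \<in> F" for i
    proof -
      have "(a i + b i) powr r = ((A + B) * ((1 - t) * (a i / A) + t * (b i / B))) powr r"
        using 3 unfolding t(3) by (simp add: t_def distrib_left)
      also have "\<dots> = (A + B) powr r * ((1 - t) * (a i / A) + t * (b i / B)) powr r"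
        using 3 t a[OF that] b[OF that] by (subst powr_mult) auto
      also have "((1 - t) * (a i / A) + t * (b i / B)) powr r
          \<le> (1 - t) * (a i / A) powr r + t * (b i / B) powr r"
        using convex_onD[OF convex_on_powr_nonneg[OF assms(2)], of t "a i / A" "b i / B"]
          3 t a[OF that] b[OF that] by simp
      finally show ?thesis
        using 3 a[OF that] b[OF that] by (simp add: powr_divide)
    qed
    have "(\<Sum>i\<in>F. w i * (a i + b i) powr r)
        \<le> (\<Sum>i\<in>F. w i * ((A + B) powr r * ((1 - t) * (a i powr r / A powr r) + t * (b i powr r / B powr r))))"
      by (intro sum_mono mult_left_mono pt w)
    also have "\<dots> = (A + B) powr r * ((1 - t) * ((\<Sum>i\<in>F. w i * a i powr r) / A powr r)
        + t * ((\<Sum>i\<in>F. w i * b i powr r) / B powr r))"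
      by (simp add: sum_divide_distrib sum_distrib_left distrib_left sum.distrib mult_ac)
    also have "\<dots> \<le> (A + B) powr r * ((1 - t) * 1 + t * 1)"
      using 3 A B t by (intro mult_left_mono add_mono) (auto simp: divide_le_eq)
    finally show ?thesis
      by simp
  qed
qed

text \<open>Estimates in the \<open>l^r\<close> sum are made through finite partial sums, so that
  neither summability nor the existence of a supremum has to be carried along, and
  \<open>r = \<infinity>\<close> runs through the same lemmas. \<open>lr_le_iff\<close> converts to
  membership and norm.\<close>

definition lr_le :: "ereal \<Rightarrow> (nat \<Rightarrow> real) \<Rightarrow> real \<Rightarrow> bool" where
  "lr_le r a c \<longleftrightarrow> 0 \<le> c \<and> (if r = \<infinity> then \<forall>n. a n \<le> c
     else \<forall>F. finite F \<longrightarrow> (\<Sum>i\<in>F. a i powr real_of_ereal r) \<le> c powr real_of_ereal r)"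

section \<open>Calculus of bounds for \<open>l^r\<close> norms\<close>

locale lr_exponent =
  fixes r :: ereal
  assumes r1: "1 \<le> r"
begin

abbreviation "s \<equiv> real_of_ereal r"

lemma s1: "r \<noteq> \<infinity> \<Longrightarrow> 1 \<le> s"
  using r1 by (cases r) auto

lemma lr_le_iff:
  assumes X: "\<And>n. f n \<in> vecs (X n)" and nn: "\<And>n. 0 \<le> nrm (X n) (f n)" and c: "0 \<le> c"
  shows "lr_le r (\<lambda>n. nrm (X n) (f n)) c \<longleftrightarrow> f \<in> vecs (lr_sum r X) \<and> nrm (lr_sum r X) f \<le> c"
proof (cases "r = \<infinity>")
  case True
  have "(\<forall>n. nrm (X n) (f n) \<le> c) \<longleftrightarrow>
      bdd_above (range (\<lambda>n. nrm (X n) (f n))) \<and> (SUP n. nrm (X n) (f n)) \<le> c"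
  proof (intro iffI conjI allI)
    assume *: "\<forall>n. nrm (X n) (f n) \<le> c"
    show "bdd_above (range (\<lambda>n. nrm (X n) (f n)))"
      using * by (intro bdd_aboveI[of _ c]) auto
    show "(SUP n. nrm (X n) (f n)) \<le> c"
      using * by (intro cSUP_least) auto
  next
    fix n assume *: "bdd_above (range (\<lambda>n. nrm (X n) (f n))) \<and> (SUP n. nrm (X n) (f n)) \<le> c"
    then have "nrm (X n) (f n) \<le> (SUP n. nrm (X n) (f n))"
      by (intro cSUP_upper) auto
    then show "nrm (X n) (f n) \<le> c"
      using * by linarith
  qed
  then show ?thesis
    using True X c by (simp add: lr_le_def lr_sum_def)
next
  case False
  let ?a = "\<lambda>n. nrm (X n) (f n) powr s"
  have s: "1 \<le> s" by (rule s1[OF False])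
  have "lr_le r (\<lambda>n. nrm (X n) (f n)) c \<longleftrightarrow> (\<forall>F. finite F \<longrightarrow> sum ?a F \<le> c powr s)"
    using False c by (simp add: lr_le_def)
  also have "\<dots> \<longleftrightarrow> summable ?a \<and> suminf ?a \<le> c powr s"
  proof (intro iffI conjI allI impI)
    assume *: "\<forall>F. finite F \<longrightarrow> sum ?a F \<le> c powr s"
    show "summable ?a"
      by (rule summableI_nonneg_bounded[of _ "c powr s"]) (use * in auto)
    then show "suminf ?a \<le> c powr s"
      using * by (intro suminf_le_const) auto
  next
    fix F :: "nat set" assume "finite F" "summable ?a \<and> suminf ?a \<le> c powr s"
    then show "sum ?a F \<le> c powr s"
      using sum_le_suminf[of ?a F] by auto
  qed
  also have "\<dots> \<longleftrightarrow> summable ?a \<and> suminf ?a powr (1 / s) \<le> c"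
  proof (intro conj_cong refl)
    assume "summable ?a"
    then have p: "0 \<le> suminf ?a" by (intro suminf_nonneg) auto
    show "(suminf ?a \<le> c powr s) = (suminf ?a powr (1 / s) \<le> c)"
    proof
      assume "suminf ?a \<le> c powr s"
      then have "suminf ?a powr (1 / s) \<le> (c powr s) powr (1 / s)"
        using p s by (intro powr_mono2) auto
      then show "suminf ?a powr (1 / s) \<le> c"
        using s c by (simp add: powr_powr)
    next
      assume "suminf ?a powr (1 / s) \<le> c"
      then have "(suminf ?a powr (1 / s)) powr s \<le> c powr s"
        using p s by (intro powr_mono2) auto
      then show "suminf ?a \<le> c powr s"
        using s p by (simp add: powr_powr)
    qed
  qed
  also have "\<dots> \<longleftrightarrow> f \<in> vecs (lr_sum r X) \<and> nrm (lr_sum r X) f \<le> c"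
    using False X by (simp add: lr_sum_def)
  finally show ?thesis .
qed

lemma lr_le_mono:
  assumes "lr_le r b c" "\<And>n. 0 \<le> a n" "\<And>n. a n \<le> b n"
  shows "lr_le r a c"
proof (cases "r = \<infinity>")
  case True
  then show ?thesis
    using assms by (auto simp: lr_le_def intro: order_trans)
next
  case False
  have "(\<Sum>i\<in>F. a i powr s) \<le> (\<Sum>i\<in>F. b i powr s)" for F
    using s1[OF False] assms by (intro sum_mono powr_mono2) auto
  then show ?thesis
    using assms False by (fastforce simp: lr_le_def intro: order_trans)
qed

lemma lr_le_add:
  assumes "lr_le r a A" "lr_le r b B" "\<And>n. 0 \<le> a n" "\<And>n. 0 \<le> b n"
  shows "lr_le r (\<lambda>n. a n + b n) (A + B)"
proof (cases "r = \<infinity>")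
  case True
  then show ?thesis
    using assms by (auto simp: lr_le_def intro: add_mono)
next
  case False
  show ?thesis
    using minkowski_weighted[OF _ s1[OF False], of _ "\<lambda>_. 1" a b A B] assms False
    by (simp add: lr_le_def)
qed

lemma lr_le_scale:
  assumes "lr_le r a A" "0 \<le> c" "\<And>n. 0 \<le> a n"
  shows "lr_le r (\<lambda>n. c * a n) (c * A)"
proof (cases "r = \<infinity>")
  case True
  then show ?thesis
    using assms by (auto simp: lr_le_def intro: mult_left_mono)
next
  case False
  have "(\<Sum>i\<in>F. (c * a i) powr s) = c powr s * (\<Sum>i\<in>F. a i powr s)" for F
    using assms by (simp add: powr_mult sum_distrib_left)
  then show ?thesis
    using assms False by (auto simp: lr_le_def powr_mult intro!: mult_left_mono)
qed

lemma lr_le_nth: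
  assumes "lr_le r a A" "\<And>n. 0 \<le> a n"
  shows "a n \<le> A"
proof (cases "r = \<infinity>")
  case True
  then show ?thesis
    using assms by (auto simp: lr_le_def)
next
  case False
  have "a n powr s \<le> A powr s"
    using assms False unfolding lr_le_def by (force dest: spec[of _ "{n}"])
  then show ?thesis
    using s1[OF False] assms powr_less_mono2[of s A "a n"] by (force simp: lr_le_def)
qed

lemma lr_le_inj:
  assumes "lr_le r a A" "inj j"
  shows "lr_le r (\<lambda>n. a (j n)) A"
proof (cases "r = \<infinity>")
  case True
  then show ?thesis
    using assms by (auto simp: lr_le_def)
next
  case False
  have "(\<Sum>i\<in>F. a (j i) powr s) = (\<Sum>i\<in>j ` F. a i powr s)" for F
    using assms(2) by (subst sum.reindex) (auto intro: inj_on_subset)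
  then show ?thesis
    using assms False by (simp add: lr_le_def)
qed

lemma lr_le_spread:
  assumes "lr_le r a A" "inj j" "\<And>n. b (j n) = a n" "\<And>i. i \<notin> range j \<Longrightarrow> b i = 0"
  shows "lr_le r b A"
proof (cases "r = \<infinity>")
  case True
  then have A: "\<And>n. a n \<le> A" "0 \<le> A"
    using assms(1) by (auto simp: lr_le_def)
  have "b i \<le> A" for i
    by (cases "i \<in> range j") (use A assms(3,4) in auto)
  then show ?thesis
    using True A(2) by (auto simp: lr_le_def)
next
  case False
  show ?thesis
    unfolding lr_le_def if_not_P[OF False]
  proof (intro conjI allI impI)
    fix F :: "nat set" assume "finite F"
    have "(\<Sum>i\<in>F. b i powr s) = (\<Sum>i\<in>F \<inter> range j. b i powr s)"
      using \<open>finite F\<close> assms(4) by (intro sum.mono_neutral_right) auto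
    also have "F \<inter> range j = j ` (j -` F)"
      by auto
    also have "(\<Sum>i\<in>j ` (j -` F). b i powr s) = (\<Sum>i\<in>j -` F. a i powr s)"
      using assms(2,3) by (subst sum.reindex) (auto intro: inj_on_subset)
    also have "\<dots> \<le> A powr s"
      using assms(1) False \<open>finite F\<close> finite_vimageI[OF \<open>finite F\<close> assms(2)] by (simp add: lr_le_def)
    finally show "(\<Sum>i\<in>F. b i powr s) \<le> A powr s" .
  qed (use assms(1) in \<open>simp add: lr_le_def\<close>)
qed

lemma lr_le_single:
  assumes "0 \<le> c"
  shows "lr_le r (\<lambda>i. if i = n then c else 0) c"
proof (cases "r = \<infinity>")
  case True
  then show ?thesis using assms by (auto simp: lr_le_def)
next
  case False
  have "(\<Sum>i\<in>F. (if i = n then c else 0) powr s) = (if n \<in> F then c powr s else 0)" if "finite F" for F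
    using that by (simp add: if_distrib[of "\<lambda>x. x powr s"] cong: if_cong)
  then show ?thesis
    using False assms by (simp add: lr_le_def)
qed

text \<open>One bound for all \<open>r\<close> at once: for a finite exponent s \<ge> 1 one has
  (2^-n)^s \<le> 2^-n, so the sum of powers is at most 2 c^s \<le> (2c)^s. This is how
  coordinatewise errors with a geometric factor become an operator norm estimate.\<close>

lemma lr_le_geometric:
  assumes "\<And>n. 0 \<le> a n" "\<And>n. a n \<le> c / 2 ^ n" "0 \<le> c"
  shows "lr_le r a (2 * c)"
proof (cases "r = \<infinity>")
  case True
  have "c / 2 ^ n \<le> 2 * c" for n
    using divide_left_mono[of 1 "2 ^ n" c] assms(3) by simp
  then show ?thesis
    using True assms by (auto simp: lr_le_def intro: order_trans)
next
  case False
  note s = s1[OF False]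
  show ?thesis
    unfolding lr_le_def if_not_P[OF False]
  proof (intro conjI allI impI)
    fix F :: "nat set" assume "finite F"
    have one: "a n powr s \<le> c powr s * (1 / 2) ^ n" for n
    proof -
      have "a n powr s \<le> (c * (1 / 2) ^ n) powr s"
        using assms s by (intro powr_mono2) (auto simp: power_one_over field_simps)
      also have "\<dots> = c powr s * ((1 / 2) ^ n) powr s"
        using assms by (simp add: powr_mult)
      also have "((1 / 2 :: real) ^ n) powr s \<le> ((1 / 2) ^ n) powr 1"
        using s by (intro powr_mono') (auto simp: power_le_one)
      finally show ?thesis
        by (simp add: mult_left_mono)
    qed
    have "(\<Sum>i\<in>F. a i powr s) \<le> (\<Sum>i\<in>F. c powr s * (1 / 2) ^ i)"
      by (intro sum_mono one)
    also have "\<dots> \<le> c powr s * 2"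
    proof -
      have "(\<Sum>i\<in>F. (1 / 2 :: real) ^ i) \<le> (\<Sum>i. (1 / 2 :: real) ^ i)"
        using \<open>finite F\<close> by (intro sum_le_suminf) (auto simp: summable_geometric)
      also have "\<dots> = 2"
        by (subst suminf_geometric) auto
      finally show ?thesis
        by (simp add: sum_distrib_left [symmetric] mult_left_mono)
    qed
    also have "\<dots> \<le> c powr s * 2 powr s"
      using powr_mono[of 1 s 2] s by (intro mult_left_mono) auto
    also have "\<dots> = (2 * c) powr s"
      using assms by (simp add: powr_mult)
    finally show "(\<Sum>i\<in>F. a i powr s) \<le> (2 * c) powr s" .
  qed (use assms(3) in simp)
qed

text \<open>Fatou's lemma for sequences; in \<open>complete_lr_sum\<close> it carries the bound for
  differences of partial sums over to the limit.\<close>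

lemma lr_le_limit:
  assumes "\<And>k. lr_le r (\<lambda>n. a k n) c" "\<And>n. (\<lambda>k. a k n) \<longlonglongrightarrow> b n" "\<And>k n. 0 \<le> a k n"
  shows "lr_le r b c"
proof (cases "r = \<infinity>")
  case True
  then show ?thesis
    using assms(1) LIMSEQ_le_const2[OF assms(2)] by (auto simp: lr_le_def)
next
  case False
  note s = s1[OF False]
  have "(\<Sum>i\<in>F. b i powr s) \<le> c powr s" if "finite F" for F
  proof -
    have b: "0 \<le> b i" for i
      using LIMSEQ_le_const[OF assms(2)] assms(3) by blast
    have "(\<lambda>k. \<Sum>i\<in>F. a k i powr s) \<longlonglongrightarrow> (\<Sum>i\<in>F. b i powr s)"
      using s assms(3) by (intro tendsto_sum tendsto_powr' assms(2)) auto
    moreover have "(\<Sum>i\<in>F. a k i powr s) \<le> c powr s" for k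
      using assms(1)[of k] False that by (simp add: lr_le_def)
    ultimately show ?thesis
      by (intro LIMSEQ_le_const2) auto
  qed
  then show ?thesis
    using False assms(1) by (simp add: lr_le_def)
qed

text \<open>For \<open>r = \<infinity>\<close> a constant sequence keeps its norm in every tail;
  this failure is what makes the second half of \<open>tails_vanish\<close> necessary.\<close>

lemma lr_le_tail:
  assumes "lr_le r a c" "r \<noteq> \<infinity>" "0 < e" "\<And>n. 0 \<le> a n"
  shows "\<exists>L0. \<forall>L\<ge>L0. lr_le r (\<lambda>i. if i < L then 0 else a i) e"
proof -
  note s = s1[OF assms(2)]
  have "summable (\<lambda>n. a n powr s)"
    by (rule summableI_nonneg_bounded[of _ "c powr s"]) (use assms in \<open>auto simp: lr_le_def\<close>)
  then obtain L0 where L0: "\<And>L n. L \<ge> L0 \<Longrightarrow> norm (\<Sum>i\<in>{L..<n}. a i powr s) < e powr s"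
    unfolding summable_Cauchy using assms(3) by (metis powr_gt_zero less_numeral_extra(3))
  have "lr_le r (\<lambda>i. if i < L then 0 else a i) e" if "L \<ge> L0" for L
    unfolding lr_le_def if_not_P[OF assms(2)]
  proof (intro conjI allI impI)
    fix F :: "nat set" assume F: "finite F"
    have "(\<Sum>i\<in>F. (if i < L then 0 else a i) powr s) = (\<Sum>i\<in>F \<inter> {L..}. a i powr s)"
      using F by (intro sum.mono_neutral_cong_right) auto
    also have "\<dots> \<le> (\<Sum>i\<in>{L..<Suc (Max (insert 0 F))}. a i powr s)"
      using F by (intro sum_mono2) (auto simp: less_Suc_eq_le)
    also have "\<dots> \<le> e powr s"
      using L0[OF that, of "Suc (Max (insert 0 F))"] by (simp add: abs_less_iff less_imp_le)
    finally show "(\<Sum>i\<in>F. (if i < L then 0 else a i) powr s) \<le> e powr s" .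
  qed (use assms in simp)
  then show ?thesis by blast
qed

end

section \<open>Bounded operators and dual spaces\<close>

definition normed_sp :: "'v::real_vector nspace \<Rightarrow> bool" where
  "normed_sp X \<longleftrightarrow> subspace (vecs X)
     \<and> (\<forall>x\<in>vecs X. 0 \<le> nrm X x \<and> (nrm X x = 0 \<longrightarrow> x = 0))
     \<and> (\<forall>x\<in>vecs X. \<forall>y\<in>vecs X. nrm X (x + y) \<le> nrm X x + nrm X y)
     \<and> (\<forall>c. \<forall>x\<in>vecs X. nrm X (c *\<^sub>R x) = \<bar>c\<bar> * nrm X x)"

locale normed_sp_loc =
  fixes X :: "'v::real_vector nspace"
  assumes normed_sp: "normed_sp X"
begin

lemma subsp: "subspace (vecs X)"
  using normed_sp by (simp add: normed_sp_def)

lemma zero_mem [simp, intro]: "0 \<in> vecs X"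
  using subsp by (rule subspace_0)

lemma add_mem [intro]: "x \<in> vecs X \<Longrightarrow> y \<in> vecs X \<Longrightarrow> x + y \<in> vecs X"
  using subsp by (rule subspace_add)

lemma diff_mem [intro]: "x \<in> vecs X \<Longrightarrow> y \<in> vecs X \<Longrightarrow> x - y \<in> vecs X"
  using subsp by (rule subspace_diff)

lemma scale_mem [intro]: "x \<in> vecs X \<Longrightarrow> c *\<^sub>R x \<in> vecs X"
  using subsp by (rule subspace_scale)

lemma sum_mem [intro]: "(\<And>i. i \<in> A \<Longrightarrow> f i \<in> vecs X) \<Longrightarrow> (\<Sum>i\<in>A. f i) \<in> vecs X"
  using subsp by (intro subspace_sum) auto

lemma nrm_nonneg [simp]: "x \<in> vecs X \<Longrightarrow> 0 \<le> nrm X x"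
  using normed_sp by (simp add: normed_sp_def)

lemma nrm_eq_0D: "x \<in> vecs X \<Longrightarrow> nrm X x = 0 \<Longrightarrow> x = 0"
  using normed_sp by (simp add: normed_sp_def)

lemma nrm_add: "x \<in> vecs X \<Longrightarrow> y \<in> vecs X \<Longrightarrow> nrm X (x + y) \<le> nrm X x + nrm X y"
  using normed_sp by (simp add: normed_sp_def)

lemma nrm_scale: "x \<in> vecs X \<Longrightarrow> nrm X (c *\<^sub>R x) = \<bar>c\<bar> * nrm X x"
  using normed_sp by (simp add: normed_sp_def)

lemma nrm_0 [simp]: "nrm X 0 = 0"
  using nrm_scale[of 0 0] by simp

lemma nrm_minus: "x \<in> vecs X \<Longrightarrow> nrm X (- x) = nrm X x"
  using nrm_scale[of x "- 1"] by simp

lemma minus_mem [intro]: "x \<in> vecs X \<Longrightarrow> - x \<in> vecs X"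
  using scale_mem[of x "- 1"] by simp

lemma nrm_diff: "x \<in> vecs X \<Longrightarrow> y \<in> vecs X \<Longrightarrow> nrm X (x - y) \<le> nrm X x + nrm X y"
  using nrm_add[of x "- y"] nrm_minus[of y] minus_mem[of y] by simp

lemma nrm_diff_commute: "x \<in> vecs X \<Longrightarrow> y \<in> vecs X \<Longrightarrow> nrm X (x - y) = nrm X (y - x)"
  using nrm_minus[of "x - y"] diff_mem[of x y] by simp

lemma nrm_triangle_rev:
  assumes "x \<in> vecs X" "y \<in> vecs X"
  shows "\<bar>nrm X x - nrm X y\<bar> \<le> nrm X (x - y)"
  using nrm_add[OF diff_mem[OF assms] assms(2)] nrm_add[OF diff_mem[OF assms(2,1)] assms(1)]
    nrm_diff_commute[OF assms] by simp

lemma nrm_sum: "(\<And>i. i \<in> A \<Longrightarrow> f i \<in> vecs X) \<Longrightarrow> nrm X (\<Sum>i\<in>A. f i) \<le> (\<Sum>i\<in>A. nrm X (f i))"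
proof (induction A rule: infinite_finite_induct)
  case (insert a A)
  then have "nrm X (f a + (\<Sum>i\<in>A. f i)) \<le> nrm X (f a) + nrm X (\<Sum>i\<in>A. f i)"
    by (intro nrm_add sum_mem) auto
  then show ?case
    using insert by fastforce
qed auto

lemma nrm_tendsto:
  assumes "\<And>k. u k \<in> vecs X" "x \<in> vecs X" "(\<lambda>k. nrm X (u k - x)) \<longlonglongrightarrow> 0"
  shows "(\<lambda>k. nrm X (u k)) \<longlonglongrightarrow> nrm X x"
proof -
  have "(\<lambda>k. nrm X (u k) - nrm X x) \<longlonglongrightarrow> 0"
    by (rule Lim_null_comparison[OF _ assms(3)]) (use assms nrm_triangle_rev in auto)
  then show ?thesis
    by (simp add: LIM_zero_iff)
qed

end

text \<open>\<open>B\<close> is some admissible bound, not the norm. Such bounds compose and add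
  without any supremum; \<open>op_norm\<close> is met again in the dual norm and in the final
  estimate.\<close>

definition bop :: "'v::real_vector nspace \<Rightarrow> 'w::real_vector nspace \<Rightarrow> real \<Rightarrow> ('v \<Rightarrow> 'w) \<Rightarrow> bool" where
  "bop X Y B T \<longleftrightarrow> 0 \<le> B \<and>
     (\<forall>x\<in>vecs X. T x \<in> vecs Y) \<and>
     (\<forall>x\<in>vecs X. \<forall>y\<in>vecs X. T (x + y) = T x + T y) \<and>
     (\<forall>c. \<forall>x\<in>vecs X. T (c *\<^sub>R x) = c *\<^sub>R T x) \<and>
     (\<forall>x\<in>vecs X. nrm Y (T x) \<le> B * nrm X x)"

lemma bopD:
  assumes "bop X Y B T"
  shows "0 \<le> B" "x \<in> vecs X \<Longrightarrow> T x \<in> vecs Y"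
    "x \<in> vecs X \<Longrightarrow> y \<in> vecs X \<Longrightarrow> T (x + y) = T x + T y"
    "x \<in> vecs X \<Longrightarrow> T (c *\<^sub>R x) = c *\<^sub>R T x"
    "x \<in> vecs X \<Longrightarrow> nrm Y (T x) \<le> B * nrm X x"
  using assms by (auto simp: bop_def)

lemma bop_imp_bounded_op: "bop X Y B T \<Longrightarrow> bounded_op X Y T"
  unfolding bop_def bounded_op_def by auto

lemma bounded_op_imp_bop:
  assumes "bounded_op X Y T" "normed_sp X"
  obtains B where "bop X Y B T"
proof -
  interpret normed_sp_loc X by standard fact
  obtain B where B: "\<forall>x\<in>vecs X. nrm Y (T x) \<le> B * nrm X x"
    using assms(1) by (auto simp: bounded_op_def)
  have "nrm Y (T x) \<le> max B 0 * nrm X x" if "x \<in> vecs X" for x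
    using B that mult_right_mono[of B "max B 0" "nrm X x"] by (force intro: order_trans)
  then have "bop X Y (max B 0) T"
    using assms(1) by (simp add: bop_def bounded_op_def)
  then show thesis by (rule that)
qed

lemma bop_mono:
  assumes "bop X Y B T" "B \<le> B'" "normed_sp X"
  shows "bop X Y B' T"
proof -
  interpret normed_sp_loc X by standard fact
  have "nrm Y (T x) \<le> B' * nrm X x" if "x \<in> vecs X" for x
    using bopD(5)[OF assms(1) that] mult_right_mono[OF assms(2), of "nrm X x"] that by simp
  then show ?thesis
    using assms by (simp add: bop_def)
qed

lemma bop_comp:
  assumes "bop X Y B T" "bop Y Z C U"
  shows "bop X Z (C * B) (\<lambda>x. U (T x))"
proof -
  have "nrm Z (U (T x)) \<le> C * B * nrm X x" if "x \<in> vecs X" for x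
    using bopD(5)[OF assms(1) that] bopD(5)[OF assms(2), of "T x"] bopD(1,2)[OF assms(1)]
      bopD(1)[OF assms(2)] that by (simp add: mult.assoc) (meson mult_left_mono order_trans)
  then show ?thesis
    using assms by (auto simp: bop_def)
qed

lemma bop_scale:
  assumes "bop X Y B T" "normed_sp Y"
  shows "bop X Y (\<bar>c\<bar> * B) (\<lambda>x. c *\<^sub>R T x)"
proof -
  interpret Y: normed_sp_loc Y by standard fact
  show ?thesis
    using assms(1) unfolding bop_def
    by (auto simp: Y.nrm_scale scaleR_right_distrib mult.assoc intro!: mult_left_mono)
qed

lemma bop_diff:
  assumes "bop X Y B T" "bop X Y C U" "normed_sp Y"
  shows "bop X Y (B + C) (\<lambda>x. T x - U x)"
proof -
  interpret Y: normed_sp_loc Y by standard fact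
  have "nrm Y (T x - U x) \<le> (B + C) * nrm X x" if "x \<in> vecs X" for x
    using Y.nrm_diff[of "T x" "U x"] bopD(2,5)[OF assms(1) that] bopD(2,5)[OF assms(2) that]
    by (simp add: distrib_right)
  then show ?thesis
    using assms by (auto simp: bop_def algebra_simps)
qed

lemma bop_id: "normed_sp X \<Longrightarrow> bop X X 1 (\<lambda>x. x)"
  by (simp add: bop_def)

lemma bop_0: "bop X Y B T \<Longrightarrow> normed_sp X \<Longrightarrow> T 0 = 0"
  using bopD(4)[of X Y B T 0 0] normed_sp_loc.zero_mem[of X] by (simp add: normed_sp_loc_def)

lemma bop_sum:
  assumes "bop X Y B T" "normed_sp X" "\<And>i. i \<in> A \<Longrightarrow> f i \<in> vecs X"
  shows "T (\<Sum>i\<in>A. f i) = (\<Sum>i\<in>A. T (f i))"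
  using assms(3)
proof (induction A rule: infinite_finite_induct)
  case (insert a A)
  interpret normed_sp_loc X by standard fact
  show ?case
    using insert by (simp add: bopD(3)[OF assms(1)] sum_mem)
qed (simp_all add: bop_0[OF assms(1,2)])

lemma bop_minus: "bop X Y B T \<Longrightarrow> x \<in> vecs X \<Longrightarrow> T (- x) = - T x"
  using bopD(4)[of X Y B T x "- 1"] by simp

lemma bop_diff_apply:
  assumes "bop X Y B T" "normed_sp X" "x \<in> vecs X" "y \<in> vecs X"
  shows "T (x - y) = T x - T y"
proof -
  interpret normed_sp_loc X by standard fact
  show ?thesis
    using bopD(3)[OF assms(1), of x "- y"] bop_minus[OF assms(1), of y] assms by auto
qed

lemma op_norm_le:
  assumes "bop X Y B T" "normed_sp X"
  shows "op_norm X Y T \<le> B"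
proof -
  interpret normed_sp_loc X by standard fact
  show ?thesis
    unfolding op_norm_def
  proof (rule cSUP_least)
    show "{x \<in> vecs X. nrm X x \<le> 1} \<noteq> {}"
      using zero_mem nrm_0 by (metis (mono_tags, lifting) empty_iff mem_Collect_eq zero_le_one)
    fix x assume "x \<in> {x \<in> vecs X. nrm X x \<le> 1}"
    then show "nrm Y (T x) \<le> B"
      using bopD(1)[OF assms(1)] bopD(5)[OF assms(1), of x] mult_left_mono[of "nrm X x" 1 B] by auto
  qed
qed

lemma op_norm_bop:
  assumes "bop X Y B T" "normed_sp X" "normed_sp Y"
  shows "bop X Y (op_norm X Y T) T"
proof -
  interpret normed_sp_loc X by standard fact
  interpret Y: normed_sp_loc Y by standard fact
  have bdd: "bdd_above ((\<lambda>x. nrm Y (T x)) ` {x \<in> vecs X. nrm X x \<le> 1})"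
  proof (rule bdd_aboveI[of _ B])
    fix y assume "y \<in> (\<lambda>x. nrm Y (T x)) ` {x \<in> vecs X. nrm X x \<le> 1}"
    then show "y \<le> B"
      using bopD(1,5)[OF assms(1)] by (auto intro: order_trans[OF _ mult_left_le])
  qed
  have le: "nrm Y (T x) \<le> op_norm X Y T" if "x \<in> vecs X" "nrm X x \<le> 1" for x
    unfolding op_norm_def using that by (intro cSUP_upper[OF _ bdd]) auto
  have "0 \<le> op_norm X Y T"
    using le[of 0] bop_0[OF assms(1,2)] by simp
  moreover have "nrm Y (T x) \<le> op_norm X Y T * nrm X x" if x: "x \<in> vecs X" for x
  proof (cases "nrm X x = 0")
    case True
    then show ?thesis
      using nrm_eq_0D[OF x] bop_0[OF assms(1,2)] by simp
  next
    case False
    then have pos: "0 < nrm X x"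
      using nrm_nonneg[OF x] by linarith
    have "nrm Y (T ((1 / nrm X x) *\<^sub>R x)) \<le> op_norm X Y T"
      using pos x by (intro le) (auto simp: nrm_scale)
    also have "nrm Y (T ((1 / nrm X x) *\<^sub>R x)) = nrm Y (T x) / nrm X x"
      using pos x bopD(2,4)[OF assms(1)] by (simp add: Y.nrm_scale)
    finally show ?thesis
      using pos by (simp add: divide_le_eq)
  qed
  ultimately show ?thesis
    using assms(1) by (simp add: bop_def)
qed

lemma vecs_real_line [simp]: "vecs real_line = UNIV"
  and nrm_real_line [simp]: "nrm real_line = abs"
  by (simp_all add: real_line_def)

lemma normed_sp_real_line: "normed_sp real_line"
  unfolding normed_sp_def by (simp add: subspace_UNIV abs_mult abs_triangle_ineq)

lemma dual_bop:
  assumes "normed_sp X" "\<phi> \<in> vecs (dual_space X)"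
  shows "bop X real_line (nrm (dual_space X) \<phi>) \<phi>"
proof -
  obtain B where "bop X real_line B \<phi>"
    using assms by (auto simp: dual_space_def elim: bounded_op_imp_bop)
  then show ?thesis
    using op_norm_bop[OF _ assms(1) normed_sp_real_line] by (simp add: dual_space_def)
qed

lemma dualI:
  assumes "normed_sp X" "bop X real_line B \<phi>" "\<And>x. x \<notin> vecs X \<Longrightarrow> \<phi> x = 0"
  shows "\<phi> \<in> vecs (dual_space X)" "nrm (dual_space X) \<phi> \<le> B"
  using assms(3) op_norm_le[OF assms(2,1)] bop_imp_bounded_op[OF assms(2)] by (simp_all add: dual_space_def)

lemma normed_sp_dual:
  assumes "normed_sp X"
  shows "normed_sp (dual_space X)"
proof -
  interpret normed_sp_loc X by standard fact
  let ?D = "dual_space X"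
  have off: "\<phi> x = 0" if "\<phi> \<in> vecs ?D" "x \<notin> vecs X" for \<phi> x
    using that by (auto simp: dual_space_def)
  have add: "\<phi> + \<psi> \<in> vecs ?D \<and> nrm ?D (\<phi> + \<psi>) \<le> nrm ?D \<phi> + nrm ?D \<psi>"
    if "\<phi> \<in> vecs ?D" "\<psi> \<in> vecs ?D" for \<phi> \<psi>
  proof -
    have "bop X real_line (nrm ?D \<phi> + nrm ?D \<psi>) (\<phi> + \<psi>)"
      using dual_bop[OF assms that(1)] dual_bop[OF assms that(2)]
      unfolding bop_def by (auto simp: algebra_simps intro: order_trans[OF abs_triangle_ineq add_mono])
    then show ?thesis
      by (intro conjI dualI[OF assms]) (auto simp: off that)
  qed
  have scale: "c *\<^sub>R \<phi> \<in> vecs ?D \<and> nrm ?D (c *\<^sub>R \<phi>) \<le> \<bar>c\<bar> * nrm ?D \<phi>" if "\<phi> \<in> vecs ?D" for c \<phi>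
  proof -
    have "bop X real_line (\<bar>c\<bar> * nrm ?D \<phi>) (c *\<^sub>R \<phi>)"
      using bop_scale[OF dual_bop[OF assms that] normed_sp_real_line, of c] by (simp add: scaleR_fun_def)
    then show ?thesis
      by (intro conjI dualI[OF assms]) (auto simp: off that)
  qed
  have nonneg: "0 \<le> nrm ?D \<phi>" if "\<phi> \<in> vecs ?D" for \<phi>
    using dual_bop[OF assms that] by (simp add: bop_def)
  have scale': "nrm ?D (c *\<^sub>R \<phi>) = \<bar>c\<bar> * nrm ?D \<phi>" if "\<phi> \<in> vecs ?D" for c \<phi>
  proof (cases "c = 0")
    case True
    then show ?thesis
      using scale[OF that, of c] nonneg[of "c *\<^sub>R \<phi>"] by simp
  next
    case False
    have "nrm ?D ((1 / c) *\<^sub>R c *\<^sub>R \<phi>) \<le> \<bar>1 / c\<bar> * nrm ?D (c *\<^sub>R \<phi>)"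
      using scale[of "c *\<^sub>R \<phi>" "1 / c"] scale[OF that] by blast
    then have "\<bar>c\<bar> * nrm ?D \<phi> \<le> nrm ?D (c *\<^sub>R \<phi>)"
      using False by (simp add: field_simps)
    then show ?thesis
      using scale[OF that, of c] by simp
  qed
  have zero: "0 \<in> vecs ?D"
    using dualI(1)[OF assms, of 0 0] by (simp add: bop_def)
  have def0: "\<phi> = 0" if "\<phi> \<in> vecs ?D" "nrm ?D \<phi> = 0" for \<phi>
  proof
    fix x show "\<phi> x = 0 x"
      using dual_bop[OF assms that(1)] that(2) off[OF that(1), of x] by (cases "x \<in> vecs X") (auto simp: bop_def)
  qed
  show ?thesis
    unfolding normed_sp_def subspace_def using zero add scale scale' nonneg def0 by blast
qed

section \<open>The sum of normed spaces as a normed space\<close>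

context lr_exponent
begin

context
  fixes X :: "nat \<Rightarrow> 'v::real_vector nspace"
  assumes X: "\<And>n. normed_sp (X n)"
begin

interpretation X: normed_sp_loc "X n" for n
  by standard (rule X)

lemma lr_nth_mem: "f \<in> vecs (lr_sum r X) \<Longrightarrow> f n \<in> vecs (X n)"
  by (auto simp: lr_sum_def)

lemma lr_sumI:
  assumes "\<And>n. f n \<in> vecs (X n)" "lr_le r (\<lambda>n. nrm (X n) (f n)) c"
  shows "f \<in> vecs (lr_sum r X)" "nrm (lr_sum r X) f \<le> c"
  using lr_le_iff[of f X c] assms by (auto simp: lr_le_def)

lemma lr_sum_nonneg:
  assumes "f \<in> vecs (lr_sum r X)"
  shows "0 \<le> nrm (lr_sum r X) f"
proof (cases "r = \<infinity>")
  case True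
  have "nrm (X 0) (f 0) \<le> (SUP n. nrm (X n) (f n))"
    using assms True by (intro cSUP_upper) (auto simp: lr_sum_def)
  then show ?thesis
    using True X.nrm_nonneg[OF lr_nth_mem[OF assms, of 0]] by (simp add: lr_sum_def)
qed (simp add: lr_sum_def)

lemma lr_sumD:
  assumes "f \<in> vecs (lr_sum r X)"
  shows "lr_le r (\<lambda>n. nrm (X n) (f n)) (nrm (lr_sum r X) f)"
  using lr_le_iff[of f X "nrm (lr_sum r X) f"] assms lr_nth_mem[OF assms] lr_sum_nonneg[OF assms] by auto

lemma lr_nrm_nth:
  assumes "f \<in> vecs (lr_sum r X)"
  shows "nrm (X n) (f n) \<le> nrm (lr_sum r X) f"
  using lr_le_nth[OF lr_sumD[OF assms]] lr_nth_mem[OF assms] by simp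

lemma normed_sp_lr_sum: "normed_sp (lr_sum r X)"
proof -
  let ?L = "lr_sum r X"
  have zero: "0 \<in> vecs ?L"
    by (rule lr_sumI[of _ 0]) (auto simp: lr_le_def)
  have add: "f + g \<in> vecs ?L \<and> nrm ?L (f + g) \<le> nrm ?L f + nrm ?L g"
    if "f \<in> vecs ?L" "g \<in> vecs ?L" for f g
  proof -
    note mem = lr_nth_mem[OF that(1)] lr_nth_mem[OF that(2)]
    have "lr_le r (\<lambda>n. nrm (X n) ((f + g) n)) (nrm ?L f + nrm ?L g)"
      by (rule lr_le_mono[OF lr_le_add[OF lr_sumD[OF that(1)] lr_sumD[OF that(2)]]])
        (use mem X.nrm_add in \<open>auto simp: X.add_mem\<close>)
    then show ?thesis
      using lr_sumI[of "f + g" "nrm ?L f + nrm ?L g"] mem by (simp add: X.add_mem)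
  qed
  have scale: "c *\<^sub>R f \<in> vecs ?L \<and> nrm ?L (c *\<^sub>R f) \<le> \<bar>c\<bar> * nrm ?L f" if "f \<in> vecs ?L" for c f
  proof -
    have "lr_le r (\<lambda>n. nrm (X n) ((c *\<^sub>R f) n)) (\<bar>c\<bar> * nrm ?L f)"
      using lr_le_scale[OF lr_sumD[OF that], of "\<bar>c\<bar>"] lr_nth_mem[OF that] by (simp add: X.nrm_scale)
    then show ?thesis
      using lr_sumI[of "c *\<^sub>R f" "\<bar>c\<bar> * nrm ?L f"] lr_nth_mem[OF that] by (simp add: X.scale_mem)
  qed
  have scale': "nrm ?L (c *\<^sub>R f) = \<bar>c\<bar> * nrm ?L f" if "f \<in> vecs ?L" for c f
  proof (cases "c = 0")
    case True
    then show ?thesis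
      using scale[OF that, of c] lr_sum_nonneg[of "c *\<^sub>R f"] by simp
  next
    case False
    have "nrm ?L ((1 / c) *\<^sub>R c *\<^sub>R f) \<le> \<bar>1 / c\<bar> * nrm ?L (c *\<^sub>R f)"
      using scale[of "c *\<^sub>R f" "1 / c"] scale[OF that] by blast
    then have "\<bar>c\<bar> * nrm ?L f \<le> nrm ?L (c *\<^sub>R f)"
      using False by (simp add: field_simps)
    then show ?thesis
      using scale[OF that, of c] by simp
  qed
  have def0: "f = 0" if "f \<in> vecs ?L" "nrm ?L f = 0" for f
  proof
    fix n show "f n = 0 n"
      using lr_nrm_nth[OF that(1), of n] that(2) X.nrm_nonneg[OF lr_nth_mem[OF that(1)]]
        X.nrm_eq_0D[OF lr_nth_mem[OF that(1)]] by (auto intro: antisym)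
  qed
  show ?thesis
    unfolding normed_sp_def subspace_def using zero add scale scale' lr_sum_nonneg def0 by blast
qed

end

end

text \<open>Only series with geometrically decreasing terms are tested. For normed spaces this is
  equivalent to convergence of all Cauchy sequences, and it is the shape of a Neumann series for an
  operator of norm at most 1/2.\<close>

definition complete_sp :: "'v::real_vector nspace \<Rightarrow> bool" where
  "complete_sp X \<longleftrightarrow> (\<forall>u C. (\<forall>k. u k \<in> vecs X \<and> nrm X (u k) \<le> C / 2 ^ k) \<longrightarrow>
     (\<exists>x\<in>vecs X. (\<lambda>k. nrm X ((\<Sum>i<k. u i) - x)) \<longlonglongrightarrow> 0))"

lemma geometric_tail_le:
  fixes C :: real
  assumes "0 \<le> C"
  shows "(\<Sum>i\<in>{k..<m}. C / 2 ^ i) \<le> 2 * C / 2 ^ k"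
proof -
  have "(\<Sum>i\<in>{k..<m}. C / 2 ^ i) = 2 * C / 2 ^ k - 2 * C / 2 ^ m" if "k \<le> m"
    using that by (induction m rule: dec_induct) simp_all
  then show ?thesis
    using assms by (cases "k \<le> m") auto
qed

lemma (in normed_sp_loc) partial_sums_tail:
  assumes u: "\<And>k. u k \<in> vecs X" "\<And>k. nrm X (u k) \<le> C / 2 ^ k" and "k \<le> m"
  shows "nrm X ((\<Sum>i<m. u i) - (\<Sum>i<k. u i)) \<le> 2 * C / 2 ^ k"
proof -
  have C: "0 \<le> C"
    using u(2)[of 0] nrm_nonneg[OF u(1), of 0] by simp
  have "(\<Sum>i<m. u i) - (\<Sum>i<k. u i) = (\<Sum>i\<in>{k..<m}. u i)"
    using sum_diff_nat_ivl[of 0 k m u] \<open>k \<le> m\<close> by (simp add: lessThan_atLeast0)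
  then have "nrm X ((\<Sum>i<m. u i) - (\<Sum>i<k. u i)) \<le> (\<Sum>i\<in>{k..<m}. C / 2 ^ i)"
    using nrm_sum[of "{k..<m}" u] u(1) sum_mono[of "{k..<m}" "\<lambda>i. nrm X (u i)" "\<lambda>i. C / 2 ^ i", OF u(2)]
    by simp
  then show ?thesis
    using geometric_tail_le[OF C, of k m] by simp
qed

text \<open>The coordinatewise limit is the candidate. The bound 2C/2^k for the difference of two
  partial sums does not depend on the later index, so \<open>lr_le_limit\<close> transfers it to the
  limit; membership and convergence come out together.\<close>

lemma (in lr_exponent) complete_lr_sum:
  fixes X :: "nat \<Rightarrow> 'v::real_vector nspace"
  assumes X: "\<And>n. normed_sp (X n)" and "\<And>n. complete_sp (X n)"
  shows "complete_sp (lr_sum r X)"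
  unfolding complete_sp_def
proof (intro allI impI)
  fix u C assume u: "\<forall>k. u k \<in> vecs (lr_sum r X) \<and> nrm (lr_sum r X) (u k) \<le> C / 2 ^ k"
  interpret X: normed_sp_loc "X n" for n by standard (rule X)
  interpret L: normed_sp_loc "lr_sum r X" by standard (rule normed_sp_lr_sum[OF X])
  have un: "u k n \<in> vecs (X n)" "nrm (X n) (u k n) \<le> C / 2 ^ k" for k n
    using u lr_nth_mem[of X "u k" n] lr_nrm_nth[of X "u k" n] X order_trans by blast+
  have "\<exists>x\<in>vecs (X n). (\<lambda>k. nrm (X n) ((\<Sum>i<k. u i n) - x)) \<longlonglongrightarrow> 0" for n
    using assms(2)[of n, unfolded complete_sp_def, rule_format, of "\<lambda>k. u k n" C] un by blast
  then obtain x where x: "\<And>n. x n \<in> vecs (X n)"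
    "\<And>n. (\<lambda>k. nrm (X n) ((\<Sum>i<k. u i n) - x n)) \<longlonglongrightarrow> 0"
    by metis
  let ?s = "\<lambda>k. \<Sum>i<k. u i"
  have s: "?s k \<in> vecs (lr_sum r X)" for k
    using u by auto
  have tail: "lr_le r (\<lambda>n. nrm (X n) ((?s k - x) n)) (2 * C / 2 ^ k)" for k
  proof (rule lr_le_limit[where a = "\<lambda>m n. nrm (X n) ((?s k - ?s (k + m)) n)"])
    fix m
    have "nrm (lr_sum r X) (?s (k + m) - ?s k) \<le> 2 * C / 2 ^ k"
      using u by (intro L.partial_sums_tail) auto
    then have le: "nrm (lr_sum r X) (?s k - ?s (k + m)) \<le> 2 * C / 2 ^ k"
      using L.nrm_diff_commute[OF s s] by metis
    have "0 \<le> 2 * C / 2 ^ k"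
      using le L.nrm_nonneg[of "?s k - ?s (k + m)"] s by (meson L.diff_mem order_trans)
    then show "lr_le r (\<lambda>n. nrm (X n) ((?s k - ?s (k + m)) n)) (2 * C / 2 ^ k)"
      by (intro lr_le_iff[THEN iffD2] conjI X.nrm_nonneg L.diff_mem s le lr_nth_mem[where X = X, OF X])
  next
    fix n
    have "(\<lambda>m. nrm (X n) ((\<Sum>i<m + k. u i n) - x n)) \<longlonglongrightarrow> 0"
      by (rule LIMSEQ_ignore_initial_segment[OF x(2)])
    then have "(\<lambda>m. nrm (X n) ((\<Sum>i<k. u i n) - (\<Sum>i<k + m. u i n) - ((\<Sum>i<k. u i n) - x n))) \<longlonglongrightarrow> 0"
      by (subst X.nrm_diff_commute) (auto simp: un x add.commute intro!: X.diff_mem X.sum_mem)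
    then show "(\<lambda>m. nrm (X n) ((?s k - ?s (k + m)) n)) \<longlonglongrightarrow> nrm (X n) ((?s k - x) n)"
      unfolding fun_diff_def sum_fun_apply
      by (intro X.nrm_tendsto) (auto simp: un x intro!: X.diff_mem X.sum_mem)
  next
    show "0 \<le> nrm (X n) ((?s k - ?s (k + m)) n)" for m n
      by (intro X.nrm_nonneg L.diff_mem s lr_nth_mem[where X = X, OF X])
  qed
  have dx: "?s k - x \<in> vecs (lr_sum r X)" "nrm (lr_sum r X) (?s k - x) \<le> 2 * C / 2 ^ k" for k
    by (rule lr_sumI[OF X _ tail]; auto simp: sum_fun_apply x un intro!: X.diff_mem X.sum_mem)+
  show "\<exists>x\<in>vecs (lr_sum r X). (\<lambda>k. nrm (lr_sum r X) (?s k - x)) \<longlonglongrightarrow> 0"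
  proof (rule bexI[of _ x])
    show "x \<in> vecs (lr_sum r X)"
      using dx(1)[of 0] L.minus_mem[of "- x"] by simp
    have "(\<lambda>k. 2 * C * (1 / 2) ^ k) \<longlonglongrightarrow> 2 * C * 0"
      by (intro tendsto_intros) auto
    then have lim: "(\<lambda>k. 2 * C * (1 / 2) ^ k) \<longlonglongrightarrow> 0"
      by simp
    show "(\<lambda>k. nrm (lr_sum r X) (?s k - x)) \<longlonglongrightarrow> 0"
    proof (rule Lim_null_comparison[of _ "\<lambda>k. 2 * C * (1 / 2) ^ k", OF _ lim])
      have "norm (nrm (lr_sum r X) (?s k - x)) \<le> 2 * C * (1 / 2) ^ k" for k
        using dx(2)[of k] L.nrm_nonneg[OF dx(1)[of k]] by (simp only: real_norm_def abs_of_nonneg power_one_over) simp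
      then show "\<forall>\<^sub>F k in sequentially. norm (nrm (lr_sum r X) (?s k - x)) \<le> 2 * C * (1 / 2) ^ k"
        by simp
    qed
  qed
qed

text \<open>\<open>G\<close> inverts Id + K. Existence of a solution comes from the series of (-K)^k
  y, whose terms decrease at least like 2^-k; uniqueness comes from K being a strict contraction.
  The constant 1 + 2\<delta> is a linear majorant of 1 / (1 - \<delta>) on [0, 1/2].\<close>

lemma neumann:
  assumes X: "normed_sp X" and "complete_sp X" and K: "bop X X \<delta> K" and \<delta>: "\<delta> \<le> 1 / 2"
  obtains G where "bop X X (1 + 2 * \<delta>) G" "\<And>x. x \<in> vecs X \<Longrightarrow> G (x + K x) = x"
proof -
  interpret normed_sp_loc X by standard fact
  have \<delta>0: "0 \<le> \<delta>" using K by (simp add: bop_def)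
  define M where "M x = - K x" for x
  have Mmem: "M x \<in> vecs X" if "x \<in> vecs X" for x
    using that bopD(2)[OF K] by (auto simp: M_def)
  have Mn: "nrm X (M x) \<le> \<delta> * nrm X x" if "x \<in> vecs X" for x
    using that bopD(2,5)[OF K] by (simp add: M_def nrm_minus)
  have inj: "x = y" if "x \<in> vecs X" "y \<in> vecs X" "x + K x = y + K y" for x y
  proof -
    have d: "x - y \<in> vecs X" using that by auto
    have "x - y = - K (x - y)"
    proof -
      have "x - y = (x + K x) - (y + K x)" by simp
      also have "\<dots> = - (K x - K y)" unfolding that(3) by simp
      finally have "x - y = - (K x - K y)" .
      moreover have "K (x - y) = K x - K y"
        by (rule bop_diff_apply[OF K X that(1,2)])
      ultimately show ?thesis by argo
    qed
    then have "nrm X (x - y) \<le> \<delta> * nrm X (x - y)"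
      using bopD(2,5)[OF K d] nrm_minus by metis
    then have "nrm X (x - y) = 0"
      using nrm_nonneg[OF d] mult_right_mono[OF \<delta>, of "nrm X (x - y)"] by linarith
    then show ?thesis
      using nrm_eq_0D[OF d] by simp
  qed
  have sol: "\<exists>x\<in>vecs X. x + K x = y" if y: "y \<in> vecs X" for y
  proof -
    define u where "u k = (M ^^ k) y" for k
    have u: "u k \<in> vecs X" for k
      by (induction k) (auto simp: u_def y Mmem)
    have un: "nrm X (u k) \<le> nrm X y / 2 ^ k" for k
    proof (induction k)
      case (Suc k)
      have "nrm X (u (Suc k)) \<le> \<delta> * nrm X (u k)"
        using Mn[OF u, of k] by (simp add: u_def)
      also have "\<dots> \<le> 1 / 2 * (nrm X y / 2 ^ k)"
        using Suc \<delta> \<delta>0 u by (intro mult_mono) auto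
      finally show ?case by simp
    qed (simp add: u_def)
    obtain x where x: "x \<in> vecs X" "(\<lambda>k. nrm X ((\<Sum>i<k. u i) - x)) \<longlonglongrightarrow> 0"
      using assms(2)[unfolded complete_sp_def, rule_format, of u "nrm X y"] u un by blast
    let ?s = "\<lambda>k. \<Sum>i<k. u i"
    have s: "?s k \<in> vecs X" for k using u by auto
    have step: "?s k + K (?s k) = y - u k" for k
    proof (induction k)
      case 0 then show ?case using bop_0[OF K X] by (simp add: u_def)
    next
      case (Suc k)
      have "K (?s k + u k) = K (?s k) + K (u k)"
        using s u by (intro bopD(3)[OF K])
      moreover have "K (u k) = - u (Suc k)"
        by (simp add: u_def M_def)
      ultimately have "?s (Suc k) + K (?s (Suc k)) = (?s k + K (?s k)) + u k - u (Suc k)"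
        by (simp add: algebra_simps)
      then show ?case
        unfolding Suc by simp
    qed
    have "nrm X (x + K x - y) \<le> 2 * nrm X (?s k - x) + nrm X y * (1 / 2) ^ k" for k
    proof -
      have uk: "u k = y - (?s k + K (?s k))"
        unfolding step by simp
      have eq: "x + K x - y = (x - ?s k) + K (x - ?s k) - u k"
        unfolding uk bop_diff_apply[OF K X x(1) s] by simp
      have d: "x - ?s k \<in> vecs X" using x s by auto
      have "nrm X (x + K x - y) \<le> nrm X (x - ?s k) + nrm X (K (x - ?s k)) + nrm X (u k)"
        unfolding eq using d u bopD(2)[OF K d]
        by (intro order_trans[OF nrm_diff] add_mono nrm_add order_refl) auto
      also have "\<dots> \<le> nrm X (x - ?s k) + 1 * nrm X (x - ?s k) + nrm X y / 2 ^ k"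
        using bopD(5)[OF K d] \<delta> d mult_right_mono[of \<delta> 1 "nrm X (x - ?s k)"] un[of k]
        by (intro add_mono) auto
      finally show ?thesis
        using nrm_diff_commute[OF x(1) s, of k] by (simp add: field_simps)
    qed
    moreover have "(\<lambda>k. 2 * nrm X (?s k - x) + nrm X y * (1 / 2) ^ k) \<longlonglongrightarrow> 2 * 0 + nrm X y * 0"
      by (intro tendsto_intros x) auto
    ultimately have "nrm X (x + K x - y) \<le> 0"
      by (intro LIMSEQ_le_const[of _ "0::real"]) auto
    then have "x + K x - y = 0"
      using x(1) y bopD(2)[OF K x(1)] by (intro nrm_eq_0D antisym nrm_nonneg) auto
    then show ?thesis using x by auto
  qed
  \<comment> \<open>\<open>G\<close> is defined by choice; its linearity is recovered from the
    uniqueness of the solution, through \<open>left\<close>.\<close>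
  define G where "G y = (SOME x. x \<in> vecs X \<and> x + K x = y)" for y
  have G: "G y \<in> vecs X" "G y + K (G y) = y" if "y \<in> vecs X" for y
    using someI_ex[of "\<lambda>x. x \<in> vecs X \<and> x + K x = y"] sol[OF that] by (auto simp: G_def)
  have left: "G (x + K x) = x" if "x \<in> vecs X" for x
  proof -
    have y: "x + K x \<in> vecs X"
      using that bopD(2)[OF K that] by auto
    show ?thesis
      by (rule inj[OF G(1)[OF y] that G(2)[OF y]])
  qed
  have "bop X X (1 + 2 * \<delta>) G"
    unfolding bop_def
  proof (intro conjI ballI allI)
    fix y assume y: "y \<in> vecs X"
    show "G y \<in> vecs X" by (rule G[OF y])
    have "nrm X (y - K (G y)) \<le> nrm X y + nrm X (K (G y))"
      using y G[OF y] bopD(2)[OF K] by (intro nrm_diff) auto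
    moreover have e: "y - K (G y) = G y"
      using G(2)[OF y] by (metis add_diff_cancel_right')
    ultimately have "nrm X (G y) \<le> nrm X y + \<delta> * nrm X (G y)"
      unfolding e using bopD(5)[OF K G(1)[OF y]] by linarith
    then have "(1 - \<delta>) * nrm X (G y) \<le> nrm X y"
      by (simp add: algebra_simps)
    then have "(1 + 2 * \<delta>) * ((1 - \<delta>) * nrm X (G y)) \<le> (1 + 2 * \<delta>) * nrm X y"
      using \<delta>0 by (intro mult_left_mono) auto
    moreover have "1 * nrm X (G y) \<le> ((1 + 2 * \<delta>) * (1 - \<delta>)) * nrm X (G y)"
    proof (rule mult_right_mono)
      \<comment> \<open>(1 + 2\<delta>)(1 - \<delta>) = 1 + \<delta>(1 - 2\<delta>), hence at least
        1 for \<delta> \<le> 1/2.\<close>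
      have "0 \<le> \<delta> * (1 - 2 * \<delta>)"
        using \<delta> \<delta>0 by (intro mult_nonneg_nonneg) auto
      then show "1 \<le> (1 + 2 * \<delta>) * (1 - \<delta>)"
        by (simp add: algebra_simps)
    qed (use G[OF y] in auto)
    ultimately show "nrm X (G y) \<le> (1 + 2 * \<delta>) * nrm X y"
      by (simp add: mult.assoc)
    fix z assume z: "z \<in> vecs X"
    have "G y + G z + K (G y + G z) = (G y + K (G y)) + (G z + K (G z))"
      using bopD(3)[OF K G(1)[OF y] G(1)[OF z]] by (simp add: algebra_simps)
    then have "G y + G z + K (G y + G z) = y + z"
      by (simp only: G(2)[OF y] G(2)[OF z])
    then show "G (y + z) = G y + G z"
      using left[OF add_mem[OF G(1)[OF y] G(1)[OF z]]] by metis
  next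
    fix c y assume y: "y \<in> vecs X"
    have "c *\<^sub>R G y + K (c *\<^sub>R G y) = c *\<^sub>R (G y + K (G y))"
      by (simp only: bopD(4)[OF K G(1)[OF y]] scaleR_right_distrib)
    then show "G (c *\<^sub>R y) = c *\<^sub>R G y"
      using left[OF scale_mem[OF G(1)[OF y]], of c] G(2)[OF y] by metis
  qed (use \<delta>0 in auto)
  then show thesis
    using left by (rule that)
qed

section \<open>Gluing local factorizations\<close>

text \<open>Bounded functionals that reproduce every vector. In this form finite dimensionality
  turns finitely many scalar estimates into a norm estimate, and it passes to the dual by exchanging
  the roles of \<open>e\<close> and \<open>c\<close>.\<close>

definition coord_system :: "'v::real_vector nspace \<Rightarrow> nat \<Rightarrow> (nat \<Rightarrow> 'v) \<Rightarrow> (nat \<Rightarrow> 'v \<Rightarrow> real) \<Rightarrow> (nat \<Rightarrow> real) \<Rightarrow> bool" where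
  "coord_system X d e c B \<longleftrightarrow> (\<forall>i<d. e i \<in> vecs X \<and> bop X real_line (B i) (c i)) \<and>
     (\<forall>x\<in>vecs X. x = (\<Sum>i<d. c i x *\<^sub>R e i))"

definition fdim :: "'v::real_vector nspace \<Rightarrow> bool" where
  "fdim X \<longleftrightarrow> (\<exists>d e c B. coord_system X d e c B)"

lemma coord_nrm_le:
  assumes "coord_system X d e c B" "normed_sp X" "x \<in> vecs X"
  shows "nrm X x \<le> (\<Sum>i<d. \<bar>c i x\<bar> * nrm X (e i))"
proof -
  interpret normed_sp_loc X by standard fact
  have e: "e i \<in> vecs X" if "i < d" for i
    using assms(1) that by (simp add: coord_system_def)
  have "nrm X x = nrm X (\<Sum>i<d. c i x *\<^sub>R e i)"
    using assms(1,3) by (simp add: coord_system_def)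
  also have "\<dots> \<le> (\<Sum>i<d. nrm X (c i x *\<^sub>R e i))"
    using e by (intro nrm_sum) auto
  also have "\<dots> = (\<Sum>i<d. \<bar>c i x\<bar> * nrm X (e i))"
    using e by (intro sum.cong) (auto simp: nrm_scale)
  finally show ?thesis .
qed

lemma coord_bound:
  assumes "coord_system X d e c B" "i < d" "x \<in> vecs X"
  shows "\<bar>c i x\<bar> \<le> B i * nrm X x"
  using assms bopD(5)[of X real_line "B i" "c i" x] by (simp add: coord_system_def)

lemma fdim_complete:
  assumes "fdim X" "normed_sp X"
  shows "complete_sp X"
  unfolding complete_sp_def
proof (intro allI impI)
  fix u C assume u: "\<forall>k. u k \<in> vecs X \<and> nrm X (u k) \<le> C / 2 ^ k"
  interpret normed_sp_loc X by standard fact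
  obtain d e c B where sys: "coord_system X d e c B"
    using assms(1) by (auto simp: fdim_def)
  have e: "e i \<in> vecs X" and c: "bop X real_line (B i) (c i)" if "i < d" for i
    using sys that by (auto simp: coord_system_def)
  have bd: "norm (c i (u k)) \<le> B i * C * (1 / 2) ^ k" if "i < d" for i k
  proof -
    have "norm (c i (u k)) \<le> B i * nrm X (u k)"
      using coord_bound[OF sys that] u by simp
    also have "\<dots> \<le> B i * (C / 2 ^ k)"
      using u bopD(1)[OF c[OF that]] by (intro mult_left_mono) auto
    finally show ?thesis
      by (simp add: power_one_over)
  qed
  have summ: "summable (\<lambda>k. c i (u k))" if "i < d" for i
    by (rule summable_comparison_test'[of "\<lambda>k. B i * C * (1 / 2) ^ k" 0])
      (use bd[OF that] in \<open>auto intro!: summable_mult summable_geometric\<close>)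
  define x where "x = (\<Sum>i<d. (\<Sum>k. c i (u k)) *\<^sub>R e i)"
  have x: "x \<in> vecs X"
    unfolding x_def using e by auto
  have eq: "(\<Sum>k<m. u k) - x = (\<Sum>i<d. ((\<Sum>k<m. c i (u k)) - (\<Sum>k. c i (u k))) *\<^sub>R e i)" for m
  proof -
    have "(\<Sum>k<m. u k) = (\<Sum>k<m. \<Sum>i<d. c i (u k) *\<^sub>R e i)"
      using sys u by (intro sum.cong) (auto simp: coord_system_def)
    also have "\<dots> = (\<Sum>i<d. (\<Sum>k<m. c i (u k)) *\<^sub>R e i)"
      by (subst sum.swap) (simp add: scaleR_sum_left)
    finally show ?thesis
      by (simp add: x_def sum_subtractf scaleR_diff_left)
  qed
  have "(\<lambda>m. \<Sum>i<d. \<bar>(\<Sum>k<m. c i (u k)) - (\<Sum>k. c i (u k))\<bar> * nrm X (e i)) \<longlonglongrightarrow> (\<Sum>i<d. \<bar>0\<bar> * nrm X (e i))"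
  proof (intro tendsto_sum tendsto_mult tendsto_rabs tendsto_const)
    fix i assume "i \<in> {..<d}"
    then have "(\<lambda>m. \<Sum>k<m. c i (u k)) \<longlonglongrightarrow> (\<Sum>k. c i (u k))"
      using summ[of i] by (intro summable_LIMSEQ) auto
    then show "(\<lambda>m. (\<Sum>k<m. c i (u k)) - (\<Sum>k. c i (u k))) \<longlonglongrightarrow> 0"
      by (rule LIM_zero)
  qed
  then have lim: "(\<lambda>m. \<Sum>i<d. \<bar>(\<Sum>k<m. c i (u k)) - (\<Sum>k. c i (u k))\<bar> * nrm X (e i)) \<longlonglongrightarrow> 0"
    by simp
  have "(\<lambda>m. nrm X ((\<Sum>k<m. u k) - x)) \<longlonglongrightarrow> 0"
  proof (rule Lim_null_comparison[OF _ lim])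
    have "nrm X ((\<Sum>k<m. u k) - x) \<le> (\<Sum>i<d. \<bar>(\<Sum>k<m. c i (u k)) - (\<Sum>k. c i (u k))\<bar> * nrm X (e i))" for m
      unfolding eq using e by (intro order_trans[OF nrm_sum] sum_mono) (auto simp: nrm_scale)
    moreover have "0 \<le> nrm X ((\<Sum>k<m. u k) - x)" for m
      using u x by (intro nrm_nonneg) auto
    ultimately show "\<forall>\<^sub>F m in sequentially. norm (nrm X ((\<Sum>k<m. u k) - x))
        \<le> (\<Sum>i<d. \<bar>(\<Sum>k<m. c i (u k)) - (\<Sum>k. c i (u k))\<bar> * nrm X (e i))"
      by simp
  qed
  with x show "\<exists>x\<in>vecs X. (\<lambda>k. nrm X ((\<Sum>i<k. u i) - x)) \<longlonglongrightarrow> 0"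
    by blast
qed

text \<open>Besides compressing T to almost a multiple of the identity, the copy is made almost
  invisible to prescribed vectors and functionals: \<open>R\<close> nearly kills \<open>V\<close>,
  and \<open>\<Phi>\<close> nearly vanishes on the range of \<open>S\<close>. In the gluing they
  encode the interaction with the copies chosen before. Only their number and size are fixed in
  advance, since \<open>N\<close> has to be chosen before objects on \<open>Y N\<close> can be
  named.\<close>

definition local_factor_at :: "(nat \<Rightarrow> 'v::real_vector nspace) \<Rightarrow> nat \<Rightarrow> nat \<Rightarrow> real \<Rightarrow> nat \<Rightarrow> real \<Rightarrow> bool" where
  "local_factor_at Y n N \<Gamma> M \<epsilon> \<longleftrightarrow> (\<forall>T V \<Phi>.
     bop (Y N) (Y N) \<Gamma> T \<and> finite V \<and> card V \<le> M \<and> (\<forall>v\<in>V. v \<in> vecs (Y N) \<and> nrm (Y N) v \<le> \<Gamma>) \<and>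
     finite \<Phi> \<and> card \<Phi> \<le> M \<and> (\<forall>\<phi>\<in>\<Phi>. bop (Y N) real_line \<Gamma> \<phi>) \<longrightarrow>
     (\<exists>R S l. bop (Y N) (Y n) 1 R \<and> bop (Y n) (Y N) 1 S \<and>
        (\<forall>x\<in>vecs (Y n). R (S x) = x \<and> nrm (Y n) (R (T (S x)) - l *\<^sub>R x) \<le> \<epsilon> * nrm (Y n) x \<and>
           (\<forall>\<phi>\<in>\<Phi>. \<bar>\<phi> (S x)\<bar> \<le> \<epsilon> * nrm (Y n) x)) \<and>
        (\<forall>v\<in>V. nrm (Y n) (R v) \<le> \<epsilon>)))"

lemma local_factor_atE:
  assumes "local_factor_at Y n N \<Gamma> M \<epsilon>"
    and "bop (Y N) (Y N) \<Gamma> T" "finite V" "card V \<le> M"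
    and "\<And>v. v \<in> V \<Longrightarrow> v \<in> vecs (Y N)" "\<And>v. v \<in> V \<Longrightarrow> nrm (Y N) v \<le> \<Gamma>"
    and "finite \<Phi>" "card \<Phi> \<le> M" "\<And>\<phi>. \<phi> \<in> \<Phi> \<Longrightarrow> bop (Y N) real_line \<Gamma> \<phi>"
  obtains R S l where "bop (Y N) (Y n) 1 R" "bop (Y n) (Y N) 1 S"
    "\<And>x. x \<in> vecs (Y n) \<Longrightarrow> R (S x) = x"
    "\<And>x. x \<in> vecs (Y n) \<Longrightarrow> nrm (Y n) (R (T (S x)) - l *\<^sub>R x) \<le> \<epsilon> * nrm (Y n) x"
    "\<And>x \<phi>. x \<in> vecs (Y n) \<Longrightarrow> \<phi> \<in> \<Phi> \<Longrightarrow> \<bar>\<phi> (S x)\<bar> \<le> \<epsilon> * nrm (Y n) x"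
    "\<And>v. v \<in> V \<Longrightarrow> nrm (Y n) (R v) \<le> \<epsilon>"
proof -
  have "\<exists>R S l. bop (Y N) (Y n) 1 R \<and> bop (Y n) (Y N) 1 S \<and>
        (\<forall>x\<in>vecs (Y n). R (S x) = x \<and> nrm (Y n) (R (T (S x)) - l *\<^sub>R x) \<le> \<epsilon> * nrm (Y n) x \<and>
           (\<forall>\<phi>\<in>\<Phi>. \<bar>\<phi> (S x)\<bar> \<le> \<epsilon> * nrm (Y n) x)) \<and>
        (\<forall>v\<in>V. nrm (Y n) (R v) \<le> \<epsilon>)"
    by (rule assms(1)[unfolded local_factor_at_def, rule_format]) (use assms(2-) in auto)
  then show thesis
    using that by blast
qed

definition local_factor :: "(nat \<Rightarrow> 'v::real_vector nspace) \<Rightarrow> bool" where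
  "local_factor Y \<longleftrightarrow> (\<forall>n \<Gamma> M \<epsilon>. 0 < \<epsilon> \<longrightarrow> (\<exists>N0. \<forall>N\<ge>N0. local_factor_at Y n N \<Gamma> M \<epsilon>))"

definition emb :: "nat \<Rightarrow> 'v \<Rightarrow> nat \<Rightarrow> 'v::real_vector" where
  "emb N x = (\<lambda>i. if i = N then x else 0)"

definition tail :: "nat \<Rightarrow> (nat \<Rightarrow> 'v) \<Rightarrow> nat \<Rightarrow> 'v::real_vector" where
  "tail L f = (\<lambda>i. if i < L then 0 else f i)"

section \<open>Coordinates and tails in the sum\<close>

locale lr_family = lr_exponent +
  fixes Y :: "nat \<Rightarrow> 'v::real_vector nspace"
  assumes Y: "\<And>n. normed_sp (Y n)"
begin

sublocale Y: normed_sp_loc "Y n" for n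
  by standard (rule Y)

abbreviation "X \<equiv> lr_sum r Y"

lemma X: "normed_sp X"
  by (rule normed_sp_lr_sum[OF Y])

sublocale X: normed_sp_loc X
  by standard (rule X)

lemma nth_mem: "f \<in> vecs X \<Longrightarrow> f n \<in> vecs (Y n)"
  by (rule lr_nth_mem[where X = Y, OF Y])

lemma nrm_nth: "f \<in> vecs X \<Longrightarrow> nrm (Y n) (f n) \<le> nrm X f"
  by (rule lr_nrm_nth[where X = Y, OF Y])

lemma nrm_nth_nonneg: "f \<in> vecs X \<Longrightarrow> 0 \<le> nrm (Y n) (f n)"
  by (intro Y.nrm_nonneg nth_mem)

lemma emb:
  assumes "x \<in> vecs (Y N)"
  shows "emb N x \<in> vecs X" "nrm X (emb N x) \<le> nrm (Y N) x"
proof -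
  have "(\<lambda>i. nrm (Y i) (emb N x i)) = (\<lambda>i. if i = N then nrm (Y N) x else 0)"
    by (auto simp: emb_def)
  then have le: "lr_le r (\<lambda>i. nrm (Y i) (emb N x i)) (nrm (Y N) x)"
    using lr_le_single[of "nrm (Y N) x" N] assms by simp
  have mem: "emb N x i \<in> vecs (Y i)" for i
    using assms by (auto simp: emb_def)
  show "emb N x \<in> vecs X" "nrm X (emb N x) \<le> nrm (Y N) x"
    by (rule lr_sumI[where X = Y, OF Y mem le])+
qed

lemma bop_emb: "bop (Y N) X 1 (emb N)"
  using emb unfolding bop_def by (auto simp: emb_def fun_eq_iff)

lemma bop_proj: "bop X (Y N) 1 (\<lambda>f. f N)"
  using nth_mem nrm_nth unfolding bop_def by auto

lemma tail_mem:
  assumes "f \<in> vecs X"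
  shows "tail L f \<in> vecs X" "nrm X (tail L f) \<le> nrm X f"
proof -
  have mem: "tail L f i \<in> vecs (Y i)" for i
    using nth_mem[OF assms] by (auto simp: tail_def)
  have le: "lr_le r (\<lambda>i. nrm (Y i) (tail L f i)) (nrm X f)"
    by (rule lr_le_mono[OF lr_sumD[where X = Y, OF Y assms]])
      (use nrm_nth_nonneg[OF assms] in \<open>auto simp: tail_def\<close>)
  show "tail L f \<in> vecs X" "nrm X (tail L f) \<le> nrm X f"
    by (rule lr_sumI[where X = Y, OF Y mem le])+
qed

text \<open>Split the index set into \<open>Q\<close> residue classes, with Q \<epsilon> larger than
  the norm bound. If no class worked, each would carry a vector on which \<open>\<phi>\<close> is
  large; the supports being disjoint, the normalised signed sum still has supremum norm at most 1,
  but its value under \<open>\<phi>\<close> exceeds \<open>B\<close>.\<close>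

lemma functional_split:
  assumes "r = \<infinity>" and \<phi>: "bop X real_line B \<phi>" and u: "strict_mono (u :: nat \<Rightarrow> nat)" and "0 < \<epsilon>"
  shows "\<exists>t :: nat \<Rightarrow> nat. strict_mono t \<and> (\<forall>f\<in>vecs X. (\<forall>i. i \<notin> range (u \<circ> t) \<longrightarrow> f i = 0) \<longrightarrow> \<bar>\<phi> f\<bar> \<le> \<epsilon> * nrm X f)"
proof (rule ccontr)
  assume neg: "\<not> ?thesis"
  obtain Q :: nat where Q: "B < real Q * \<epsilon>"
    using reals_Archimedean3[OF \<open>0 < \<epsilon>\<close>] by blast
  have Q0: "0 < Q"
    using Q bopD(1)[OF \<phi>] by (cases Q) auto
  define t where "t i k = Q * k + i" for i k :: nat
  have t: "strict_mono (t i)" for i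
    using Q0 by (auto simp: strict_mono_def t_def)
  have "\<exists>f. f \<in> vecs X \<and> (\<forall>n. n \<notin> range (u \<circ> t i) \<longrightarrow> f n = 0) \<and> \<epsilon> * nrm X f < \<bar>\<phi> f\<bar>" for i
    using neg[unfolded not_ex, rule_format, of "t i"] t[of i] unfolding not_le[symmetric] by blast
  then obtain f where f: "\<And>i. f i \<in> vecs X" "\<And>i n. n \<notin> range (u \<circ> t i) \<Longrightarrow> f i n = 0"
    "\<And>i. \<epsilon> * nrm X (f i) < \<bar>\<phi> (f i)\<bar>"
    by metis
  have pos: "0 < nrm X (f i)" for i
  proof -
    have "nrm X (f i) \<noteq> 0"
    proof
      assume n0: "nrm X (f i) = 0"
      then have "\<phi> (f i) = 0"
        using X.nrm_eq_0D[OF f(1)] bop_0[OF \<phi> X] by metis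
      then show False
        using f(3)[of i] n0 by simp
    qed
    then show ?thesis
      using X.nrm_nonneg[OF f(1), of i] by linarith
  qed
  \<comment> \<open>Sign and normalisation of the witnesses: each summand of \<open>g\<close> below
    has norm at most 1 and contributes at least \<epsilon> to the value of
    \<open>\<phi>\<close>.\<close>
  define a where "a i = sgn (\<phi> (f i)) / nrm X (f i)" for i
  define g where "g = (\<Sum>i<Q. a i *\<^sub>R f i)"
  have g: "g \<in> vecs X"
    unfolding g_def using f by auto
  have a1: "\<bar>a i\<bar> * nrm X (f i) \<le> 1" for i
    using pos[of i] by (auto simp: a_def abs_mult sgn_real_def)
  have disj: "i = j" if ij: "n \<in> range (u \<circ> t i)" "n \<in> range (u \<circ> t j)" "i < Q" "j < Q" for n i j
  proof -
    obtain k l where "n = u (t i k)" "n = u (t j l)"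
      using ij(1,2) unfolding image_iff comp_def by blast
    then have "t i k = t j l"
      using strict_mono_eq[OF u] by simp
    then have "(Q * k + i) mod Q = (Q * l + j) mod Q"
      by (simp add: t_def)
    then show ?thesis
      using that by simp
  qed
  have "nrm (Y n) (g n) \<le> 1" for n
  proof (cases "\<exists>i<Q. n \<in> range (u \<circ> t i)")
    case True
    then obtain i where i: "i < Q" "n \<in> range (u \<circ> t i)" by blast
    have "g n = (\<Sum>j<Q. a j *\<^sub>R f j n)"
      by (simp add: g_def sum_fun_apply)
    also have "\<dots> = (\<Sum>j<Q. if j = i then a i *\<^sub>R f i n else 0)"
    proof (rule sum.cong [OF refl])
      fix j assume j: "j \<in> {..<Q}"
      show "a j *\<^sub>R f j n = (if j = i then a i *\<^sub>R f i n else 0)"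
      proof (cases "j = i")
        case False
        then have "n \<notin> range (u \<circ> t j)"
          using disj[OF i(2) _ i(1), of j] j by blast
        then show ?thesis
          using f(2) False by simp
      qed simp
    qed
    also have "\<dots> = a i *\<^sub>R f i n"
      using i by simp
    finally have "nrm (Y n) (g n) = \<bar>a i\<bar> * nrm (Y n) (f i n)"
      using nth_mem[OF f(1)] by (simp add: Y.nrm_scale)
    also have "\<dots> \<le> \<bar>a i\<bar> * nrm X (f i)"
      using nrm_nth[OF f(1)] by (intro mult_left_mono) auto
    finally show ?thesis
      using a1[of i] by linarith
  next
    case False
    then have "g n = 0"
      using f(2) by (simp add: g_def sum_fun_apply)
    then show ?thesis by simp
  qed
  then have "lr_le r (\<lambda>n. nrm (Y n) (g n)) 1"
    using assms(1) by (simp add: lr_le_def)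
  then have g1: "nrm X g \<le> 1"
    using lr_sumI(2)[where X = Y, OF Y nth_mem[OF g]] by blast
  have "real Q * \<epsilon> \<le> (\<Sum>i<Q. \<bar>\<phi> (f i)\<bar> / nrm X (f i))"
  proof -
    have "\<epsilon> \<le> \<bar>\<phi> (f i)\<bar> / nrm X (f i)" for i
      using f(3)[of i] pos[of i] by (simp add: pos_le_divide_eq)
    then have "(\<Sum>i<Q. \<epsilon>) \<le> (\<Sum>i<Q. \<bar>\<phi> (f i)\<bar> / nrm X (f i))"
      by (intro sum_mono) auto
    then show ?thesis by simp
  qed
  also have "\<dots> = (\<Sum>i<Q. \<phi> (a i *\<^sub>R f i))"
    using f(1) by (intro sum.cong) (auto simp: bopD(4)[OF \<phi>] a_def sgn_real_def)
  also have "\<dots> = \<phi> g"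
    unfolding g_def using f(1) by (subst bop_sum[OF \<phi> X]) auto
  also have "\<dots> \<le> B * nrm X g"
    using bopD(5)[OF \<phi> g] by simp
  also have "\<dots> \<le> B"
    using g1 bopD(1)[OF \<phi>] mult_left_mono[OF g1, of B] by simp
  finally show False
    using Q by simp
qed

text \<open>This replaces the norm convergence of finitely supported truncations. For finite
  \<open>r\<close> tails tend to 0 in norm and all coordinates may be kept. For
  \<open>r = \<infinity>\<close> there are countably many coordinate functionals of components of T,
  and a diagonal sequence makes each of them as small as desired on sequences supported far out in
  it.\<close>

lemma tails_vanish:
  assumes T: "bop X X \<Gamma> T" and fdim: "\<And>n. fdim (Y n)"
  obtains A where "infinite (A :: nat set)"
    "\<And>f m. f \<in> vecs X \<Longrightarrow> (\<And>i. i \<notin> A \<Longrightarrow> f i = 0) \<Longrightarrow> (\<lambda>L. nrm (Y m) (T (tail L f) m)) \<longlonglongrightarrow> 0"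
proof (cases "r = \<infinity>")
  case False
  have "(\<lambda>L. nrm (Y m) (T (tail L f) m)) \<longlonglongrightarrow> 0" if f: "f \<in> vecs X" for f m
  proof (rule LIMSEQ_I)
    fix e :: real assume "0 < e"
    define e' where "e' = e / (2 * (\<Gamma> + 1))"
    have \<Gamma>: "0 \<le> \<Gamma>" using bopD(1)[OF T] .
    have e': "0 < e'" "\<Gamma> * e' < e"
      using \<open>0 < e\<close> \<Gamma> by (auto simp: e'_def field_simps add_pos_nonneg add_nonneg_pos)
    obtain L0 where L0: "\<And>L. L \<ge> L0 \<Longrightarrow> lr_le r (\<lambda>i. if i < L then 0 else nrm (Y i) (f i)) e'"
      using lr_le_tail[OF lr_sumD[where X = Y, OF Y f] False e'(1) nrm_nth_nonneg[OF f]] by blast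
    have "norm (nrm (Y m) (T (tail L f) m) - 0) < e" if "L \<ge> L0" for L
    proof -
      have "(\<lambda>i. nrm (Y i) (tail L f i)) = (\<lambda>i. if i < L then 0 else nrm (Y i) (f i))"
        by (auto simp: tail_def)
      then have "lr_le r (\<lambda>i. nrm (Y i) (tail L f i)) e'"
        using L0[OF that] by simp
      then have "nrm X (tail L f) \<le> e'"
        by (rule lr_sumI(2)[where X = Y, OF Y nth_mem[OF tail_mem(1)[OF f]]])
      then have "\<Gamma> * nrm X (tail L f) \<le> \<Gamma> * e'"
        using \<Gamma> by (rule mult_left_mono)
      moreover have "nrm (Y m) (T (tail L f) m) \<le> \<Gamma> * nrm X (tail L f)"
        using nrm_nth[OF bopD(2)[OF T tail_mem(1)[OF f]]] bopD(5)[OF T tail_mem(1)[OF f]] order_trans by blast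
      moreover have "0 \<le> nrm (Y m) (T (tail L f) m)"
        by (intro nrm_nth_nonneg bopD(2)[OF T] tail_mem f)
      ultimately show ?thesis
        using e' by simp
    qed
    then show "\<exists>L0. \<forall>L\<ge>L0. norm (nrm (Y m) (T (tail L f) m) - 0) < e"
      by blast
  qed
  then show thesis
    using that[of UNIV] by simp
next
  case True
  have "\<forall>n. \<exists>d e c B. coord_system (Y n) d e c B"
    using fdim by (simp add: fdim_def)
  then obtain d e c B where sys: "\<And>n. coord_system (Y n) (d n) (e n) (c n) (B n)"
    by metis
  have c: "bop (Y n) real_line (B n i) (c n i)" if "i < d n" for n i
    using sys[of n] that by (simp add: coord_system_def)
  have \<phi>: "bop X real_line (B m i * (1 * \<Gamma>)) (\<lambda>f. c m i (T f m))" if "i < d m" for m i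
    by (rule bop_comp[OF bop_comp[OF T bop_proj] c[OF that]])
  \<comment> \<open>Requirement number \<open>j\<close> encodes a triple: coordinate
    \<open>i\<close> of component \<open>m\<close> of \<open>T f\<close> is at most 1 / (k + 1)
    times the norm of \<open>f\<close>, for \<open>f\<close> supported in the range of the
    subsequence. A further subsequence has smaller range and keeps the property.\<close>
  define P where "P j u \<longleftrightarrow> (case prod_decode j of (m, l) \<Rightarrow> case prod_decode l of (i, k) \<Rightarrow>
      i < d m \<longrightarrow> (\<forall>f\<in>vecs X. (\<forall>n. n \<notin> range u \<longrightarrow> f n = 0) \<longrightarrow> \<bar>c m i (T f m)\<bar> \<le> 1 / (real k + 1) * nrm X f))"
    for j and u :: "nat \<Rightarrow> nat"
  interpret subseqs P
  proof
    fix j and u :: "nat \<Rightarrow> nat" assume u: "strict_mono u"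
    obtain m l i k where j: "prod_decode j = (m, l)" "prod_decode l = (i, k)"
      by (metis surj_pair)
    have Pj: "P j w \<longleftrightarrow> (i < d m \<longrightarrow> (\<forall>f\<in>vecs X. (\<forall>n. n \<notin> range w \<longrightarrow> f n = 0) \<longrightarrow>
        \<bar>c m i (T f m)\<bar> \<le> 1 / (real k + 1) * nrm X f))" for w
      by (simp add: P_def j)
    show "\<exists>t. strict_mono t \<and> P j (u \<circ> t)"
    proof (cases "i < d m")
      case True
      show ?thesis
        using functional_split[OF \<open>r = \<infinity>\<close> \<phi>[OF True] u, of "1 / (real k + 1)"] True unfolding Pj by simp
    next
      case False
      then show ?thesis
        using u unfolding Pj by blast
    qed
  qed
  have P: "P j (diagseq \<circ> (+) (Suc j))" for j
  proof (rule diagseq_holds)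
    fix t u :: "nat \<Rightarrow> nat" and n assume "P n u"
    then show "P n (u \<circ> t)"
      unfolding P_def by (auto split: prod.splits) blast
  qed
  have lim: "(\<lambda>L. nrm (Y m) (T (tail L f) m)) \<longlonglongrightarrow> 0"
    if f: "f \<in> vecs X" and A: "\<And>i. i \<notin> range diagseq \<Longrightarrow> f i = 0" for f m
  proof -
    have ci: "(\<lambda>L. \<bar>c m i (T (tail L f) m)\<bar>) \<longlonglongrightarrow> 0" if i: "i < d m" for i
    proof (rule LIMSEQ_I)
      fix \<epsilon> :: real assume "0 < \<epsilon>"
      obtain k :: nat where k: "nrm X f < real k * \<epsilon>"
        using reals_Archimedean3[OF \<open>0 < \<epsilon>\<close>] by blast
      define j where "j = prod_encode (m, prod_encode (i, k))"
      \<comment> \<open>Requirement \<open>j\<close> is known for the part of the diagonal sequence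
        from index \<open>Suc j\<close> on; cutting at \<open>diagseq (Suc j)\<close> or later
        removes the earlier entries.\<close>
      have "norm (\<bar>c m i (T (tail L f) m)\<bar> - 0) < \<epsilon>" if L: "L \<ge> diagseq (Suc j)" for L
      proof -
        have "tail L f n = 0" if n: "n \<notin> range (diagseq \<circ> (+) (Suc j))" for n
        proof (rule ccontr)
          assume "tail L f n \<noteq> 0"
          then have "L \<le> n" "f n \<noteq> 0"
            by (auto simp: tail_def split: if_splits)
          then obtain l where l: "n = diagseq l"
            using A by blast
          then have "Suc j \<le> l"
            using \<open>L \<le> n\<close> L strict_mono_less_eq[OF subseq_diagseq] by (metis order_trans)
          then have "n = (diagseq \<circ> (+) (Suc j)) (l - Suc j)"
            by (simp add: l)
          then show False
            using n by blast
        qed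
        then have "\<bar>c m i (T (tail L f) m)\<bar> \<le> 1 / (real k + 1) * nrm X (tail L f)"
          using P[of j] i tail_mem(1)[OF f, of L] by (simp add: P_def j_def)
        also have "\<dots> \<le> 1 / (real k + 1) * nrm X f"
          using tail_mem(2)[OF f] by (intro mult_left_mono) auto
        also have "\<dots> < \<epsilon>"
          using k \<open>0 < \<epsilon>\<close> by (simp add: divide_less_eq) (simp add: algebra_simps)
        finally show ?thesis by simp
      qed
      then show "\<exists>L0. \<forall>L\<ge>L0. norm (\<bar>c m i (T (tail L f) m)\<bar> - 0) < \<epsilon>" by blast
    qed
    have lim0: "(\<lambda>L. \<Sum>i<d m. \<bar>c m i (T (tail L f) m)\<bar> * nrm (Y m) (e m i)) \<longlonglongrightarrow> 0"
      using ci by (intro tendsto_null_sum tendsto_mult_left_zero) auto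
    show ?thesis
    proof (rule Lim_null_comparison[OF _ lim0])
      have "T (tail L f) m \<in> vecs (Y m)" for L
        by (intro nth_mem bopD(2)[OF T] tail_mem f)
      then show "\<forall>\<^sub>F L in sequentially. norm (nrm (Y m) (T (tail L f) m))
          \<le> (\<Sum>i<d m. \<bar>c m i (T (tail L f) m)\<bar> * nrm (Y m) (e m i))"
        using coord_nrm_le[OF sys Y] by (intro always_eventually allI) simp
    qed
  qed
  show thesis
    by (rule that[of "range diagseq"])
      (use lim range_inj_infinite[OF strict_mono_imp_inj_on[OF subseq_diagseq]] in auto)
qed

end

section \<open>Gluing local maps along a sequence of coordinates\<close>

context lr_family
begin

definition spread :: "(nat \<Rightarrow> nat) \<Rightarrow> (nat \<Rightarrow> 'v \<Rightarrow> 'v) \<Rightarrow> (nat \<Rightarrow> 'v) \<Rightarrow> nat \<Rightarrow> 'v" where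
  "spread N S f = (\<lambda>i. if i \<in> range N then S (inv N i) (f (inv N i)) else 0)"

definition gather :: "(nat \<Rightarrow> nat) \<Rightarrow> (nat \<Rightarrow> 'v \<Rightarrow> 'v) \<Rightarrow> (nat \<Rightarrow> 'v) \<Rightarrow> nat \<Rightarrow> 'v" where
  "gather N R f = (\<lambda>n. R n (f (N n)))"

lemma spread_apply: "inj N \<Longrightarrow> spread N S f (N n) = S n (f n)"
  by (simp add: spread_def inv_f_f)

lemma spread_off: "i \<notin> range N \<Longrightarrow> spread N S f i = 0"
  by (simp add: spread_def)

lemma bop_spread:
  assumes N: "inj N" and S: "\<And>n. bop (Y n) (Y (N n)) 1 (S n)"
  shows "bop X X 1 (spread N S)"
proof -
  have mem: "spread N S f i \<in> vecs (Y i)" if f: "f \<in> vecs X" for f i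
  proof (cases "i \<in> range N")
    case True
    then obtain n where "i = N n" by blast
    then show ?thesis
      using bopD(2)[OF S nth_mem[OF f]] by (simp add: spread_apply[OF N])
  qed (simp add: spread_off)
  have le: "lr_le r (\<lambda>i. nrm (Y i) (spread N S f i)) (nrm X f)" if f: "f \<in> vecs X" for f
  proof (rule lr_le_spread[OF _ N])
    show "lr_le r (\<lambda>n. nrm (Y (N n)) (S n (f n))) (nrm X f)"
    proof (rule lr_le_mono[OF lr_sumD[where X = Y, OF Y f]])
      show "nrm (Y (N n)) (S n (f n)) \<le> nrm (Y n) (f n)" for n
        using bopD(5)[OF S nth_mem[OF f]] by simp
      show "0 \<le> nrm (Y (N n)) (S n (f n))" for n
        by (intro Y.nrm_nonneg bopD(2)[OF S] nth_mem f)
    qed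
  qed (simp_all add: spread_apply[OF N] spread_off)
  show ?thesis
    unfolding bop_def
  proof (intro conjI ballI allI)
    fix f assume f: "f \<in> vecs X"
    show "spread N S f \<in> vecs X" "nrm X (spread N S f) \<le> 1 * nrm X f"
      using lr_sumI[where X = Y, OF Y mem[OF f] le[OF f]] by auto
    show "spread N S (c *\<^sub>R f) = c *\<^sub>R spread N S f" for c
      using bopD(4)[OF S nth_mem[OF f]] by (auto simp: spread_def)
    fix g assume g: "g \<in> vecs X"
    show "spread N S (f + g) = spread N S f + spread N S g"
      using bopD(3)[OF S nth_mem[OF f] nth_mem[OF g]] by (auto simp: spread_def)
  qed simp
qed

lemma bop_gather:
  assumes N: "inj N" and R: "\<And>n. bop (Y (N n)) (Y n) B (R n)" and B: "0 \<le> B"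
  shows "bop X X B (gather N R)"
proof -
  have mem: "gather N R f n \<in> vecs (Y n)" if f: "f \<in> vecs X" for f n
    using bopD(2)[OF R nth_mem[OF f]] by (simp add: gather_def)
  have le: "lr_le r (\<lambda>n. nrm (Y n) (gather N R f n)) (B * nrm X f)" if f: "f \<in> vecs X" for f
  proof (rule lr_le_mono[OF lr_le_scale[OF lr_le_inj[OF lr_sumD[where X = Y, OF Y f] N] B]])
    show "0 \<le> nrm (Y (N n)) (f (N n))" for n
      by (intro nrm_nth_nonneg f)
    show "0 \<le> nrm (Y n) (gather N R f n)" for n
      by (intro Y.nrm_nonneg mem f)
    show "nrm (Y n) (gather N R f n) \<le> B * nrm (Y (N n)) (f (N n))" for n
      using bopD(5)[OF R nth_mem[OF f]] by (simp add: gather_def)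
  qed
  show ?thesis
    unfolding bop_def
  proof (intro conjI ballI allI)
    fix f assume f: "f \<in> vecs X"
    show "gather N R f \<in> vecs X" "nrm X (gather N R f) \<le> B * nrm X f"
      using lr_sumI[where X = Y, OF Y mem[OF f] le[OF f]] by auto
    show "gather N R (c *\<^sub>R f) = c *\<^sub>R gather N R f" for c
      using bopD(4)[OF R nth_mem[OF f]] by (auto simp: gather_def)
    fix g assume g: "g \<in> vecs X"
    show "gather N R (f + g) = gather N R f + gather N R g"
      using bopD(3)[OF R nth_mem[OF f] nth_mem[OF g]] by (auto simp: gather_def)
  qed (use B in simp)
qed

lemma spread_split:
  assumes N: "strict_mono N"
  shows "spread N S f = (\<Sum>k<K. emb (N k) (S k (f k))) + tail (N K) (spread N S f)"
proof
  fix i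
  have inj: "inj N" using N by (rule strict_mono_imp_inj_on)
  have sum: "(\<Sum>k<K. emb (N k) (S k (f k))) i = (\<Sum>k<K. if i = N k then S k (f k) else 0)"
    by (simp add: sum_fun_apply emb_def)
  show "spread N S f i = ((\<Sum>k<K. emb (N k) (S k (f k))) + tail (N K) (spread N S f)) i"
  proof (cases "i \<in> range N")
    case True
    then obtain n where n: "i = N n" by blast
    have "(\<Sum>k<K. if i = N k then S k (f k) else 0) = (\<Sum>k<K. if k = n then S n (f n) else 0)"
      using injD[OF inj] n by (intro sum.cong) auto
    also have "\<dots> = (if n < K then S n (f n) else 0)"
      by simp
    finally show ?thesis
      unfolding plus_fun_apply sum using n strict_mono_less[OF N]
      by (simp add: tail_def spread_apply[OF inj])
  next
    case False
    then have "(\<Sum>k<K. if i = N k then S k (f k) else 0) = 0"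
      by (intro sum.neutral) auto
    then show ?thesis
      unfolding plus_fun_apply sum using False by (simp add: tail_def spread_off)
  qed
qed

lemma sum_half_powers_le: "(\<Sum>k<K. 1 / 2 ^ k :: real) \<le> 2"
  using geometric_tail_le[of 1 0 K] by (simp add: lessThan_atLeast0)

context
  fixes \<Gamma> \<epsilon> :: real and T A N R S l
  assumes T: "bop X X \<Gamma> T" and \<epsilon>: "0 < \<epsilon>"
    and A: "\<And>f m. f \<in> vecs X \<Longrightarrow> (\<And>i. i \<notin> A \<Longrightarrow> f i = 0) \<Longrightarrow> (\<lambda>L. nrm (Y m) (T (tail L f) m)) \<longlonglongrightarrow> 0"
    and N: "strict_mono N" and NA: "\<And>k. N k \<in> A"
    and R: "\<And>k. bop (Y (N k)) (Y k) 1 (R k)" and S: "\<And>k. bop (Y k) (Y (N k)) 1 (S k)"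
    and RS: "\<And>k x. x \<in> vecs (Y k) \<Longrightarrow> R k (S k x) = x"
    and diag: "\<And>k x. x \<in> vecs (Y k) \<Longrightarrow>
      nrm (Y k) (R k (T (emb (N k) (S k x)) (N k)) - l k *\<^sub>R x) \<le> \<epsilon> / 2 ^ (k + k) * nrm (Y k) x"
    and off: "\<And>j k x. j \<noteq> k \<Longrightarrow> x \<in> vecs (Y k) \<Longrightarrow>
      nrm (Y j) (R j (T (emb (N k) (S k x)) (N j))) \<le> \<epsilon> / 2 ^ (j + k) * nrm (Y k) x"
begin

lemma glue_inj: "inj N"
  using N by (rule strict_mono_imp_inj_on)

text \<open>Cut the spread sequence after finitely many blocks. The errors \<epsilon> / 2^(n + k) of
  the blocks add up to 2\<epsilon> / 2^n. The rest is not small in norm, but its image under T is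
  small in coordinate \<open>N n\<close>, by the choice of \<open>A\<close>. The surviving factor
  2^-n makes the bound usable for every \<open>r\<close>.\<close>

lemma glue_almost_diagonal:
  assumes f: "f \<in> vecs X"
  shows "nrm (Y n) (R n (T (spread N S f) (N n)) - l n *\<^sub>R f n) \<le> 2 * \<epsilon> / 2 ^ n * nrm X f"
proof -
  let ?g = "spread N S f"
  have g: "?g \<in> vecs X"
    using bopD(2)[OF bop_spread[OF glue_inj S] f] .
  have ek: "emb (N k) (S k (f k)) \<in> vecs X" for k
    by (intro emb bopD(2)[OF S] nth_mem f)
  have RT: "bop X (Y n) (1 * (1 * \<Gamma>)) (\<lambda>h. R n (T h (N n)))"
    by (rule bop_comp[OF bop_comp[OF T bop_proj] R])
  let ?t = "\<lambda>K. nrm (Y (N n)) (T (tail (N K) ?g) (N n))"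
  \<comment> \<open>The cut has to come after block \<open>n\<close>, so that the diagonal term is
    among the blocks split off and \<open>l n\<close> can be subtracted there.\<close>
  have bound: "nrm (Y n) (R n (T ?g (N n)) - l n *\<^sub>R f n) \<le> 2 * \<epsilon> / 2 ^ n * nrm X f + ?t K" if K: "n < K" for K
  proof -
    let ?z = "\<lambda>k. R n (T (emb (N k) (S k (f k))) (N n)) - (if k = n then l n *\<^sub>R f n else 0)"
    have zm: "?z k \<in> vecs (Y n)" for k
      using bopD(2)[OF RT ek] nth_mem[OF f] by (cases "k = n") auto
    have tm: "R n (T (tail (N K) ?g) (N n)) \<in> vecs (Y n)"
      by (intro bopD(2)[OF RT] tail_mem g)
    have "R n (T ?g (N n)) = R n (T ((\<Sum>k<K. emb (N k) (S k (f k))) + tail (N K) ?g) (N n))"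
      using spread_split[OF N, of S f K] by simp
    also have "\<dots> = R n (T (\<Sum>k<K. emb (N k) (S k (f k))) (N n)) + R n (T (tail (N K) ?g) (N n))"
      by (intro bopD(3)[OF RT] X.sum_mem ek tail_mem g)
    also have "R n (T (\<Sum>k<K. emb (N k) (S k (f k))) (N n)) = (\<Sum>k<K. R n (T (emb (N k) (S k (f k))) (N n)))"
      by (intro bop_sum[OF RT X] ek)
    finally have "R n (T ?g (N n)) - l n *\<^sub>R f n = (\<Sum>k<K. ?z k) + R n (T (tail (N K) ?g) (N n))"
      using K by (simp add: sum_subtractf)
    then have "nrm (Y n) (R n (T ?g (N n)) - l n *\<^sub>R f n)
        \<le> nrm (Y n) (\<Sum>k<K. ?z k) + nrm (Y n) (R n (T (tail (N K) ?g) (N n)))"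
      using Y.nrm_add[OF Y.sum_mem tm, of "{..<K}" ?z] zm by simp
    also have "nrm (Y n) (\<Sum>k<K. ?z k) \<le> (\<Sum>k<K. nrm (Y n) (?z k))"
      by (intro Y.nrm_sum zm)
    also have "(\<Sum>k<K. nrm (Y n) (?z k)) \<le> (\<Sum>k<K. \<epsilon> / 2 ^ n * nrm X f * (1 / 2 ^ k))"
    proof (rule sum_mono)
      fix k
      have "nrm (Y n) (?z k) \<le> \<epsilon> / 2 ^ (n + k) * nrm (Y k) (f k)"
        using diag[OF nth_mem[OF f], of n] off[OF _ nth_mem[OF f], of n k] by (cases "k = n") auto
      also have "\<dots> \<le> \<epsilon> / 2 ^ (n + k) * nrm X f"
        using \<epsilon> nrm_nth[OF f] by (intro mult_left_mono) auto
      finally show "nrm (Y n) (?z k) \<le> \<epsilon> / 2 ^ n * nrm X f * (1 / 2 ^ k)"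
        by (simp add: power_add)
    qed
    also have "\<dots> = \<epsilon> / 2 ^ n * nrm X f * (\<Sum>k<K. 1 / 2 ^ k)"
      by (simp add: sum_distrib_left)
    also have "\<dots> \<le> \<epsilon> / 2 ^ n * nrm X f * 2"
      using \<epsilon> f sum_half_powers_le by (intro mult_left_mono) auto
    also have "nrm (Y n) (R n (T (tail (N K) ?g) (N n))) \<le> ?t K"
      using bopD(5)[OF R nth_mem[OF bopD(2)[OF T tail_mem(1)[OF g]]]] by simp
    finally show ?thesis by (simp add: mult_ac)
  qed
  have "(\<lambda>L. nrm (Y (N n)) (T (tail L ?g) (N n))) \<longlonglongrightarrow> 0"
  proof (rule A[OF g])
    fix i assume "i \<notin> A"
    then have "i \<notin> range N"
      using NA by auto
    then show "spread N S f i = 0"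
      by (rule spread_off)
  qed
  then have "?t \<longlonglongrightarrow> 0"
    using LIMSEQ_subseq_LIMSEQ[OF _ N] by (simp add: o_def)
  then have "(\<lambda>K. 2 * \<epsilon> / 2 ^ n * nrm X f + ?t K) \<longlonglongrightarrow> 2 * \<epsilon> / 2 ^ n * nrm X f + 0"
    by (intro tendsto_add tendsto_const)
  then show ?thesis
    using bound by (intro LIMSEQ_le_const[of _ "2 * \<epsilon> / 2 ^ n * nrm X f"]) (auto intro!: exI[of _ "Suc n"])
qed

text \<open>Since \<open>R n\<close> inverts \<open>S n\<close>, passing from T to Id - T replaces
  \<open>l n\<close> by 1 - l n with the same error, so both cases can be treated together. Division
  by c n \<ge> 1/2 costs the factor 2 and doubles the error to 4\<epsilon> / 2^n per coordinate,
  that is 8\<epsilon> in the sum. The Neumann series then gives 2 (1 + 16\<epsilon>) = 2 +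
  32\<epsilon>.\<close>

lemma glue_factor:
  assumes Hc: "H = T \<and> c = l \<or> H = (\<lambda>x. x - T x) \<and> c = (\<lambda>n. 1 - l n)" and c: "\<And>n. 1 / 2 \<le> c n"
    and \<epsilon>16: "16 * \<epsilon> \<le> 1" and complete: "\<And>n. complete_sp (Y n)"
  shows "\<exists>R S. bop X X (2 + 32 * \<epsilon>) R \<and> bop X X 1 S \<and> (\<forall>x\<in>vecs X. R (H (S x)) = x)"
proof -
  have Sb: "bop X X 1 (spread N S)"
    by (rule bop_spread[OF glue_inj S])
  obtain \<Gamma>' where H: "bop X X \<Gamma>' H"
    using Hc T bop_diff[OF bop_id[OF X] T X] by blast
  have diagH: "nrm (Y n) (R n (H (spread N S f) (N n)) - c n *\<^sub>R f n) \<le> 2 * \<epsilon> / 2 ^ n * nrm X f"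
    if f: "f \<in> vecs X" for f n
    using Hc
  proof
    assume "H = T \<and> c = l"
    then show ?thesis
      using glue_almost_diagonal[OF f] by simp
  next
    assume HT: "H = (\<lambda>x. x - T x) \<and> c = (\<lambda>n. 1 - l n)"
    have g: "spread N S f \<in> vecs X"
      by (rule bopD(2)[OF Sb f])
    have RTm: "R n (T (spread N S f) (N n)) \<in> vecs (Y n)"
      by (intro bopD(2)[OF R] nth_mem bopD(2)[OF T] g)
    have "R n (spread N S f (N n) - T (spread N S f) (N n))
        = R n (spread N S f (N n)) - R n (T (spread N S f) (N n))"
      by (intro bop_diff_apply[OF R Y] nth_mem bopD(2)[OF T] g)
    then have "R n (H (spread N S f) (N n)) - c n *\<^sub>R f n = - (R n (T (spread N S f) (N n)) - l n *\<^sub>R f n)"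
      using HT by (simp add: spread_apply[OF glue_inj] RS[OF nth_mem[OF f]] scaleR_diff_left)
    then show ?thesis
      using glue_almost_diagonal[OF f, of n] Y.nrm_minus[of "R n (T (spread N S f) (N n)) - l n *\<^sub>R f n"]
        Y.diff_mem[OF RTm Y.scale_mem[OF nth_mem[OF f]]] by simp
  qed
  define R1 where "R1 = gather N (\<lambda>n x. (1 / c n) *\<^sub>R R n x)"
  have cpos: "0 < c n" "1 / c n \<le> 2" for n
    using c[of n] by (auto simp: divide_le_eq)
  have R1: "bop X X 2 R1"
    unfolding R1_def
  proof (rule bop_gather[OF glue_inj])
    fix n
    show "bop (Y (N n)) (Y n) 2 (\<lambda>x. (1 / c n) *\<^sub>R R n x)"
      using bop_mono[OF bop_scale[OF R Y, of n "1 / c n"] _ Y, of 2] cpos[of n] by simp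
  qed simp
  define K where "K f = R1 (H (spread N S f)) - f" for f
  have K0: "bop X X (2 * (\<Gamma>' * 1) + 1) K"
    unfolding K_def by (rule bop_diff[OF bop_comp[OF bop_comp[OF Sb H] R1] bop_id[OF X] X])
  have Kn: "nrm (Y n) (K f n) \<le> (4 * \<epsilon> * nrm X f) / 2 ^ n" if f: "f \<in> vecs X" for f n
  proof -
    have m: "R n (H (spread N S f) (N n)) - c n *\<^sub>R f n \<in> vecs (Y n)"
      by (intro Y.diff_mem Y.scale_mem bopD(2)[OF R] nth_mem bopD(2)[OF H] bopD(2)[OF Sb] f)
    have "K f n = (1 / c n) *\<^sub>R (R n (H (spread N S f) (N n)) - c n *\<^sub>R f n)"
      using cpos(1)[of n] by (simp add: K_def R1_def gather_def scaleR_diff_right)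
    then have "nrm (Y n) (K f n) = 1 / c n * nrm (Y n) (R n (H (spread N S f) (N n)) - c n *\<^sub>R f n)"
      using cpos(1)[of n] m by (simp add: Y.nrm_scale)
    also have "\<dots> \<le> 2 * (2 * \<epsilon> / 2 ^ n * nrm X f)"
      using cpos[of n] diagH[OF f, of n] m by (intro mult_mono) auto
    finally show ?thesis by simp
  qed
  have K: "bop X X (8 * \<epsilon>) K"
  proof -
    have "nrm X (K f) \<le> 8 * \<epsilon> * nrm X f" if f: "f \<in> vecs X" for f
    proof -
      have Kf: "K f n \<in> vecs (Y n)" for n
        by (rule nth_mem[OF bopD(2)[OF K0 f]])
      have "lr_le r (\<lambda>n. nrm (Y n) (K f n)) (2 * (4 * \<epsilon> * nrm X f))"
        using Kn[OF f] Kf \<epsilon> f by (intro lr_le_geometric) auto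
      then show ?thesis
        using lr_sumI(2)[where X = Y, OF Y Kf] by fastforce
    qed
    then show ?thesis
      using K0 \<epsilon> unfolding bop_def by simp
  qed
  have "8 * \<epsilon> \<le> 1 / 2" using \<epsilon>16 by simp
  then obtain G where G: "bop X X (1 + 2 * (8 * \<epsilon>)) G" "\<And>x. x \<in> vecs X \<Longrightarrow> G (x + K x) = x"
    using neumann[OF X complete_lr_sum[OF Y complete] K] by blast
  have "bop X X ((1 + 2 * (8 * \<epsilon>)) * 2) (\<lambda>x. G (R1 x))"
    by (rule bop_comp[OF R1 G(1)])
  moreover have "(1 + 2 * (8 * \<epsilon>)) * 2 = 2 + 32 * \<epsilon>"
    by simp
  moreover have "G (R1 (H (spread N S x))) = x" if "x \<in> vecs X" for x
  proof -
    have "R1 (H (spread N S x)) = x + K x"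
      by (simp add: K_def)
    then show ?thesis
      using G(2)[OF that] by simp
  qed
  ultimately show ?thesis
    using Sb by metis
qed

end

end

section \<open>Choosing the copies one after another\<close>

context lr_family
begin

text \<open>A stage of the construction is a tuple \<open>(N, R, S, l)\<close>.\<close>

definition stage :: "nat set \<Rightarrow> real \<Rightarrow> ((nat \<Rightarrow> 'v) \<Rightarrow> nat \<Rightarrow> 'v) \<Rightarrow>
    (nat \<Rightarrow> nat \<times> ('v \<Rightarrow> 'v) \<times> ('v \<Rightarrow> 'v) \<times> real) \<Rightarrow> nat \<Rightarrow> nat \<times> ('v \<Rightarrow> 'v) \<times> ('v \<Rightarrow> 'v) \<times> real \<Rightarrow> bool" where
  "stage A \<epsilon> T f k = (\<lambda>(N, R, S, l). N \<in> A \<and> bop (Y N) (Y k) 1 R \<and> bop (Y k) (Y N) 1 S \<and>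
     (\<forall>x\<in>vecs (Y k). R (S x) = x \<and> nrm (Y k) (R (T (emb N (S x)) N) - l *\<^sub>R x) \<le> \<epsilon> / 2 ^ (k + k) * nrm (Y k) x) \<and>
     (\<forall>j<k. case f j of (N', R', S', l') \<Rightarrow> N' < N \<and>
        (\<forall>x\<in>vecs (Y k). nrm (Y j) (R' (T (emb N (S x)) N')) \<le> \<epsilon> / 2 ^ (j + k) * nrm (Y k) x) \<and>
        (\<forall>x\<in>vecs (Y j). nrm (Y k) (R (T (emb N' (S' x)) N)) \<le> \<epsilon> / 2 ^ (j + k) * nrm (Y j) x)))"

text \<open>Interaction with the earlier copies runs in both directions. What the new copy sends to
  old coordinates is controlled by finitely many functionals, what old copies send to the new
  coordinate by finitely many vectors; both are finite in number because the earlier spaces have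
  finite coordinate systems. One application of local factorization handles all of them together
  with T.\<close>

lemma ex_stage:
  fixes f :: "nat \<Rightarrow> nat \<times> ('v \<Rightarrow> 'v) \<times> ('v \<Rightarrow> 'v) \<times> real"
  assumes T: "bop X X \<Gamma> T" and \<epsilon>: "0 < \<epsilon>" and A: "infinite A"
    and fdim: "\<And>n. fdim (Y n)" and loc: "local_factor Y"
    and prev: "\<And>j. j < k \<Longrightarrow> stage A \<epsilon> T f j (f j)"
  shows "\<exists>z. stage A \<epsilon> T f k z"
proof -
  have "\<forall>n. \<exists>d e c B. coord_system (Y n) d e c B"
    using fdim by (simp add: fdim_def)
  then obtain d e c B where sys: "\<And>n. coord_system (Y n) (d n) (e n) (c n) (B n)"
    by metis
  have e: "e n i \<in> vecs (Y n)" and c: "bop (Y n) real_line (B n i) (c n i)" if "i < d n" for n i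
    using sys[of n] that by (auto simp: coord_system_def)
  note c_le = coord_bound[OF sys]
  have B0: "0 \<le> B n i" if "i < d n" for n i
    using bopD(1)[OF c[OF that]] .
  have e0: "0 \<le> nrm (Y n) (e n i)" if "i < d n" for n i
    using e[OF that] by simp
  have \<Gamma>: "0 \<le> \<Gamma>" using bopD(1)[OF T] .
  define N' where "N' j = fst (f j)" for j
  define R' where "R' j = fst (snd (f j))" for j
  define S' where "S' j = fst (snd (snd (f j)))" for j
  have R': "bop (Y (N' j)) (Y j) 1 (R' j)" and S': "bop (Y j) (Y (N' j)) 1 (S' j)" if "j < k" for j
    using prev[OF that] by (auto simp: stage_def N'_def R'_def S'_def case_prod_unfold)
  define I where "I = (SIGMA j:{..<k}. {..<d j})"
  have I: "finite I" by (simp add: I_def)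
  \<comment> \<open>\<open>W\<close> is the loss in passing from coordinates to norms,
    \<open>\<Gamma>'\<close> dominates T and all auxiliary functionals and vectors. Neither depends
    on \<open>N\<close>, which is still to be chosen. The power k + k in \<open>\<epsilon>'\<close>
    suffices for all j + k with j \<le> k.\<close>
  define W where "W = 1 + (\<Sum>(j, i)\<in>I. B j i + nrm (Y j) (e j i))"
  define \<Gamma>' where "\<Gamma>' = \<Gamma> + (\<Sum>(j, i)\<in>I. B j i * \<Gamma> + \<Gamma> * nrm (Y j) (e j i))"
  define \<epsilon>' where "\<epsilon>' = \<epsilon> / 2 ^ (k + k) / W"
  have nonneg: "0 \<le> B j i + nrm (Y j) (e j i)" "0 \<le> B j i * \<Gamma> + \<Gamma> * nrm (Y j) (e j i)" if "(j, i) \<in> I" for j i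
    using that B0[of i j] e0[of i j] \<Gamma> by (auto simp: I_def)
  have W1: "1 \<le> W"
    unfolding W_def using nonneg(1) by (auto intro!: sum_nonneg)
  have \<epsilon>': "0 < \<epsilon>'"
    using \<epsilon> W1 by (simp add: \<epsilon>'_def)
  have \<Gamma>'1: "\<Gamma> \<le> \<Gamma>'"
    unfolding \<Gamma>'_def using nonneg(2) by (auto intro!: sum_nonneg)
  have \<Gamma>'2: "B j i * \<Gamma> \<le> \<Gamma>'" "\<Gamma> * nrm (Y j) (e j i) \<le> \<Gamma>'" if "(j, i) \<in> I" for j i
  proof -
    have "B j i * \<Gamma> + \<Gamma> * nrm (Y j) (e j i) \<le> (\<Sum>(j, i)\<in>I. B j i * \<Gamma> + \<Gamma> * nrm (Y j) (e j i))"
      using member_le_sum[OF that, of "\<lambda>(j, i). B j i * \<Gamma> + \<Gamma> * nrm (Y j) (e j i)"] nonneg(2) I by auto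
    moreover have "0 \<le> B j i * \<Gamma>" "0 \<le> \<Gamma> * nrm (Y j) (e j i)"
      using that B0[of i j] e0[of i j] \<Gamma> by (auto simp: I_def)
    ultimately show "B j i * \<Gamma> \<le> \<Gamma>'" "\<Gamma> * nrm (Y j) (e j i) \<le> \<Gamma>'"
      using \<Gamma> by (simp_all add: \<Gamma>'_def)
  qed
  have WB: "(\<Sum>i<d j. B j i) \<le> W" "(\<Sum>i<d j. nrm (Y j) (e j i)) \<le> W" if "j < k" for j
  proof -
    have "(\<Sum>i<d j. B j i + nrm (Y j) (e j i)) \<le> (\<Sum>j<k. \<Sum>i<d j. B j i + nrm (Y j) (e j i))"
      using that nonneg(1) by (intro member_le_sum[of j "{..<k}" "\<lambda>j. \<Sum>i<d j. B j i + nrm (Y j) (e j i)"])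
        (auto intro!: sum_nonneg simp: I_def)
    also have "\<dots> = (\<Sum>(j, i)\<in>I. B j i + nrm (Y j) (e j i))"
      unfolding I_def by (subst sum.Sigma) auto
    finally have "(\<Sum>i<d j. B j i) + (\<Sum>i<d j. nrm (Y j) (e j i)) \<le> W"
      by (simp add: W_def sum.distrib)
    moreover have "0 \<le> (\<Sum>i<d j. B j i)" "0 \<le> (\<Sum>i<d j. nrm (Y j) (e j i))"
      using B0 e0 by (auto intro!: sum_nonneg)
    ultimately show "(\<Sum>i<d j. B j i) \<le> W" "(\<Sum>i<d j. nrm (Y j) (e j i)) \<le> W"
      by auto
  qed
  have \<epsilon>'W: "\<epsilon>' * w \<le> \<epsilon> / 2 ^ (j + k)" if "w \<le> W" "j \<le> k" for w j
  proof -
    have "\<epsilon>' * w \<le> \<epsilon>' * W"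
      using that \<epsilon>' by (intro mult_left_mono) auto
    also have "\<dots> = \<epsilon> / 2 ^ (k + k)"
      using W1 by (simp add: \<epsilon>'_def)
    also have "\<dots> \<le> \<epsilon> / 2 ^ (j + k)"
      using \<epsilon> that by (intro divide_left_mono power_increasing) auto
    finally show ?thesis .
  qed
  obtain N0 where N0: "\<And>N. N \<ge> N0 \<Longrightarrow> local_factor_at Y k N \<Gamma>' (card I) \<epsilon>'"
    using loc \<epsilon>' unfolding local_factor_def by blast
  \<comment> \<open>Exceeding the sum of the earlier indices makes \<open>N\<close> exceed each of
    them.\<close>
  obtain N where N: "N \<in> A" "N > N0 + (\<Sum>j<k. N' j)"
    using A infinite_nat_iff_unbounded by blast
  have NN: "N' j < N" if "j < k" for j
    using member_le_sum[of j "{..<k}" N'] that N(2) by auto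
  \<comment> \<open>\<open>\<phi>\<close> reads the coordinates of what a vector at position
    \<open>N\<close> causes at the earlier copies; \<open>v\<close> collects what the basis vectors
    of the earlier copies cause at position \<open>N\<close>.\<close>
  define \<phi> where "\<phi> = (\<lambda>(j, i) x. c j i (R' j (T (emb N x) (N' j))))"
  define v where "v = (\<lambda>(j, i). T (emb (N' j) (S' j (e j i))) N)"
  have TN: "bop (Y N) (Y M) (1 * (\<Gamma> * 1)) (\<lambda>x. T (emb N x) M)" for N M
    by (rule bop_comp[OF bop_comp[OF bop_emb T] bop_proj])
  have \<phi>: "bop (Y N) real_line \<Gamma>' (\<phi> z)" if z: "z \<in> I" for z
  proof -
    obtain j i where z': "z = (j, i)" "j < k" "i < d j"
      using z by (auto simp: I_def)
    have "bop (Y N) real_line (B j i * (1 * (1 * (\<Gamma> * 1)))) (\<phi> z)"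
      unfolding \<phi>_def z'(1) split by (rule bop_comp[OF bop_comp[OF TN R'[OF z'(2)]] c[OF z'(3)]])
    then show ?thesis
      by (rule bop_mono[OF _ _ Y]) (use \<Gamma>'2(1)[of j i] z z' in auto)
  qed
  have v: "v z \<in> vecs (Y N) \<and> nrm (Y N) (v z) \<le> \<Gamma>'" if z: "z \<in> I" for z
  proof -
    obtain j i where z': "z = (j, i)" "j < k" "i < d j"
      using z by (auto simp: I_def)
    have b: "bop (Y j) (Y N) (1 * (\<Gamma> * 1) * 1) (\<lambda>x. T (emb (N' j) (S' j x)) N)"
      by (rule bop_comp[OF S'[OF z'(2)] TN])
    show ?thesis
      using bopD(2,5)[OF b e[OF z'(3)]] \<Gamma>'2(2)[of j i] z z' unfolding v_def by simp
  qed
  have bT: "bop (Y N) (Y N) \<Gamma>' (\<lambda>x. T (emb N x) N)"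
    using bop_mono[OF TN _ Y] \<Gamma>'1 by simp
  have lf: "local_factor_at Y k N \<Gamma>' (card I) \<epsilon>'"
    using N(2) by (intro N0) simp
  have V: "finite (v ` I)" "card (v ` I) \<le> card I" "\<And>u. u \<in> v ` I \<Longrightarrow> u \<in> vecs (Y N)"
    "\<And>u. u \<in> v ` I \<Longrightarrow> nrm (Y N) u \<le> \<Gamma>'"
    using I v card_image_le[OF I] by auto
  have \<Phi>: "finite (\<phi> ` I)" "card (\<phi> ` I) \<le> card I" "\<And>\<psi>. \<psi> \<in> \<phi> ` I \<Longrightarrow> bop (Y N) real_line \<Gamma>' \<psi>"
    using I \<phi> card_image_le[OF I] by auto
  have "\<exists>R S l. bop (Y N) (Y k) 1 R \<and> bop (Y k) (Y N) 1 S \<and>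
        (\<forall>x\<in>vecs (Y k). R (S x) = x \<and> nrm (Y k) (R (T (emb N (S x)) N) - l *\<^sub>R x) \<le> \<epsilon>' * nrm (Y k) x \<and>
           (\<forall>\<psi>\<in>\<phi> ` I. \<bar>\<psi> (S x)\<bar> \<le> \<epsilon>' * nrm (Y k) x)) \<and>
        (\<forall>u\<in>v ` I. nrm (Y k) (R u) \<le> \<epsilon>')"
    by (rule lf[unfolded local_factor_at_def, rule_format]) (intro conjI ballI bT V \<Phi>; assumption)
  then obtain R S l where R: "bop (Y N) (Y k) 1 R" and S: "bop (Y k) (Y N) 1 S"
    and all: "\<forall>x\<in>vecs (Y k). R (S x) = x \<and> nrm (Y k) (R (T (emb N (S x)) N) - l *\<^sub>R x) \<le> \<epsilon>' * nrm (Y k) x \<and>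
           (\<forall>\<psi>\<in>\<phi> ` I. \<bar>\<psi> (S x)\<bar> \<le> \<epsilon>' * nrm (Y k) x)"
    and d3': "\<forall>u\<in>v ` I. nrm (Y k) (R u) \<le> \<epsilon>'"
    by (elim exE conjE) (rule that; assumption)
  have RS: "R (S x) = x"
    and d1: "nrm (Y k) (R (T (emb N (S x)) N) - l *\<^sub>R x) \<le> \<epsilon>' * nrm (Y k) x" if "x \<in> vecs (Y k)" for x
    using all[rule_format, OF that] by simp_all
  have d2: "\<bar>\<phi> z (S x)\<bar> \<le> \<epsilon>' * nrm (Y k) x" if "x \<in> vecs (Y k)" "z \<in> I" for x z
    using all[rule_format, OF that(1)] that(2) by simp
  have d3: "nrm (Y k) (R (v z)) \<le> \<epsilon>'" if "z \<in> I" for z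
    using d3' that by simp
  have "stage A \<epsilon> T f k (N, R, S, l)"
    unfolding stage_def split
  proof (intro conjI ballI allI impI)
    fix x assume x: "x \<in> vecs (Y k)"
    show "R (S x) = x" by (rule RS[OF x])
    have "nrm (Y k) (R (T (emb N (S x)) N) - l *\<^sub>R x) \<le> \<epsilon>' * nrm (Y k) x"
      by (rule d1[OF x])
    also have "\<dots> \<le> \<epsilon> / 2 ^ (k + k) * nrm (Y k) x"
      using \<epsilon>'W[OF W1, of k] x by (intro mult_right_mono) auto
    finally show "nrm (Y k) (R (T (emb N (S x)) N) - l *\<^sub>R x) \<le> \<epsilon> / 2 ^ (k + k) * nrm (Y k) x" .
  next
    fix j assume j: "j < k"
    obtain l' where fj: "f j = (N' j, R' j, S' j, l')"
      by (simp add: N'_def R'_def S'_def prod_eq_iff)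
    show "case f j of (N', R', S', l') \<Rightarrow> N' < N \<and>
        (\<forall>x\<in>vecs (Y k). nrm (Y j) (R' (T (emb N (S x)) N')) \<le> \<epsilon> / 2 ^ (j + k) * nrm (Y k) x) \<and>
        (\<forall>x\<in>vecs (Y j). nrm (Y k) (R (T (emb N' (S' x)) N)) \<le> \<epsilon> / 2 ^ (j + k) * nrm (Y j) x)"
      unfolding fj split
    proof (intro conjI ballI NN j)
      fix x assume x: "x \<in> vecs (Y k)"
      let ?y = "R' j (T (emb N (S x)) (N' j))"
      have y: "?y \<in> vecs (Y j)"
        by (rule bopD(2)[OF R'[OF j] bopD(2)[OF TN bopD(2)[OF S x]]])
      have "nrm (Y j) ?y \<le> (\<Sum>i<d j. \<bar>c j i ?y\<bar> * nrm (Y j) (e j i))"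
        by (rule coord_nrm_le[OF sys Y y])
      also have "\<dots> \<le> (\<Sum>i<d j. \<epsilon>' * nrm (Y k) x * nrm (Y j) (e j i))"
      proof (rule sum_mono)
        fix i assume "i \<in> {..<d j}"
        then have i: "i < d j" by simp
        have "\<bar>c j i ?y\<bar> \<le> \<epsilon>' * nrm (Y k) x"
          using d2[OF x, of "(j, i)"] i j by (simp add: \<phi>_def I_def)
        then show "\<bar>c j i ?y\<bar> * nrm (Y j) (e j i) \<le> \<epsilon>' * nrm (Y k) x * nrm (Y j) (e j i)"
          using e0[OF i] by (rule mult_right_mono)
      qed
      also have "\<dots> = (\<epsilon>' * (\<Sum>i<d j. nrm (Y j) (e j i))) * nrm (Y k) x"
        by (simp add: sum_distrib_left sum_distrib_right mult_ac)
      also have "\<dots> \<le> \<epsilon> / 2 ^ (j + k) * nrm (Y k) x"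
        using \<epsilon>'W[OF WB(2)[OF j]] j x by (intro mult_right_mono) auto
      finally show "nrm (Y j) ?y \<le> \<epsilon> / 2 ^ (j + k) * nrm (Y k) x" .
    next
      fix x assume x: "x \<in> vecs (Y j)"
      let ?U = "\<lambda>x. R (T (emb (N' j) (S' j x)) N)"
      have U: "bop (Y j) (Y k) (1 * (1 * (\<Gamma> * 1) * 1)) ?U"
        by (rule bop_comp[OF bop_comp[OF S'[OF j] TN] R])
      have "x = (\<Sum>i<d j. c j i x *\<^sub>R e j i)"
        using sys[of j] x unfolding coord_system_def by blast
      then have "?U x = ?U (\<Sum>i<d j. c j i x *\<^sub>R e j i)"
        by (rule arg_cong)
      also have "\<dots> = (\<Sum>i<d j. ?U (c j i x *\<^sub>R e j i))"
        using e by (intro bop_sum[OF U Y]) auto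
      also have "\<dots> = (\<Sum>i<d j. c j i x *\<^sub>R ?U (e j i))"
        using bopD(4)[OF U e] by simp
      finally have "nrm (Y k) (?U x) \<le> (\<Sum>i<d j. nrm (Y k) (c j i x *\<^sub>R ?U (e j i)))"
        using bopD(2)[OF U e] by (auto intro!: Y.nrm_sum Y.scale_mem)
      also have "\<dots> \<le> (\<Sum>i<d j. B j i * nrm (Y j) x * \<epsilon>')"
      proof (rule sum_mono)
        fix i assume "i \<in> {..<d j}"
        then have i: "i < d j" by simp
        have "nrm (Y k) (?U (e j i)) \<le> \<epsilon>'"
          using d3[of "(j, i)"] i j by (simp add: v_def I_def)
        then have "\<bar>c j i x\<bar> * nrm (Y k) (?U (e j i)) \<le> (B j i * nrm (Y j) x) * \<epsilon>'"
          using c_le[OF i x] bopD(2)[OF U e[OF i]] B0[OF i] x by (intro mult_mono) auto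
        then show "nrm (Y k) (c j i x *\<^sub>R ?U (e j i)) \<le> B j i * nrm (Y j) x * \<epsilon>'"
          using bopD(2)[OF U e[OF i]] by (simp add: Y.nrm_scale)
      qed
      also have "\<dots> = (\<epsilon>' * (\<Sum>i<d j. B j i)) * nrm (Y j) x"
        by (simp add: sum_distrib_left sum_distrib_right mult_ac)
      also have "\<dots> \<le> \<epsilon> / 2 ^ (j + k) * nrm (Y j) x"
        using \<epsilon>'W[OF WB(1)[OF j]] j x by (intro mult_right_mono) auto
      finally show "nrm (Y k) (?U x) \<le> \<epsilon> / 2 ^ (j + k) * nrm (Y j) x" .
    qed
  qed (use N R S in auto)
  then show ?thesis by blast
qed

lemma ex_construction:
  assumes T: "bop X X \<Gamma> T" and \<epsilon>: "0 < \<epsilon>" and A: "infinite A"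
    and fdim: "\<And>n. fdim (Y n)" and loc: "local_factor Y"
  obtains N R S l where "strict_mono N" "\<And>k. N k \<in> A"
    "\<And>k. bop (Y (N k)) (Y k) 1 (R k)" "\<And>k. bop (Y k) (Y (N k)) 1 (S k)"
    "\<And>k x. x \<in> vecs (Y k) \<Longrightarrow> R k (S k x) = x"
    "\<And>k x. x \<in> vecs (Y k) \<Longrightarrow>
      nrm (Y k) (R k (T (emb (N k) (S k x)) (N k)) - l k *\<^sub>R x) \<le> \<epsilon> / 2 ^ (k + k) * nrm (Y k) x"
    "\<And>j k x. j \<noteq> k \<Longrightarrow> x \<in> vecs (Y k) \<Longrightarrow>
      nrm (Y j) (R j (T (emb (N k) (S k x)) (N j))) \<le> \<epsilon> / 2 ^ (j + k) * nrm (Y k) x"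
proof -
  \<comment> \<open>The predicate at stage \<open>k\<close> depends on \<open>f\<close> only through
    its values below \<open>k\<close>, as the choice principle demands.\<close>
  have "\<exists>f. \<forall>k. stage A \<epsilon> T f k (f k)"
  proof (rule dependent_wellorder_choice)
    fix z and f g :: "nat \<Rightarrow> nat \<times> ('v \<Rightarrow> 'v) \<times> ('v \<Rightarrow> 'v) \<times> real" and k :: nat assume "\<And>j. j < k \<Longrightarrow> f j = g j"
    then show "stage A \<epsilon> T f k z = stage A \<epsilon> T g k z"
      unfolding stage_def by (auto simp: case_prod_unfold)
  qed (rule ex_stage[OF T \<epsilon> A fdim loc])
  then obtain f where f: "\<And>k. stage A \<epsilon> T f k (f k)" by blast
  define N where "N j = fst (f j)" for j
  define R where "R j = fst (snd (f j))" for j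
  define S where "S j = fst (snd (snd (f j)))" for j
  define l where "l j = snd (snd (snd (f j)))" for j
  have fj: "f j = (N j, R j, S j, l j)" for j
    by (simp add: N_def R_def S_def l_def)
  note st = f[unfolded stage_def fj split]
  have mono: "strict_mono N"
    using st by (auto simp: strict_mono_def)
  have off: "nrm (Y j) (R j (T (emb (N k) (S k x)) (N j))) \<le> \<epsilon> / 2 ^ (j + k) * nrm (Y k) x"
    if "j \<noteq> k" "x \<in> vecs (Y k)" for j k x
  proof (cases "j < k")
    case True
    then show ?thesis using st[of k] that by blast
  next
    case False
    then have "k < j" using that by simp
    then have "nrm (Y j) (R j (T (emb (N k) (S k x)) (N j))) \<le> \<epsilon> / 2 ^ (k + j) * nrm (Y k) x"
      using st[of j] that by blast
    then show ?thesis by (simp add: add.commute)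
  qed
  show thesis
    by (rule that[OF mono _ _ _ _ _ off]) (use st in blast)+
qed

text \<open>Local factorization with trivial data, of which only the norm one complemented copies of
  \<open>Y n\<close> in all large \<open>Y N\<close> are kept. They allow unsuitable stages to be
  dropped in the next theorem.\<close>

lemma local_factor_embed:
  assumes "local_factor Y"
  obtains N0 where "\<And>n N. N0 n \<le> N \<Longrightarrow> \<exists>R S. bop (Y N) (Y n) 1 R \<and> bop (Y n) (Y N) 1 S \<and>
    (\<forall>x\<in>vecs (Y n). R (S x) = x)"
proof -
  have "\<exists>N0. \<forall>N\<ge>N0. \<exists>R S. bop (Y N) (Y n) 1 R \<and> bop (Y n) (Y N) 1 S \<and> (\<forall>x\<in>vecs (Y n). R (S x) = x)" for n
  proof -
    obtain N0 where N0: "\<And>N. N \<ge> N0 \<Longrightarrow> local_factor_at Y n N 1 0 1"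
      using assms[unfolded local_factor_def] zero_less_one by blast
    have "\<exists>R S. bop (Y N) (Y n) 1 R \<and> bop (Y n) (Y N) 1 S \<and> (\<forall>x\<in>vecs (Y n). R (S x) = x)" if "N \<ge> N0" for N
      by (rule local_factor_atE[OF N0[OF that] bop_id[OF Y], where V = "{}" and \<Phi> = "{}"]) auto
    then show ?thesis by blast
  qed
  then show thesis using that by metis
qed

text \<open>The stages with c k \<ge> 1/2 form an infinite set but possibly a thin one. Choose stage
  \<open>j n\<close> in it so late that \<open>Y (j n)\<close> contains a complemented copy of
  \<open>Y n\<close>, and compose with that copy. The errors do not grow, since the maps have norm
  one and j n \<ge> n.\<close>

theorem factor_through_lr_sum:
  assumes T: "bounded_op X X T" and \<eta>: "0 < \<eta>" and fdim: "\<And>n. fdim (Y n)" and loc: "local_factor Y"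
  shows "\<exists>R S. bounded_op X X R \<and> bounded_op X X S \<and>
    (\<exists>H\<in>{T, \<lambda>x. x - T x}. \<forall>x\<in>vecs X. R (H (S x)) = x) \<and> op_norm X X R * op_norm X X S \<le> 2 + \<eta>"
proof -
  obtain \<Gamma> where T: "bop X X \<Gamma> T"
    using bounded_op_imp_bop[OF T X] .
  \<comment> \<open>1/16 is the demand of the Neumann series, \<eta>/32 turns 2 + 32\<epsilon> into
    2 + \<eta>.\<close>
  define \<epsilon> where "\<epsilon> = min (1 / 16) (\<eta> / 32)"
  have \<epsilon>: "0 < \<epsilon>" "16 * \<epsilon> \<le> 1" "32 * \<epsilon> \<le> \<eta>"
    using \<eta> by (auto simp: \<epsilon>_def)
  obtain A where A: "infinite A"
    "\<And>f m. f \<in> vecs X \<Longrightarrow> (\<And>i. i \<notin> A \<Longrightarrow> f i = 0) \<Longrightarrow> (\<lambda>L. nrm (Y m) (T (tail L f) m)) \<longlonglongrightarrow> 0"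
    using tails_vanish[OF T fdim] by blast
  obtain N R S l where N: "strict_mono N" and NA: "\<And>k. N k \<in> A"
    and R: "\<And>k. bop (Y (N k)) (Y k) 1 (R k)" and S: "\<And>k. bop (Y k) (Y (N k)) 1 (S k)"
    and RS: "\<And>k x. x \<in> vecs (Y k) \<Longrightarrow> R k (S k x) = x"
    and dg: "\<And>k x. x \<in> vecs (Y k) \<Longrightarrow>
      nrm (Y k) (R k (T (emb (N k) (S k x)) (N k)) - l k *\<^sub>R x) \<le> \<epsilon> / 2 ^ (k + k) * nrm (Y k) x"
    and off: "\<And>j k x. j \<noteq> k \<Longrightarrow> x \<in> vecs (Y k) \<Longrightarrow>
      nrm (Y j) (R j (T (emb (N k) (S k x)) (N j))) \<le> \<epsilon> / 2 ^ (j + k) * nrm (Y k) x"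
    using ex_construction[OF T \<epsilon>(1) A(1) fdim loc] by blast
  obtain N0 where N0: "\<And>n N. N0 n \<le> N \<Longrightarrow> \<exists>R S. bop (Y N) (Y n) 1 R \<and> bop (Y n) (Y N) 1 S \<and>
    (\<forall>x\<in>vecs (Y n). R (S x) = x)"
    using local_factor_embed[OF loc] by blast
  have "infinite {k. 1 / 2 \<le> l k} \<or> infinite {k. 1 / 2 \<le> 1 - l k}"
  proof (rule ccontr)
    assume "\<not> ?thesis"
    then have "finite ({k. 1 / 2 \<le> l k} \<union> {k. 1 / 2 \<le> 1 - l k})"
      by (simp only: finite_Un de_Morgan_disj not_not)
    moreover have "{k. 1 / 2 \<le> l k} \<union> {k. 1 / 2 \<le> 1 - l k} = UNIV"
      by auto
    ultimately show False
      by (simp only: infinite_UNIV_nat)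
  qed
  then obtain H c where Hc: "H = T \<and> c = l \<or> H = (\<lambda>x. x - T x) \<and> c = (\<lambda>n. 1 - l n)"
    and inf: "infinite {k. 1 / 2 \<le> c k}"
    by blast
  have "\<exists>j. \<forall>n. (1 / 2 \<le> c (j n) \<and> N0 n \<le> j n) \<and> j n < j (Suc n)"
  proof (rule dependent_nat_choice)
    show "\<exists>x. 1 / 2 \<le> c x \<and> N0 0 \<le> x"
      using inf unfolding infinite_nat_iff_unbounded_le by blast
    fix x n
    show "\<exists>y. (1 / 2 \<le> c y \<and> N0 (Suc n) \<le> y) \<and> x < y"
      using inf[unfolded infinite_nat_iff_unbounded_le, rule_format, of "N0 (Suc n) + Suc x"] by fastforce
  qed
  then obtain j where j: "\<And>n. 1 / 2 \<le> c (j n)" "\<And>n. N0 n \<le> j n" "\<And>n. j n < j (Suc n)"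
    by blast
  have jm: "strict_mono j"
    using j(3) by (simp add: strict_mono_Suc_iff)
  have "\<forall>n. \<exists>P I. bop (Y (j n)) (Y n) 1 P \<and> bop (Y n) (Y (j n)) 1 I \<and> (\<forall>x\<in>vecs (Y n). P (I x) = x)"
    using N0 j(2) by blast
  then obtain P I where P: "\<And>n. bop (Y (j n)) (Y n) 1 (P n)" and I: "\<And>n. bop (Y n) (Y (j n)) 1 (I n)"
    and PI: "\<And>n x. x \<in> vecs (Y n) \<Longrightarrow> P n (I n x) = x"
    by metis
  have le: "\<epsilon> / 2 ^ (j m + j n) * nrm (Y (j n)) (I n x) \<le> \<epsilon> / 2 ^ (m + n) * nrm (Y n) x" if x: "x \<in> vecs (Y n)" for m n x
  proof (rule mult_mono)
    show "\<epsilon> / 2 ^ (j m + j n) \<le> \<epsilon> / 2 ^ (m + n)"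
      using \<epsilon> strict_mono_imp_increasing[OF jm] by (intro divide_left_mono power_increasing add_mono) auto
  qed (use bopD(2,5)[OF I x] \<epsilon> in auto)
  have "\<exists>R S. bop X X (2 + 32 * \<epsilon>) R \<and> bop X X 1 S \<and> (\<forall>x\<in>vecs X. R (H (S x)) = x)"
  proof (rule glue_factor[OF T \<epsilon>(1) A(2)])
    show "strict_mono (N \<circ> j)"
      using N jm by (rule strict_mono_o)
    show "bop (Y ((N \<circ> j) n)) (Y n) 1 (\<lambda>x. P n (R (j n) x))" for n
      using bop_comp[OF R P] by simp
    show "bop (Y n) (Y ((N \<circ> j) n)) 1 (\<lambda>x. S (j n) (I n x))" for n
      using bop_comp[OF I S] by simp
    show "P n (R (j n) (S (j n) (I n x))) = x" if "x \<in> vecs (Y n)" for n x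
      using RS[OF bopD(2)[OF I that]] PI[OF that] by simp
    show "H = T \<and> c \<circ> j = l \<circ> j \<or> H = (\<lambda>x. x - T x) \<and> c \<circ> j = (\<lambda>n. 1 - (l \<circ> j) n)"
      using Hc by auto
    show "nrm (Y n) (P n (R (j n) (T (emb ((N \<circ> j) n) (S (j n) (I n x))) ((N \<circ> j) n))) - (l \<circ> j) n *\<^sub>R x)
      \<le> \<epsilon> / 2 ^ (n + n) * nrm (Y n) x" if x: "x \<in> vecs (Y n)" for n x
    proof -
      let ?z = "R (j n) (T (emb (N (j n)) (S (j n) (I n x))) (N (j n)))"
      have Ix: "I n x \<in> vecs (Y (j n))" by (rule bopD(2)[OF I x])
      have z: "?z \<in> vecs (Y (j n))"
        by (intro bopD(2)[OF R] nth_mem bopD(2)[OF T] bopD(2)[OF bop_emb] bopD(2)[OF S] Ix)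
      have "P n ?z - l (j n) *\<^sub>R x = P n (?z - l (j n) *\<^sub>R I n x)"
        unfolding bop_diff_apply[OF P Y z Y.scale_mem[OF Ix]] bopD(4)[OF P Ix] PI[OF x] ..
      then have "nrm (Y n) (P n ?z - l (j n) *\<^sub>R x) \<le> nrm (Y (j n)) (?z - l (j n) *\<^sub>R I n x)"
        using bopD(5)[OF P, of "?z - l (j n) *\<^sub>R I n x"] z Ix by auto
      also have "\<dots> \<le> \<epsilon> / 2 ^ (j n + j n) * nrm (Y (j n)) (I n x)"
        by (rule dg[OF Ix])
      also have "\<dots> \<le> \<epsilon> / 2 ^ (n + n) * nrm (Y n) x"
        by (rule le[OF x])
      finally show ?thesis by simp
    qed
    show "nrm (Y m) (P m (R (j m) (T (emb ((N \<circ> j) n) (S (j n) (I n x))) ((N \<circ> j) m))))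
      \<le> \<epsilon> / 2 ^ (m + n) * nrm (Y n) x" if "m \<noteq> n" and x: "x \<in> vecs (Y n)" for m n x
    proof -
      let ?z = "R (j m) (T (emb (N (j n)) (S (j n) (I n x))) (N (j m)))"
      have Ix: "I n x \<in> vecs (Y (j n))" by (rule bopD(2)[OF I x])
      have z: "?z \<in> vecs (Y (j m))"
        by (intro bopD(2)[OF R] nth_mem bopD(2)[OF T] bopD(2)[OF bop_emb] bopD(2)[OF S] Ix)
      have ne: "j m \<noteq> j n"
        using \<open>m \<noteq> n\<close> strict_mono_eq[OF jm] by simp
      have "nrm (Y m) (P m ?z) \<le> nrm (Y (j m)) ?z"
        using bopD(5)[OF P z] by simp
      also have "\<dots> \<le> \<epsilon> / 2 ^ (j m + j n) * nrm (Y (j n)) (I n x)"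
        by (rule off[OF ne Ix])
      also have "\<dots> \<le> \<epsilon> / 2 ^ (m + n) * nrm (Y n) x"
        by (rule le[OF x])
      finally show ?thesis by simp
    qed
  qed (use NA j(1) \<epsilon>(2) fdim_complete[OF fdim Y] in auto)
  then obtain R S where RS: "bop X X (2 + 32 * \<epsilon>) R" "bop X X 1 S" "\<forall>x\<in>vecs X. R (H (S x)) = x"
    by blast
  have "0 \<le> op_norm X X S"
    using op_norm_bop[OF RS(2) X X] by (rule bopD(1))
  then have "op_norm X X R * op_norm X X S \<le> (2 + 32 * \<epsilon>) * 1"
    using op_norm_le[OF RS(1) X] op_norm_le[OF RS(2) X] \<epsilon> by (intro mult_mono) auto
  then show ?thesis
    using RS Hc \<epsilon>(3) bop_imp_bounded_op[OF RS(1)] bop_imp_bounded_op[OF RS(2)]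
    by (intro exI[of _ R] exI[of _ S]) auto
qed

end

section \<open>Block systems\<close>

text \<open>Bit lists are the nodes of the binary tree and stand for dyadic intervals, see
  \<open>ivl\<close>: the list of length i for an interval of length 2^-i, \<open>take i x\<close>
  for the ancestors of \<open>x\<close>. The leaves \<open>Lv N\<close> take the place of the points
  of [0, 1).\<close>

definition Lv :: "nat \<Rightarrow> bool list set" where
  "Lv n = {xs. length xs = n}"

definition idx :: "nat \<Rightarrow> bool list set" where
  "idx n = {xs. length xs \<le> n}"

lemma Lv_iff [simp]: "x \<in> Lv n \<longleftrightarrow> length x = n"
  by (simp add: Lv_def)

lemma idx_iff [simp]: "x \<in> idx n \<longleftrightarrow> length x \<le> n"
  by (simp add: idx_def)

lemma finite_Lv [simp, intro]: "finite (Lv n)"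
  using finite_lists_length_eq[of "UNIV :: bool set" n] by (simp add: Lv_def)

lemma finite_idx [simp, intro]: "finite (idx n)"
  using finite_lists_length_le[of "UNIV :: bool set" n] by (simp add: idx_def)

lemma card_Lv [simp]: "card (Lv n) = 2 ^ n"
  using card_lists_length_eq[of "UNIV :: bool set" n] by (simp add: Lv_def)

lemma finite_Lv_filter [simp, intro]: "finite {x \<in> Lv n. P x}"
  by (rule finite_subset[OF _ finite_Lv[of n]]) blast

definition ind :: "'a set \<Rightarrow> 'a \<Rightarrow> real" where
  "ind A x = (if x \<in> A then 1 else 0)"

text \<open>Each prescribed digit halves the count, because flipping it is a bijection between the
  two halves. The multiplicative form avoids subtraction in exponents.\<close>

lemma card_fixed_digits:
  assumes "finite D" "D \<subseteq> {..<N}"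
  shows "card {x \<in> Lv N. \<forall>d\<in>D. x ! d = f d} * 2 ^ card D = 2 ^ N"
  using assms
proof (induction D)
  case empty
  then show ?case
    using card_Lv[of N] by (simp add: Lv_def del: card_Lv)
next
  case (insert a D)
  let ?P = "\<lambda>b. {x \<in> Lv N. (\<forall>d\<in>D. x ! d = f d) \<and> x ! a = b}"
  have unflip: "(x[a := c])[a := b] = x" if "x \<in> ?P b" for x b c
  proof -
    have "b = x ! a" using that by simp
    then show ?thesis by simp
  qed
  have flip: "x[a := c] \<in> ?P c" if "x \<in> ?P b" for x b c
    using that insert.hyps insert.prems by (auto simp: nth_list_update)
  have "bij_betw (\<lambda>x. x[a := \<not> f a]) (?P (f a)) (?P (\<not> f a))"
    by (intro bij_betw_byWitness[where f' = "\<lambda>x. x[a := f a]"] ballI image_subsetI unflip flip)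
  then have "card (?P (f a)) = card (?P (\<not> f a))"
    by (rule bij_betw_same_card)
  moreover have "{x \<in> Lv N. \<forall>d\<in>D. x ! d = f d} = ?P (f a) \<union> ?P (\<not> f a)"
    by auto
  moreover have "card (?P (f a) \<union> ?P (\<not> f a)) = card (?P (f a)) + card (?P (\<not> f a))"
    by (intro card_Un_disjoint finite_Lv_filter) blast
  ultimately have "card {x \<in> Lv N. \<forall>d\<in>D. x ! d = f d} = 2 * card (?P (f a))"
    by simp
  moreover have "{x \<in> Lv N. \<forall>d\<in>insert a D. x ! d = f d} = ?P (f a)"
    by auto
  ultimately show ?case
    using insert by simp
qed

text \<open>A block system is a measure preserving map \<open>\<tau>\<close> between binary trees together with
  collections \<open>B I\<close> of nodes of the finer tree. The branch \<open>x\<close> meets \<open>B I\<close> at level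
  \<open>\<kappa> (length I) x\<close> if \<open>I\<close> lies on the branch \<open>\<tau> x\<close>, and not at all otherwise. The
  condition \<open>fibre\<close> says that \<open>\<tau>\<close> remains equidistributed on each node of \<open>B I\<close>.\<close>

locale block_system =
  fixes n N :: nat and B :: "bool list \<Rightarrow> bool list set"
    and \<tau> :: "bool list \<Rightarrow> bool list" and \<kappa> :: "nat \<Rightarrow> bool list \<Rightarrow> nat"
  assumes tau_mem: "x \<in> Lv N \<Longrightarrow> \<tau> x \<in> Lv n"
    and kappa_le: "x \<in> Lv N \<Longrightarrow> l \<le> n \<Longrightarrow> \<kappa> l x \<le> N"
    and kappa_inj: "x \<in> Lv N \<Longrightarrow> inj_on (\<lambda>l. \<kappa> l x) {..n}"
    and B_iff: "x \<in> Lv N \<Longrightarrow> i \<le> N \<Longrightarrow> I \<in> idx n \<Longrightarrow>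
      take i x \<in> B I \<longleftrightarrow> i = \<kappa> (length I) x \<and> take (length I) (\<tau> x) = I"
    and B_idx: "I \<in> idx n \<Longrightarrow> B I \<subseteq> idx N"
    and fibre: "I \<in> idx n \<Longrightarrow> K \<in> B I \<Longrightarrow> \<omega> \<in> Lv n \<Longrightarrow> take (length I) \<omega> = I \<Longrightarrow>
      card {x \<in> Lv N. \<tau> x = \<omega> \<and> take (length K) x = K} * (2 ^ length K * 2 ^ n) = 2 ^ N * 2 ^ length I"
    and fibre0: "\<omega> \<in> Lv n \<Longrightarrow> card {x \<in> Lv N. \<tau> x = \<omega>} * 2 ^ n = 2 ^ N"
begin

lemma finite_B: "I \<in> idx n \<Longrightarrow> finite (B I)"
  using B_idx finite_subset by blast

lemma extend_mem:
  assumes "K \<in> idx N"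
  obtains x where "x \<in> Lv N" "take (length K) x = K"
proof (rule that)
  show "K @ replicate (N - length K) False \<in> Lv N"
    using assms by simp
qed simp

lemma B_through:
  assumes "I \<in> idx n" "K \<in> B I" "x \<in> Lv N" "take (length K) x = K"
  shows "length K = \<kappa> (length I) x" "take (length I) (\<tau> x) = I"
proof -
  have "length K \<le> N" using B_idx[OF assms(1)] assms(2) by auto
  then show "length K = \<kappa> (length I) x" "take (length I) (\<tau> x) = I"
    using B_iff[OF assms(3) _ assms(1), of "length K"] assms(2,4) by simp_all
qed

lemma B_disjoint:
  assumes "I \<in> idx n" "I' \<in> idx n" "K \<in> B I" "K \<in> B I'"
  shows "I = I'"
proof -
  obtain x where x: "x \<in> Lv N" "take (length K) x = K"
    using extend_mem[of K] B_idx[OF assms(1)] assms(3) by blast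
  have "\<kappa> (length I) x = \<kappa> (length I') x"
    using B_through(1)[OF assms(1,3) x] B_through(1)[OF assms(2,4) x] by simp
  then have "length I = length I'"
    using inj_onD[OF kappa_inj[OF x(1)]] assms(1,2) by simp
  then show ?thesis
    using B_through(2)[OF assms(1,3) x] B_through(2)[OF assms(2,4) x] by metis
qed

end

text \<open>Blocks of blocks: this allows a construction to be repeated inside the copy produced by
  another one. For the counting conditions, sort the leaves \<open>x\<close> by the intermediate
  leaf \<open>\<tau> x\<close>; all fibres that occur have the same size.\<close>

lemma block_system_compose:
  assumes "block_system m N B \<tau> \<kappa>" and "block_system n m B' \<tau>' \<kappa>'"
  shows "block_system n N (\<lambda>I. \<Union>K\<in>B' I. B K) (\<lambda>x. \<tau>' (\<tau> x)) (\<lambda>l x. \<kappa> (\<kappa>' l (\<tau> x)) x)"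
proof -
  interpret a: block_system m N B \<tau> \<kappa> by fact
  interpret b: block_system n m B' \<tau>' \<kappa>' by fact
  show ?thesis
  proof
    fix x assume x: "x \<in> Lv N"
    note tx = a.tau_mem[OF x]
    show "\<tau>' (\<tau> x) \<in> Lv n"
      by (rule b.tau_mem[OF tx])
    show "\<kappa> (\<kappa>' l (\<tau> x)) x \<le> N" if "l \<le> n" for l
      by (rule a.kappa_le[OF x b.kappa_le[OF tx that]])
    show "inj_on (\<lambda>l. \<kappa> (\<kappa>' l (\<tau> x)) x) {..n}"
    proof (rule inj_onI)
      fix l l' assume l: "l \<in> {..n}" "l' \<in> {..n}" "\<kappa> (\<kappa>' l (\<tau> x)) x = \<kappa> (\<kappa>' l' (\<tau> x)) x"
      then have "\<kappa>' l (\<tau> x) = \<kappa>' l' (\<tau> x)"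
        using inj_onD[OF a.kappa_inj[OF x] l(3)] b.kappa_le[OF tx] by simp
      then show "l = l'"
        using inj_onD[OF b.kappa_inj[OF tx]] l by blast
    qed
    fix i I assume i: "i \<le> N" and I: "I \<in> idx n"
    show "take i x \<in> (\<Union>K\<in>B' I. B K) \<longleftrightarrow>
        i = \<kappa> (\<kappa>' (length I) (\<tau> x)) x \<and> take (length I) (\<tau>' (\<tau> x)) = I"
    proof
      assume "take i x \<in> (\<Union>K\<in>B' I. B K)"
      then obtain K where K: "K \<in> B' I" "take i x \<in> B K" by blast
      have Km: "K \<in> idx m" using b.B_idx[OF I] K(1) by blast
      have iK: "i = \<kappa> (length K) x" "take (length K) (\<tau> x) = K"
        using a.B_iff[OF x i Km] K(2) by auto
      show "i = \<kappa> (\<kappa>' (length I) (\<tau> x)) x \<and> take (length I) (\<tau>' (\<tau> x)) = I"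
        using b.B_through[OF I K(1) tx iK(2)] iK(1) by simp
    next
      assume *: "i = \<kappa> (\<kappa>' (length I) (\<tau> x)) x \<and> take (length I) (\<tau>' (\<tau> x)) = I"
      define k where "k = \<kappa>' (length I) (\<tau> x)"
      have k: "k \<le> m" using b.kappa_le[OF tx] I by (simp add: k_def)
      have 1: "take k (\<tau> x) \<in> B' I"
        using b.B_iff[OF tx k I] * by (simp add: k_def)
      have "take i x \<in> B (take k (\<tau> x))"
        using a.B_iff[OF x i, of "take k (\<tau> x)"] * k tx by (simp add: k_def[symmetric])
      then show "take i x \<in> (\<Union>K\<in>B' I. B K)"
        using 1 by blast
    qed
  next
    fix I assume I: "I \<in> idx n"
    show "(\<Union>K\<in>B' I. B K) \<subseteq> idx N"
      using a.B_idx b.B_idx[OF I] by blast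
    fix K0 \<omega> assume "K0 \<in> (\<Union>K\<in>B' I. B K)" and \<omega>: "\<omega> \<in> Lv n" "take (length I) \<omega> = I"
    then obtain K where K: "K \<in> B' I" "K0 \<in> B K" by blast
    have Km: "K \<in> idx m" using b.B_idx[OF I] K(1) by blast
    let ?W = "{w \<in> Lv m. \<tau>' w = \<omega> \<and> take (length K) w = K}"
    let ?X = "\<lambda>w. {x \<in> Lv N. \<tau> x = w \<and> take (length K0) x = K0}"
    \<comment> \<open>The common fibre size, written as a quotient of naturals; the condition
      \<open>fibre\<close> of the outer system shows that the division is exact.\<close>
    define c where "c = (2 ^ N * 2 ^ length K) div (2 ^ length K0 * 2 ^ m :: nat)"
    have c: "card (?X w) = c" "c * (2 ^ length K0 * 2 ^ m) = 2 ^ N * 2 ^ length K" if "w \<in> ?W" for w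
    proof -
      have f: "card (?X w) * (2 ^ length K0 * 2 ^ m) = 2 ^ N * 2 ^ length K"
        using a.fibre[OF Km K(2), of w] that by simp
      show "card (?X w) = c"
        unfolding c_def f[symmetric] by simp
      then show "c * (2 ^ length K0 * 2 ^ m) = 2 ^ N * 2 ^ length K"
        using f by simp
    qed
    \<comment> \<open>A leaf through \<open>K0\<close> lies over a leaf through \<open>K\<close>,
      because \<open>K0\<close> belongs to the block of \<open>K\<close>; so restricting to
      \<open>?W\<close> loses nothing.\<close>
    have eq: "{x \<in> Lv N. \<tau>' (\<tau> x) = \<omega> \<and> take (length K0) x = K0} = (\<Union>w\<in>?W. ?X w)"
      using a.B_through(2)[OF Km K(2)] a.tau_mem by auto
    have "card {x \<in> Lv N. \<tau>' (\<tau> x) = \<omega> \<and> take (length K0) x = K0} = (\<Sum>w\<in>?W. card (?X w))"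
      unfolding eq by (rule card_UN_disjoint, rule finite_Lv_filter, intro ballI, rule finite_Lv_filter, blast)
    also have "\<dots> = card ?W * c"
      using c(1) by simp
    finally have 1: "card {x \<in> Lv N. \<tau>' (\<tau> x) = \<omega> \<and> take (length K0) x = K0} = card ?W * c" .
    have W: "card ?W * (2 ^ length K * 2 ^ n) = 2 ^ m * 2 ^ length I"
      by (rule b.fibre[OF I K(1) \<omega>])
    then have "card ?W \<noteq> 0"
      by (intro notI) (simp only: mult_0, simp)
    then have "?W \<noteq> {}"
      by (metis card.empty)
    then have c': "c * (2 ^ length K0 * 2 ^ m) = 2 ^ N * 2 ^ length K"
      using c(2) by blast
    have "card ?W * c * (2 ^ length K0 * 2 ^ n) * (2 ^ m * 2 ^ length K)
        = (card ?W * (2 ^ length K * 2 ^ n)) * (c * (2 ^ length K0 * 2 ^ m))"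
      by (simp only: mult_ac)
    also have "\<dots> = 2 ^ N * 2 ^ length I * (2 ^ m * 2 ^ length K)"
      unfolding W c' by (simp only: mult_ac)
    finally show "card {x \<in> Lv N. \<tau>' (\<tau> x) = \<omega> \<and> take (length K0) x = K0} * (2 ^ length K0 * 2 ^ n)
        = 2 ^ N * 2 ^ length I"
      unfolding 1 by simp
  next
    fix \<omega> assume \<omega>: "\<omega> \<in> Lv n"
    let ?W = "{w \<in> Lv m. \<tau>' w = \<omega>}"
    let ?X = "\<lambda>w. {x \<in> Lv N. \<tau> x = w}"
    define c where "c = 2 ^ N div (2 ^ m :: nat)"
    have c: "card (?X w) = c" "c * 2 ^ m = 2 ^ N" if "w \<in> ?W" for w
    proof -
      have f: "card (?X w) * 2 ^ m = 2 ^ N"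
        using a.fibre0[of w] a.tau_mem that by simp
      show "card (?X w) = c"
        unfolding c_def f[symmetric] by simp
      then show "c * 2 ^ m = 2 ^ N"
        using f by simp
    qed
    have eq: "{x \<in> Lv N. \<tau>' (\<tau> x) = \<omega>} = (\<Union>w\<in>?W. ?X w)"
      using a.tau_mem by auto
    have "card {x \<in> Lv N. \<tau>' (\<tau> x) = \<omega>} = (\<Sum>w\<in>?W. card (?X w))"
      unfolding eq by (rule card_UN_disjoint, rule finite_Lv_filter, intro ballI, rule finite_Lv_filter, blast)
    also have "\<dots> = card ?W * c"
      using c(1) by simp
    finally have 1: "card {x \<in> Lv N. \<tau>' (\<tau> x) = \<omega>} = card ?W * c" .
    have W: "card ?W * 2 ^ n = 2 ^ m"
      by (rule b.fibre0[OF \<omega>])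
    then have "card ?W \<noteq> 0"
      by (intro notI) (simp only: mult_0, simp)
    then have "?W \<noteq> {}"
      by (metis card.empty)
    then have c': "c * 2 ^ m = 2 ^ N"
      using c(2) by blast
    have "card ?W * c * 2 ^ n * 2 ^ m = (card ?W * 2 ^ n) * (c * 2 ^ m)"
      by (simp only: mult_ac)
    also have "\<dots> = 2 ^ N * 2 ^ m"
      unfolding W c' by (simp only: mult_ac)
    finally show "card {x \<in> Lv N. \<tau>' (\<tau> x) = \<omega>} * 2 ^ n = 2 ^ N"
      unfolding 1 by simp
  qed
qed

text \<open>A decision tree: the position of the digit of \<open>x\<close> that is inspected next
  may depend on the digits already read. The nodes in \<open>digit_blocks m I\<close> are those of
  level \<open>m I\<close> at which this reading has produced \<open>I\<close>. This is the
  Gamlen-Gaudet construction with each collection contained in a single level.\<close>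

primrec path :: "(bool list \<Rightarrow> nat) \<Rightarrow> bool list \<Rightarrow> nat \<Rightarrow> bool list" where
  "path m x 0 = []"
| "path m x (Suc l) = path m x l @ [x ! m (path m x l)]"

definition digit_blocks :: "(bool list \<Rightarrow> nat) \<Rightarrow> bool list \<Rightarrow> bool list set" where
  "digit_blocks m I = {K. length K = m I \<and> (\<forall>j<length I. K ! m (take j I) = I ! j)}"

lemma length_path [simp]: "length (path m x l) = l"
  by (induction l) auto

lemma take_path: "j \<le> l \<Longrightarrow> take j (path m x l) = path m x j"
  by (induction l) (auto simp: le_Suc_eq)

lemma path_nth: "j < l \<Longrightarrow> path m x l ! j = x ! m (path m x j)"
  by (induction l) (auto simp: nth_append less_Suc_eq)

lemma path_eq_iff:
  assumes "length \<omega> = l"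
  shows "path m x l = \<omega> \<longleftrightarrow> (\<forall>j<l. x ! m (take j \<omega>) = \<omega> ! j)"
proof
  assume "path m x l = \<omega>"
  then show "\<forall>j<l. x ! m (take j \<omega>) = \<omega> ! j"
    using path_nth[of _ l m x] take_path[of _ l m x] by auto
next
  assume *: "\<forall>j<l. x ! m (take j \<omega>) = \<omega> ! j"
  have "path m x j = take j \<omega>" if "j \<le> l" for j
    using that
  proof (induction j)
    case (Suc j)
    then show ?case
      using * assms by (simp add: take_Suc_conv_app_nth)
  qed simp
  then show "path m x l = \<omega>"
    using assms by auto
qed

text \<open>For the condition \<open>fibre\<close>: a node \<open>K\<close> in the block of
  \<open>I\<close> has length \<open>m I\<close>, so it already fixes the digits read on the way to
  \<open>I\<close>, while the n - length I digits still to be read sit at distinct positions from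
  \<open>m I\<close> on and are free.\<close>

lemma block_system_digits:
  assumes mono: "\<And>I j. I \<in> idx n \<Longrightarrow> j < length I \<Longrightarrow> m (take j I) < m I"
    and bound: "\<And>I. I \<in> idx n \<Longrightarrow> m I < N"
  shows "block_system n N (digit_blocks m) (\<lambda>x. path m x n) (\<lambda>l x. m (path m x l))"
proof -
  have smono: "m (take i \<omega>) < m (take j \<omega>)" if "\<omega> \<in> Lv n" "i < j" "j \<le> n" for \<omega> i j
    using mono[of "take j \<omega>" i] that by (simp add: min_def)
  have inj: "inj_on (\<lambda>j. m (take j \<omega>)) {..n}" if "\<omega> \<in> Lv n" for \<omega>
    by (rule linorder_inj_onI) (use smono[OF that] in fastforce)+
  \<comment> \<open>The first \<open>k\<close> digits and the positions read from step
    \<open>l\<close> on are disjoint, since these positions increase from one that is at least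
    \<open>k\<close>. Together they prescribe k + (n - l) digits.\<close>
  have count: "card {x \<in> Lv N. (\<forall>j\<in>{l..<n}. x ! m (take j \<omega>) = \<omega> ! j) \<and> (\<forall>d<k. x ! d = K ! d)} * 2 ^ (k + (n - l)) = 2 ^ N"
    if \<omega>: "\<omega> \<in> Lv n" and l: "l \<le> n" and k: "k \<le> m (take l \<omega>)" for \<omega> l k K
  proof -
    let ?g = "\<lambda>j. m (take j \<omega>)"
    let ?D = "{..<k} \<union> ?g ` {l..<n}"
    define f where "f d = (if d < k then K ! d else \<omega> ! inv_into {l..<n} ?g d)" for d
    have ge: "k \<le> ?g j" if "j \<in> {l..<n}" for j
      using smono[OF \<omega>, of l j] k that by (cases "j = l") auto
    have inj': "inj_on ?g {l..<n}"
      by (rule inj_on_subset[OF inj[OF \<omega>]]) auto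
    have "k \<le> N"
      using k bound[of "take l \<omega>"] \<omega> l by simp
    then have D: "?D \<subseteq> {..<N}"
      using bound \<omega> by auto
    have "card ?D = card {..<k} + card (?g ` {l..<n})"
      using ge by (intro card_Un_disjoint) fastforce+
    then have cD: "card ?D = k + (n - l)"
      using card_image[OF inj'] by simp
    have "{x \<in> Lv N. (\<forall>j\<in>{l..<n}. x ! ?g j = \<omega> ! j) \<and> (\<forall>d<k. x ! d = K ! d)} = {x \<in> Lv N. \<forall>d\<in>?D. x ! d = f d}"
    proof -
      have fg: "f (?g j) = \<omega> ! j" if "j \<in> {l..<n}" for j
        using ge[OF that] inv_into_f_f[OF inj' that] by (simp add: f_def)
      have e1: "(\<forall>d\<in>?g ` {l..<n}. x ! d = f d) \<longleftrightarrow> (\<forall>j\<in>{l..<n}. x ! ?g j = \<omega> ! j)" for x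
        unfolding ball_simps by (intro ball_cong refl) (simp only: fg)
      have e2: "(\<forall>d\<in>{..<k}. x ! d = f d) \<longleftrightarrow> (\<forall>d<k. x ! d = K ! d)" for x
        by (auto simp: f_def)
      show ?thesis
        by (simp only: ball_Un e1 e2 conj_commute)
    qed
    then show ?thesis
      using card_fixed_digits[OF _ D, of f] cD by simp
  qed
  show ?thesis
  proof
    fix x assume x: "x \<in> Lv N"
    show "path m x n \<in> Lv n" by simp
    show "m (path m x l) \<le> N" if "l \<le> n" for l
      using bound[of "path m x l"] that by simp
    show "inj_on (\<lambda>l. m (path m x l)) {..n}"
      using inj[of "path m x n"] by (rule inj_on_cong[THEN iffD1, rotated]) (auto simp: take_path)
    fix i I assume i: "i \<le> N" and I: "I \<in> idx n"
    have "take i x ! m (take j I) = x ! m (take j I)" if "i = m I" "j < length I" for j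
      using mono[OF I that(2)] that by simp
    then show "take i x \<in> digit_blocks m I \<longleftrightarrow> i = m (path m x (length I)) \<and> take (length I) (path m x n) = I"
      using x i I path_eq_iff[OF refl, of m x I] take_path[of "length I" n m x]
      by (auto simp: digit_blocks_def)
  next
    fix I assume I: "I \<in> idx n"
    show "digit_blocks m I \<subseteq> idx N"
      using bound[OF I] by (auto simp: digit_blocks_def)
    fix K \<omega> assume K: "K \<in> digit_blocks m I" and \<omega>: "\<omega> \<in> Lv n" "take (length I) \<omega> = I"
    let ?l = "length I"
    have l: "?l \<le> n" using I by simp
    have Kl: "length K = m I" using K by (simp add: digit_blocks_def)
    have "{x \<in> Lv N. path m x n = \<omega> \<and> take (length K) x = K}
        = {x \<in> Lv N. (\<forall>j\<in>{?l..<n}. x ! m (take j \<omega>) = \<omega> ! j) \<and> (\<forall>d<length K. x ! d = K ! d)}"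
    proof -
      have "path m x n = \<omega> \<and> take (length K) x = K \<longleftrightarrow>
          (\<forall>j\<in>{?l..<n}. x ! m (take j \<omega>) = \<omega> ! j) \<and> (\<forall>d<length K. x ! d = K ! d)" if x: "x \<in> Lv N" for x
      proof -
        have KN: "length K \<le> N" using Kl bound[OF I] by simp
        have t: "take (length K) x = K \<longleftrightarrow> (\<forall>d<length K. x ! d = K ! d)"
          using KN x by (simp add: list_eq_iff_nth_eq)
        have p: "path m x n = \<omega> \<longleftrightarrow> (\<forall>j<n. x ! m (take j \<omega>) = \<omega> ! j)"
          using path_eq_iff[of \<omega> n] \<omega> by simp
        have s: "x ! m (take j \<omega>) = \<omega> ! j" if "\<forall>d<length K. x ! d = K ! d" "j < ?l" for j
        proof -
          have tj: "take j \<omega> = take j I" "\<omega> ! j = I ! j"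
            using \<omega>(2) that(2) by (metis take_take min.absorb1 less_imp_le, metis nth_take)
          have "m (take j I) < length K"
            using mono[OF I that(2)] Kl by simp
          then show ?thesis
            using that K unfolding tj by (simp add: digit_blocks_def)
        qed
        show ?thesis
          unfolding t p using s l by (auto simp: not_less)
      qed
      then show ?thesis by blast
    qed
    then have "card {x \<in> Lv N. path m x n = \<omega> \<and> take (length K) x = K} * 2 ^ (length K + (n - ?l)) = 2 ^ N"
      using count[OF \<omega>(1) l, of "length K" K] \<omega>(2) Kl by simp
    then have "card {x \<in> Lv N. path m x n = \<omega> \<and> take (length K) x = K} * 2 ^ (length K + (n - ?l)) * 2 ^ ?l = 2 ^ N * 2 ^ ?l"
      by simp
    moreover have "(2::nat) ^ (length K + (n - ?l)) * 2 ^ ?l = 2 ^ length K * 2 ^ n"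
      using l by (simp flip: power_add)
    ultimately show "card {x \<in> Lv N. path m x n = \<omega> \<and> take (length K) x = K} * (2 ^ length K * 2 ^ n) = 2 ^ N * 2 ^ ?l"
      by (simp only: mult.assoc)
  next
    fix \<omega> assume \<omega>: "\<omega> \<in> Lv n"
    have "{x \<in> Lv N. path m x n = \<omega>}
        = {x \<in> Lv N. (\<forall>j\<in>{0..<n}. x ! m (take j \<omega>) = \<omega> ! j) \<and> (\<forall>d<0. x ! d = [] ! d)}"
      using path_eq_iff[of \<omega> n m] \<omega> by auto
    then show "card {x \<in> Lv N. path m x n = \<omega>} * 2 ^ n = 2 ^ N"
      using count[OF \<omega>, of 0 0 "[]"] by simp
  qed
qed

section \<open>Diagonalisation in one parameter\<close>

text \<open>The union bound. The candidates will be levels or digit positions, the tests functionals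
  or means that have to be small there.\<close>

lemma avoid_bad:
  fixes c :: real
  assumes "finite V" "finite T" "\<And>t. t \<in> T \<Longrightarrow> real (card {v \<in> V. bad t v}) \<le> c"
    and "real (card T) * c < real (card V)"
  shows "\<exists>v\<in>V. \<forall>t\<in>T. \<not> bad t v"
proof (rule ccontr)
  assume "\<not> ?thesis"
  then have "V \<subseteq> (\<Union>t\<in>T. {v \<in> V. bad t v})"
    by blast
  then have "card V \<le> card (\<Union>t\<in>T. {v \<in> V. bad t v})"
    using assms(1,2) by (intro card_mono) auto
  also have "\<dots> \<le> (\<Sum>t\<in>T. card {v \<in> V. bad t v})"
    by (rule card_UN_le[OF assms(2)])
  finally have "real (card V) \<le> (\<Sum>t\<in>T. real (card {v \<in> V. bad t v}))"
    by (simp flip: of_nat_sum)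
  also have "\<dots> \<le> real (card T) * c"
    using sum_bounded_above[of T "\<lambda>t. real (card {v \<in> V. bad t v})" c] assms(3) by simp
  finally show False
    using assms(4) by simp
qed

text \<open>The square function of the Haar sum with coefficients \<open>f\<close>, evaluated at a
  leaf: the squared Haar functions are the indicators of the ancestors.\<close>

definition sq1 :: "nat \<Rightarrow> (bool list \<Rightarrow> real) \<Rightarrow> bool list \<Rightarrow> real" where
  "sq1 N f x = (\<Sum>i\<le>N. (f (take i x))\<^sup>2)"

definition flat1 :: "nat \<Rightarrow> bool list set \<Rightarrow> real \<Rightarrow> (bool list \<Rightarrow> real) \<Rightarrow> bool" where
  "flat1 N A G f \<longleftrightarrow> (\<forall>x\<in>Lv N. sq1 N f x \<le> (if x \<in> A then G\<^sup>2 else 0))"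

text \<open>card A / 2^N is the measure of \<open>A\<close>. It is what the product of a norm and
  its dual norm contributes for functions flat on \<open>A\<close>, whatever the exponent.
  Localising to \<open>A\<close> gives diagonal entries the size 2^-length I that makes their
  normalisation bounded.\<close>

definition form_bd :: "nat \<Rightarrow> real \<Rightarrow> ((bool list \<Rightarrow> real) \<Rightarrow> (bool list \<Rightarrow> real) \<Rightarrow> real) \<Rightarrow> bool" where
  "form_bd N \<Gamma> \<beta> \<longleftrightarrow> (\<forall>A G G' f g. A \<subseteq> Lv N \<and> 0 \<le> G \<and> 0 \<le> G' \<and> flat1 N A G f \<and> flat1 N A G' g \<longrightarrow>
     \<bar>\<beta> f g\<bar> \<le> \<Gamma> * G * G' * (real (card A) / 2 ^ N))"

definition func_bd :: "nat \<Rightarrow> real \<Rightarrow> ((bool list \<Rightarrow> real) \<Rightarrow> real) \<Rightarrow> bool" where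
  "func_bd N \<Gamma> \<phi> \<longleftrightarrow> (\<forall>G f. 0 \<le> G \<and> flat1 N (Lv N) G f \<longrightarrow> \<bar>\<phi> f\<bar> \<le> \<Gamma> * G)"

definition bilin :: "('a::real_vector \<Rightarrow> 'b::real_vector \<Rightarrow> real) \<Rightarrow> bool" where
  "bilin \<beta> \<longleftrightarrow> (\<forall>g. linear (\<lambda>f. \<beta> f g)) \<and> (\<forall>f. linear (\<beta> f))"

lemma flat1_ind_level:
  assumes "E \<subseteq> {K. length K = v}"
  shows "flat1 N (Lv N) 1 (ind E)"
  unfolding flat1_def
proof
  fix x assume x: "x \<in> Lv N"
  have "sq1 N (ind E) x \<le> (\<Sum>i\<le>N. if i = v then 1 else 0)"
    unfolding sq1_def
  proof (rule sum_mono)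
    fix i assume "i \<in> {..N}"
    then show "(ind E (take i x))\<^sup>2 \<le> (if i = v then 1 else 0)"
      using x assms by (auto simp: ind_def)
  qed
  also have "\<dots> \<le> 1"
    by simp
  finally show "sq1 N (ind E) x \<le> (if x \<in> Lv N then 1\<^sup>2 else 0)"
    using x by simp
qed

lemma form_bd_fix:
  assumes "form_bd N \<Gamma> \<beta>" "flat1 N (Lv N) 1 g"
  shows "func_bd N \<Gamma> (\<lambda>f. \<beta> f g)" "func_bd N \<Gamma> (\<beta> g)"
  using assms(1)[unfolded form_bd_def, rule_format, of "Lv N" _ 1 _ g]
    assms(1)[unfolded form_bd_def, rule_format, of "Lv N" 1 _ g] assms(2)
  by (auto simp: func_bd_def)

text \<open>The functions \<open>ind (E v)\<close> live on different levels, so a signed sum of \<open>k\<close> of them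
  has square function at most \<open>sqrt k\<close>. Hence a bounded functional is large on few of them.\<close>

lemma few_large:
  assumes lin: "linear \<phi>" and bd: "func_bd N \<Gamma> \<phi>" and V: "finite V" and E: "\<And>v. v \<in> V \<Longrightarrow> E v \<subseteq> {K. length K = v}"
    and \<epsilon>: "0 < \<epsilon>"
  shows "real (card {v \<in> V. \<epsilon> < \<bar>\<phi> (ind (E v))\<bar>}) \<le> (\<Gamma> / \<epsilon>)\<^sup>2"
proof -
  define F where "F = {v \<in> V. \<epsilon> < \<bar>\<phi> (ind (E v))\<bar>}"
  have F: "finite F" "F \<subseteq> V" using V by (auto simp: F_def)
  define g where "g = (\<Sum>v\<in>F. sgn (\<phi> (ind (E v))) *\<^sub>R ind (E v))"
  have "flat1 N (Lv N) (sqrt (real (card F))) g"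
    unfolding flat1_def
  proof
    fix x assume x: "x \<in> Lv N"
    have "sq1 N g x \<le> (\<Sum>i\<le>N. if i \<in> F then 1 else 0)"
      unfolding sq1_def
    proof (rule sum_mono)
      fix i assume i: "i \<in> {..N}"
      have "g (take i x) = (\<Sum>v\<in>F. if v = i then sgn (\<phi> (ind (E i))) * ind (E i) (take i x) else 0)"
        unfolding g_def sum_fun_apply
      proof (rule sum.cong [OF refl])
        fix v assume "v \<in> F"
        then have "E v \<subseteq> {K. length K = v}" using E F by blast
        then show "(sgn (\<phi> (ind (E v))) *\<^sub>R ind (E v)) (take i x)
            = (if v = i then sgn (\<phi> (ind (E i))) * ind (E i) (take i x) else 0)"
          using x i by (auto simp: ind_def)
      qed
      also have "\<dots> = (if i \<in> F then sgn (\<phi> (ind (E i))) * ind (E i) (take i x) else 0)"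
        using F by simp
      finally show "(g (take i x))\<^sup>2 \<le> (if i \<in> F then 1 else 0)"
        by (auto simp: ind_def sgn_real_def)
    qed
    also have "\<dots> = real (card ({..N} \<inter> F))"
      by (simp add: sum.If_cases)
    also have "\<dots> \<le> real (card F)"
      using F by (auto intro: card_mono)
    finally show "sq1 N g x \<le> (if x \<in> Lv N then (sqrt (real (card F)))\<^sup>2 else 0)"
      using x by simp
  qed
  then have le: "\<bar>\<phi> g\<bar> \<le> \<Gamma> * sqrt (real (card F))"
    using bd by (simp add: func_bd_def)
  have "\<epsilon> * real (card F) \<le> (\<Sum>v\<in>F. \<bar>\<phi> (ind (E v))\<bar>)"
    using sum_bounded_below[of F \<epsilon> "\<lambda>v. \<bar>\<phi> (ind (E v))\<bar>"] by (auto simp: F_def mult.commute)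
  also have "\<dots> = \<phi> g"
    unfolding g_def linear_sum[OF lin] linear_scale[OF lin] by (intro sum.cong) (auto simp: sgn_real_def)
  finally have "\<epsilon> * real (card F) \<le> \<Gamma> * sqrt (real (card F))"
    using le by linarith
  then have "(\<epsilon> * sqrt (real (card F))) * sqrt (real (card F)) \<le> \<Gamma> * sqrt (real (card F))"
    by (simp add: mult.assoc)
  then have "\<epsilon> * sqrt (real (card F)) \<le> \<Gamma> \<or> card F = 0"
    by (cases "card F = 0") (auto dest: mult_right_le_imp_le)
  then have "real (card F) \<le> (\<Gamma> / \<epsilon>)\<^sup>2"
  proof
    assume "\<epsilon> * sqrt (real (card F)) \<le> \<Gamma>"
    then have "sqrt (real (card F)) \<le> \<Gamma> / \<epsilon>"
      using \<epsilon> by (simp add: pos_le_divide_eq mult.commute)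
    then have "(sqrt (real (card F)))\<^sup>2 \<le> (\<Gamma> / \<epsilon>)\<^sup>2"
      by (intro power_mono) auto
    then show ?thesis by simp
  qed simp
  then show ?thesis
    by (simp add: F_def)
qed

text \<open>The binary value with a leading digit 1, that is the breadth-first numbering of the
  tree. It orders the choices so that ancestors come first, and it assigns disjoint chunks of levels
  to the nodes.\<close>

definition code :: "bool list \<Rightarrow> nat" where
  "code I = foldl (\<lambda>a b. 2 * a + of_bool b) 1 I"

lemma code_snoc: "code (I @ [b]) = 2 * code I + of_bool b"
  by (simp add: code_def)

lemma code_bounds: "2 ^ length I \<le> code I \<and> code I < 2 ^ Suc (length I)"
proof (induction I rule: rev_induct)
  case (snoc b I)
  then show ?case by (auto simp: code_snoc of_bool_def)
qed (simp add: code_def)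

lemma code_less: "length I < length I' \<Longrightarrow> code I < code I'"
  using code_bounds[of I] code_bounds[of I'] power_increasing[of "Suc (length I)" "length I'" "2::nat"]
  by simp

lemma code_inj_length: "length I = length I' \<Longrightarrow> code I = code I' \<Longrightarrow> I = I'"
proof (induction I arbitrary: I' rule: rev_induct)
  case (snoc b I)
  then obtain J c where I': "I' = J @ [c]"
    by (metis length_0_conv rev_exhaust snoc_eq_iff_butlast)
  have "2 * code I + of_bool b = 2 * code J + of_bool c"
    using snoc.prems by (simp add: I' code_snoc)
  then have "code I = code J \<and> b = c"
    by (cases b; cases c) (simp_all, presburger+)
  then show ?case
    using snoc.IH[of J] snoc.prems by (simp add: I')
qed simp

lemma code_inj: "code I = code I' \<Longrightarrow> I = I'"
  using code_less[of I I'] code_less[of I' I] code_inj_length[of I I']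
  by (metis less_irrefl linorder_neqE_nat)

definition small_blocks where
  "small_blocks m \<epsilon> \<BB> \<Psi> J \<longleftrightarrow>
     (\<forall>\<beta>\<in>\<BB>. \<forall>I\<in>J. \<forall>I'\<in>J. I \<noteq> I' \<longrightarrow> \<bar>\<beta> (ind (digit_blocks m I)) (ind (digit_blocks m I'))\<bar> \<le> (\<epsilon>::real)) \<and>
     (\<forall>\<psi>\<in>\<Psi>. \<forall>I\<in>J. \<bar>\<psi> (ind (digit_blocks m I))\<bar> \<le> \<epsilon>)"

text \<open>The level for node \<open>I\<close> is sought in a chunk of \<open>P\<close> levels
  reserved for it, so that levels increase along branches whatever is chosen. Nodes are handled in
  the order of \<open>code\<close>. At each step there are at most \<open>T\<close> functionals to
  be made small, each ruling out at most (\<Gamma> / \<epsilon>)^2 levels by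
  \<open>few_large\<close>; P > T (\<Gamma> / \<epsilon>)^2 leaves one. The threshold depends only
  on the number and bounds of the forms, not on the forms or on \<open>N\<close>.\<close>

lemma diagonalise:
  fixes \<Gamma> \<epsilon> :: real
  assumes "0 < \<epsilon>" "0 \<le> \<Gamma>"
  obtains N0 where "\<And>N \<BB> \<Psi>. N0 \<le> N \<Longrightarrow> finite \<BB> \<Longrightarrow> card \<BB> \<le> Q \<Longrightarrow> finite \<Psi> \<Longrightarrow> card \<Psi> \<le> Q \<Longrightarrow>
    (\<And>\<beta>. \<beta> \<in> \<BB> \<Longrightarrow> bilin \<beta> \<and> form_bd N \<Gamma> \<beta>) \<Longrightarrow> (\<And>\<psi>. \<psi> \<in> \<Psi> \<Longrightarrow> linear \<psi> \<and> func_bd N \<Gamma> \<psi>) \<Longrightarrow>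
    \<exists>m. (\<forall>I\<in>idx n. \<forall>j<length I. m (take j I) < m I) \<and> (\<forall>I\<in>idx n. m I < N0) \<and> small_blocks m \<epsilon> \<BB> \<Psi> (idx n)"
proof -
  let ?M = "2 ^ Suc n :: nat"
  define T where "T = Q * card (idx n) + Q * card (idx n) + Q"
  obtain P where P: "real T * (\<Gamma> / \<epsilon>)\<^sup>2 < real P"
    using reals_Archimedean2 by blast
  have P0: "0 < P"
  proof (rule ccontr)
    assume "\<not> 0 < P"
    then have "real T * (\<Gamma> / \<epsilon>)\<^sup>2 < 0" using P by simp
    moreover have "0 \<le> real T * (\<Gamma> / \<epsilon>)\<^sup>2" by simp
    ultimately show False by linarith
  qed
  have "\<exists>m. (\<forall>I\<in>idx n. \<forall>j<length I. m (take j I) < m I) \<and> (\<forall>I\<in>idx n. m I < ?M * P) \<and> small_blocks m \<epsilon> \<BB> \<Psi> (idx n)"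
    if "finite \<BB>" "card \<BB> \<le> Q" "finite \<Psi>" "card \<Psi> \<le> Q"
      and \<BB>: "\<And>\<beta>. \<beta> \<in> \<BB> \<Longrightarrow> bilin \<beta> \<and> form_bd N \<Gamma> \<beta>" and \<Psi>: "\<And>\<psi>. \<psi> \<in> \<Psi> \<Longrightarrow> linear \<psi> \<and> func_bd N \<Gamma> \<psi>" for N \<BB> \<Psi>
  proof -
    let ?J = "\<lambda>c. {I \<in> idx n. code I < c}"
    \<comment> \<open>Induction on the number of codes treated. Nodes not yet treated hold some
      level in their chunk, initially its first one.\<close>
    have "\<exists>m. (\<forall>I. code I * P \<le> m I \<and> m I < Suc (code I) * P) \<and> small_blocks m \<epsilon> \<BB> \<Psi> (?J c)" for c
    proof (induction c)
      case 0
      have "(\<forall>I. code I * P \<le> code I * P \<and> code I * P < Suc (code I) * P) \<and> small_blocks (\<lambda>I. code I * P) \<epsilon> \<BB> \<Psi> (?J 0)"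
        using P0 by (simp add: small_blocks_def)
      then show ?case by (rule exI[of _ "\<lambda>I. code I * P"])
    next
      case (Suc c)
      then obtain m where m: "\<And>I. code I * P \<le> m I \<and> m I < Suc (code I) * P" and sm: "small_blocks m \<epsilon> \<BB> \<Psi> (?J c)"
        by blast
      show ?case
      proof (cases "\<exists>I\<in>idx n. code I = c")
        case False
        then have "?J (Suc c) = ?J c"
          by (auto simp: less_Suc_eq)
        then show ?thesis
          using m sm by auto
      next
        case True
        then obtain I where I: "I \<in> idx n" "code I = c" by blast
        have Jc: "?J (Suc c) = insert I (?J c)"
          using I code_inj by (auto simp: less_Suc_eq)
        define b where "b J = ind (digit_blocks m J)" for J
        have b: "flat1 N (Lv N) 1 (b J)" for J
          unfolding b_def by (rule flat1_ind_level[of _ "m J"]) (auto simp: digit_blocks_def)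
        \<comment> \<open>The block that \<open>I\<close> would receive if level \<open>v\<close>
          were chosen. Different \<open>v\<close> put it on different levels, as
          \<open>few_large\<close> requires.\<close>
        define E where "E v = digit_blocks (m(I := v)) I" for v
        \<comment> \<open>The forms are not assumed symmetric, so each earlier block function is
          frozen in either argument.\<close>
        let ?\<Phi> = "(\<lambda>(\<beta>, J) f. \<beta> f (b J)) ` (\<BB> \<times> ?J c) \<union> (\<lambda>(\<beta>, J). \<beta> (b J)) ` (\<BB> \<times> ?J c) \<union> \<Psi>"
        have lin: "linear \<phi>" "func_bd N \<Gamma> \<phi>" if "\<phi> \<in> ?\<Phi>" for \<phi>
          using that \<BB> \<Psi> form_bd_fix[OF _ b] by (auto simp: bilin_def)
        have fJ: "finite (?J c)" "card (?J c) \<le> card (idx n)"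
          by (rule finite_subset[OF _ finite_idx[of n]], blast, rule card_mono[OF finite_idx], blast)
        have fBJ: "finite (\<BB> \<times> ?J c)"
          by (rule finite_cartesian_product[OF that(1) fJ(1)])
        have fin\<Phi>: "finite ?\<Phi>"
          by (intro finite_UnI finite_imageI fBJ that(3))
        have "card ?\<Phi> \<le> T"
        proof -
          have "card (\<BB> \<times> ?J c) \<le> Q * card (idx n)"
            unfolding card_cartesian_product using that(2) fJ(2) by (intro mult_mono) auto
          moreover have "card ((\<lambda>(\<beta>, J) f. \<beta> f (b J)) ` (\<BB> \<times> ?J c)) \<le> card (\<BB> \<times> ?J c)"
            "card ((\<lambda>(\<beta>, J). \<beta> (b J)) ` (\<BB> \<times> ?J c)) \<le> card (\<BB> \<times> ?J c)"
            by (intro card_image_le fBJ)+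
          moreover have "card ?\<Phi> \<le> card ((\<lambda>(\<beta>, J) f. \<beta> f (b J)) ` (\<BB> \<times> ?J c))
              + card ((\<lambda>(\<beta>, J). \<beta> (b J)) ` (\<BB> \<times> ?J c)) + card \<Psi>"
            by (meson add_le_mono1 card_Un_le order_trans)
          ultimately show ?thesis
            using that(4) unfolding T_def by linarith
        qed
        then have "real (card ?\<Phi>) * (\<Gamma> / \<epsilon>)\<^sup>2 < real (card {c * P..<Suc c * P})"
          using P mult_right_mono[of "real (card ?\<Phi>)" "real T" "(\<Gamma> / \<epsilon>)\<^sup>2"] by simp
        moreover have "real (card {v \<in> {c * P..<Suc c * P}. \<epsilon> < \<bar>\<phi> (ind (E v))\<bar>}) \<le> (\<Gamma> / \<epsilon>)\<^sup>2"
          if "\<phi> \<in> ?\<Phi>" for \<phi>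
          by (rule few_large[OF lin[OF that] _ _ assms(1)]) (auto simp: E_def digit_blocks_def)
        ultimately have "\<exists>v\<in>{c * P..<Suc c * P}. \<forall>\<phi>\<in>?\<Phi>. \<not> \<epsilon> < \<bar>\<phi> (ind (E v))\<bar>"
          by (intro avoid_bad[OF finite_atLeastLessThan fin\<Phi>])
        then obtain v where v: "v \<in> {c * P..<Suc c * P}" and small: "\<And>\<phi>. \<phi> \<in> ?\<Phi> \<Longrightarrow> \<bar>\<phi> (ind (E v))\<bar> \<le> \<epsilon>"
          by (meson not_less)
        let ?m = "m(I := v)"
        \<comment> \<open>Changing the level of \<open>I\<close> alters only the blocks of
          \<open>I\<close> and its descendants, and these have larger codes than the nodes treated
          so far.\<close>
        have same: "ind (digit_blocks ?m J) = b J" if "J \<in> ?J c" for J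
        proof -
          have "J \<noteq> I" "take j J \<noteq> I" if "j < length J" for j
            using \<open>J \<in> ?J c\<close> I(2) code_less[of "take j J" J] that by auto
          moreover have "J \<noteq> I" using \<open>J \<in> ?J c\<close> I(2) by auto
          ultimately show ?thesis
            by (simp add: b_def digit_blocks_def)
        qed
        have new: "\<bar>\<beta> (ind (digit_blocks ?m I)) (b J)\<bar> \<le> \<epsilon>" "\<bar>\<beta> (b J) (ind (digit_blocks ?m I))\<bar> \<le> \<epsilon>"
          if "\<beta> \<in> \<BB>" "J \<in> ?J c" for \<beta> J
        proof -
          have "(\<lambda>f. \<beta> f (b J)) \<in> ?\<Phi>" "\<beta> (b J) \<in> ?\<Phi>"
            using that by force+
          then show "\<bar>\<beta> (ind (digit_blocks ?m I)) (b J)\<bar> \<le> \<epsilon>" "\<bar>\<beta> (b J) (ind (digit_blocks ?m I))\<bar> \<le> \<epsilon>"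
            using small unfolding E_def by blast+
        qed
        have new\<Psi>: "\<bar>\<psi> (ind (digit_blocks ?m I))\<bar> \<le> \<epsilon>" if "\<psi> \<in> \<Psi>" for \<psi>
          using small that unfolding E_def by blast
        have old: "\<bar>\<beta> (b J) (b J')\<bar> \<le> \<epsilon>" if "\<beta> \<in> \<BB>" "J \<in> ?J c" "J' \<in> ?J c" "J \<noteq> J'" for \<beta> J J'
          using sm that unfolding small_blocks_def b_def by blast
        have old\<Psi>: "\<bar>\<psi> (b J)\<bar> \<le> \<epsilon>" if "\<psi> \<in> \<Psi>" "J \<in> ?J c" for \<psi> J
          using conjunct2[OF sm[unfolded small_blocks_def], rule_format, OF that] by (simp add: b_def)
        have "small_blocks ?m \<epsilon> \<BB> \<Psi> (?J (Suc c))"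
          unfolding Jc small_blocks_def
        proof (intro conjI ballI impI)
          fix \<beta> J J' assume "\<beta> \<in> \<BB>" "J \<in> insert I (?J c)" "J' \<in> insert I (?J c)" "J \<noteq> J'"
          then consider "J = I" "J' \<in> ?J c" | "J' = I" "J \<in> ?J c" | "J \<in> ?J c" "J' \<in> ?J c"
            by blast
          then show "\<bar>\<beta> (ind (digit_blocks ?m J)) (ind (digit_blocks ?m J'))\<bar> \<le> \<epsilon>"
            by cases (use new old same \<open>\<beta> \<in> \<BB>\<close> \<open>J \<noteq> J'\<close> in simp_all)
        next
          fix \<psi> J assume "\<psi> \<in> \<Psi>" "J \<in> insert I (?J c)"
          then show "\<bar>\<psi> (ind (digit_blocks ?m J))\<bar> \<le> \<epsilon>"
            using new\<Psi> old\<Psi> same by (cases "J = I") simp_all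
        qed
        moreover have "code J * P \<le> ?m J \<and> ?m J < Suc (code J) * P" for J
          using m v I(2) by simp
        ultimately show ?thesis by (intro exI[of _ ?m]) blast
      qed
    qed
    from this[of ?M] obtain m where m: "\<And>I. code I * P \<le> m I \<and> m I < Suc (code I) * P"
      and sm: "small_blocks m \<epsilon> \<BB> \<Psi> (?J ?M)"
      by blast
    have code: "code I < ?M" if "I \<in> idx n" for I
    proof -
      have "(2::nat) ^ length I \<le> 2 ^ n"
        using that by (intro power_increasing) simp_all
      then show ?thesis
        using conjunct2[OF code_bounds[of I]] unfolding power_Suc by linarith
    qed
    have chunk: "m I < k * P" if "code I < k" for I k
      using m[of I] mult_le_mono1[of "Suc (code I)" k P] that by linarith
    show ?thesis
    proof (intro exI[of _ m] conjI ballI allI impI)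
      fix I j assume "I \<in> idx n" "j < length I"
      then have "code (take j I) < code I"
        by (intro code_less) simp
      then show "m (take j I) < m I"
        using chunk[of "take j I" "code I"] m[of I] by linarith
    next
      fix I assume "I \<in> idx n"
      then show "m I < ?M * P"
        by (intro chunk code)
    next
      have "?J ?M = idx n"
        using code by auto
      then show "small_blocks m \<epsilon> \<BB> \<Psi> (idx n)"
        using sm by simp
    qed
  qed
  then show thesis
    by (intro that[of "?M * P"]) blast
qed

section \<open>Means over cylinders and Rademacher coefficients\<close>

definition rad :: "nat \<Rightarrow> bool list \<Rightarrow> real" where
  "rad p K = (if K ! p then 1 else - 1)"

definition av :: "('a \<Rightarrow> real) \<Rightarrow> 'a set \<Rightarrow> real" where
  "av d U = (\<Sum>K\<in>U. d K) / real (card U)"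

definition fixd :: "nat \<Rightarrow> nat set \<Rightarrow> (nat \<Rightarrow> bool) \<Rightarrow> bool list set" where
  "fixd M D f = {K \<in> Lv M. \<forall>d\<in>D. K ! d = f d}"

lemma finite_fixd [simp]: "finite (fixd M D f)"
  unfolding fixd_def by (rule finite_Lv_filter)

lemma card_fixd:
  assumes "finite D" "D \<subseteq> {..<M}"
  shows "card (fixd M D f) * 2 ^ card D = 2 ^ M"
  unfolding fixd_def by (rule card_fixed_digits[OF assms])

lemma card_fixd_pos:
  assumes "finite D" "D \<subseteq> {..<M}"
  shows "0 < card (fixd M D f)"
  using card_fixd[OF assms, of f] by (metis gr0I mult_is_0 power_not_zero zero_neq_numeral)

lemma fixd_insert: "p \<notin> D \<Longrightarrow> {K \<in> fixd M D f. K ! p = b} = fixd M (insert p D) (f(p := b))"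
  by (auto simp: fixd_def)

text \<open>The indicator of one value of digit \<open>p\<close> is (1 + rad p) / 2 or (1 - rad p) /
  2, and both halves have the same size. Fixing one more digit thus changes a mean by a Rademacher
  coefficient.\<close>

lemma av_half:
  assumes D: "finite D" "D \<subseteq> {..<M}" and p: "p < M" "p \<notin> D"
  shows "av d {K \<in> fixd M D f. K ! p = b} = av d (fixd M D f) + (if b then 1 else - 1) * av (\<lambda>K. d K * rad p K) (fixd M D f)"
proof -
  let ?U = "fixd M D f"
  let ?V = "{K \<in> ?U. K ! p = b}"
  let ?s = "if b then 1 else - 1 :: real"
  have "card ?V * 2 ^ card (insert p D) = 2 ^ M"
    unfolding fixd_insert[OF p(2)] using D p by (intro card_fixd) auto
  then have "card ?V * 2 * 2 ^ card D = card ?U * 2 ^ card D"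
    using card_fixd[OF D, of f] D p by simp
  then have c: "real (card ?V) = real (card ?U) / 2"
    by simp
  have "(\<Sum>K\<in>?V. d K) = (\<Sum>K\<in>?U. if K ! p = b then d K else 0)"
    by (rule sum.inter_filter) simp
  also have "\<dots> = (\<Sum>K\<in>?U. (d K + ?s * (d K * rad p K)) / 2)"
    by (intro sum.cong) (auto simp: rad_def)
  also have "\<dots> = ((\<Sum>K\<in>?U. d K) + ?s * (\<Sum>K\<in>?U. d K * rad p K)) / 2"
    by (simp only: sum_divide_distrib[symmetric] sum.distrib sum_distrib_left)
  finally show ?thesis
    unfolding av_def c by (simp add: add_divide_distrib)
qed

text \<open>Flipping digit \<open>p\<close> maps the cylinder onto itself and reverses the sign of
  the product.\<close>

lemma rad_orthogonal:
  assumes "p \<noteq> p'" "p < M" "p \<notin> D"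
  shows "(\<Sum>K\<in>fixd M D f. rad p K * rad p' K) = 0"
proof -
  let ?U = "fixd M D f"
  have "(\<Sum>K\<in>?U. rad p K * rad p' K) = (\<Sum>K\<in>?U. - (rad p K * rad p' K))"
    using assms
    by (intro sum.reindex_bij_witness[where i = "\<lambda>K. K[p := \<not> K ! p]" and j = "\<lambda>K. K[p := \<not> K ! p]"])
      (auto simp: fixd_def rad_def nth_list_update)
  then show ?thesis
    by (simp add: sum_negf)
qed

text \<open>Bessel's inequality: on the cylinder the functions \<open>rad p\<close> with
  \<open>p\<close> outside \<open>D\<close> are orthonormal for the uniform measure, and
  \<open>d\<close> has mean square at most \<Gamma>^2. The proof tests \<open>d\<close> against the
  signed sum of the offending \<open>rad p\<close>.\<close>

lemma bessel_digits:
  fixes \<Gamma> \<epsilon> :: real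
  assumes D: "finite D" "D \<subseteq> {..<M}" and Z: "finite Z" "Z \<subseteq> {..<M}" "Z \<inter> D = {}"
    and d: "\<And>K. K \<in> Lv M \<Longrightarrow> \<bar>d K\<bar> \<le> \<Gamma>" and \<epsilon>: "0 < \<epsilon>"
  shows "real (card {p \<in> Z. \<epsilon> < \<bar>av (\<lambda>K. d K * rad p K) (fixd M D f)\<bar>}) \<le> (\<Gamma> / \<epsilon>)\<^sup>2"
proof -
  let ?U = "fixd M D f"
  let ?c = "real (card ?U)"
  define F where "F = {p \<in> Z. \<epsilon> < \<bar>av (\<lambda>K. d K * rad p K) ?U\<bar>}"
  have F: "finite F" "F \<subseteq> {..<M}" "F \<inter> D = {}"
    using Z by (auto simp: F_def)
  have c: "0 < ?c" using card_fixd_pos[OF D] by simp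
  define s where "s p = sgn (\<Sum>K\<in>?U. d K * rad p K)" for p
  define g where "g K = (\<Sum>p\<in>F. s p * rad p K)" for K
  have "\<epsilon> * ?c \<le> \<bar>\<Sum>K\<in>?U. d K * rad p K\<bar>" if "p \<in> F" for p
    using that c by (simp add: F_def av_def pos_less_divide_eq)
  then have "real (card F) * (\<epsilon> * ?c) \<le> (\<Sum>p\<in>F. \<bar>\<Sum>K\<in>?U. d K * rad p K\<bar>)"
    by (rule sum_bounded_below)
  also have "\<dots> = (\<Sum>p\<in>F. \<Sum>K\<in>?U. d K * (s p * rad p K))"
  proof (rule sum.cong [OF refl])
    fix p
    have "\<bar>\<Sum>K\<in>?U. d K * rad p K\<bar> = s p * (\<Sum>K\<in>?U. d K * rad p K)"
      by (simp add: s_def sgn_real_def)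
    then show "\<bar>\<Sum>K\<in>?U. d K * rad p K\<bar> = (\<Sum>K\<in>?U. d K * (s p * rad p K))"
      by (simp add: sum_distrib_left mult_ac)
  qed
  also have "\<dots> = (\<Sum>K\<in>?U. d K * g K)"
    by (subst sum.swap) (simp add: g_def sum_distrib_left)
  finally have le: "real (card F) * (\<epsilon> * ?c) \<le> (\<Sum>K\<in>?U. d K * g K)" .
  have "(\<Sum>K\<in>?U. (g K)\<^sup>2) = (\<Sum>K\<in>?U. \<Sum>p\<in>F. \<Sum>p'\<in>F. s p * s p' * (rad p K * rad p' K))"
    by (simp add: g_def power2_eq_square sum_product mult_ac)
  also have "\<dots> = (\<Sum>p\<in>F. \<Sum>p'\<in>F. s p * s p' * (\<Sum>K\<in>?U. rad p K * rad p' K))"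
    by (subst sum.swap, intro sum.cong refl, subst sum.swap) (simp add: sum_distrib_left)
  also have "\<dots> = (\<Sum>p\<in>F. \<Sum>p'\<in>F. if p' = p then (s p)\<^sup>2 * ?c else 0)"
  proof (intro sum.cong refl)
    fix p p' assume "p \<in> F" "p' \<in> F"
    have "rad p K * rad p K = 1" for K
      by (simp add: rad_def)
    then have "(\<Sum>K\<in>?U. rad p K * rad p K) = ?c"
      by simp
    moreover have "(\<Sum>K\<in>?U. rad p K * rad p' K) = 0" if "p' \<noteq> p"
      using that F \<open>p \<in> F\<close> by (intro rad_orthogonal) auto
    ultimately show "s p * s p' * (\<Sum>K\<in>?U. rad p K * rad p' K) = (if p' = p then (s p)\<^sup>2 * ?c else 0)"
      by (simp add: power2_eq_square)
  qed
  also have "\<dots> = (\<Sum>p\<in>F. (s p)\<^sup>2 * ?c)"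
    using F(1) by simp
  also have "\<dots> \<le> (\<Sum>p\<in>F. 1 * ?c)"
    by (intro sum_mono mult_right_mono) (auto simp: s_def sgn_real_def)
  finally have g2: "(\<Sum>K\<in>?U. (g K)\<^sup>2) \<le> real (card F) * ?c"
    by simp
  have "(\<Sum>K\<in>?U. (d K)\<^sup>2) \<le> real (card ?U) * \<Gamma>\<^sup>2"
  proof (rule sum_bounded_above)
    fix K assume "K \<in> ?U"
    then have "\<bar>d K\<bar> \<le> \<Gamma>" by (intro d) (simp add: fixd_def)
    then show "(d K)\<^sup>2 \<le> \<Gamma>\<^sup>2"
      by (metis abs_ge_zero power2_abs power_mono)
  qed
  then have "(\<Sum>K\<in>?U. d K * g K)\<^sup>2 \<le> (?c * \<Gamma>\<^sup>2) * (real (card F) * ?c)"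
    using Cauchy_Schwarz_ineq_sum[of d g ?U] g2
    by (meson mult_mono order_trans sum_nonneg zero_le_power2 mult_nonneg_nonneg of_nat_0_le_iff)
  moreover have "(real (card F) * (\<epsilon> * ?c))\<^sup>2 \<le> (\<Sum>K\<in>?U. d K * g K)\<^sup>2"
    using le \<epsilon> by (intro power_mono) auto
  ultimately have "(real (card F) * (\<epsilon> * ?c))\<^sup>2 \<le> (?c * \<Gamma>\<^sup>2) * (real (card F) * ?c)"
    by linarith
  then have "(real (card F) * \<epsilon>\<^sup>2) * (real (card F) * ?c\<^sup>2) \<le> \<Gamma>\<^sup>2 * (real (card F) * ?c\<^sup>2)"
    by (simp add: power2_eq_square mult_ac)
  note le2 = this
  have "card F = 0 \<or> real (card F) * \<epsilon>\<^sup>2 \<le> \<Gamma>\<^sup>2"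
  proof (cases "card F = 0")
    case False
    then have "0 < real (card F) * ?c\<^sup>2"
      using c by (intro mult_pos_pos zero_less_power) simp_all
    then show ?thesis
      using mult_right_le_imp_le[OF le2] by blast
  qed simp
  then have "real (card F) \<le> (\<Gamma> / \<epsilon>)\<^sup>2"
    using \<epsilon> by (auto simp: power_divide pos_le_divide_eq)
  then show ?thesis
    by (simp add: F_def)
qed

text \<open>The means of \<open>d\<close> over whole levels are made equal by the pigeonhole principle.\<close>

lemma levels_with_equal_means:
  fixes \<Gamma> \<delta> :: real and P Q :: nat
  assumes "0 < \<delta>" "0 \<le> \<Gamma>"
  obtains N0 where "\<And>\<DD>. finite \<DD> \<Longrightarrow> card \<DD> \<le> Q \<Longrightarrow> (\<And>d K. d \<in> \<DD> \<Longrightarrow> length K < N0 \<Longrightarrow> \<bar>d K\<bar> \<le> \<Gamma>) \<Longrightarrow>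
    \<exists>e. strict_mono_on {..<P} e \<and> e ` {..<P} \<subseteq> {..<N0} \<and>
      (\<forall>d\<in>\<DD>. \<forall>i<P. \<forall>j<P. \<bar>av d (Lv (e i)) - av d (Lv (e j))\<bar> \<le> \<delta>)"
proof -
  define c where "c = \<lceil>\<Gamma> / \<delta>\<rceil> + 1"
  have c0: "0 \<le> c"
    using ceiling_mono[of 0 "\<Gamma> / \<delta>"] assms by (simp add: c_def)
  define C where "C = nat (2 * c + 1)"
  have C1: "1 \<le> C" using c0 by (simp add: C_def)
  have "\<exists>e. strict_mono_on {..<P} e \<and> e ` {..<P} \<subseteq> {..<P * C ^ Q} \<and>
      (\<forall>d\<in>\<DD>. \<forall>i<P. \<forall>j<P. \<bar>av d (Lv (e i)) - av d (Lv (e j))\<bar> \<le> \<delta>)"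
    if \<DD>: "finite \<DD>" "card \<DD> \<le> Q" and d: "\<And>d K. d \<in> \<DD> \<Longrightarrow> length K < P * C ^ Q \<Longrightarrow> \<bar>d K\<bar> \<le> \<Gamma>" for \<DD>
  proof -
    let ?N = "P * C ^ Q"
    \<comment> \<open>The colour of a level is the vector of all its means, rounded down to
      multiples of \<delta>. Levels of one colour have means within \<delta>; there are at most C^Q
      colours, so P * C^Q levels contain \<open>P\<close> of the same colour.\<close>
    define col where "col M = (\<lambda>d\<in>\<DD>. \<lfloor>av d (Lv M) / \<delta>\<rfloor>)" for M
    let ?B = "\<Pi>\<^sub>E d\<in>\<DD>. {- c..c}"
    have avb: "\<bar>av d (Lv M)\<bar> \<le> \<Gamma>" if "d \<in> \<DD>" "M < ?N" for d M
    proof -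
      have "\<bar>\<Sum>K\<in>Lv M. d K\<bar> \<le> (\<Sum>K\<in>Lv M. \<bar>d K\<bar>)"
        by (rule sum_abs)
      also have "\<dots> \<le> real (card (Lv M)) * \<Gamma>"
        using d that by (intro sum_bounded_above) auto
      finally show ?thesis
        by (simp add: av_def divide_le_eq mult.commute)
    qed
    have "col \<in> {..<?N} \<rightarrow> ?B"
    proof
      fix M assume M: "M \<in> {..<?N}"
      show "col M \<in> ?B"
        unfolding col_def
      proof (rule restrict_PiE_iff[THEN iffD2], intro ballI)
        fix d assume "d \<in> \<DD>"
        define x where "x = av d (Lv M) / \<delta>"
        have "\<bar>x\<bar> \<le> \<Gamma> / \<delta>"
          using avb[OF \<open>d \<in> \<DD>\<close>] M assms(1) by (simp add: x_def abs_divide divide_right_mono)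
        also have "\<dots> \<le> real_of_int c - 1"
          by (simp add: c_def)
        finally have "real_of_int (- c) \<le> x" "x < real_of_int c + 1"
          by auto
        then have "- c \<le> \<lfloor>x\<rfloor> \<and> \<lfloor>x\<rfloor> \<le> c"
          by (simp only: le_floor_iff floor_le_iff)
        then show "\<lfloor>av d (Lv M) / \<delta>\<rfloor> \<in> {- c..c}"
          by (simp add: x_def)
      qed
    qed
    moreover have "finite ?B" "?B \<noteq> {}"
      using \<DD> c0 by (auto intro!: finite_PiE simp: PiE_eq_empty_iff)
    ultimately obtain y where y: "card (col -` {y} \<inter> {..<?N}) * card ?B \<ge> card {..<?N}"
      using pigeonhole_card[of col "{..<?N}" ?B] by blast
    let ?Z = "col -` {y} \<inter> {..<?N}"
    have "card ?B = C ^ card \<DD>"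
      using \<DD> by (simp add: card_PiE C_def)
    also have "\<dots> \<le> C ^ Q"
      using \<DD> C1 by (intro power_increasing) auto
    finally have cB: "card ?B \<le> C ^ Q" .
    have "?N \<le> card ?Z * card ?B"
      using y by (simp only: card_lessThan)
    also have "\<dots> \<le> card ?Z * C ^ Q"
      using cB by (rule mult_le_mono2)
    finally have "?N \<le> card ?Z * C ^ Q" .
    then have PZ: "P \<le> card ?Z"
      by (rule mult_right_le_imp_le) (use C1 in simp)
    obtain h where h: "bij_betw h {..<card ?Z} ?Z" "strict_mono_on {..<card ?Z} h"
      using ex_bij_betw_strict_mono_card[of ?Z] by auto
    have hZ: "h i \<in> ?Z" if "i < P" for i
      using h(1) that PZ unfolding bij_betw_def by auto
    show ?thesis
    proof (intro exI conjI ballI allI impI)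
      show "strict_mono_on {..<P} h"
        using h(2) PZ by (auto simp: strict_mono_on_def)
      show "h ` {..<P} \<subseteq> {..<?N}"
        using hZ by auto
      fix d i j assume d: "d \<in> \<DD>" "i < P" "j < P"
      have "col (h i) d = col (h j) d"
        using hZ[OF d(2)] hZ[OF d(3)] by simp
      then have "\<lfloor>av d (Lv (h i)) / \<delta>\<rfloor> = \<lfloor>av d (Lv (h j)) / \<delta>\<rfloor>"
        using d(1) by (simp add: col_def)
      then have "\<bar>av d (Lv (h i)) / \<delta> - av d (Lv (h j)) / \<delta>\<bar> \<le> 1"
        by linarith
      then have "\<bar>(av d (Lv (h i)) - av d (Lv (h j))) / \<delta>\<bar> \<le> 1"
        by (simp add: diff_divide_distrib)
      then show "\<bar>av d (Lv (h i)) - av d (Lv (h j))\<bar> \<le> \<delta>"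
        using assms(1) by (simp add: abs_divide)
    qed
  qed
  then show thesis
    by (intro that[of "P * C ^ Q"]) blast
qed

text \<open>With one level for all nodes of the same length, the weighted sum over a block is the
  mean of \<open>d\<close> over a cylinder in level \<open>\<mu> (length I)\<close>. It differs from
  the mean over the whole level by one Rademacher coefficient for each fixed digit, and the digits
  can be placed where these coefficients are small. Means of whole levels agree by
  \<open>levels_with_equal_means\<close>.\<close>

lemma equalise:
  fixes \<Gamma> \<epsilon> :: real
  assumes "0 < \<epsilon>" "0 \<le> \<Gamma>"
  obtains N0 where "\<And>\<DD>. finite \<DD> \<Longrightarrow> card \<DD> \<le> Q \<Longrightarrow> (\<And>d K. d \<in> \<DD> \<Longrightarrow> length K < N0 \<Longrightarrow> \<bar>d K\<bar> \<le> \<Gamma>) \<Longrightarrow>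
    \<exists>\<mu> l. (\<forall>j\<le>n. \<forall>i<j. \<mu> i < \<mu> j) \<and> (\<forall>i\<le>n. \<mu> i < N0) \<and>
      (\<forall>d\<in>\<DD>. \<forall>I\<in>idx n. \<bar>2 ^ length I * (\<Sum>K\<in>digit_blocks (\<lambda>I. \<mu> (length I)) I. d K / 2 ^ length K) - l d\<bar> \<le> \<epsilon>)"
proof -
  \<comment> \<open>At most \<open>n\<close> digits are fixed, so the cylinders cost less than
    \<epsilon> / 2; the other half is for comparing levels.\<close>
  define \<epsilon>' where "\<epsilon>' = \<epsilon> / (2 * (real n + 1))"
  have \<epsilon>': "0 < \<epsilon>'" using assms by (simp add: \<epsilon>'_def)
  obtain P where P: "real (Q * card (idx n)) * (\<Gamma> / \<epsilon>')\<^sup>2 < real P"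
    using reals_Archimedean2 by blast
  have P0: "0 < P"
  proof (rule ccontr)
    assume "\<not> 0 < P"
    then have "real (Q * card (idx n)) * (\<Gamma> / \<epsilon>')\<^sup>2 < 0" using P by simp
    moreover have "0 \<le> real (Q * card (idx n)) * (\<Gamma> / \<epsilon>')\<^sup>2" by simp
    ultimately show False by linarith
  qed
  have e2: "0 < \<epsilon> / 2" using assms by simp
  obtain N0 where N0: "\<And>\<DD>. finite \<DD> \<Longrightarrow> card \<DD> \<le> Q \<Longrightarrow> (\<And>d K. d \<in> \<DD> \<Longrightarrow> length K < N0 \<Longrightarrow> \<bar>d K\<bar> \<le> \<Gamma>) \<Longrightarrow>
    \<exists>e. strict_mono_on {..<Suc n * P} e \<and> e ` {..<Suc n * P} \<subseteq> {..<N0} \<and>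
      (\<forall>d\<in>\<DD>. \<forall>i<Suc n * P. \<forall>j<Suc n * P. \<bar>av d (Lv (e i)) - av d (Lv (e j))\<bar> \<le> \<epsilon> / 2)"
    using levels_with_equal_means[OF e2 assms(2), of Q "Suc n * P"] by blast
  have "\<exists>\<mu> l. (\<forall>j\<le>n. \<forall>i<j. \<mu> i < \<mu> j) \<and> (\<forall>i\<le>n. \<mu> i < N0) \<and>
      (\<forall>d\<in>\<DD>. \<forall>I\<in>idx n. \<bar>2 ^ length I * (\<Sum>K\<in>digit_blocks (\<lambda>I. \<mu> (length I)) I. d K / 2 ^ length K) - l d\<bar> \<le> \<epsilon>)"
    if \<DD>: "finite \<DD>" "card \<DD> \<le> Q" and d: "\<And>d K. d \<in> \<DD> \<Longrightarrow> length K < N0 \<Longrightarrow> \<bar>d K\<bar> \<le> \<Gamma>" for \<DD>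
  proof -
    have "\<exists>e. strict_mono_on {..<Suc n * P} e \<and> e ` {..<Suc n * P} \<subseteq> {..<N0} \<and>
      (\<forall>d\<in>\<DD>. \<forall>i<Suc n * P. \<forall>j<Suc n * P. \<bar>av d (Lv (e i)) - av d (Lv (e j))\<bar> \<le> \<epsilon> / 2)"
      by (rule N0[OF \<DD>]) (rule d)
    then obtain e where e: "strict_mono_on {..<Suc n * P} e" "e ` {..<Suc n * P} \<subseteq> {..<N0}"
      and mean': "\<forall>d\<in>\<DD>. \<forall>i<Suc n * P. \<forall>j<Suc n * P. \<bar>av d (Lv (e i)) - av d (Lv (e j))\<bar> \<le> \<epsilon> / 2"
      by (elim exE conjE) (rule that)
    note mean = mean'[rule_format]
    \<comment> \<open>\<open>\<mu> i\<close> is going to be taken from the chunk \<open>Z i\<close>;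
      the chunks are ordered, hence so are the choices.\<close>
    define Z where "Z i = e ` {i * P..<Suc i * P}" for i
    have chunk: "{i * P..<Suc i * P} \<subseteq> {..<Suc n * P}" if "i \<le> n" for i
    proof -
      have "Suc i * P \<le> Suc n * P"
        using that by (intro mult_le_mono1) simp
      then show ?thesis
        by (intro subsetI) (simp only: atLeastLessThan_iff lessThan_iff, linarith)
    qed
    have Zless: "p < p'" if pp: "p \<in> Z i" "p' \<in> Z j" "i < j" "j \<le> n" for p p' i j
    proof -
      obtain a b where ab: "p = e a" "p' = e b" "a \<in> {i * P..<Suc i * P}" "b \<in> {j * P..<Suc j * P}"
        using pp(1,2) unfolding Z_def by blast
      have "Suc i * P \<le> j * P"
        using pp(3) by (intro mult_le_mono1) simp
      then have "a < b"
        using ab(3,4) by (simp only: atLeastLessThan_iff) linarith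
      moreover have "a \<in> {..<Suc n * P}" "b \<in> {..<Suc n * P}"
        using ab(3,4) chunk[of i] chunk[of j] that by auto
      ultimately show ?thesis
        using e(1) ab(1,2) by (simp add: strict_mono_on_def)
    qed
    have ZN: "Z i \<subseteq> {..<N0}" if "i \<le> n" for i
      using e(2) chunk[OF that] by (auto simp: Z_def)
    have cZ: "card (Z i) = P" if "i \<le> n" for i
    proof -
      have "inj_on e {i * P..<Suc i * P}"
        using strict_mono_on_imp_inj_on[OF e(1)] chunk[OF that] by (rule inj_on_subset)
      then show ?thesis
        by (simp add: Z_def card_image)
    qed
    \<comment> \<open>The cylinder in which only the digits with index at least \<open>j\<close>
      have been fixed: all of the level for j = length I, the digit block of \<open>I\<close> for j
      = 0.\<close>
    define U where "U \<mu> I j = {K \<in> Lv (\<mu> (length I)). \<forall>i\<in>{j..<length I}. K ! \<mu> i = I ! i}" for \<mu> :: "nat \<Rightarrow> nat" and I :: "bool list" and j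
    have U_fixd: "\<exists>f. U \<mu> I j = fixd (\<mu> (length I)) (\<mu> ` {j..<length I}) f"
      if \<mu>: "\<And>i. j \<le> i \<Longrightarrow> i \<le> n \<Longrightarrow> \<mu> i \<in> Z i" and I: "I \<in> idx n" for \<mu> I j
    proof -
      have "inj_on \<mu> {j..<length I}"
      proof (rule inj_onI)
        have lt: "\<mu> a < \<mu> b" if "a \<in> {j..<length I}" "b \<in> {j..<length I}" "a < b" for a b
          using Zless[OF \<mu> \<mu> that(3)] that I by simp
        fix a b assume "a \<in> {j..<length I}" "b \<in> {j..<length I}" "\<mu> a = \<mu> b"
        then show "a = b"
          using lt[of a b] lt[of b a] by (metis less_irrefl linorder_neqE_nat)
      qed
      then have "U \<mu> I j = fixd (\<mu> (length I)) (\<mu> ` {j..<length I}) (\<lambda>d. I ! inv_into {j..<length I} \<mu> d)"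
        by (simp add: U_def fixd_def inv_into_f_f)
      then show ?thesis by blast
    qed
    have D_le: "\<mu> ` {j..<length I} \<subseteq> {..<\<mu> (length I)}"
      if \<mu>: "\<And>i. j \<le> i \<Longrightarrow> i \<le> n \<Longrightarrow> \<mu> i \<in> Z i" and I: "I \<in> idx n" for \<mu> I j
    proof
      fix v assume "v \<in> \<mu> ` {j..<length I}"
      then obtain i where i: "v = \<mu> i" "j \<le> i" "i < length I" by auto
      then have "\<mu> i \<in> Z i" "\<mu> (length I) \<in> Z (length I)"
        using I by (auto intro!: \<mu>)
      then show "v \<in> {..<\<mu> (length I)}"
        using Zless[of "\<mu> i" i "\<mu> (length I)" "length I"] i I by simp
    qed
    \<comment> \<open>The choice runs downwards from \<open>n\<close>. A digit
      \<open>\<mu> j\<close> must be good for the means in all levels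
      \<open>\<mu> (length I)\<close> with length I > j, so these levels have to be known when it is
      chosen.\<close>
    have "\<exists>\<mu>. (\<forall>i. j \<le> i \<and> i \<le> n \<longrightarrow> \<mu> i \<in> Z i) \<and>
       (\<forall>d\<in>\<DD>. \<forall>I\<in>idx n. j \<le> length I \<longrightarrow> \<bar>av d (U \<mu> I j) - av d (Lv (\<mu> (length I)))\<bar> \<le> real (length I - j) * \<epsilon>')"
      if "j \<le> Suc n" for j
      using that
    proof (induction j rule: inc_induct)
      case base
      then show ?case by auto
    next
      case (step j)
      then obtain \<mu> where \<mu>: "\<And>i. Suc j \<le> i \<Longrightarrow> i \<le> n \<Longrightarrow> \<mu> i \<in> Z i"
        and \<mu>av: "\<And>d I. d \<in> \<DD> \<Longrightarrow> I \<in> idx n \<Longrightarrow> Suc j \<le> length I \<Longrightarrow>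
          \<bar>av d (U \<mu> I (Suc j)) - av d (Lv (\<mu> (length I)))\<bar> \<le> real (length I - Suc j) * \<epsilon>'"
        by blast
      have jn: "j \<le> n" using step by simp
      let ?T = "\<DD> \<times> {I \<in> idx n. j < length I}"
      have finT: "finite ?T"
        using \<DD> by (intro finite_cartesian_product finite_subset[OF _ finite_idx[of n]]) auto
      have "card ?T \<le> Q * card (idx n)"
        unfolding card_cartesian_product using \<DD> by (intro mult_mono card_mono) auto
      then have "real (card ?T) * (\<Gamma> / \<epsilon>')\<^sup>2 < real (card (Z j))"
      proof -
        assume "card ?T \<le> Q * card (idx n)"
        then have "real (card ?T) * (\<Gamma> / \<epsilon>')\<^sup>2 \<le> real (Q * card (idx n)) * (\<Gamma> / \<epsilon>')\<^sup>2"
          by (intro mult_right_mono) (simp_all only: of_nat_le_iff zero_le_power2)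
        then show ?thesis
          using P cZ[OF jn] by simp
      qed
      moreover have "real (card {p \<in> Z j. case t of (d, I) \<Rightarrow> \<epsilon>' < \<bar>av (\<lambda>K. d K * rad p K) (U \<mu> I (Suc j))\<bar>}) \<le> (\<Gamma> / \<epsilon>')\<^sup>2"
        if tT: "t \<in> ?T" for t
      proof -
        obtain d0 I where t: "t = (d0, I)" "d0 \<in> \<DD>" "I \<in> idx n" "j < length I"
          using tT by auto
        obtain f where f: "U \<mu> I (Suc j) = fixd (\<mu> (length I)) (\<mu> ` {Suc j..<length I}) f"
          using U_fixd[OF \<mu> t(3)] by blast
        have M: "\<mu> (length I) \<in> Z (length I)"
          using t by (intro \<mu>) auto
        have l: "length I \<le> n" using t by simp
        have "real (card {p \<in> Z j. \<epsilon>' < \<bar>av (\<lambda>K. d0 K * rad p K) (fixd (\<mu> (length I)) (\<mu> ` {Suc j..<length I}) f)\<bar>}) \<le> (\<Gamma> / \<epsilon>')\<^sup>2"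
        proof (rule bessel_digits)
          show "\<mu> ` {Suc j..<length I} \<subseteq> {..<\<mu> (length I)}"
            using \<mu> t(3) by (rule D_le)
          show "finite (Z j)" by (simp add: Z_def)
          show "Z j \<subseteq> {..<\<mu> (length I)}"
            using Zless[OF _ M t(4) l] by auto
          show "Z j \<inter> \<mu> ` {Suc j..<length I} = {}"
          proof -
            have "p \<noteq> \<mu> i" if "p \<in> Z j" "Suc j \<le> i" "i < length I" for p i
              using Zless[OF that(1) \<mu>[OF that(2)]] that l by fastforce
            then show ?thesis by force
          qed
          show "\<bar>d0 K\<bar> \<le> \<Gamma>" if "K \<in> Lv (\<mu> (length I))" for K
            using that ZN[OF l] M by (intro d t) auto
        qed (use \<epsilon>' in auto)
        then show ?thesis
          unfolding t(1) split f .
      qed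
      ultimately have "\<exists>p\<in>Z j. \<forall>t\<in>?T. \<not> (case t of (d, I) \<Rightarrow> \<epsilon>' < \<bar>av (\<lambda>K. d K * rad p K) (U \<mu> I (Suc j))\<bar>)"
        by (intro avoid_bad finT) (auto simp: Z_def)
      then obtain p where p: "p \<in> Z j"
        and small: "\<And>d I. d \<in> \<DD> \<Longrightarrow> I \<in> idx n \<Longrightarrow> j < length I \<Longrightarrow> \<bar>av (\<lambda>K. d K * rad p K) (U \<mu> I (Suc j))\<bar> \<le> \<epsilon>'"
        by force
      let ?\<mu> = "\<mu>(j := p)"
      show ?case
      proof (intro exI[of _ ?\<mu>] conjI allI impI ballI)
        fix i assume "j \<le> i \<and> i \<le> n"
        then show "?\<mu> i \<in> Z i"
          using p \<mu>[of i] by (cases "i = j") auto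
      next
        fix d0 I assume d0: "d0 \<in> \<DD>" and I: "I \<in> idx n" and jI: "j \<le> length I"
        show "\<bar>av d0 (U ?\<mu> I j) - av d0 (Lv (?\<mu> (length I)))\<bar> \<le> real (length I - j) * \<epsilon>'"
        proof (cases "j = length I")
          case True
          then have "U ?\<mu> I j = Lv (?\<mu> (length I))"
            by (auto simp: U_def)
          then show ?thesis using \<epsilon>' by simp
        next
          case False
          then have jl: "j < length I" using jI by simp
          obtain f where f: "U \<mu> I (Suc j) = fixd (\<mu> (length I)) (\<mu> ` {Suc j..<length I}) f"
            using U_fixd[OF \<mu> I] by blast
          have M: "\<mu> (length I) \<in> Z (length I)"
            using jl I by (intro \<mu>) auto
          have l: "length I \<le> n" using I by simp
          have pM: "p < \<mu> (length I)"
            using Zless[OF p M jl l] .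
          have pD: "p \<notin> \<mu> ` {Suc j..<length I}"
          proof
            assume "p \<in> \<mu> ` {Suc j..<length I}"
            then obtain i where i: "p = \<mu> i" "Suc j \<le> i" "i < length I" by auto
            then show False
              using Zless[OF p \<mu>[OF i(2)]] i l by simp
          qed
          have "U ?\<mu> I j = {K \<in> U \<mu> I (Suc j). K ! p = I ! j}"
          proof -
            have "{j..<length I} = insert j {Suc j..<length I}"
              using jl by auto
            then show ?thesis
              using jl by (auto simp: U_def)
          qed
          then have "av d0 (U ?\<mu> I j) = av d0 (U \<mu> I (Suc j))
              + (if I ! j then 1 else - 1) * av (\<lambda>K. d0 K * rad p K) (U \<mu> I (Suc j))"
            unfolding f using av_half[OF _ D_le[OF \<mu> I] pM pD] by simp
          then have "\<bar>av d0 (U ?\<mu> I j) - av d0 (U \<mu> I (Suc j))\<bar> \<le> \<epsilon>'"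
            using small[OF d0 I jl] by (auto split: if_splits)
          moreover have "\<bar>av d0 (U \<mu> I (Suc j)) - av d0 (Lv (\<mu> (length I)))\<bar> \<le> real (length I - Suc j) * \<epsilon>'"
            using jl by (intro \<mu>av d0 I) simp
          moreover have "real (length I - j) * \<epsilon>' = real (length I - Suc j) * \<epsilon>' + \<epsilon>'"
            using jl by (simp add: of_nat_diff algebra_simps)
          ultimately show ?thesis
            using jl by simp
        qed
      qed
    qed
    from this[of 0] obtain \<mu> where \<mu>': "\<forall>i. 0 \<le> i \<and> i \<le> n \<longrightarrow> \<mu> i \<in> Z i"
      and \<mu>av': "\<forall>d\<in>\<DD>. \<forall>I\<in>idx n. 0 \<le> length I \<longrightarrow>
        \<bar>av d (U \<mu> I 0) - av d (Lv (\<mu> (length I)))\<bar> \<le> real (length I - 0) * \<epsilon>'"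
      by blast
    have \<mu>: "\<mu> i \<in> Z i" if "i \<le> n" for i
      using \<mu>' that by blast
    have \<mu>av: "\<bar>av d (U \<mu> I 0) - av d (Lv (\<mu> (length I)))\<bar> \<le> real (length I) * \<epsilon>'"
      if "d \<in> \<DD>" "I \<in> idx n" for d I
      using \<mu>av' that by simp
    show ?thesis
    \<comment> \<open>Any of the selected levels may serve as reference for the constant;
      \<open>e 0\<close> is taken.\<close>
    proof (intro exI[of _ \<mu>] exI[of _ "\<lambda>d. av d (Lv (e 0))"] conjI allI impI ballI)
      fix i j assume "j \<le> n" "i < j"
      then show "\<mu> i < \<mu> j"
        using Zless[of "\<mu> i" i "\<mu> j" j] \<mu>[of i] \<mu>[of j] by simp
    next
      fix i assume "i \<le> n"
      then show "\<mu> i < N0"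
        using ZN[of i] \<mu>[of i] by auto
    next
      fix d0 I assume d0: "d0 \<in> \<DD>" and I: "I \<in> idx n"
      let ?l = "length I"
      have l: "?l \<le> n" using I by simp
      have U0: "U \<mu> I 0 = digit_blocks (\<lambda>I. \<mu> (length I)) I"
        by (auto simp: U_def digit_blocks_def)
      obtain f where f: "U \<mu> I 0 = fixd (\<mu> ?l) (\<mu> ` {0..<?l}) f"
        using U_fixd[of 0 \<mu> I] \<mu> I by blast
      have D: "\<mu> ` {0..<?l} \<subseteq> {..<\<mu> ?l}"
        using D_le[of 0 \<mu> I] \<mu> I by blast
      have "inj_on \<mu> {0..<?l}"
      proof (rule inj_onI)
        have lt: "\<mu> a < \<mu> b" if "a \<in> {0..<?l}" "b \<in> {0..<?l}" "a < b" for a b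
          using Zless[OF \<mu> \<mu> that(3)] that l by simp
        fix a b assume "a \<in> {0..<?l}" "b \<in> {0..<?l}" "\<mu> a = \<mu> b"
        then show "a = b"
          using lt[of a b] lt[of b a] by (metis less_irrefl linorder_neqE_nat)
      qed
      then have "card (\<mu> ` {0..<?l}) = ?l"
        by (simp add: card_image)
      then have "card (U \<mu> I 0) * 2 ^ ?l = 2 ^ \<mu> ?l"
        using card_fixd[OF _ D, of f] f by simp
      then have "real (card (U \<mu> I 0)) * 2 ^ ?l = 2 ^ \<mu> ?l"
        by (metis of_nat_mult of_nat_numeral of_nat_power)
      then have c: "real (card (U \<mu> I 0)) = 2 ^ \<mu> ?l / 2 ^ ?l"
        by (simp add: field_simps)
      have "2 ^ ?l * (\<Sum>K\<in>digit_blocks (\<lambda>I. \<mu> (length I)) I. d0 K / 2 ^ length K) = av d0 (U \<mu> I 0)"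
      proof -
        have "(\<Sum>K\<in>digit_blocks (\<lambda>I. \<mu> (length I)) I. d0 K / 2 ^ length K) = (\<Sum>K\<in>U \<mu> I 0. d0 K / 2 ^ \<mu> ?l)"
          unfolding U0 by (intro sum.cong) (auto simp: digit_blocks_def)
        then show ?thesis
          unfolding av_def c by (simp add: sum_divide_distrib[symmetric])
      qed
      moreover have "\<bar>av d0 (U \<mu> I 0) - av d0 (Lv (\<mu> ?l))\<bar> \<le> \<epsilon> / 2"
      proof -
        have "real ?l * \<epsilon>' \<le> (real n + 1) * \<epsilon>'"
          using l \<epsilon>' by (intro mult_right_mono) auto
        also have "\<dots> = \<epsilon> / 2"
          by (simp add: \<epsilon>'_def divide_simps)
        finally show ?thesis
          using \<mu>av[OF d0 I] by linarith
      qed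
      moreover have "\<bar>av d0 (Lv (\<mu> ?l)) - av d0 (Lv (e 0))\<bar> \<le> \<epsilon> / 2"
      proof -
        obtain a where "\<mu> ?l = e a" "a \<in> {?l * P..<Suc ?l * P}"
          using \<mu>[OF l] by (auto simp: Z_def)
        then show ?thesis
          using mean[OF d0, of a 0] chunk[OF l] P0 by auto
      qed
      ultimately show "\<bar>2 ^ ?l * (\<Sum>K\<in>digit_blocks (\<lambda>I. \<mu> (length I)) I. d0 K / 2 ^ length K) - av d0 (Lv (e 0))\<bar> \<le> \<epsilon>"
        by linarith
    qed
  qed
  then show thesis
    by (intro that[of N0]) blast
qed

context block_system
begin

lemma sq1_ind_B:
  assumes I: "I \<in> idx n" and x: "x \<in> Lv N"
  shows "sq1 N (ind (B I)) x = (if take (length I) (\<tau> x) = I then 1 else 0)"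
proof -
  have "sq1 N (ind (B I)) x
      = (\<Sum>i\<le>N. if i = \<kappa> (length I) x then (if take (length I) (\<tau> x) = I then 1 else 0) else 0)"
    unfolding sq1_def by (intro sum.cong refl) (simp add: ind_def B_iff[OF x _ I])
  also have "\<dots> = (if take (length I) (\<tau> x) = I then 1 else 0)"
    using kappa_le[OF x, of "length I"] I by simp
  finally show ?thesis .
qed

lemma flat1_ind_B:
  assumes "I \<in> idx n"
  shows "flat1 N {x \<in> Lv N. take (length I) (\<tau> x) = I} 1 (ind (B I))"
  unfolding flat1_def by (simp add: sq1_ind_B[OF assms])

lemma card_through:
  assumes I: "I \<in> idx n"
  shows "card {x \<in> Lv N. take (length I) (\<tau> x) = I} * 2 ^ length I = 2 ^ N"
proof -
  let ?W = "{\<omega> \<in> Lv n. take (length I) \<omega> = I}"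
  let ?X = "\<lambda>\<omega>. {x \<in> Lv N. \<tau> x = \<omega>}"
  have W: "card ?W * 2 ^ length I = 2 ^ n"
  proof -
    have "take (length I) \<omega> = I \<longleftrightarrow> (\<forall>d\<in>{..<length I}. \<omega> ! d = I ! d)" if "\<omega> \<in> Lv n" for \<omega>
      using that I by (auto simp: list_eq_iff_nth_eq)
    then have "?W = {\<omega> \<in> Lv n. \<forall>d\<in>{..<length I}. \<omega> ! d = I ! d}"
      by blast
    then show ?thesis
      using card_fixed_digits[of "{..<length I}" n "(!) I"] I by simp
  qed
  have eq: "{x \<in> Lv N. take (length I) (\<tau> x) = I} = (\<Union>\<omega>\<in>?W. ?X \<omega>)"
    using tau_mem by auto
  have "card {x \<in> Lv N. take (length I) (\<tau> x) = I} = (\<Sum>\<omega>\<in>?W. card (?X \<omega>))"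
    unfolding eq by (rule card_UN_disjoint, rule finite_Lv_filter, intro ballI, rule finite_Lv_filter, blast)
  then have "card {x \<in> Lv N. take (length I) (\<tau> x) = I} * 2 ^ n = (\<Sum>\<omega>\<in>?W. card (?X \<omega>) * 2 ^ n)"
    by (simp only: sum_distrib_right)
  also have "\<dots> = (\<Sum>\<omega>\<in>?W. 2 ^ N)"
    by (intro sum.cong refl fibre0) simp
  finally have "card {x \<in> Lv N. take (length I) (\<tau> x) = I} * 2 ^ n = card ?W * 2 ^ N"
    by simp
  moreover have "card {x \<in> Lv N. take (length I) (\<tau> x) = I} * 2 ^ length I * 2 ^ n
      = card {x \<in> Lv N. take (length I) (\<tau> x) = I} * 2 ^ n * 2 ^ length I"
    by (simp only: mult_ac)
  ultimately have "card {x \<in> Lv N. take (length I) (\<tau> x) = I} * 2 ^ length I * 2 ^ n = (card ?W * 2 ^ length I) * 2 ^ N"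
    by (simp only: mult_ac)
  then show ?thesis
    unfolding W by (simp add: mult.commute)
qed

lemma card_through_real:
  assumes "I \<in> idx n"
  shows "real (card {x \<in> Lv N. take (length I) (\<tau> x) = I}) / 2 ^ N = 1 / 2 ^ length I"
proof -
  have "real (card {x \<in> Lv N. take (length I) (\<tau> x) = I}) * 2 ^ length I = 2 ^ N"
    using arg_cong[OF card_through[OF assms], of real] by simp
  then show ?thesis
    by (simp add: field_simps)
qed

end

lemma bilin_sum:
  assumes "bilin \<beta>"
  shows "\<beta> (\<Sum>i\<in>A. f i) (\<Sum>j\<in>C. g j) = (\<Sum>i\<in>A. \<Sum>j\<in>C. \<beta> (f i) (g j))"
proof -
  have h1: "\<beta> (\<Sum>i\<in>A. f i) h = (\<Sum>i\<in>A. \<beta> (f i) h)" for h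
    using assms unfolding bilin_def by (intro linear_sum[of "\<lambda>f. \<beta> f h"]) blast
  have h2: "\<beta> h (\<Sum>j\<in>C. g j) = (\<Sum>j\<in>C. \<beta> h (g j))" for h
    using assms unfolding bilin_def by (intro linear_sum[of "\<beta> h"]) blast
  show ?thesis
    unfolding h1 by (intro sum.cong refl h2)
qed

lemma ind_UN_disjoint:
  assumes "finite A" "\<And>i j x. i \<in> A \<Longrightarrow> j \<in> A \<Longrightarrow> x \<in> F i \<Longrightarrow> x \<in> F j \<Longrightarrow> i = j"
  shows "ind (\<Union>i\<in>A. F i) = (\<Sum>i\<in>A. ind (F i))"
proof
  fix x
  show "ind (\<Union>i\<in>A. F i) x = (\<Sum>i\<in>A. ind (F i)) x"
  proof (cases "\<exists>i\<in>A. x \<in> F i")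
    case True
    then obtain i where i: "i \<in> A" "x \<in> F i" by blast
    have "ind (F j) x = (if j = i then 1 else 0)" if "j \<in> A" for j
      using assms(2)[OF that i(1) _ i(2)] i(2) by (cases "x \<in> F j") (auto simp: ind_def)
    then have "(\<Sum>j\<in>A. ind (F j) x) = (\<Sum>j\<in>A. if j = i then 1 else 0)"
      by (intro sum.cong refl)
    then show ?thesis
      using i assms(1) by (auto simp: sum_fun_apply ind_def)
  next
    case False
    then show ?thesis
      by (auto simp: sum_fun_apply ind_def intro!: sum.neutral)
  qed
qed

lemma abs_double_sum_le:
  fixes e :: "'a \<Rightarrow> 'b \<Rightarrow> real"
  assumes "\<And>i j. i \<in> A \<Longrightarrow> j \<in> C \<Longrightarrow> \<bar>e i j\<bar> \<le> \<delta>" "card A \<le> M" "card C \<le> M" "0 \<le> \<delta>"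
  shows "\<bar>\<Sum>i\<in>A. \<Sum>j\<in>C. e i j\<bar> \<le> (real M)\<^sup>2 * \<delta>"
proof -
  have "\<bar>\<Sum>i\<in>A. \<Sum>j\<in>C. e i j\<bar> \<le> (\<Sum>i\<in>A. \<Sum>j\<in>C. \<bar>e i j\<bar>)"
    by (intro order_trans[OF sum_abs] sum_mono order_refl)
  also have "\<dots> \<le> (\<Sum>i\<in>A. \<Sum>j\<in>C. \<delta>)"
    by (intro sum_mono assms(1))
  also have "\<dots> = real (card A) * real (card C) * \<delta>"
    by simp
  also have "\<dots> \<le> real M * real M * \<delta>"
    using assms by (intro mult_right_mono mult_mono) auto
  finally show ?thesis
    by (simp add: power2_eq_square)
qed

text \<open>Two block constructions are composed. The inner blocks, over a tree of depth
  \<open>n'\<close>, make all forms almost diagonal; the outer ones group them so that the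
  normalised diagonal becomes constant. As \<open>n'\<close> is determined before the inner blocks,
  their error can be chosen to survive the summation. Confining the blocks to \<open>idx N0\<close>,
  with \<open>N0\<close> independent of \<open>N\<close>, bounds the number of Haar functions
  involved, which the two-parameter argument relies on.\<close>

lemma one_parameter:
  fixes \<Gamma> \<epsilon> :: real and Q n :: nat
  assumes "0 < \<epsilon>" "0 \<le> \<Gamma>"
  obtains N0 where "\<And>N \<BB> \<Psi>. N0 \<le> N \<Longrightarrow> finite \<BB> \<Longrightarrow> card \<BB> \<le> Q \<Longrightarrow> finite \<Psi> \<Longrightarrow> card \<Psi> \<le> Q \<Longrightarrow>
    (\<And>\<beta>. \<beta> \<in> \<BB> \<Longrightarrow> bilin \<beta> \<and> form_bd N \<Gamma> \<beta>) \<Longrightarrow> (\<And>\<psi>. \<psi> \<in> \<Psi> \<Longrightarrow> linear \<psi> \<and> func_bd N \<Gamma> \<psi>) \<Longrightarrow>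
    \<exists>B \<tau> \<kappa> l. block_system n N B \<tau> \<kappa> \<and> (\<forall>I\<in>idx n. B I \<subseteq> idx N0) \<and>
      (\<forall>\<beta>\<in>\<BB>. \<forall>I\<in>idx n. \<forall>I'\<in>idx n.
        \<bar>\<beta> (ind (B I)) (ind (B I')) - (if I = I' then l \<beta> / 2 ^ length I else 0)\<bar> \<le> \<epsilon>) \<and>
      (\<forall>\<psi>\<in>\<Psi>. \<forall>I\<in>idx n. \<bar>\<psi> (ind (B I))\<bar> \<le> \<epsilon>)"
proof -
  have e2: "0 < \<epsilon> / 2" using assms by simp
  obtain n' where n': "\<And>\<DD>. finite \<DD> \<Longrightarrow> card \<DD> \<le> Q \<Longrightarrow> (\<And>d K. d \<in> \<DD> \<Longrightarrow> length K < n' \<Longrightarrow> \<bar>d K\<bar> \<le> \<Gamma>) \<Longrightarrow>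
    \<exists>\<mu> l. (\<forall>j\<le>n. \<forall>i<j. \<mu> i < \<mu> j) \<and> (\<forall>i\<le>n. \<mu> i < n') \<and>
      (\<forall>d\<in>\<DD>. \<forall>I\<in>idx n. \<bar>2 ^ length I * (\<Sum>K\<in>digit_blocks (\<lambda>I. \<mu> (length I)) I. d K / 2 ^ length K) - l d\<bar> \<le> \<epsilon> / 2)"
    by (rule equalise[OF e2 assms(2), of Q n]) (erule that)
  define M where "M = card (idx n')"
  have M: "0 < M"
  proof -
    have "[] \<in> idx n'" by simp
    then show ?thesis
      unfolding M_def using finite_idx[of n'] card_gt_0_iff by blast
  qed
  \<comment> \<open>A block of blocks consists of at most \<open>M\<close> inner blocks, so a pair
    of them collects at most M^2 errors, together \<epsilon> / 2. The other half is spent on the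
    diagonal.\<close>
  define \<epsilon>1 where "\<epsilon>1 = \<epsilon> / (2 * (real M)\<^sup>2)"
  have \<epsilon>1: "0 < \<epsilon>1" "(real M)\<^sup>2 * \<epsilon>1 = \<epsilon> / 2"
    using assms M by (simp_all add: \<epsilon>1_def)
  have M\<epsilon>1: "real M * \<epsilon>1 \<le> \<epsilon>"
  proof -
    have "real M * \<epsilon>1 \<le> (real M)\<^sup>2 * \<epsilon>1"
      using M \<epsilon>1(1) by (intro mult_right_mono) (auto simp: power2_eq_square)
    then show ?thesis
      using \<epsilon>1(2) assms by linarith
  qed
  obtain N0 where N0: "\<And>N \<BB> \<Psi>. N0 \<le> N \<Longrightarrow> finite \<BB> \<Longrightarrow> card \<BB> \<le> Q \<Longrightarrow> finite \<Psi> \<Longrightarrow> card \<Psi> \<le> Q \<Longrightarrow>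
    (\<And>\<beta>. \<beta> \<in> \<BB> \<Longrightarrow> bilin \<beta> \<and> form_bd N \<Gamma> \<beta>) \<Longrightarrow> (\<And>\<psi>. \<psi> \<in> \<Psi> \<Longrightarrow> linear \<psi> \<and> func_bd N \<Gamma> \<psi>) \<Longrightarrow>
    \<exists>m. (\<forall>I\<in>idx n'. \<forall>j<length I. m (take j I) < m I) \<and> (\<forall>I\<in>idx n'. m I < N0) \<and> small_blocks m \<epsilon>1 \<BB> \<Psi> (idx n')"
    by (rule diagonalise[OF \<epsilon>1(1) assms(2), of Q n']) (erule that)
  have "\<exists>B \<tau> \<kappa> l. block_system n N B \<tau> \<kappa> \<and> (\<forall>I\<in>idx n. B I \<subseteq> idx N0) \<and>
      (\<forall>\<beta>\<in>\<BB>. \<forall>I\<in>idx n. \<forall>I'\<in>idx n.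
        \<bar>\<beta> (ind (B I)) (ind (B I')) - (if I = I' then l \<beta> / 2 ^ length I else 0)\<bar> \<le> \<epsilon>) \<and>
      (\<forall>\<psi>\<in>\<Psi>. \<forall>I\<in>idx n. \<bar>\<psi> (ind (B I))\<bar> \<le> \<epsilon>)"
    if N: "N0 \<le> N" and fin: "finite \<BB>" "card \<BB> \<le> Q" "finite \<Psi>" "card \<Psi> \<le> Q"
      and \<BB>: "\<And>\<beta>. \<beta> \<in> \<BB> \<Longrightarrow> bilin \<beta> \<and> form_bd N \<Gamma> \<beta>"
      and \<Psi>: "\<And>\<psi>. \<psi> \<in> \<Psi> \<Longrightarrow> linear \<psi> \<and> func_bd N \<Gamma> \<psi>" for N \<BB> \<Psi>
  proof -
    have "\<exists>m. (\<forall>I\<in>idx n'. \<forall>j<length I. m (take j I) < m I) \<and> (\<forall>I\<in>idx n'. m I < N0) \<and> small_blocks m \<epsilon>1 \<BB> \<Psi> (idx n')"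
      by (rule N0[OF N fin \<BB> \<Psi>])
    then obtain m where m: "\<forall>I\<in>idx n'. \<forall>j<length I. m (take j I) < m I" "\<forall>I\<in>idx n'. m I < N0"
      and sm: "small_blocks m \<epsilon>1 \<BB> \<Psi> (idx n')"
      by (elim exE conjE) (rule that)
    have sysa: "block_system n' N (digit_blocks m) (\<lambda>x. path m x n') (\<lambda>l x. m (path m x l))"
    proof (rule block_system_digits)
      show "m I < N" if "I \<in> idx n'" for I
        using m(2) that N by (meson less_le_trans)
    qed (use m(1) in blast)
    then interpret a: block_system n' N "digit_blocks m" "\<lambda>x. path m x n'" "\<lambda>l x. m (path m x l)" .
    define b where "b K = ind (digit_blocks m K)" for K
    \<comment> \<open>The diagonal entry divided by the measure of the support of
      \<open>b K\<close>; localisation in \<open>form_bd\<close> bounds it by \<Gamma> for all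
      \<open>K\<close>.\<close>
    define dm where "dm \<beta> K = 2 ^ length K * \<beta> (b K) (b K)" for \<beta> :: "(bool list \<Rightarrow> real) \<Rightarrow> (bool list \<Rightarrow> real) \<Rightarrow> real" and K
    have dm: "\<bar>dm \<beta> K\<bar> \<le> \<Gamma>" if "\<beta> \<in> \<BB>" "length K < n'" for \<beta> K
    proof -
      let ?A = "{x \<in> Lv N. take (length K) (path m x n') = K}"
      have K: "K \<in> idx n'" using that by simp
      have "\<bar>\<beta> (b K) (b K)\<bar> \<le> \<Gamma> * 1 * 1 * (real (card ?A) / 2 ^ N)"
      proof -
        have "form_bd N \<Gamma> \<beta>" using \<BB> that by blast
        then show ?thesis
          unfolding form_bd_def
        proof (elim allE impE)
          show "?A \<subseteq> Lv N \<and> (0::real) \<le> 1 \<and> (0::real) \<le> 1 \<and> flat1 N ?A 1 (b K) \<and> flat1 N ?A 1 (b K)"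
            using a.flat1_ind_B[OF K] by (auto simp: b_def)
        qed
      qed
      also have "\<dots> = \<Gamma> / 2 ^ length K"
        unfolding a.card_through_real[OF K] by simp
      finally show ?thesis
        by (simp add: dm_def abs_mult field_simps)
    qed
    have "\<exists>\<mu> l. (\<forall>j\<le>n. \<forall>i<j. \<mu> i < \<mu> j) \<and> (\<forall>i\<le>n. \<mu> i < n') \<and>
      (\<forall>d\<in>dm ` \<BB>. \<forall>I\<in>idx n. \<bar>2 ^ length I * (\<Sum>K\<in>digit_blocks (\<lambda>I. \<mu> (length I)) I. d K / 2 ^ length K) - l d\<bar> \<le> \<epsilon> / 2)"
    proof (rule n')
      show "finite (dm ` \<BB>)" "card (dm ` \<BB>) \<le> Q"
        using fin card_image_le[of \<BB> dm] by auto
    qed (use dm in auto)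
    then obtain \<mu> l where \<mu>: "\<forall>j\<le>n. \<forall>i<j. \<mu> i < \<mu> j" "\<forall>i\<le>n. \<mu> i < n'"
      and l: "\<forall>d\<in>dm ` \<BB>. \<forall>I\<in>idx n. \<bar>2 ^ length I * (\<Sum>K\<in>digit_blocks (\<lambda>I. \<mu> (length I)) I. d K / 2 ^ length K) - l d\<bar> \<le> \<epsilon> / 2"
      by (elim exE conjE) (rule that)
    define B' where "B' = digit_blocks (\<lambda>I. \<mu> (length I))"
    have sysb: "block_system n n' B' (\<lambda>x. path (\<lambda>I. \<mu> (length I)) x n) (\<lambda>l x. \<mu> (length (path (\<lambda>I. \<mu> (length I)) x l)))"
      unfolding B'_def by (rule block_system_digits) (use \<mu> in auto)
    then interpret b: block_system n n' B' "\<lambda>x. path (\<lambda>I. \<mu> (length I)) x n" "\<lambda>l x. \<mu> (length (path (\<lambda>I. \<mu> (length I)) x l))" .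
    define B where "B I = (\<Union>K\<in>B' I. digit_blocks m K)" for I
    have B: "ind (B I) = (\<Sum>K\<in>B' I. b K)" if "I \<in> idx n" for I
      unfolding B_def b_def using b.B_idx[OF that] a.B_disjoint
      by (intro ind_UN_disjoint b.finite_B[OF that]) blast
    have cB: "card (B' I) \<le> M" if "I \<in> idx n" for I
      unfolding M_def by (rule card_mono[OF finite_idx b.B_idx[OF that]])
    have off: "\<bar>\<beta> (b K) (b K') - (if K = K' then \<beta> (b K) (b K) else 0)\<bar> \<le> \<epsilon>1"
      if "\<beta> \<in> \<BB>" "K \<in> idx n'" "K' \<in> idx n'" for \<beta> K K'
      using conjunct1[OF sm[unfolded small_blocks_def], rule_format, OF that] \<epsilon>1 by (simp add: b_def)
    have main: "\<bar>\<beta> (ind (B I)) (ind (B I')) - (if I = I' then l (dm \<beta>) / 2 ^ length I else 0)\<bar> \<le> \<epsilon>"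
      if \<beta>: "\<beta> \<in> \<BB>" and I: "I \<in> idx n" and I': "I' \<in> idx n" for \<beta> I I'
    proof -
      have bil: "bilin \<beta>" using \<BB> \<beta> by blast
      let ?D = "if I = I' then (\<Sum>K\<in>B' I. dm \<beta> K / 2 ^ length K) else 0"
      have D: "(\<Sum>K\<in>B' I. \<Sum>K'\<in>B' I'. if K = K' then \<beta> (b K) (b K) else 0) = ?D"
      proof (cases "I = I'")
        case True
        have "(\<Sum>K\<in>B' I. \<Sum>K'\<in>B' I. if K = K' then \<beta> (b K) (b K) else 0) = (\<Sum>K\<in>B' I. \<beta> (b K) (b K))"
          using b.finite_B[OF I] by (intro sum.cong) auto
        then show ?thesis
          using True by (simp add: dm_def)
      next
        case False
        then have ne: "K \<noteq> K'" if "K \<in> B' I" "K' \<in> B' I'" for K K'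
          using b.B_disjoint[OF I I' that(1)] that(2) by metis
        have "(\<Sum>K\<in>B' I. \<Sum>K'\<in>B' I'. if K = K' then \<beta> (b K) (b K) else 0) = 0"
          by (intro sum.neutral ballI) (simp add: ne)
        then show ?thesis
          using False by simp
      qed
      have "\<beta> (ind (B I)) (ind (B I')) - ?D
          = (\<Sum>K\<in>B' I. \<Sum>K'\<in>B' I'. \<beta> (b K) (b K') - (if K = K' then \<beta> (b K) (b K) else 0))"
        unfolding B[OF I] B[OF I'] bilin_sum[OF bil] D[symmetric] by (simp only: sum_subtractf)
      also have "\<bar>\<dots>\<bar> \<le> (real M)\<^sup>2 * \<epsilon>1"
        using b.B_idx[OF I] b.B_idx[OF I'] \<epsilon>1
        by (intro abs_double_sum_le cB I I' off \<beta>) auto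
      finally have 1: "\<bar>\<beta> (ind (B I)) (ind (B I')) - ?D\<bar> \<le> \<epsilon> / 2"
        using \<epsilon>1(2) by simp
      have 2: "\<bar>?D - (if I = I' then l (dm \<beta>) / 2 ^ length I else 0)\<bar> \<le> \<epsilon> / 2"
      proof (cases "I = I'")
        case True
        let ?S = "\<Sum>K\<in>B' I. dm \<beta> K / 2 ^ length K"
        have h1: "\<bar>2 ^ length I * ?S - l (dm \<beta>)\<bar> \<le> \<epsilon> / 2"
          using l \<beta> I unfolding B'_def by blast
        have h2: "?S - l (dm \<beta>) / 2 ^ length I = (2 ^ length I * ?S - l (dm \<beta>)) / 2 ^ length I"
          by (simp add: diff_divide_distrib)
        have h3: "\<bar>(2 ^ length I * ?S - l (dm \<beta>)) / 2 ^ length I\<bar> \<le> \<bar>2 ^ length I * ?S - l (dm \<beta>)\<bar> / 1"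
          unfolding abs_divide by (intro divide_left_mono) auto
        have "\<bar>?S - l (dm \<beta>) / 2 ^ length I\<bar> \<le> \<epsilon> / 2"
          unfolding h2 by (rule order_trans[OF h3]) (use h1 in simp)
        then show ?thesis
          using True by simp
      next
        case False
        then show ?thesis using e2 by simp
      qed
      show ?thesis
        using 1 2 by linarith
    qed
    have kill: "\<bar>\<psi> (ind (B I))\<bar> \<le> \<epsilon>" if \<psi>: "\<psi> \<in> \<Psi>" and I: "I \<in> idx n" for \<psi> I
    proof -
      have "\<psi> (ind (B I)) = (\<Sum>K\<in>B' I. \<psi> (b K))"
        unfolding B[OF I] by (rule linear_sum[OF conjunct1[OF \<Psi>[OF \<psi>]]])
      also have "\<bar>\<dots>\<bar> \<le> (\<Sum>K\<in>B' I. \<bar>\<psi> (b K)\<bar>)"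
        by (rule sum_abs)
      also have "\<dots> \<le> (\<Sum>K\<in>B' I. \<epsilon>1)"
      proof (rule sum_mono)
        fix K assume "K \<in> B' I"
        then have "K \<in> idx n'" using b.B_idx[OF I] by blast
        then show "\<bar>\<psi> (b K)\<bar> \<le> \<epsilon>1"
          using conjunct2[OF sm[unfolded small_blocks_def], rule_format, OF \<psi>] by (simp add: b_def)
      qed
      also have "\<dots> \<le> real M * \<epsilon>1"
        using cB[OF I] \<epsilon>1 by (simp add: mult_right_mono)
      finally show ?thesis using M\<epsilon>1 by linarith
    qed
    have "B I \<subseteq> idx N0" if "I \<in> idx n" for I
    proof
      fix K0 assume "K0 \<in> B I"
      then obtain K where K: "K \<in> B' I" "K0 \<in> digit_blocks m K" by (auto simp: B_def)
      then have "m K < N0" using b.B_idx[OF that] m(2) by blast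
      then show "K0 \<in> idx N0" using K(2) by (simp add: digit_blocks_def)
    qed
    moreover have "block_system n N B (\<lambda>x. path (\<lambda>I. \<mu> (length I)) (path m x n') n)
        (\<lambda>l x. m (path m x (\<mu> (length (path (\<lambda>I. \<mu> (length I)) (path m x n') l)))))"
      unfolding B_def by (rule block_system_compose[OF sysa sysb])
    ultimately show ?thesis
      using main kill by (intro exI[of _ B] exI[of _ "\<lambda>\<beta>. l (dm \<beta>)"] exI conjI) blast+
  qed
  then show thesis
    by (intro that[of N0]) blast
qed

section \<open>Diagonalisation in two parameters\<close>

definition sq2 :: "nat \<Rightarrow> (bool list \<Rightarrow> bool list \<Rightarrow> real) \<Rightarrow> bool list \<Rightarrow> bool list \<Rightarrow> real" where
  "sq2 N a x y = (\<Sum>i\<le>N. \<Sum>j\<le>N. (a (take i x) (take j y))\<^sup>2)"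

definition flat2 :: "nat \<Rightarrow> bool list set \<Rightarrow> bool list set \<Rightarrow> real \<Rightarrow> (bool list \<Rightarrow> bool list \<Rightarrow> real) \<Rightarrow> bool" where
  "flat2 N A C G a \<longleftrightarrow> (\<forall>x\<in>Lv N. \<forall>y\<in>Lv N. sq2 N a x y \<le> (if x \<in> A \<and> y \<in> C then G\<^sup>2 else 0))"

definition form2_bd :: "nat \<Rightarrow> real \<Rightarrow> ((bool list \<Rightarrow> bool list \<Rightarrow> real) \<Rightarrow> (bool list \<Rightarrow> bool list \<Rightarrow> real) \<Rightarrow> real) \<Rightarrow> bool" where
  "form2_bd N \<Gamma> t \<longleftrightarrow> (\<forall>A C G G' f g. A \<subseteq> Lv N \<and> C \<subseteq> Lv N \<and> 0 \<le> G \<and> 0 \<le> G' \<and> flat2 N A C G f \<and> flat2 N A C G' g \<longrightarrow>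
     \<bar>t f g\<bar> \<le> \<Gamma> * G * G' * (real (card A) / 2 ^ N * (real (card C) / 2 ^ N)))"

definition func2_bd :: "nat \<Rightarrow> real \<Rightarrow> ((bool list \<Rightarrow> bool list \<Rightarrow> real) \<Rightarrow> real) \<Rightarrow> bool" where
  "func2_bd N \<Gamma> \<psi> \<longleftrightarrow> (\<forall>G f. 0 \<le> G \<and> flat2 N (Lv N) (Lv N) G f \<longrightarrow> \<bar>\<psi> f\<bar> \<le> \<Gamma> * G)"

definition tens :: "(bool list \<Rightarrow> real) \<Rightarrow> (bool list \<Rightarrow> real) \<Rightarrow> bool list \<Rightarrow> bool list \<Rightarrow> real" where
  "tens f g = (\<lambda>K L. f K * g L)"

lemma sq2_tens: "sq2 N (tens f g) x y = sq1 N f x * sq1 N g y"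
  by (simp add: sq2_def sq1_def tens_def power_mult_distrib sum_product)

lemma sq1_nonneg: "0 \<le> sq1 N f x"
  by (simp add: sq1_def sum_nonneg)

lemma flat2_tens:
  assumes "flat1 N A G f" "flat1 N C G' g" "0 \<le> G" "0 \<le> G'"
  shows "flat2 N A C (G * G') (tens f g)"
  unfolding flat2_def
proof (intro ballI)
  fix x y assume x: "x \<in> Lv N" and y: "y \<in> Lv N"
  have "sq2 N (tens f g) x y \<le> (if x \<in> A then G\<^sup>2 else 0) * (if y \<in> C then G'\<^sup>2 else 0)"
    unfolding sq2_tens using assms(1,2) x y sq1_nonneg
    by (intro mult_mono) (auto simp: flat1_def simp del: Lv_iff)
  also have "\<dots> = (if x \<in> A \<and> y \<in> C then (G * G')\<^sup>2 else 0)"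
    by (simp add: power_mult_distrib)
  finally show "sq2 N (tens f g) x y \<le> (if x \<in> A \<and> y \<in> C then (G * G')\<^sup>2 else 0)" .
qed

lemma linear_tens_left: "linear (\<lambda>f. tens f g)"
  by (rule linearI) (auto simp: tens_def fun_eq_iff algebra_simps)

lemma linear_tens_right: "linear (tens f)"
  by (rule linearI) (auto simp: tens_def fun_eq_iff algebra_simps)

lemma linear_bilin_comp:
  assumes "bilin t" "linear F" "linear H"
  shows "bilin (\<lambda>f g. t (F f) (H g))"
proof -
  have 1: "linear (\<lambda>f. t f g)" and 2: "linear (t f)" for f g
    using assms(1) by (auto simp: bilin_def)
  show ?thesis
    unfolding bilin_def
    using linear_compose[OF assms(2) 1] linear_compose[OF assms(3) 2] by (simp add: o_def)
qed

text \<open>A frozen factor with square function at most 1 is flat on the set of all leaves, which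
  has measure 1, so the constant \<Gamma> is kept.\<close>

lemma form_bd_tens_right:
  assumes t: "form2_bd N \<Gamma> t" and h: "flat1 N (Lv N) 1 h" "flat1 N (Lv N) 1 h'"
  shows "form_bd N \<Gamma> (\<lambda>f g. t (tens f h) (tens g h'))"
  unfolding form_bd_def
proof (intro allI impI)
  fix A G G' f g assume *: "A \<subseteq> Lv N \<and> 0 \<le> G \<and> 0 \<le> G' \<and> flat1 N A G f \<and> flat1 N A G' g"
  then have "flat2 N A (Lv N) (G * 1) (tens f h)" "flat2 N A (Lv N) (G' * 1) (tens g h')"
    using h by (blast intro: flat2_tens zero_le_one)+
  then have "\<bar>t (tens f h) (tens g h')\<bar> \<le> \<Gamma> * G * G' * (real (card A) / 2 ^ N * (real (card (Lv N)) / 2 ^ N))"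
    using t[unfolded form2_bd_def, rule_format, of A "Lv N" G G' "tens f h" "tens g h'"] * by simp
  then show "\<bar>t (tens f h) (tens g h')\<bar> \<le> \<Gamma> * G * G' * (real (card A) / 2 ^ N)"
    by simp
qed

lemma form_bd_tens_left:
  assumes t: "form2_bd N \<Gamma> t" and h: "flat1 N (Lv N) 1 h" "flat1 N (Lv N) 1 h'"
  shows "form_bd N \<Gamma> (\<lambda>f g. t (tens h f) (tens h' g))"
  unfolding form_bd_def
proof (intro allI impI)
  fix A G G' f g assume *: "A \<subseteq> Lv N \<and> 0 \<le> G \<and> 0 \<le> G' \<and> flat1 N A G f \<and> flat1 N A G' g"
  then have "flat2 N (Lv N) A (1 * G) (tens h f)" "flat2 N (Lv N) A (1 * G') (tens h' g)"
    using h by (blast intro: flat2_tens zero_le_one)+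
  then have "\<bar>t (tens h f) (tens h' g)\<bar> \<le> \<Gamma> * G * G' * (real (card (Lv N)) / 2 ^ N * (real (card A) / 2 ^ N))"
    using t[unfolded form2_bd_def, rule_format, of "Lv N" A G G' "tens h f" "tens h' g"] * by simp
  then show "\<bar>t (tens h f) (tens h' g)\<bar> \<le> \<Gamma> * G * G' * (real (card A) / 2 ^ N)"
    by simp
qed

lemma func_bd_tens:
  assumes "func2_bd N \<Gamma> \<psi>" "flat1 N (Lv N) 1 h"
  shows "func_bd N \<Gamma> (\<lambda>f. \<psi> (tens f h))"
  unfolding func_bd_def
proof (intro allI impI)
  fix G f assume *: "0 \<le> G \<and> flat1 N (Lv N) G f"
  then have "flat2 N (Lv N) (Lv N) (G * 1) (tens f h)"
    using assms(2) by (intro flat2_tens) auto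
  then show "\<bar>\<psi> (tens f h)\<bar> \<le> \<Gamma> * G"
    using assms(1) * by (simp add: func2_bd_def)
qed

lemma flat1_mono: "flat1 N A G f \<Longrightarrow> A \<subseteq> A' \<Longrightarrow> flat1 N A' G f"
  unfolding flat1_def by (smt (verit, best) subsetD zero_le_power2)

lemma tens_ind_sum:
  assumes "finite C"
  shows "tens f (ind C) = (\<Sum>L\<in>C. tens f (ind {L}))"
proof -
  have "ind C = (\<Sum>L\<in>C. ind {L})"
    using ind_UN_disjoint[of C "\<lambda>L. {L}"] assms by simp
  then show ?thesis
    by (simp add: linear_sum[OF linear_tens_right])
qed

text \<open>First the one-parameter result is applied in the first variable to all forms obtained by
  fixing Haar functions in the second variable; this leaves the single form
  \<open>\<lambda>g g'. t (tens (ind (B [])) g) (tens (ind (B [])) g')\<close> in the second variable. In this way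
  one constant \<open>l\<close> suffices.\<close>

lemma two_parameter:
  fixes \<Gamma> \<epsilon> :: real and Q n :: nat
  assumes "0 < \<epsilon>" "0 \<le> \<Gamma>"
  obtains N0 where "\<And>N t \<Psi>. N0 \<le> N \<Longrightarrow> bilin t \<Longrightarrow> form2_bd N \<Gamma> t \<Longrightarrow> finite \<Psi> \<Longrightarrow> card \<Psi> \<le> Q \<Longrightarrow>
    (\<And>\<psi>. \<psi> \<in> \<Psi> \<Longrightarrow> linear \<psi> \<and> func2_bd N \<Gamma> \<psi>) \<Longrightarrow>
    \<exists>B \<tau> \<kappa> C \<sigma> \<nu> l. block_system n N B \<tau> \<kappa> \<and> block_system n N C \<sigma> \<nu> \<and>
      (\<forall>I\<in>idx n. \<forall>J\<in>idx n. \<forall>I'\<in>idx n. \<forall>J'\<in>idx n.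
        \<bar>t (tens (ind (B I)) (ind (C J))) (tens (ind (B I')) (ind (C J')))
          - (if I = I' \<and> J = J' then l / 2 ^ length I / 2 ^ length J else 0)\<bar> \<le> \<epsilon>) \<and>
      (\<forall>\<psi>\<in>\<Psi>. \<forall>I\<in>idx n. \<forall>J\<in>idx n. \<bar>\<psi> (tens (ind (B I)) (ind (C J)))\<bar> \<le> \<epsilon>)"
proof -
  have e2: "0 < \<epsilon> / 2" using assms by simp
  \<comment> \<open>The second variable will carry one form and no functionals. Its threshold is
    fixed first, because the nodes to be frozen in the second variable while the first is treated
    are those of \<open>idx Ny\<close>.\<close>
  obtain Ny where Ny: "\<And>N \<BB> \<Psi>. Ny \<le> N \<Longrightarrow> finite \<BB> \<Longrightarrow> card \<BB> \<le> 1 \<Longrightarrow> finite \<Psi> \<Longrightarrow> card \<Psi> \<le> 1 \<Longrightarrow>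
    (\<And>\<beta>. \<beta> \<in> \<BB> \<Longrightarrow> bilin \<beta> \<and> form_bd N \<Gamma> \<beta>) \<Longrightarrow> (\<And>\<psi>. \<psi> \<in> \<Psi> \<Longrightarrow> linear \<psi> \<and> func_bd N \<Gamma> \<psi>) \<Longrightarrow>
    \<exists>B \<tau> \<kappa> l. block_system n N B \<tau> \<kappa> \<and> (\<forall>I\<in>idx n. B I \<subseteq> idx Ny) \<and>
      (\<forall>\<beta>\<in>\<BB>. \<forall>I\<in>idx n. \<forall>I'\<in>idx n.
        \<bar>\<beta> (ind (B I)) (ind (B I')) - (if I = I' then l \<beta> / 2 ^ length I else 0)\<bar> \<le> \<epsilon> / 2) \<and>
      (\<forall>\<psi>\<in>\<Psi>. \<forall>I\<in>idx n. \<bar>\<psi> (ind (B I))\<bar> \<le> \<epsilon> / 2)"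
    by (rule one_parameter[OF e2 assms(2), of 1 n]) (erule that)
  define E where "E = card (idx Ny)"
  have E: "1 \<le> E"
  proof -
    have "[] \<in> idx Ny" by simp
    then have "0 < E"
      unfolding E_def using finite_idx[of Ny] card_gt_0_iff by blast
    then show ?thesis by simp
  qed
  \<comment> \<open>A pair of blocks in the second variable involves at most E^2 pairs of nodes,
    each with error 2\<epsilon>', together \<epsilon> / 2.\<close>
  define \<epsilon>' where "\<epsilon>' = \<epsilon> / (4 * (real E)\<^sup>2)"
  have \<epsilon>': "0 < \<epsilon>'" "(real E)\<^sup>2 * (2 * \<epsilon>') = \<epsilon> / 2"
    using assms E by (simp_all add: \<epsilon>'_def)
  have E\<epsilon>': "real E * \<epsilon>' \<le> \<epsilon>"
  proof -
    have "real E * \<epsilon>' \<le> (real E)\<^sup>2 * (2 * \<epsilon>')"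
      using E \<epsilon>'(1) by (intro mult_mono) (auto simp: power2_eq_square)
    then show ?thesis
      using \<epsilon>'(2) assms by linarith
  qed
  \<comment> \<open>There are \<open>E * E\<close> forms, one for each pair of frozen nodes, and
    \<open>E\<close> functionals for each given one.\<close>
  define Q' where "Q' = E * E + Q * E"
  obtain Nx where Nx: "\<And>N \<BB> \<Psi>. Nx \<le> N \<Longrightarrow> finite \<BB> \<Longrightarrow> card \<BB> \<le> Q' \<Longrightarrow> finite \<Psi> \<Longrightarrow> card \<Psi> \<le> Q' \<Longrightarrow>
    (\<And>\<beta>. \<beta> \<in> \<BB> \<Longrightarrow> bilin \<beta> \<and> form_bd N \<Gamma> \<beta>) \<Longrightarrow> (\<And>\<psi>. \<psi> \<in> \<Psi> \<Longrightarrow> linear \<psi> \<and> func_bd N \<Gamma> \<psi>) \<Longrightarrow>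
    \<exists>B \<tau> \<kappa> l. block_system n N B \<tau> \<kappa> \<and> (\<forall>I\<in>idx n. B I \<subseteq> idx Nx) \<and>
      (\<forall>\<beta>\<in>\<BB>. \<forall>I\<in>idx n. \<forall>I'\<in>idx n.
        \<bar>\<beta> (ind (B I)) (ind (B I')) - (if I = I' then l \<beta> / 2 ^ length I else 0)\<bar> \<le> \<epsilon>') \<and>
      (\<forall>\<psi>\<in>\<Psi>. \<forall>I\<in>idx n. \<bar>\<psi> (ind (B I))\<bar> \<le> \<epsilon>')"
    by (rule one_parameter[OF \<epsilon>'(1) assms(2), of Q' n]) (erule that)
  have "\<exists>B \<tau> \<kappa> C \<sigma> \<nu> l. block_system n N B \<tau> \<kappa> \<and> block_system n N C \<sigma> \<nu> \<and>
      (\<forall>I\<in>idx n. \<forall>J\<in>idx n. \<forall>I'\<in>idx n. \<forall>J'\<in>idx n.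
        \<bar>t (tens (ind (B I)) (ind (C J))) (tens (ind (B I')) (ind (C J')))
          - (if I = I' \<and> J = J' then l / 2 ^ length I / 2 ^ length J else 0)\<bar> \<le> \<epsilon>) \<and>
      (\<forall>\<psi>\<in>\<Psi>. \<forall>I\<in>idx n. \<forall>J\<in>idx n. \<bar>\<psi> (tens (ind (B I)) (ind (C J)))\<bar> \<le> \<epsilon>)"
    if N: "max Nx Ny \<le> N" and t: "bilin t" "form2_bd N \<Gamma> t" and \<Psi>: "finite \<Psi>" "card \<Psi> \<le> Q"
      "\<And>\<psi>. \<psi> \<in> \<Psi> \<Longrightarrow> linear \<psi> \<and> func2_bd N \<Gamma> \<psi>" for N t \<Psi>
  proof -
    have NN: "Nx \<le> N" "Ny \<le> N" using N by auto
    have e1: "flat1 N (Lv N) 1 (ind {L})" for L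
      by (rule flat1_ind_level[of _ "length L"]) simp
    define \<beta> where "\<beta> L L' = (\<lambda>f g. t (tens f (ind {L})) (tens g (ind {L'})))" for L L'
    define \<BB> where "\<BB> = (\<lambda>(L, L'). \<beta> L L') ` (idx Ny \<times> idx Ny)"
    define \<Psi>' where "\<Psi>' = (\<lambda>(\<psi>, L) f. \<psi> (tens f (ind {L}))) ` (\<Psi> \<times> idx Ny)"
    have \<BB>: "finite \<BB>" "card \<BB> \<le> Q'"
    proof -
      show "finite \<BB>" by (simp add: \<BB>_def)
      have "card \<BB> \<le> card (idx Ny \<times> idx Ny)"
        unfolding \<BB>_def by (intro card_image_le) simp
      also have "\<dots> \<le> Q'"
        by (simp add: card_cartesian_product E_def Q'_def)
      finally show "card \<BB> \<le> Q'" .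
    qed
    have \<Psi>': "finite \<Psi>'" "card \<Psi>' \<le> Q'"
    proof -
      show "finite \<Psi>'" using \<Psi>(1) by (simp add: \<Psi>'_def)
      have "card \<Psi>' \<le> card (\<Psi> \<times> idx Ny)"
        unfolding \<Psi>'_def using \<Psi>(1) by (intro card_image_le) simp
      also have "\<dots> \<le> Q * E"
        unfolding card_cartesian_product E_def using \<Psi>(2) by (intro mult_le_mono1)
      finally show "card \<Psi>' \<le> Q'"
        by (simp add: Q'_def)
    qed
    have \<BB>bd: "bilin \<gamma> \<and> form_bd N \<Gamma> \<gamma>" if \<gamma>B: "\<gamma> \<in> \<BB>" for \<gamma>
    proof -
      obtain L L' where \<gamma>: "\<gamma> = (\<lambda>f g. t (tens f (ind {L})) (tens g (ind {L'})))"
        using \<gamma>B by (auto simp: \<BB>_def \<beta>_def)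
      show ?thesis
        unfolding \<gamma> using linear_bilin_comp[OF t(1) linear_tens_left linear_tens_left]
          form_bd_tens_right[OF t(2) e1 e1] by blast
    qed
    have \<Psi>'bd: "linear \<psi> \<and> func_bd N \<Gamma> \<psi>" if \<psi>P: "\<psi> \<in> \<Psi>'" for \<psi>
    proof -
      obtain \<psi>0 L where \<psi>: "\<psi> = (\<lambda>f. \<psi>0 (tens f (ind {L})))" "\<psi>0 \<in> \<Psi>"
        using \<psi>P by (auto simp: \<Psi>'_def)
      show ?thesis
        unfolding \<psi>(1) using \<Psi>(3)[OF \<psi>(2)] linear_compose[OF linear_tens_left, of \<psi>0 "ind {L}"]
          func_bd_tens[OF _ e1] by (simp add: o_def)
    qed
    have "\<exists>B \<tau> \<kappa> l. block_system n N B \<tau> \<kappa> \<and> (\<forall>I\<in>idx n. B I \<subseteq> idx Nx) \<and>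
      (\<forall>\<beta>\<in>\<BB>. \<forall>I\<in>idx n. \<forall>I'\<in>idx n.
        \<bar>\<beta> (ind (B I)) (ind (B I')) - (if I = I' then l \<beta> / 2 ^ length I else 0)\<bar> \<le> \<epsilon>') \<and>
      (\<forall>\<psi>\<in>\<Psi>'. \<forall>I\<in>idx n. \<bar>\<psi> (ind (B I))\<bar> \<le> \<epsilon>')"
      by (rule Nx[OF NN(1) \<BB> \<Psi>' \<BB>bd \<Psi>'bd])
    then obtain B \<tau> \<kappa> l where sysB: "block_system n N B \<tau> \<kappa>"
      and B: "\<forall>\<beta>\<in>\<BB>. \<forall>I\<in>idx n. \<forall>I'\<in>idx n.
        \<bar>\<beta> (ind (B I)) (ind (B I')) - (if I = I' then l \<beta> / 2 ^ length I else 0)\<bar> \<le> \<epsilon>'"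
      and B\<Psi>: "\<forall>\<psi>\<in>\<Psi>'. \<forall>I\<in>idx n. \<bar>\<psi> (ind (B I))\<bar> \<le> \<epsilon>'"
      by (elim exE conjE) (rule that)
    interpret B: block_system n N B \<tau> \<kappa> by (rule sysB)
    define b where "b I = ind (B I)" for I
    have nil: "[] \<in> idx n" by simp
    have b0: "flat1 N (Lv N) 1 (b [])"
      unfolding b_def by (rule flat1_mono[OF B.flat1_ind_B[OF nil]]) auto
    have \<beta>_close: "\<bar>\<beta> L L' (b I) (b I') - (if I = I' then \<beta> L L' (b []) (b []) / 2 ^ length I else 0)\<bar> \<le> 2 * \<epsilon>'"
      if "L \<in> idx Ny" "L' \<in> idx Ny" "I \<in> idx n" "I' \<in> idx n" for L L' I I'
    proof -
      have mem: "\<beta> L L' \<in> \<BB>" using that by (force simp: \<BB>_def)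
      have 1: "\<bar>\<beta> L L' (b I) (b I') - (if I = I' then l (\<beta> L L') / 2 ^ length I else 0)\<bar> \<le> \<epsilon>'"
        using B mem that unfolding b_def by blast
      have "\<bar>\<beta> L L' (b []) (b []) - (if [] = ([] :: bool list) then l (\<beta> L L') / 2 ^ length ([] :: bool list) else 0)\<bar> \<le> \<epsilon>'"
        using B mem nil unfolding b_def by blast
      then have 2: "\<bar>\<beta> L L' (b []) (b []) - l (\<beta> L L')\<bar> \<le> \<epsilon>'"
        by simp
      have "\<bar>l (\<beta> L L') - \<beta> L L' (b []) (b [])\<bar> / 2 ^ length I \<le> \<bar>l (\<beta> L L') - \<beta> L L' (b []) (b [])\<bar> / 1"
        by (intro divide_left_mono) auto
      then have "\<bar>(l (\<beta> L L') - \<beta> L L' (b []) (b [])) / 2 ^ length I\<bar> \<le> \<epsilon>'"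
        using 2 by (simp add: abs_divide)
      then have a3: "\<bar>l (\<beta> L L') / 2 ^ length I - \<beta> L L' (b []) (b []) / 2 ^ length I\<bar> \<le> \<epsilon>'"
        by (simp add: diff_divide_distrib)
      show ?thesis
      proof (cases "I = I'")
        case True
        then show ?thesis
          using 1 a3 unfolding if_P[OF True] by linarith
      next
        case False
        then show ?thesis
          using 1 \<epsilon>'(1) unfolding if_not_P[OF False] by linarith
      qed
    qed
    define \<gamma> where "\<gamma> = (\<lambda>g g'. t (tens (b []) g) (tens (b []) g'))"
    have \<gamma>: "bilin \<gamma> \<and> form_bd N \<Gamma> \<gamma>"
      unfolding \<gamma>_def using linear_bilin_comp[OF t(1) linear_tens_right linear_tens_right]
        form_bd_tens_left[OF t(2) b0 b0] by blast
    \<comment> \<open>No functionals are passed on: they are already small on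
      \<open>tens (b I) (ind {L})\<close> for every node \<open>L\<close> of \<open>idx Ny\<close>,
      and \<open>kill\<close> below sums over these.\<close>
    have "\<exists>C \<sigma> \<nu> l. block_system n N C \<sigma> \<nu> \<and> (\<forall>I\<in>idx n. C I \<subseteq> idx Ny) \<and>
      (\<forall>\<beta>\<in>{\<gamma>}. \<forall>I\<in>idx n. \<forall>I'\<in>idx n.
        \<bar>\<beta> (ind (C I)) (ind (C I')) - (if I = I' then l \<beta> / 2 ^ length I else 0)\<bar> \<le> \<epsilon> / 2) \<and>
      (\<forall>\<psi>\<in>{}. \<forall>I\<in>idx n. \<bar>\<psi> (ind (C I))\<bar> \<le> \<epsilon> / 2)"
      by (rule Ny[OF NN(2)]) (use \<gamma> in auto)
    then obtain C \<sigma> \<nu> l' where sysC: "block_system n N C \<sigma> \<nu>" and CNy: "\<forall>I\<in>idx n. C I \<subseteq> idx Ny"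
      and C: "\<forall>\<beta>\<in>{\<gamma>}. \<forall>I\<in>idx n. \<forall>I'\<in>idx n.
        \<bar>\<beta> (ind (C I)) (ind (C I')) - (if I = I' then l' \<beta> / 2 ^ length I else 0)\<bar> \<le> \<epsilon> / 2"
      by (elim exE conjE) (rule that)
    interpret C: block_system n N C \<sigma> \<nu> by (rule sysC)
    define c where "c J = ind (C J)" for J
    have cE: "card (C J) \<le> E" if "J \<in> idx n" for J
      unfolding E_def using CNy that by (intro card_mono) auto
    have expand: "t (tens f (c J)) (tens g (c J')) = (\<Sum>L\<in>C J. \<Sum>L'\<in>C J'. t (tens f (ind {L})) (tens g (ind {L'})))"
      if "J \<in> idx n" "J' \<in> idx n" for f g J J'
      unfolding c_def tens_ind_sum[OF C.finite_B[OF that(1)]] tens_ind_sum[OF C.finite_B[OF that(2)]]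
      by (rule bilin_sum[OF t(1)])
    have main: "\<bar>t (tens (b I) (c J)) (tens (b I') (c J'))
        - (if I = I' \<and> J = J' then l' \<gamma> / 2 ^ length I / 2 ^ length J else 0)\<bar> \<le> \<epsilon>"
      if I: "I \<in> idx n" and J: "J \<in> idx n" and I': "I' \<in> idx n" and J': "J' \<in> idx n" for I J I' J'
    proof -
      \<comment> \<open>The intermediate matrix in which the first variable has been collapsed to
        the root block. Passing to it costs \<epsilon> / 2, and diagonalising
        \<open>\<gamma>\<close> costs the other \<epsilon> / 2.\<close>
      let ?g = "if I = I' then \<gamma> (c J) (c J') / 2 ^ length I else 0"
      have g: "?g = (\<Sum>L\<in>C J. \<Sum>L'\<in>C J'. if I = I' then \<beta> L L' (b []) (b []) / 2 ^ length I else 0)"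
        unfolding \<gamma>_def \<beta>_def expand[OF J J'] by (simp add: sum_divide_distrib)
      have "t (tens (b I) (c J)) (tens (b I') (c J')) - ?g
          = (\<Sum>L\<in>C J. \<Sum>L'\<in>C J'. \<beta> L L' (b I) (b I') - (if I = I' then \<beta> L L' (b []) (b []) / 2 ^ length I else 0))"
        unfolding g expand[OF J J'] by (simp only: sum_subtractf \<beta>_def)
      also have "\<bar>\<dots>\<bar> \<le> (real E)\<^sup>2 * (2 * \<epsilon>')"
      proof (rule abs_double_sum_le)
        fix L L' assume "L \<in> C J" "L' \<in> C J'"
        then show "\<bar>\<beta> L L' (b I) (b I') - (if I = I' then \<beta> L L' (b []) (b []) / 2 ^ length I else 0)\<bar> \<le> 2 * \<epsilon>'"
          using CNy J J' by (intro \<beta>_close I I') blast+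
      qed (use cE J J' \<epsilon>' in auto)
      finally have 1: "\<bar>t (tens (b I) (c J)) (tens (b I') (c J')) - ?g\<bar> \<le> \<epsilon> / 2"
        using \<epsilon>'(2) by simp
      have "\<bar>\<gamma> (c J) (c J') - (if J = J' then l' \<gamma> / 2 ^ length J else 0)\<bar> \<le> \<epsilon> / 2"
        using C J J' unfolding c_def by blast
      then have "\<bar>\<gamma> (c J) (c J') - (if J = J' then l' \<gamma> / 2 ^ length J else 0)\<bar> / 2 ^ length I \<le> (\<epsilon> / 2) / 1"
        using e2 by (intro frac_le) auto
      then have 2: "\<bar>\<gamma> (c J) (c J') / 2 ^ length I - (if J = J' then l' \<gamma> / 2 ^ length I / 2 ^ length J else 0)\<bar> \<le> \<epsilon> / 2"
      proof -
        assume a: "\<bar>\<gamma> (c J) (c J') - (if J = J' then l' \<gamma> / 2 ^ length J else 0)\<bar> / 2 ^ length I \<le> (\<epsilon> / 2) / 1"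
        have "\<gamma> (c J) (c J') / 2 ^ length I - (if J = J' then l' \<gamma> / 2 ^ length I / 2 ^ length J else 0)
            = (\<gamma> (c J) (c J') - (if J = J' then l' \<gamma> / 2 ^ length J else 0)) / 2 ^ length I"
          by (simp add: diff_divide_distrib mult.commute)
        then show ?thesis
          using a by (simp only: abs_divide) simp
      qed
      show ?thesis
      proof (cases "I = I'")
        case True
        have 3: "(if I = I' \<and> J = J' then l' \<gamma> / 2 ^ length I / 2 ^ length J else 0)
            = (if J = J' then l' \<gamma> / 2 ^ length I / 2 ^ length J else 0)"
          using True by simp
        show ?thesis
          using 1 2 unfolding 3 if_P[OF True] by linarith
      next
        case False
        then have 3: "(if I = I' \<and> J = J' then l' \<gamma> / 2 ^ length I / 2 ^ length J else 0) = 0"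
          by simp
        show ?thesis
          using 1 e2 unfolding 3 if_not_P[OF False] by linarith
      qed
    qed
    have kill: "\<bar>\<psi> (tens (b I) (c J))\<bar> \<le> \<epsilon>" if \<psi>: "\<psi> \<in> \<Psi>" and I: "I \<in> idx n" and J: "J \<in> idx n" for \<psi> I J
    proof -
      have "\<psi> (tens (b I) (c J)) = (\<Sum>L\<in>C J. \<psi> (tens (b I) (ind {L})))"
        unfolding c_def tens_ind_sum[OF C.finite_B[OF J]] by (rule linear_sum[OF conjunct1[OF \<Psi>(3)[OF \<psi>]]])
      also have "\<bar>\<dots>\<bar> \<le> (\<Sum>L\<in>C J. \<bar>\<psi> (tens (b I) (ind {L}))\<bar>)"
        by (rule sum_abs)
      also have "\<dots> \<le> (\<Sum>L\<in>C J. \<epsilon>')"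
      proof (rule sum_mono)
        fix L assume "L \<in> C J"
        then have "L \<in> idx Ny" using CNy J by blast
        then have mem: "(\<lambda>f. \<psi> (tens f (ind {L}))) \<in> \<Psi>'"
          using \<psi> unfolding \<Psi>'_def by (intro image_eqI[of _ _ "(\<psi>, L)"]) auto
        show "\<bar>\<psi> (tens (b I) (ind {L}))\<bar> \<le> \<epsilon>'"
          using B\<Psi>[rule_format, OF mem I] by (simp add: b_def)
      qed
      also have "\<dots> \<le> real E * \<epsilon>'"
        using cE[OF J] \<epsilon>' by (simp add: mult_right_mono)
      finally show ?thesis using E\<epsilon>' by linarith
    qed
    show ?thesis
      by (intro exI[of _ B] exI[of _ \<tau>] exI[of _ \<kappa>] exI[of _ C] exI[of _ \<sigma>] exI[of _ \<nu>] exI[of _ "l' \<gamma>"]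
          conjI ballI sysB sysC main[unfolded b_def c_def] kill[unfolded b_def c_def])
  qed
  note res = this
  show thesis
    by (rule that[of "max Nx Ny"], rule res; blast)
qed

section \<open>Mixed norms of the square function\<close>

text \<open>For nonnegative functions, the \<open>L^p\<close> norm with respect to the uniform
  probability measure on \<open>A\<close>.\<close>

definition pm :: "real \<Rightarrow> 'a set \<Rightarrow> ('a \<Rightarrow> real) \<Rightarrow> real" where
  "pm p A u = ((\<Sum>x\<in>A. u x powr p) / real (card A)) powr (1 / p)"

lemma pm_nonneg: "0 \<le> pm p A u"
  by (simp add: pm_def)

lemma pm_cong: "A = B \<Longrightarrow> (\<And>x. x \<in> B \<Longrightarrow> u x = v x) \<Longrightarrow> pm p A u = pm p B v"
  by (simp add: pm_def)

locale pm_exponent =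
  fixes p :: real
  assumes p1: "1 \<le> p"
begin

lemma pm_powr: "pm p A u powr p = (\<Sum>x\<in>A. u x powr p) / real (card A)"
  unfolding pm_def using p1 by (simp add: powr_powr sum_nonneg)

lemma pm_leI:
  assumes "(\<Sum>x\<in>A. u x powr p) / real (card A) \<le> c powr p" "0 \<le> c"
  shows "pm p A u \<le> c"
proof -
  have "pm p A u \<le> (c powr p) powr (1 / p)"
    unfolding pm_def using p1 assms by (intro powr_mono2) (auto intro!: divide_nonneg_nonneg sum_nonneg)
  then show ?thesis
    using p1 assms by (simp add: powr_powr)
qed

lemma pm_mono:
  assumes "\<And>x. x \<in> A \<Longrightarrow> 0 \<le> u x" "\<And>x. x \<in> A \<Longrightarrow> u x \<le> v x"
  shows "pm p A u \<le> pm p A v"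
  unfolding pm_def using p1 assms
  by (intro powr_mono2 divide_right_mono sum_mono) (auto intro!: divide_nonneg_nonneg sum_nonneg)

lemma pm_scale:
  assumes "0 \<le> c" "\<And>x. x \<in> A \<Longrightarrow> 0 \<le> u x"
  shows "pm p A (\<lambda>x. c * u x) = c * pm p A u"
proof -
  have eq: "(\<Sum>x\<in>A. (c * u x) powr p) / real (card A) = c powr p * ((\<Sum>x\<in>A. u x powr p) / real (card A))"
    using assms by (simp add: powr_mult sum_distrib_left)
  then show ?thesis
    unfolding pm_def eq using p1 assms(1)
    by (subst powr_mult) (auto simp: powr_powr intro!: divide_nonneg_nonneg sum_nonneg)
qed

lemma pm_add:
  assumes "finite A" "\<And>x. x \<in> A \<Longrightarrow> 0 \<le> u x" "\<And>x. x \<in> A \<Longrightarrow> 0 \<le> v x"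
  shows "pm p A (\<lambda>x. u x + v x) \<le> pm p A u + pm p A v"
proof (rule pm_leI)
  have eq: "(\<Sum>x\<in>A. 1 / real (card A) * w x powr p) = (\<Sum>x\<in>A. w x powr p) / real (card A)" for w
    by (simp add: sum_divide_distrib)
  show "(\<Sum>x\<in>A. (u x + v x) powr p) / real (card A) \<le> (pm p A u + pm p A v) powr p"
    using minkowski_weighted[OF assms(1) p1, of "\<lambda>_. 1 / real (card A)" u v "pm p A u" "pm p A v", unfolded eq pm_powr] assms
    by (simp add: pm_nonneg)
qed (simp add: pm_nonneg)

lemma pm_sum:
  assumes "finite A" "finite F" "\<And>i x. i \<in> F \<Longrightarrow> x \<in> A \<Longrightarrow> 0 \<le> u i x"
  shows "pm p A (\<lambda>x. \<Sum>i\<in>F. u i x) \<le> (\<Sum>i\<in>F. pm p A (u i))"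
  using assms(2,3)
proof (induction F)
  case empty
  have "pm p A (\<lambda>x. 0) = 0"
    by (simp add: pm_def)
  then show ?case by simp
next
  case (insert i F)
  have "pm p A (\<lambda>x. u i x + (\<Sum>i\<in>F. u i x)) \<le> pm p A (u i) + pm p A (\<lambda>x. \<Sum>i\<in>F. u i x)"
    using insert by (intro pm_add assms(1) sum_nonneg) auto
  then show ?case
    using insert by fastforce
qed

lemma pm_av:
  assumes "finite A" "finite F" "\<And>i x. i \<in> F \<Longrightarrow> x \<in> A \<Longrightarrow> 0 \<le> u i x"
  shows "pm p A (\<lambda>x. av (\<lambda>i. u i x) F) \<le> av (\<lambda>i. pm p A (u i)) F"
proof -
  have "pm p A (\<lambda>x. av (\<lambda>i. u i x) F) = pm p A (\<lambda>x. 1 / real (card F) * (\<Sum>i\<in>F. u i x))"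
    by (simp add: av_def)
  also have "\<dots> = 1 / real (card F) * pm p A (\<lambda>x. \<Sum>i\<in>F. u i x)"
    using assms by (intro pm_scale sum_nonneg) auto
  also have "\<dots> \<le> 1 / real (card F) * (\<Sum>i\<in>F. pm p A (u i))"
    using assms by (intro mult_left_mono pm_sum) auto
  finally show ?thesis
    by (simp add: av_def)
qed

lemma av_le_pm:
  assumes "finite A" "A \<noteq> {}" "\<And>x. x \<in> A \<Longrightarrow> 0 \<le> u x"
  shows "av u A \<le> pm p A u"
proof -
  have c: "0 < real (card A)" using assms by (simp add: card_gt_0_iff)
  have "(\<Sum>x\<in>A. (1 / real (card A)) *\<^sub>R u x) powr p \<le> (\<Sum>x\<in>A. 1 / real (card A) * u x powr p)"
    using assms c convex_on_powr_nonneg[OF p1] by (intro convex_on_sum) auto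
  then have "av u A powr p \<le> (\<Sum>x\<in>A. u x powr p) / real (card A)"
    by (simp add: av_def sum_divide_distrib)
  then have "(av u A powr p) powr (1 / p) \<le> pm p A u"
    unfolding pm_def using p1 by (intro powr_mono2) auto
  moreover have "0 \<le> av u A"
    using assms by (simp add: av_def sum_nonneg)
  ultimately show ?thesis
    using p1 by (simp add: powr_powr)
qed

text \<open>Hoelder's inequality against the indicator of \<open>A\<close>, obtained from Jensen's
  inequality on \<open>A\<close> and enlarging the domain of the mean to \<open>X\<close>.\<close>

lemma pm_restrict:
  assumes A: "A \<subseteq> X" "finite X" and u: "\<And>x. x \<in> X \<Longrightarrow> 0 \<le> u x"
  shows "(\<Sum>x\<in>A. u x) / real (card X) \<le> (real (card A) / real (card X)) powr (1 - 1 / p) * pm p X u"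
proof (cases "A = {}")
  case False
  have fA: "finite A" using A finite_subset by blast
  have cA: "0 < real (card A)" and cX: "0 < real (card X)"
    using False A fA by (auto simp: card_gt_0_iff)
  let ?\<alpha> = "real (card A) / real (card X)"
  have \<alpha>: "0 < ?\<alpha>" using cA cX by simp
  have "(\<Sum>x\<in>A. u x) / real (card X) = ?\<alpha> * av u A"
    using cA by (simp add: av_def)
  also have "\<dots> \<le> ?\<alpha> * pm p A u"
    using A u fA False \<alpha> by (intro mult_left_mono av_le_pm) auto
  also have "?\<alpha> * pm p A u \<le> ?\<alpha> * (1 / ?\<alpha> * ((\<Sum>x\<in>X. u x powr p) / real (card X))) powr (1 / p)"
  proof (rule mult_left_mono)
    have "(\<Sum>x\<in>A. u x powr p) \<le> (\<Sum>x\<in>X. u x powr p)"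
      using A by (intro sum_mono2) auto
    then have "(\<Sum>x\<in>A. u x powr p) / real (card A) \<le> (\<Sum>x\<in>X. u x powr p) / real (card A)"
      by (intro divide_right_mono) auto
    also have "\<dots> = 1 / ?\<alpha> * ((\<Sum>x\<in>X. u x powr p) / real (card X))"
      using cA cX by simp
    finally show "pm p A u \<le> (1 / ?\<alpha> * ((\<Sum>x\<in>X. u x powr p) / real (card X))) powr (1 / p)"
      unfolding pm_def using p1 by (intro powr_mono2) (auto intro!: divide_nonneg_nonneg sum_nonneg)
  qed (use \<alpha> in simp)
  also have "(1 / ?\<alpha> * ((\<Sum>x\<in>X. u x powr p) / real (card X))) powr (1 / p) = (1 / ?\<alpha>) powr (1 / p) * pm p X u"
    unfolding pm_def using \<alpha> by (subst powr_mult) (auto intro!: divide_nonneg_nonneg sum_nonneg)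
  also have "?\<alpha> * ((1 / ?\<alpha>) powr (1 / p) * pm p X u) = ?\<alpha> powr (1 - 1 / p) * pm p X u"
  proof -
    have "(1 / ?\<alpha>) powr (1 / p) = ?\<alpha> powr (- (1 / p))"
      using \<alpha> by (simp add: powr_minus_divide powr_divide)
    then have "?\<alpha> * (1 / ?\<alpha>) powr (1 / p) = ?\<alpha> powr 1 * ?\<alpha> powr (- (1 / p))"
      using \<alpha> by simp
    also have "\<dots> = ?\<alpha> powr (1 - 1 / p)"
      by (simp only: powr_add[symmetric]) simp
    finally show ?thesis
      by (simp only: mult.assoc[symmetric])
  qed
  finally show ?thesis .
qed (simp add: pm_nonneg)

lemma pm_indicator:
  assumes A: "A \<subseteq> X" "finite X" and G: "0 \<le> G"
  shows "pm p X (\<lambda>x. if x \<in> A then G else 0) = G * (real (card A) / real (card X)) powr (1 / p)"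
proof -
  have "(\<Sum>x\<in>X. (if x \<in> A then G else 0) powr p) = (\<Sum>x\<in>A. G powr p)"
    using A by (intro sum.mono_neutral_cong_right) auto
  then have "(\<Sum>x\<in>X. (if x \<in> A then G else 0) powr p) / real (card X) = G powr p * (real (card A) / real (card X))"
    by simp
  then show ?thesis
    unfolding pm_def using p1 G by (simp only: powr_mult) (simp add: powr_powr)
qed

lemma sum_fibres:
  fixes h :: "'a \<Rightarrow> real"
  assumes "finite A" "finite A'" "\<And>x. x \<in> A \<Longrightarrow> \<tau> x \<in> A'"
  shows "(\<Sum>x\<in>A. h x) = (\<Sum>\<omega>\<in>A'. \<Sum>x\<in>{x \<in> A. \<tau> x = \<omega>}. h x)"
  using assms by (intro sum.group[symmetric]) auto

text \<open>Equal fibres make \<open>\<tau>\<close> measure preserving, so composition with it keeps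
  the norm. Averaging over the fibres is a conditional expectation and contracts the norm, by
  Jensen's inequality on each fibre.\<close>

lemma pm_equidistributed:
  assumes "finite A" "finite A'" "\<And>x. x \<in> A \<Longrightarrow> \<tau> x \<in> A'"
    and c: "\<And>\<omega>. \<omega> \<in> A' \<Longrightarrow> card {x \<in> A. \<tau> x = \<omega>} = c" "0 < c"
  shows "pm p A (\<lambda>x. v (\<tau> x)) = pm p A' v"
    and "(\<And>x. x \<in> A \<Longrightarrow> 0 \<le> u x) \<Longrightarrow> pm p A' (\<lambda>\<omega>. av u {x \<in> A. \<tau> x = \<omega>}) \<le> pm p A u"
proof -
  have cA: "real (card A) = real (card A') * real c"
    using sum_fibres[OF assms(1-3), where h = "\<lambda>_. 1"] c by simp
  have "(\<Sum>x\<in>A. v (\<tau> x) powr p) = (\<Sum>\<omega>\<in>A'. \<Sum>x\<in>{x \<in> A. \<tau> x = \<omega>}. v \<omega> powr p)"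
    by (subst sum_fibres[OF assms(1-3)]) (auto intro!: sum.cong)
  also have "\<dots> = real c * (\<Sum>\<omega>\<in>A'. v \<omega> powr p)"
    using c by (simp add: sum_distrib_left)
  finally have "(\<Sum>x\<in>A. v (\<tau> x) powr p) = real c * (\<Sum>\<omega>\<in>A'. v \<omega> powr p)" .
  then show "pm p A (\<lambda>x. v (\<tau> x)) = pm p A' v"
    unfolding pm_def cA using c(2) by simp
  assume u: "\<And>x. x \<in> A \<Longrightarrow> 0 \<le> u x"
  let ?F = "\<lambda>\<omega>. {x \<in> A. \<tau> x = \<omega>}"
  have "av u (?F \<omega>) powr p \<le> (\<Sum>x\<in>?F \<omega>. u x powr p) / real c" if "\<omega> \<in> A'" for \<omega>
  proof -
    have ne: "?F \<omega> \<noteq> {}"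
      using c(1)[OF that] c(2) by (metis card.empty less_irrefl)
    have "av u (?F \<omega>) \<le> pm p (?F \<omega>) u"
      using assms(1) ne u by (intro av_le_pm) auto
    moreover have "0 \<le> av u (?F \<omega>)"
      using u by (auto simp: av_def intro!: divide_nonneg_nonneg sum_nonneg)
    ultimately have "av u (?F \<omega>) powr p \<le> pm p (?F \<omega>) u powr p"
      using p1 by (intro powr_mono2) auto
    then show ?thesis
      using c(1)[OF that] by (simp add: pm_powr)
  qed
  then have "(\<Sum>\<omega>\<in>A'. av u (?F \<omega>) powr p) \<le> (\<Sum>\<omega>\<in>A'. (\<Sum>x\<in>?F \<omega>. u x powr p) / real c)"
    by (rule sum_mono)
  also have "\<dots> = (\<Sum>x\<in>A. u x powr p) / real c"
    by (simp only: sum_fibres[OF assms(1-3), where h = "\<lambda>x. u x powr p"] sum_divide_distrib)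
  finally have "(\<Sum>\<omega>\<in>A'. av u (?F \<omega>) powr p) / real (card A') \<le> (\<Sum>x\<in>A. u x powr p) / real c / real (card A')"
    by (rule divide_right_mono) simp
  then show "pm p A' (\<lambda>\<omega>. av u (?F \<omega>)) \<le> pm p A u"
    unfolding pm_def cA using p1
    by (intro powr_mono2) (auto intro!: divide_nonneg_nonneg sum_nonneg simp: mult.commute)
qed

end

lemma L2_set_sum:
  "finite F \<Longrightarrow> L2_set (\<lambda>i. \<Sum>x\<in>F. f x i) A \<le> (\<Sum>x\<in>F. L2_set (f x) A)"
proof (induction F rule: finite_induct)
  case empty
  then show ?case by (simp add: L2_set_def)
next
  case (insert x F)
  then show ?case
    using L2_set_triangle_ineq[of "f x" "\<lambda>i. \<Sum>x\<in>F. f x i" A] by simp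
qed

lemma L2_set_av:
  assumes "finite F"
  shows "L2_set (\<lambda>i. av (\<lambda>x. f x i) F) A \<le> av (\<lambda>x. L2_set (f x) A) F"
proof -
  have "L2_set (\<lambda>i. av (\<lambda>x. f x i) F) A = L2_set (\<lambda>i. 1 / real (card F) * (\<Sum>x\<in>F. f x i)) A"
    by (simp add: av_def)
  also have "\<dots> = 1 / real (card F) * L2_set (\<lambda>i. \<Sum>x\<in>F. f x i) A"
    by (rule L2_set_right_distrib[symmetric]) simp
  also have "\<dots> \<le> 1 / real (card F) * (\<Sum>x\<in>F. L2_set (f x) A)"
    using L2_set_sum[OF assms] by (intro mult_left_mono) auto
  finally show ?thesis
    by (simp add: av_def)
qed

lemma av_mono: "(\<And>x. x \<in> F \<Longrightarrow> u x \<le> v x) \<Longrightarrow> av u F \<le> av v F"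
  unfolding av_def by (intro divide_right_mono sum_mono) auto

lemma av_nonneg: "(\<And>x. x \<in> F \<Longrightarrow> 0 \<le> u x) \<Longrightarrow> 0 \<le> av u F"
  unfolding av_def by (intro divide_nonneg_nonneg sum_nonneg) auto

lemma abs_av_Lv: "\<bar>av f (Lv N)\<bar> \<le> (\<Sum>x\<in>Lv N. \<bar>f x\<bar>) / 2 ^ N"
  by (simp add: av_def abs_divide divide_right_mono)

section \<open>Square functions, mixed norms and the duality pairing on coefficients\<close>

definition sqf :: "nat \<Rightarrow> (bool list \<Rightarrow> bool list \<Rightarrow> real) \<Rightarrow> bool list \<Rightarrow> bool list \<Rightarrow> real" where
  "sqf N a x y = L2_set (\<lambda>(i, j). a (take i x) (take j y)) ({..N} \<times> {..N})"

lemma sqf_sq2: "sqf N a x y = sqrt (sq2 N a x y)"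
  by (simp add: sqf_def sq2_def L2_set_def sum.cartesian_product case_prod_unfold)

lemma sqf_nonneg: "0 \<le> sqf N a x y"
  by (simp add: sqf_def)

definition cnorm :: "real \<Rightarrow> real \<Rightarrow> nat \<Rightarrow> (bool list \<Rightarrow> bool list \<Rightarrow> real) \<Rightarrow> real" where
  "cnorm p q N a = pm p (Lv N) (\<lambda>x. pm q (Lv N) (\<lambda>y. sqf N a x y))"

text \<open>The integral of the product of the two Haar sums: the squared \<open>L^2\<close> norm of
  the Haar function at \<open>K\<close> is 2^-length K.\<close>

definition pairing :: "nat \<Rightarrow> (bool list \<Rightarrow> bool list \<Rightarrow> real) \<Rightarrow> (bool list \<Rightarrow> bool list \<Rightarrow> real) \<Rightarrow> real" where
  "pairing N a g = (\<Sum>K\<in>idx N. \<Sum>L\<in>idx N. a K L * g K L / 2 ^ length K / 2 ^ length L)"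

text \<open>A node \<open>K\<close> is an ancestor of the fraction 2^-length K of all
  leaves.\<close>

lemma sum_idx_leaves:
  fixes h :: "bool list \<Rightarrow> real"
  shows "(\<Sum>K\<in>idx N. h K / 2 ^ length K) = av (\<lambda>x. \<Sum>i\<le>N. h (take i x)) (Lv N)"
proof -
  have level: "(\<Sum>x\<in>Lv N. h (take i x)) = (\<Sum>K\<in>Lv i. h K) * 2 ^ (N - i)" if "i \<le> N" for i
  proof -
    have c: "real (card {x \<in> Lv N. take i x = K}) = 2 ^ (N - i)" if K: "K \<in> Lv i" for K
    proof -
      have "{x \<in> Lv N. take i x = K} = {x \<in> Lv N. \<forall>d\<in>{..<i}. x ! d = K ! d}"
        using K \<open>i \<le> N\<close> by (auto simp: list_eq_iff_nth_eq)
      then have "card {x \<in> Lv N. take i x = K} * 2 ^ i = 2 ^ N"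
        using card_fixed_digits[of "{..<i}" N "(!) K"] \<open>i \<le> N\<close> by simp
      moreover have "(2::nat) ^ N = 2 ^ (N - i) * 2 ^ i"
        using \<open>i \<le> N\<close> by (simp flip: power_add)
      ultimately have "card {x \<in> Lv N. take i x = K} = 2 ^ (N - i)"
        by simp
      then show ?thesis by simp
    qed
    have "(\<Sum>x\<in>Lv N. h (take i x)) = (\<Sum>K\<in>Lv i. \<Sum>x\<in>{x \<in> Lv N. take i x = K}. h (take i x))"
      using that by (intro sum.group[symmetric]) auto
    also have "\<dots> = (\<Sum>K\<in>Lv i. real (card {x \<in> Lv N. take i x = K}) * h K)"
      by (intro sum.cong refl) simp
    also have "\<dots> = (\<Sum>K\<in>Lv i. 2 ^ (N - i) * h K)"
      by (intro sum.cong refl) (simp only: c)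
    also have "\<dots> = (\<Sum>K\<in>Lv i. h K) * 2 ^ (N - i)"
      by (simp add: sum_distrib_right mult.commute)
    finally show ?thesis .
  qed
  have "av (\<lambda>x. \<Sum>i\<le>N. h (take i x)) (Lv N) = (\<Sum>i\<le>N. \<Sum>x\<in>Lv N. h (take i x)) / 2 ^ N"
    unfolding av_def by (subst sum.swap) simp
  also have "\<dots> = (\<Sum>i\<le>N. (\<Sum>K\<in>Lv i. h K) * 2 ^ (N - i)) / 2 ^ N"
    by (simp add: level)
  also have "\<dots> = (\<Sum>i\<le>N. \<Sum>K\<in>Lv i. h K / 2 ^ length K)"
    unfolding sum_divide_distrib by (intro sum.cong refl) (simp add: power_diff sum_divide_distrib)
  also have "\<dots> = (\<Sum>K\<in>(\<Union>i\<in>{..N}. Lv i). h K / 2 ^ length K)"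
    by (rule sum.UNION_disjoint[symmetric]) auto
  also have "(\<Union>i\<in>{..N}. Lv i) = idx N"
    by auto
  finally show ?thesis ..
qed

lemma pairing_leaves:
  "pairing N a g = av (\<lambda>x. av (\<lambda>y. \<Sum>i\<le>N. \<Sum>j\<le>N. a (take i x) (take j y) * g (take i x) (take j y)) (Lv N)) (Lv N)"
proof -
  have "pairing N a g = (\<Sum>K\<in>idx N. (\<Sum>L\<in>idx N. a K L * g K L / 2 ^ length L) / 2 ^ length K)"
    by (simp add: pairing_def sum_divide_distrib mult.commute)
  also have "\<dots> = av (\<lambda>x. \<Sum>i\<le>N. av (\<lambda>y. \<Sum>j\<le>N. a (take i x) (take j y) * g (take i x) (take j y)) (Lv N)) (Lv N)"
    by (simp only: sum_idx_leaves)
  also have "(\<lambda>x. \<Sum>i\<le>N. av (\<lambda>y. \<Sum>j\<le>N. a (take i x) (take j y) * g (take i x) (take j y)) (Lv N))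
      = (\<lambda>x. av (\<lambda>y. \<Sum>i\<le>N. \<Sum>j\<le>N. a (take i x) (take j y) * g (take i x) (take j y)) (Lv N))"
    unfolding av_def by (subst sum.swap) (simp add: sum_divide_distrib)
  finally show ?thesis .
qed

locale mixed_exponents =
  fixes p q :: real
  assumes p: "1 \<le> p" and q: "1 \<le> q"
begin

sublocale P: pm_exponent p by standard (rule p)
sublocale Q: pm_exponent q by standard (rule q)

lemma cnorm_nonneg: "0 \<le> cnorm p q N a"
  by (simp add: cnorm_def pm_nonneg)

lemma cnorm_scale: "cnorm p q N (c *\<^sub>R a) = \<bar>c\<bar> * cnorm p q N a"
proof -
  have "sqf N (c *\<^sub>R a) x y = \<bar>c\<bar> * sqf N a x y" for x y
    by (simp add: sqf_sq2 sq2_def power_mult_distrib sum_distrib_left[symmetric] real_sqrt_mult)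
  then show ?thesis
    by (simp add: cnorm_def Q.pm_scale P.pm_scale sqf_nonneg pm_nonneg)
qed

lemma cnorm_add: "cnorm p q N (a + b) \<le> cnorm p q N a + cnorm p q N b"
proof -
  have "sqf N (a + b) x y \<le> sqf N a x y + sqf N b x y" for x y
    unfolding sqf_def using L2_set_triangle_ineq[of "\<lambda>(i, j). a (take i x) (take j y)"
      "\<lambda>(i, j). b (take i x) (take j y)"] by (simp add: case_prod_unfold)
  then have "cnorm p q N (a + b) \<le> pm p (Lv N) (\<lambda>x. pm q (Lv N) (\<lambda>y. sqf N a x y + sqf N b x y))"
    unfolding cnorm_def by (intro P.pm_mono Q.pm_mono sqf_nonneg pm_nonneg)
  also have "\<dots> \<le> pm p (Lv N) (\<lambda>x. pm q (Lv N) (sqf N a x) + pm q (Lv N) (sqf N b x))"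
    by (intro P.pm_mono Q.pm_add pm_nonneg sqf_nonneg) auto
  also have "\<dots> \<le> cnorm p q N a + cnorm p q N b"
    unfolding cnorm_def by (intro P.pm_add pm_nonneg) auto
  finally show ?thesis .
qed

lemma flat2_sqf:
  assumes "flat2 N A C G g" "0 \<le> G" "x \<in> Lv N" "y \<in> Lv N"
  shows "sqf N g x y \<le> (if x \<in> A \<and> y \<in> C then G else 0)"
proof -
  have "sqf N g x y \<le> sqrt (if x \<in> A \<and> y \<in> C then G\<^sup>2 else 0)"
    using assms unfolding sqf_sq2 flat2_def by (intro real_sqrt_le_mono) blast
  then show ?thesis
    using assms(2) by (auto split: if_splits)
qed

lemma cnorm_flat:
  assumes g: "flat2 N A C G g" "0 \<le> G" and A: "A \<subseteq> Lv N" and C: "C \<subseteq> Lv N"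
  shows "cnorm p q N g \<le> G * (real (card A) / 2 ^ N) powr (1 / p) * (real (card C) / 2 ^ N) powr (1 / q)"
proof -
  let ?c = "G * (real (card C) / 2 ^ N) powr (1 / q)"
  have "pm q (Lv N) (sqf N g x) \<le> (if x \<in> A then ?c else 0)" if x: "x \<in> Lv N" for x
  proof -
    have "pm q (Lv N) (sqf N g x) \<le> pm q (Lv N) (\<lambda>y. if y \<in> C then (if x \<in> A then G else 0) else 0)"
    proof (rule Q.pm_mono)
      fix y assume "y \<in> Lv N"
      then show "sqf N g x y \<le> (if y \<in> C then (if x \<in> A then G else 0) else 0)"
        using flat2_sqf[OF g x, of y] by (auto split: if_splits)
    qed (rule sqf_nonneg)
    also have "\<dots> = (if x \<in> A then G else 0) * (real (card C) / real (card (Lv N))) powr (1 / q)"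
      using C g by (intro Q.pm_indicator) auto
    finally show ?thesis by auto
  qed
  then have "cnorm p q N g \<le> pm p (Lv N) (\<lambda>x. if x \<in> A then ?c else 0)"
    unfolding cnorm_def by (intro P.pm_mono pm_nonneg)
  also have "\<dots> = ?c * (real (card A) / real (card (Lv N))) powr (1 / p)"
    using A g by (intro P.pm_indicator) auto
  finally show ?thesis
    by (simp add: mult_ac)
qed

text \<open>An upper bound for the dual norm of a flat function. Cauchy-Schwarz for the coefficients
  at each pair of leaves reduces the pairing to the square functions; Hoelder's inequality in the
  form \<open>pm_restrict\<close> is then applied in \<open>y\<close> and in \<open>x\<close>
  separately, which respects the mixed norm.\<close>

lemma pairing_flat:
  assumes g: "flat2 N A C G g" "0 \<le> G" and A: "A \<subseteq> Lv N" and C: "C \<subseteq> Lv N"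
  shows "\<bar>pairing N u g\<bar> \<le> G * (real (card A) / 2 ^ N) powr (1 - 1 / p) * (real (card C) / 2 ^ N) powr (1 - 1 / q) * cnorm p q N u"
proof -
  let ?\<gamma> = "(real (card C) / 2 ^ N) powr (1 - 1 / q)"
  let ?s = "\<lambda>x y. \<Sum>i\<le>N. \<Sum>j\<le>N. u (take i x) (take j y) * g (take i x) (take j y)"
  have s: "\<bar>?s x y\<bar> \<le> sqf N u x y * (if x \<in> A \<and> y \<in> C then G else 0)" if x: "x \<in> Lv N" and y: "y \<in> Lv N" for x y
  proof -
    let ?f = "\<lambda>(i, j). u (take i x) (take j y)" and ?h = "\<lambda>(i, j). g (take i x) (take j y)"
    have "?s x y = (\<Sum>z\<in>{..N} \<times> {..N}. ?f z * ?h z)"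
      by (simp add: sum.cartesian_product case_prod_unfold)
    then have "\<bar>?s x y\<bar> \<le> (\<Sum>z\<in>{..N} \<times> {..N}. \<bar>?f z\<bar> * \<bar>?h z\<bar>)"
      using sum_abs[of "\<lambda>z. ?f z * ?h z" "{..N} \<times> {..N}"] by (simp add: abs_mult)
    also have "\<dots> \<le> sqf N u x y * sqf N g x y"
      unfolding sqf_def by (rule L2_set_mult_ineq)
    also have "\<dots> \<le> sqf N u x y * (if x \<in> A \<and> y \<in> C then G else 0)"
      by (intro mult_left_mono flat2_sqf[OF g x y] sqf_nonneg)
    finally show ?thesis .
  qed
  have inner: "\<bar>av (?s x) (Lv N)\<bar> \<le> (if x \<in> A then G * ?\<gamma> * pm q (Lv N) (sqf N u x) else 0)" if x: "x \<in> Lv N" for x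
  proof -
    have "\<bar>av (?s x) (Lv N)\<bar> \<le> (\<Sum>y\<in>Lv N. \<bar>?s x y\<bar>) / 2 ^ N"
      by (rule abs_av_Lv)
    also have "\<dots> \<le> (\<Sum>y\<in>Lv N. sqf N u x y * (if x \<in> A \<and> y \<in> C then G else 0)) / 2 ^ N"
      using s[OF x] by (intro divide_right_mono sum_mono) auto
    also have "(\<Sum>y\<in>Lv N. sqf N u x y * (if x \<in> A \<and> y \<in> C then G else 0))
        = (if x \<in> A then G * (\<Sum>y\<in>C. sqf N u x y) else 0)"
      using C by (auto simp: sum_distrib_left mult.commute intro!: sum.mono_neutral_cong_right)
    finally have *: "\<bar>av (?s x) (Lv N)\<bar> \<le> (if x \<in> A then G * (\<Sum>y\<in>C. sqf N u x y) else 0) / 2 ^ N" .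
    have "(\<Sum>y\<in>C. sqf N u x y) / 2 ^ N \<le> ?\<gamma> * pm q (Lv N) (sqf N u x)"
      using Q.pm_restrict[OF C finite_Lv, of "sqf N u x"] sqf_nonneg by simp
    then have "G * ((\<Sum>y\<in>C. sqf N u x y) / 2 ^ N) \<le> G * (?\<gamma> * pm q (Lv N) (sqf N u x))"
      using g(2) by (rule mult_left_mono)
    then show ?thesis
      using * by (auto simp: mult.assoc)
  qed
  have "\<bar>pairing N u g\<bar> \<le> (\<Sum>x\<in>Lv N. \<bar>av (?s x) (Lv N)\<bar>) / 2 ^ N"
    unfolding pairing_leaves by (rule abs_av_Lv)
  also have "\<dots> \<le> (\<Sum>x\<in>Lv N. if x \<in> A then G * ?\<gamma> * pm q (Lv N) (sqf N u x) else 0) / 2 ^ N"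
    using inner by (intro divide_right_mono sum_mono) auto
  also have "(\<Sum>x\<in>Lv N. if x \<in> A then G * ?\<gamma> * pm q (Lv N) (sqf N u x) else 0)
      = G * ?\<gamma> * (\<Sum>x\<in>A. pm q (Lv N) (sqf N u x))"
    unfolding sum_distrib_left using A by (intro sum.mono_neutral_cong_right) auto
  also have "G * ?\<gamma> * (\<Sum>x\<in>A. pm q (Lv N) (sqf N u x)) / 2 ^ N
      = G * ?\<gamma> * ((\<Sum>x\<in>A. pm q (Lv N) (sqf N u x)) / 2 ^ N)"
    by simp
  also have "\<dots> \<le> G * ?\<gamma> * ((real (card A) / 2 ^ N) powr (1 - 1 / p) * cnorm p q N u)"
    unfolding cnorm_def using P.pm_restrict[OF A finite_Lv, of "\<lambda>x. pm q (Lv N) (sqf N u x)"] pm_nonneg g(2)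
    by (intro mult_left_mono) auto
  finally show ?thesis
    by (simp add: mult_ac)
qed

lemma powr_conjugate:
  fixes \<alpha> s :: real
  assumes "0 \<le> \<alpha>"
  shows "\<alpha> powr (1 / s) * \<alpha> powr (1 - 1 / s) = \<alpha>"
proof (cases "\<alpha> = 0")
  case False
  have "\<alpha> powr (1 / s) * \<alpha> powr (1 - 1 / s) = \<alpha> powr (1 / s + (1 - 1 / s))"
    by (rule powr_add[symmetric])
  also have "\<dots> = \<alpha>"
    using assms False by simp
  finally show ?thesis .
qed simp

text \<open>\<open>D\<close> stands for a bound of the dual norm of \<open>g\<close>. Multiplying
  \<open>cnorm_flat\<close> for \<open>f\<close> by \<open>pairing_flat\<close> for \<open>g\<close>
  brings together conjugate powers of the measures of \<open>A\<close> and of \<open>C\<close>, and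
  \<open>powr_conjugate\<close> removes the exponents.\<close>

lemma form2_bdI:
  assumes \<Gamma>: "0 \<le> \<Gamma>" and t: "\<And>f g D. 0 \<le> D \<Longrightarrow> (\<And>u. \<bar>pairing N u g\<bar> \<le> D * cnorm p q N u) \<Longrightarrow> \<bar>t f g\<bar> \<le> \<Gamma> * cnorm p q N f * D"
  shows "form2_bd N \<Gamma> t"
  unfolding form2_bd_def
proof (intro allI impI, elim conjE)
  fix A C G G' f g assume A: "A \<subseteq> Lv N" and C: "C \<subseteq> Lv N" and G: "0 \<le> G" "0 \<le> G'"
    and f: "flat2 N A C G f" and g: "flat2 N A C G' g"
  let ?\<alpha> = "real (card A) / 2 ^ N" and ?\<gamma> = "real (card C) / 2 ^ N"
  let ?D = "G' * ?\<alpha> powr (1 - 1 / p) * ?\<gamma> powr (1 - 1 / q)"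
  have "\<bar>t f g\<bar> \<le> \<Gamma> * cnorm p q N f * ?D"
    using pairing_flat[OF g G(2) A C] G by (intro t) auto
  also have "\<dots> \<le> \<Gamma> * (G * ?\<alpha> powr (1 / p) * ?\<gamma> powr (1 / q)) * ?D"
    using cnorm_flat[OF f G(1) A C] \<Gamma> G by (intro mult_right_mono mult_left_mono) auto
  also have "\<dots> = \<Gamma> * G * G' * ((?\<alpha> powr (1 / p) * ?\<alpha> powr (1 - 1 / p)) * (?\<gamma> powr (1 / q) * ?\<gamma> powr (1 - 1 / q)))"
    by (simp only: mult_ac)
  also have "\<dots> = \<Gamma> * G * G' * (?\<alpha> * ?\<gamma>)"
    by (simp only: powr_conjugate divide_nonneg_nonneg of_nat_0_le_iff zero_le_power zero_le_numeral)
  finally show "\<bar>t f g\<bar> \<le> \<Gamma> * G * G' * (?\<alpha> * ?\<gamma>)" .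
qed

end

section \<open>Embedding and projection of a pair of block systems\<close>

context block_system
begin

lemma lift_at:
  assumes x: "x \<in> Lv N" and i: "i \<le> N"
  shows "(\<Sum>I\<in>idx n. ind (B I) (take i x) * f I) = (\<Sum>k\<le>n. if i = \<kappa> k x then f (take k (\<tau> x)) else 0)"
proof -
  let ?b = "\<lambda>k. take k (\<tau> x)"
  have len: "length (\<tau> x) = n" using tau_mem[OF x] by simp
  have inj: "inj_on ?b {..n}"
    by (rule inj_onI) (metis atMost_iff len length_take min.absorb2)
  have "(\<Sum>I\<in>idx n. ind (B I) (take i x) * f I) = (\<Sum>I\<in>?b ` {..n}. ind (B I) (take i x) * f I)"
  proof (rule sum.mono_neutral_right)
    show "\<forall>I\<in>idx n - ?b ` {..n}. ind (B I) (take i x) * f I = 0"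
    proof
      fix I assume I: "I \<in> idx n - ?b ` {..n}"
      then have "take (length I) (\<tau> x) \<noteq> I" by force
      then have "take i x \<notin> B I"
        using B_iff[OF x i, of I] I by blast
      then show "ind (B I) (take i x) * f I = 0"
        by (simp add: ind_def)
    qed
  qed (auto simp: len)
  also have "\<dots> = (\<Sum>k\<le>n. ind (B (?b k)) (take i x) * f (?b k))"
    by (subst sum.reindex[OF inj]) simp
  also have "\<dots> = (\<Sum>k\<le>n. if i = \<kappa> k x then f (?b k) else 0)"
  proof (rule sum.cong [OF refl])
    fix k assume "k \<in> {..n}"
    then have "?b k \<in> idx n" "length (?b k) = k" by (auto simp: len)
    then show "ind (B (?b k)) (take i x) * f (?b k) = (if i = \<kappa> k x then f (?b k) else 0)"
      using B_iff[OF x i, of "?b k"] by (simp add: ind_def)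
  qed
  finally show ?thesis .
qed

text \<open>By \<open>kappa_inj\<close> different \<open>k\<close> are met at different levels, so
  no two terms are added before squaring.\<close>

lemma sum_levels:
  assumes x: "x \<in> Lv N"
  shows "(\<Sum>i\<le>N. (\<Sum>k\<le>n. if i = \<kappa> k x then g k else 0)\<^sup>2) = (\<Sum>k\<le>n. (g k :: real)\<^sup>2)"
proof -
  let ?h = "\<lambda>i. (\<Sum>k\<le>n. if i = \<kappa> k x then g k else 0)\<^sup>2"
  have "(\<Sum>i\<le>N. ?h i) = (\<Sum>i\<in>(\<lambda>k. \<kappa> k x) ` {..n}. ?h i)"
  proof (rule sum.mono_neutral_right)
    show "(\<lambda>k. \<kappa> k x) ` {..n} \<subseteq> {..N}"
      using kappa_le[OF x] by auto
    show "\<forall>i\<in>{..N} - (\<lambda>k. \<kappa> k x) ` {..n}. ?h i = 0"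
      by (auto intro!: sum.neutral)
  qed simp
  also have "\<dots> = (\<Sum>k\<le>n. ?h (\<kappa> k x))"
    by (subst sum.reindex[OF kappa_inj[OF x]]) simp
  also have "\<dots> = (\<Sum>k\<le>n. (g k)\<^sup>2)"
  proof (rule sum.cong [OF refl])
    fix k assume k: "k \<in> {..n}"
    have "(\<Sum>k'\<le>n. if \<kappa> k x = \<kappa> k' x then g k' else 0) = (\<Sum>k'\<le>n. if k' = k then g k else 0)"
    proof (rule sum.cong [OF refl])
      fix k' assume "k' \<in> {..n}"
      then have "\<kappa> k x = \<kappa> k' x \<longleftrightarrow> k' = k"
        using inj_onD[OF kappa_inj[OF x], of k k'] k by blast
      then show "(if \<kappa> k x = \<kappa> k' x then g k' else 0) = (if k' = k then g k else 0)"
        by auto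
    qed
    then show "?h (\<kappa> k x) = (g k)\<^sup>2"
      using k by simp
  qed
  finally show ?thesis .
qed

definition fibre_of :: "bool list \<Rightarrow> bool list set" where
  "fibre_of \<omega> = {x \<in> Lv N. \<tau> x = \<omega>}"

lemma fibre_ofD: "x \<in> fibre_of \<omega> \<Longrightarrow> x \<in> Lv N" "x \<in> fibre_of \<omega> \<Longrightarrow> \<tau> x = \<omega>"
  unfolding fibre_of_def by blast+

lemma finite_fibre_of [simp]: "finite (fibre_of \<omega>)"
  unfolding fibre_of_def by (rule finite_Lv_filter)

lemma card_fibre_of:
  assumes "\<omega> \<in> Lv n"
  shows "card (fibre_of \<omega>) = 2 ^ N div 2 ^ n" "0 < (2 ^ N div 2 ^ n :: nat)" "real (card (fibre_of \<omega>)) = 2 ^ N / 2 ^ n"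
proof -
  have c: "card (fibre_of \<omega>) * 2 ^ n = 2 ^ N"
    using fibre0[OF assms] by (simp add: fibre_of_def)
  show 1: "card (fibre_of \<omega>) = 2 ^ N div 2 ^ n"
    unfolding c[symmetric] by simp
  have "card (fibre_of \<omega>) \<noteq> 0"
  proof
    assume "card (fibre_of \<omega>) = 0"
    then have "(2::nat) ^ N = 0" using c by simp
    then show False by simp
  qed
  then show "0 < (2 ^ N div 2 ^ n :: nat)"
    unfolding 1[symmetric] by (rule neq0_conv[THEN iffD1])
  have "real (card (fibre_of \<omega>)) * 2 ^ n = 2 ^ N"
    using arg_cong[OF c, of real] by simp
  then show "real (card (fibre_of \<omega>)) = 2 ^ N / 2 ^ n"
    by (simp add: field_simps)
qed

text \<open>By the condition \<open>fibre\<close>, each node \<open>K\<close> of the block receives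
  a share of the fibre proportional to 2^-length K. The weighted sum over the block is therefore a
  mean over the fibre.\<close>

lemma restrict_at:
  assumes \<omega>: "\<omega> \<in> Lv n" and k: "k \<le> n"
  shows "2 ^ k * (\<Sum>K\<in>B (take k \<omega>). h K / 2 ^ length K) = av (\<lambda>x. h (take (\<kappa> k x) x)) (fibre_of \<omega>)"
proof -
  let ?I = "take k \<omega>"
  have I: "?I \<in> idx n" "length ?I = k" using \<omega> k by auto
  let ?F = "\<lambda>K. {x \<in> fibre_of \<omega>. take (\<kappa> k x) x = K}"
  have mem: "take (\<kappa> k x) x \<in> B ?I" if "x \<in> fibre_of \<omega>" for x
    using B_iff[OF fibre_ofD(1)[OF that] _ I(1), of "\<kappa> k x"] kappa_le[OF fibre_ofD(1)[OF that] k]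
      fibre_ofD(2)[OF that] I(2) by simp
  have cF: "real (card (?F K)) = 2 ^ N * 2 ^ k / (2 ^ length K * 2 ^ n)" if K: "K \<in> B ?I" for K
  proof -
    have "?F K = {x \<in> Lv N. \<tau> x = \<omega> \<and> take (length K) x = K}"
    proof (intro equalityI subsetI)
      fix x assume x: "x \<in> ?F K"
      then have xL: "x \<in> Lv N" "\<tau> x = \<omega>" "take (\<kappa> k x) x = K"
        using fibre_ofD by auto
      then have "length K = \<kappa> k x"
        using kappa_le[OF xL(1) k] by auto
      then show "x \<in> {x \<in> Lv N. \<tau> x = \<omega> \<and> take (length K) x = K}"
        using xL by simp
    next
      fix x assume x: "x \<in> {x \<in> Lv N. \<tau> x = \<omega> \<and> take (length K) x = K}"
      then have "length K = \<kappa> k x"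
        using B_through(1)[OF I(1) K, of x] I(2) by auto
      then show "x \<in> ?F K"
        using x by (simp add: fibre_of_def)
    qed
    then have "card (?F K) * (2 ^ length K * 2 ^ n) = 2 ^ N * 2 ^ k"
      using fibre[OF I(1) K \<omega>] I(2) by simp
    from arg_cong[OF this, of real] have "real (card (?F K)) * (2 ^ length K * 2 ^ n) = 2 ^ N * 2 ^ k"
      by (simp only: of_nat_mult of_nat_power of_nat_numeral)
    then show ?thesis
      by (simp add: field_simps)
  qed
  have "(\<Sum>x\<in>fibre_of \<omega>. h (take (\<kappa> k x) x)) = (\<Sum>K\<in>B ?I. \<Sum>x\<in>?F K. h (take (\<kappa> k x) x))"
    using mem finite_B[OF I(1)] by (intro sum.group[symmetric]) auto
  also have "\<dots> = (\<Sum>K\<in>B ?I. real (card (?F K)) * h K)"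
    by (intro sum.cong refl) simp
  also have "\<dots> = (\<Sum>K\<in>B ?I. 2 ^ N / 2 ^ n * (2 ^ k * (h K / 2 ^ length K)))"
    by (intro sum.cong refl) (simp add: cF mult_ac)
  also have "\<dots> = 2 ^ N / 2 ^ n * (2 ^ k * (\<Sum>K\<in>B ?I. h K / 2 ^ length K))"
    by (simp only: sum_distrib_left)
  finally show ?thesis
    by (simp add: av_def card_fibre_of(3)[OF \<omega>])
qed

end

locale block_pair = B: block_system n N B \<tau> \<kappa> + C: block_system n N C \<sigma> \<nu>
  for n N B \<tau> \<kappa> C \<sigma> \<nu>
begin

definition lift :: "(bool list \<Rightarrow> bool list \<Rightarrow> real) \<Rightarrow> bool list \<Rightarrow> bool list \<Rightarrow> real" where
  "lift a = (\<lambda>K L. \<Sum>I\<in>idx n. ind (B I) K * (\<Sum>J\<in>idx n. ind (C J) L * a I J))"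

text \<open>The adjoint of \<open>lift\<close> for the pairing, see \<open>pairing_rest\<close>. The
  weights make it a left inverse of \<open>lift\<close> and, by \<open>rest_at2\<close>, an average
  over fibres, which is why it is a contraction.\<close>

definition rest :: "(bool list \<Rightarrow> bool list \<Rightarrow> real) \<Rightarrow> bool list \<Rightarrow> bool list \<Rightarrow> real" where
  "rest a = (\<lambda>I J. 2 ^ length I * (\<Sum>K\<in>B I. (2 ^ length J * (\<Sum>L\<in>C J. a K L / 2 ^ length L)) / 2 ^ length K))"

lemma lift_at2:
  assumes "x \<in> Lv N" "y \<in> Lv N" "i \<le> N" "j \<le> N"
  shows "lift a (take i x) (take j y)
    = (\<Sum>k\<le>n. if i = \<kappa> k x then (\<Sum>l\<le>n. if j = \<nu> l y then a (take k (\<tau> x)) (take l (\<sigma> y)) else 0) else 0)"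
  unfolding lift_def using assms by (simp add: B.lift_at C.lift_at del: Lv_iff)

text \<open>A pointwise identity: lifting composes the square function with the measure preserving
  maps. Hence \<open>lift\<close> is isometric in all mixed norms.\<close>

lemma sq2_lift:
  assumes x: "x \<in> Lv N" and y: "y \<in> Lv N"
  shows "sq2 N (lift a) x y = sq2 n a (\<tau> x) (\<sigma> y)"
proof -
  let ?a = "\<lambda>k l. a (take k (\<tau> x)) (take l (\<sigma> y))"
  have "sq2 N (lift a) x y
      = (\<Sum>j\<le>N. \<Sum>i\<le>N. (\<Sum>k\<le>n. if i = \<kappa> k x then (\<Sum>l\<le>n. if j = \<nu> l y then ?a k l else 0) else 0)\<^sup>2)"
    unfolding sq2_def by (subst sum.swap) (simp add: lift_at2[OF x y])
  also have "\<dots> = (\<Sum>k\<le>n. \<Sum>j\<le>N. (\<Sum>l\<le>n. if j = \<nu> l y then ?a k l else 0)\<^sup>2)"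
    unfolding B.sum_levels[OF x] by (rule sum.swap)
  also have "\<dots> = sq2 n a (\<tau> x) (\<sigma> y)"
    unfolding C.sum_levels[OF y] sq2_def ..
  finally show ?thesis .
qed

lemma rest_at2:
  assumes \<omega>: "\<omega> \<in> Lv n" and \<upsilon>: "\<upsilon> \<in> Lv n" and kl: "k \<le> n" "l \<le> n"
  shows "rest a (take k \<omega>) (take l \<upsilon>)
    = av (\<lambda>x. av (\<lambda>y. a (take (\<kappa> k x) x) (take (\<nu> l y) y)) (C.fibre_of \<upsilon>)) (B.fibre_of \<omega>)"
proof -
  have len: "length (take k \<omega>) = k" "length (take l \<upsilon>) = l"
    using assms by auto
  show ?thesis
    unfolding rest_def len C.restrict_at[OF \<upsilon> kl(2)]
    by (rule B.restrict_at[OF \<omega> kl(1)])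
qed

text \<open>Every coefficient of \<open>rest a\<close> on the branches is an average of coefficients
  of \<open>a\<close>, so Minkowski's inequality in \<open>L2_set\<close> bounds the square function
  by the average of square functions. For fixed leaves the coefficients that occur sit at distinct
  pairs of levels, hence are part of the full square function.\<close>

lemma sqf_rest:
  assumes \<omega>: "\<omega> \<in> Lv n" and \<upsilon>: "\<upsilon> \<in> Lv n"
  shows "sqf n (rest a) \<omega> \<upsilon> \<le> av (\<lambda>x. av (\<lambda>y. sqf N a x y) (C.fibre_of \<upsilon>)) (B.fibre_of \<omega>)"
proof -
  let ?g = "\<lambda>x y (k, l). a (take (\<kappa> k x) x) (take (\<nu> l y) y)"
  let ?P = "{..n} \<times> {..n}"
  have "sqf n (rest a) \<omega> \<upsilon> = L2_set (\<lambda>z. av (\<lambda>x. av (\<lambda>y. ?g x y z) (C.fibre_of \<upsilon>)) (B.fibre_of \<omega>)) ?P"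
    unfolding sqf_def by (rule L2_set_cong) (auto simp: rest_at2[OF \<omega> \<upsilon>])
  also have "\<dots> \<le> av (\<lambda>x. L2_set (\<lambda>z. av (\<lambda>y. ?g x y z) (C.fibre_of \<upsilon>)) ?P) (B.fibre_of \<omega>)"
    by (rule L2_set_av) simp
  also have "\<dots> \<le> av (\<lambda>x. av (\<lambda>y. L2_set (?g x y) ?P) (C.fibre_of \<upsilon>)) (B.fibre_of \<omega>)"
    by (intro av_mono L2_set_av) simp
  also have "\<dots> \<le> av (\<lambda>x. av (\<lambda>y. sqf N a x y) (C.fibre_of \<upsilon>)) (B.fibre_of \<omega>)"
  proof (intro av_mono)
    fix x y assume x: "x \<in> B.fibre_of \<omega>" and y: "y \<in> C.fibre_of \<upsilon>"
    note xL = B.fibre_ofD(1)[OF x] and yL = C.fibre_ofD(1)[OF y]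
    let ?m = "\<lambda>(k, l). (\<kappa> k x, \<nu> l y)"
    let ?f = "\<lambda>(i, j). a (take i x) (take j y)"
    have inj: "inj_on ?m ?P"
      using B.kappa_inj[OF xL] C.kappa_inj[OF yL] by (auto simp: inj_on_def)
    have "(\<Sum>z\<in>?P. (?g x y z)\<^sup>2) = (\<Sum>z\<in>?m ` ?P. (?f z)\<^sup>2)"
      by (subst sum.reindex[OF inj]) (auto intro!: sum.cong)
    also have "\<dots> \<le> (\<Sum>z\<in>{..N} \<times> {..N}. (?f z)\<^sup>2)"
      using B.kappa_le[OF xL] C.kappa_le[OF yL] by (intro sum_mono2) auto
    finally show "L2_set (?g x y) ?P \<le> sqf N a x y"
      unfolding L2_set_def sqf_def by (rule real_sqrt_le_mono)
  qed
  finally show ?thesis .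
qed

lemma rest_lift:
  assumes I: "I \<in> idx n" and J: "J \<in> idx n"
  shows "rest (lift a) I J = a I J"
proof -
  \<comment> \<open>Any leaf below \<open>I\<close> will do. On its fibre, and likewise for
    \<open>J\<close>, all the values averaged by \<open>rest\<close> equal
    \<open>a I J\<close>.\<close>
  define \<omega> where "\<omega> = I @ replicate (n - length I) False"
  define \<upsilon> where "\<upsilon> = J @ replicate (n - length J) False"
  have \<omega>: "\<omega> \<in> Lv n" "take (length I) \<omega> = I" and \<upsilon>: "\<upsilon> \<in> Lv n" "take (length J) \<upsilon> = J"
    using I J by (auto simp: \<omega>_def \<upsilon>_def)
  let ?k = "length I" and ?l = "length J"
  have kl: "?k \<le> n" "?l \<le> n" using I J by auto
  have one: "lift a (take (\<kappa> ?k x) x) (take (\<nu> ?l y) y) = a I J" if x: "x \<in> B.fibre_of \<omega>" and y: "y \<in> C.fibre_of \<upsilon>" for x y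
  proof -
    note xL = B.fibre_ofD(1)[OF x] and yL = C.fibre_ofD(1)[OF y]
    have "\<kappa> ?k x = \<kappa> k x \<longleftrightarrow> k = ?k" if "k \<in> {..n}" for k
      using inj_onD[OF B.kappa_inj[OF xL], of "?k" k] that kl by auto
    then have "(\<Sum>k\<le>n. if \<kappa> ?k x = \<kappa> k x then g k else 0) = (\<Sum>k\<le>n. if k = ?k then g k else 0)"
      for g :: "nat \<Rightarrow> real"
      by (intro sum.cong refl) simp
    then have 1: "(\<Sum>k\<le>n. if \<kappa> ?k x = \<kappa> k x then g k else 0) = g ?k" for g :: "nat \<Rightarrow> real"
      using kl by simp
    have "\<nu> ?l y = \<nu> l y \<longleftrightarrow> l = ?l" if "l \<in> {..n}" for l
      using inj_onD[OF C.kappa_inj[OF yL], of "?l" l] that kl by auto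
    then have "(\<Sum>l\<le>n. if \<nu> ?l y = \<nu> l y then g l else 0) = (\<Sum>l\<le>n. if l = ?l then g l else 0)"
      for g :: "nat \<Rightarrow> real"
      by (intro sum.cong refl) simp
    then have 2: "(\<Sum>l\<le>n. if \<nu> ?l y = \<nu> l y then g l else 0) = g ?l" for g :: "nat \<Rightarrow> real"
      using kl by simp
    show ?thesis
      unfolding lift_at2[OF xL yL B.kappa_le[OF xL kl(1)] C.kappa_le[OF yL kl(2)]] 1 2
        B.fibre_ofD(2)[OF x] C.fibre_ofD(2)[OF y] \<omega>(2) \<upsilon>(2) ..
  qed
  have avc: "av (\<lambda>_. c) F = c" if "card F \<noteq> 0" for c and F :: "bool list set"
    using that by (simp add: av_def)
  have c0: "card (B.fibre_of \<omega>) \<noteq> 0" "card (C.fibre_of \<upsilon>) \<noteq> 0"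
    using B.card_fibre_of(1,2)[OF \<omega>(1)] C.card_fibre_of(1,2)[OF \<upsilon>(1)] by simp_all
  have "rest (lift a) I J = av (\<lambda>x. av (\<lambda>y. lift a (take (\<kappa> ?k x) x) (take (\<nu> ?l y) y)) (C.fibre_of \<upsilon>)) (B.fibre_of \<omega>)"
    using rest_at2[OF \<omega>(1) \<upsilon>(1) kl] \<omega>(2) \<upsilon>(2) by simp
  also have "\<dots> = av (\<lambda>x. av (\<lambda>y. a I J) (C.fibre_of \<upsilon>)) (B.fibre_of \<omega>)"
    unfolding av_def using one by simp
  also have "\<dots> = a I J"
    by (simp add: avc c0)
  finally show ?thesis .
qed

lemma pairing_rest: "pairing n (rest a) g = pairing N a (lift g)"
proof -
  have sumB: "(\<Sum>K\<in>B I. h K) = (\<Sum>K\<in>idx N. ind (B I) K * h K)" if "I \<in> idx n" for I and h :: "bool list \<Rightarrow> real"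
    using B.B_idx[OF that] by (intro sum.mono_neutral_cong_left) (auto simp: ind_def)
  have sumC: "(\<Sum>L\<in>C J. h L) = (\<Sum>L\<in>idx N. ind (C J) L * h L)" if "J \<in> idx n" for J and h :: "bool list \<Rightarrow> real"
    using C.B_idx[OF that] by (intro sum.mono_neutral_cong_left) (auto simp: ind_def)
  let ?f = "\<lambda>I J K L. ind (B I) K * ind (C J) L * g I J * a K L / 2 ^ length K / 2 ^ length L"
  have "pairing n (rest a) g = (\<Sum>I\<in>idx n. \<Sum>J\<in>idx n. \<Sum>K\<in>idx N. \<Sum>L\<in>idx N. ?f I J K L)"
    unfolding pairing_def rest_def
    by (intro sum.cong refl) (simp add: sumB sumC sum_distrib_left sum_distrib_right sum_divide_distrib mult_ac)
  also have "\<dots> = (\<Sum>K\<in>idx N. \<Sum>L\<in>idx N. \<Sum>I\<in>idx n. \<Sum>J\<in>idx n. ?f I J K L)"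
  proof -
    have "(\<Sum>I\<in>idx n. \<Sum>J\<in>idx n. \<Sum>K\<in>idx N. \<Sum>L\<in>idx N. ?f I J K L)
        = (\<Sum>I\<in>idx n. \<Sum>K\<in>idx N. \<Sum>J\<in>idx n. \<Sum>L\<in>idx N. ?f I J K L)"
      by (intro sum.cong refl sum.swap)
    also have "\<dots> = (\<Sum>K\<in>idx N. \<Sum>I\<in>idx n. \<Sum>J\<in>idx n. \<Sum>L\<in>idx N. ?f I J K L)"
      by (rule sum.swap)
    also have "\<dots> = (\<Sum>K\<in>idx N. \<Sum>I\<in>idx n. \<Sum>L\<in>idx N. \<Sum>J\<in>idx n. ?f I J K L)"
      by (intro sum.cong refl sum.swap)
    also have "\<dots> = (\<Sum>K\<in>idx N. \<Sum>L\<in>idx N. \<Sum>I\<in>idx n. \<Sum>J\<in>idx n. ?f I J K L)"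
      by (intro sum.cong refl sum.swap)
    finally show ?thesis .
  qed
  also have "\<dots> = pairing N a (lift g)"
    unfolding pairing_def lift_def
    by (intro sum.cong refl) (simp add: sum_distrib_left sum_divide_distrib mult_ac)
  finally show ?thesis .
qed

lemma linear_lift: "linear lift"
  by (rule linearI) (auto simp: lift_def fun_eq_iff sum.distrib distrib_left sum_distrib_left mult_ac)

lemma linear_rest: "linear rest"
  by (rule linearI) (auto simp: rest_def fun_eq_iff sum.distrib add_divide_distrib distrib_left sum_distrib_left sum_divide_distrib mult_ac)

end

locale block_pair_norm = block_pair + mixed_exponents
begin

lemma cnorm_lift: "cnorm p q N (lift a) = cnorm p q n a"
proof -
  have \<omega>: "\<omega> \<in> Lv n \<Longrightarrow> card {x \<in> Lv N. \<tau> x = \<omega>} = 2 ^ N div 2 ^ n" for \<omega>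
    using B.card_fibre_of(1)[of \<omega>] by (simp add: B.fibre_of_def)
  have \<upsilon>: "\<upsilon> \<in> Lv n \<Longrightarrow> card {x \<in> Lv N. \<sigma> x = \<upsilon>} = 2 ^ N div 2 ^ n" for \<upsilon>
    using C.card_fibre_of(1)[of \<upsilon>] by (simp add: C.fibre_of_def)
  have pos: "0 < (2 ^ N div 2 ^ n :: nat)"
    using B.card_fibre_of(2)[of "replicate n False"] by simp
  have "cnorm p q N (lift a) = pm p (Lv N) (\<lambda>x. pm q (Lv N) (\<lambda>y. sqf n a (\<tau> x) (\<sigma> y)))"
    unfolding cnorm_def by (intro pm_cong refl) (simp add: sqf_sq2 sq2_lift)
  also have "\<dots> = pm p (Lv N) (\<lambda>x. pm q (Lv n) (sqf n a (\<tau> x)))"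
    by (intro pm_cong refl Q.pm_equidistributed(1)[OF finite_Lv finite_Lv C.tau_mem \<upsilon> pos])
  also have "\<dots> = pm p (Lv n) (\<lambda>\<omega>. pm q (Lv n) (sqf n a \<omega>))"
    by (rule P.pm_equidistributed(1)[OF finite_Lv finite_Lv B.tau_mem \<omega> pos])
  finally show ?thesis
    by (simp add: cnorm_def)
qed

text \<open>The two averages are removed one at a time. Minkowski's inequality takes the average
  over \<open>x\<close> out of the inner norm, the conditional expectation in \<open>y\<close>
  contracts the inner norm, and that in \<open>x\<close> the outer one.\<close>

lemma cnorm_rest: "cnorm p q n (rest a) \<le> cnorm p q N a"
proof -
  have \<omega>: "\<omega> \<in> Lv n \<Longrightarrow> card {x \<in> Lv N. \<tau> x = \<omega>} = 2 ^ N div 2 ^ n" for \<omega>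
    using B.card_fibre_of(1)[of \<omega>] by (simp add: B.fibre_of_def)
  have \<upsilon>: "\<upsilon> \<in> Lv n \<Longrightarrow> card {x \<in> Lv N. \<sigma> x = \<upsilon>} = 2 ^ N div 2 ^ n" for \<upsilon>
    using C.card_fibre_of(1)[of \<upsilon>] by (simp add: C.fibre_of_def)
  have pos: "0 < (2 ^ N div 2 ^ n :: nat)"
    using B.card_fibre_of(2)[of "replicate n False"] by simp
  have "cnorm p q n (rest a)
      \<le> pm p (Lv n) (\<lambda>\<omega>. pm q (Lv n) (\<lambda>\<upsilon>. av (\<lambda>x. av (sqf N a x) (C.fibre_of \<upsilon>)) (B.fibre_of \<omega>)))"
    unfolding cnorm_def by (intro P.pm_mono Q.pm_mono sqf_rest pm_nonneg sqf_nonneg)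
  also have "\<dots> \<le> pm p (Lv n) (\<lambda>\<omega>. av (\<lambda>x. pm q (Lv n) (\<lambda>\<upsilon>. av (sqf N a x) (C.fibre_of \<upsilon>))) (B.fibre_of \<omega>))"
    by (intro P.pm_mono Q.pm_av pm_nonneg av_nonneg sqf_nonneg) auto
  also have "\<dots> \<le> pm p (Lv n) (\<lambda>\<omega>. av (\<lambda>x. pm q (Lv N) (sqf N a x)) (B.fibre_of \<omega>))"
    unfolding C.fibre_of_def
    by (intro P.pm_mono av_mono av_nonneg pm_nonneg Q.pm_equidistributed(2)[OF finite_Lv finite_Lv C.tau_mem \<upsilon> pos] sqf_nonneg)
  also have "\<dots> \<le> cnorm p q N a"
    unfolding B.fibre_of_def cnorm_def
    by (intro P.pm_equidistributed(2)[OF finite_Lv finite_Lv B.tau_mem \<omega> pos] pm_nonneg)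
  finally show ?thesis .
qed

end

section \<open>Forms on a space and its dual\<close>

text \<open>The adjoint of \<open>R\<close>, cut off outside the carrier to meet the normalisation
  of functionals in \<open>dual_space\<close>.\<close>

definition pullback :: "'v::real_vector nspace \<Rightarrow> ('v \<Rightarrow> 'w) \<Rightarrow> ('w \<Rightarrow> real) \<Rightarrow> 'v \<Rightarrow> real" where
  "pullback X R \<psi> = (\<lambda>x. if x \<in> vecs X then \<psi> (R x) else 0)"

lemma pullback_apply: "x \<in> vecs X \<Longrightarrow> pullback X R \<psi> x = \<psi> (R x)"
  by (simp add: pullback_def)

lemma pullback_add: "pullback X R (\<phi> + \<psi>) = pullback X R \<phi> + pullback X R \<psi>"
  and pullback_scale: "pullback X R (k *\<^sub>R \<psi>) = k *\<^sub>R pullback X R \<psi>"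
  by (auto simp: pullback_def fun_eq_iff)

lemma bop_restrict:
  assumes "bop X Y B T" "normed_sp X" "\<And>x. x \<in> vecs X \<Longrightarrow> U x = T x"
  shows "bop X Y B U"
proof -
  interpret normed_sp_loc X by standard fact
  show ?thesis
    using assms(1) add_mem scale_mem by (simp add: bop_def assms(3))
qed

lemma pullback_dual:
  assumes X: "normed_sp X" and "bop X real_line B (\<lambda>x. \<psi> (R x))"
  shows "pullback X R \<psi> \<in> vecs (dual_space X)" "nrm (dual_space X) (pullback X R \<psi>) \<le> B"
proof -
  have "bop X real_line B (pullback X R \<psi>)"
    by (rule bop_restrict[OF assms(2,1)]) (simp add: pullback_apply)
  then show "pullback X R \<psi> \<in> vecs (dual_space X)" "nrm (dual_space X) (pullback X R \<psi>) \<le> B"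
    by (auto intro!: dualI X simp: pullback_def)
qed

lemmas pullback_id_dual = pullback_dual[where R = "\<lambda>x. x"]

lemma bop_pullback:
  assumes X: "normed_sp X" and Y: "normed_sp Y" and R: "bop X Y B R"
  shows "bop (dual_space Y) (dual_space X) B (pullback X R)"
proof -
  have pb: "pullback X R \<psi> \<in> vecs (dual_space X)" "nrm (dual_space X) (pullback X R \<psi>) \<le> nrm (dual_space Y) \<psi> * B"
    if "\<psi> \<in> vecs (dual_space Y)" for \<psi>
    by (rule pullback_dual[OF X], rule bop_comp[OF R dual_bop[OF Y that]])+
  show ?thesis
    unfolding bop_def
  proof (intro conjI ballI allI)
    fix \<psi> assume \<psi>: "\<psi> \<in> vecs (dual_space Y)"
    show "pullback X R \<psi> \<in> vecs (dual_space X)"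
      by (rule pb(1)[OF \<psi>])
    show "nrm (dual_space X) (pullback X R \<psi>) \<le> B * nrm (dual_space Y) \<psi>"
      using pb(2)[OF \<psi>] by (simp only: mult.commute)
  qed (simp_all add: bopD(1)[OF R] pullback_add pullback_scale)
qed

lemma bop_dual_eval:
  assumes X: "normed_sp X" and x: "x \<in> vecs X" and "nrm X x \<le> B"
  shows "bop (dual_space X) real_line B (\<lambda>\<phi>. \<phi> x)"
proof -
  interpret normed_sp_loc X by standard fact
  interpret D: normed_sp_loc "dual_space X" by standard (rule normed_sp_dual[OF X])
  have "\<bar>\<phi> x\<bar> \<le> B * nrm (dual_space X) \<phi>" if "\<phi> \<in> vecs (dual_space X)" for \<phi>
  proof -
    have "\<bar>\<phi> x\<bar> \<le> nrm (dual_space X) \<phi> * nrm X x"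
      using bopD(5)[OF dual_bop[OF X that] x] by simp
    also have "\<dots> \<le> nrm (dual_space X) \<phi> * B"
      using assms(3) that by (intro mult_left_mono) auto
    finally show ?thesis by (simp add: mult.commute)
  qed
  then show ?thesis
    using nrm_nonneg[OF x] assms(3) by (simp add: bop_def)
qed

text \<open>A finite dimensional substitute for norming functionals: the coordinate functionals
  control the norm up to a factor \<open>D\<close>. The loss is harmless, as \<open>D\<close>
  belongs to the small space and is known before \<epsilon> is passed on.\<close>

lemma norm_le_of_functionals:
  assumes X: "normed_sp X" and "fdim X"
  shows "\<exists>D>0. \<forall>y\<in>vecs X. \<forall>\<delta>\<ge>0.
    (\<forall>\<psi>\<in>vecs (dual_space X). \<bar>\<psi> y\<bar> \<le> \<delta> * nrm (dual_space X) \<psi>) \<longrightarrow> nrm X y \<le> \<delta> * D"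
proof -
  interpret normed_sp_loc X by standard fact
  obtain d e c B where sys: "coord_system X d e c B"
    using assms(2) by (auto simp: fdim_def)
  have e: "e i \<in> vecs X" and c: "bop X real_line (B i) (c i)" if "i < d" for i
    using sys that by (auto simp: coord_system_def)
  let ?D = "(\<Sum>i<d. B i * nrm X (e i)) + 1"
  have nn: "0 \<le> (\<Sum>i<d. B i * nrm X (e i))"
    using e bopD(1)[OF c] by (intro sum_nonneg) auto
  show ?thesis
  proof (intro exI[of _ ?D] conjI ballI allI impI)
    show "0 < ?D" using nn by simp
    fix y \<delta> assume y: "y \<in> vecs X" and \<delta>: "(0::real) \<le> \<delta>"
      and le: "\<forall>\<psi>\<in>vecs (dual_space X). \<bar>\<psi> y\<bar> \<le> \<delta> * nrm (dual_space X) \<psi>"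
    have cb: "\<bar>c i y\<bar> \<le> \<delta> * B i" if "i < d" for i
    proof -
      have pb: "pullback X (\<lambda>x. x) (c i) \<in> vecs (dual_space X)" "nrm (dual_space X) (pullback X (\<lambda>x. x) (c i)) \<le> B i"
        using pullback_id_dual[OF X c[OF that]] by auto
      have "\<bar>c i y\<bar> \<le> \<delta> * nrm (dual_space X) (pullback X (\<lambda>x. x) (c i))"
        using bspec[OF le pb(1)] y by (simp add: pullback_apply)
      also have "\<dots> \<le> \<delta> * B i"
        using pb(2) \<delta> by (rule mult_left_mono)
      finally show ?thesis .
    qed
    have "nrm X y \<le> (\<Sum>i<d. \<bar>c i y\<bar> * nrm X (e i))"
      by (rule coord_nrm_le[OF sys X y])
    also have "\<dots> \<le> (\<Sum>i<d. \<delta> * B i * nrm X (e i))"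
      using cb e by (intro sum_mono mult_right_mono) auto
    also have "\<dots> \<le> \<delta> * ?D"
      using \<delta> by (simp add: sum_distrib_left distrib_left mult.assoc)
    finally show "nrm X y \<le> \<delta> * ?D" .
  qed
qed

text \<open>The coordinate functionals become the vectors and evaluation at the old vectors becomes
  the coordinates.\<close>

lemma fdim_dual:
  assumes X: "normed_sp X" and "fdim X"
  shows "fdim (dual_space X)"
proof -
  interpret normed_sp_loc X by standard fact
  obtain d e c B where sys: "coord_system X d e c B"
    using assms(2) by (auto simp: fdim_def)
  have e: "e i \<in> vecs X" and c: "bop X real_line (B i) (c i)" if "i < d" for i
    using sys that by (auto simp: coord_system_def)
  have rep: "x = (\<Sum>i<d. c i x *\<^sub>R e i)" if "x \<in> vecs X" for x
    using sys that by (auto simp: coord_system_def)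
  have "\<phi> = (\<Sum>i<d. \<phi> (e i) *\<^sub>R pullback X (\<lambda>x. x) (c i))" if \<phi>: "\<phi> \<in> vecs (dual_space X)" for \<phi>
  proof
    fix x
    show "\<phi> x = (\<Sum>i<d. \<phi> (e i) *\<^sub>R pullback X (\<lambda>x. x) (c i)) x"
    proof (cases "x \<in> vecs X")
      case True
      note b = dual_bop[OF X \<phi>]
      have "\<phi> x = \<phi> (\<Sum>i<d. c i x *\<^sub>R e i)"
        using rep[OF True] by (rule arg_cong)
      also have "\<dots> = (\<Sum>i<d. \<phi> (c i x *\<^sub>R e i))"
        using e by (intro bop_sum[OF b X]) auto
      also have "\<dots> = (\<Sum>i<d. c i x * \<phi> (e i))"
        using bopD(4)[OF b] e by (intro sum.cong) auto
      finally show ?thesis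
        using True by (simp add: sum_fun_apply pullback_apply mult.commute)
    next
      case False
      then show ?thesis
        using \<phi> by (simp add: sum_fun_apply pullback_def dual_space_def)
    qed
  qed
  then have "coord_system (dual_space X) d (\<lambda>i. pullback X (\<lambda>x. x) (c i)) (\<lambda>i \<phi>. \<phi> (e i)) (\<lambda>i. nrm X (e i))"
    unfolding coord_system_def using pullback_id_dual(1)[OF X c] bop_dual_eval[OF X e] by auto
  then show ?thesis
    by (auto simp: fdim_def)
qed

definition dual_form :: "'v::real_vector nspace \<Rightarrow> real \<Rightarrow> ('v \<Rightarrow> ('v \<Rightarrow> real) \<Rightarrow> real) \<Rightarrow> bool" where
  "dual_form X \<Gamma> t \<longleftrightarrow> 0 \<le> \<Gamma> \<and>
     (\<forall>\<phi>\<in>vecs (dual_space X). bop X real_line (\<Gamma> * nrm (dual_space X) \<phi>) (\<lambda>x. t x \<phi>)) \<and>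
     (\<forall>x\<in>vecs X. bop (dual_space X) real_line (\<Gamma> * nrm X x) (t x))"

text \<open>Bilinear forms on a space times its dual encode operators on the space as well as operators
  on the dual. This makes the following property self-dual.\<close>

definition local_form_factor_at :: "(nat \<Rightarrow> 'v::real_vector nspace) \<Rightarrow> nat \<Rightarrow> nat \<Rightarrow> real \<Rightarrow> nat \<Rightarrow> real \<Rightarrow> bool" where
  "local_form_factor_at Y n N \<Gamma> M \<epsilon> \<longleftrightarrow> (\<forall>t \<Phi> W.
     dual_form (Y N) \<Gamma> t \<and> finite \<Phi> \<and> card \<Phi> \<le> M \<and> (\<forall>\<phi>\<in>\<Phi>. bop (Y N) real_line \<Gamma> \<phi>) \<and>
     finite W \<and> card W \<le> M \<and> (\<forall>w\<in>W. bop (dual_space (Y N)) real_line \<Gamma> w) \<longrightarrow>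
     (\<exists>R S l. bop (Y N) (Y n) 1 R \<and> bop (Y n) (Y N) 1 S \<and>
        (\<forall>x\<in>vecs (Y n). R (S x) = x \<and> (\<forall>\<phi>\<in>\<Phi>. \<bar>\<phi> (S x)\<bar> \<le> \<epsilon> * nrm (Y n) x)) \<and>
        (\<forall>\<psi>\<in>vecs (dual_space (Y n)).
          (\<forall>x\<in>vecs (Y n). \<bar>t (S x) (pullback (Y N) R \<psi>) - l * \<psi> x\<bar> \<le> \<epsilon> * nrm (Y n) x * nrm (dual_space (Y n)) \<psi>) \<and>
          (\<forall>w\<in>W. \<bar>w (pullback (Y N) R \<psi>)\<bar> \<le> \<epsilon> * nrm (dual_space (Y n)) \<psi>))))"

definition local_form_factor :: "(nat \<Rightarrow> 'v::real_vector nspace) \<Rightarrow> bool" where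
  "local_form_factor Y \<longleftrightarrow> (\<forall>n \<Gamma> M \<epsilon>. 0 < \<epsilon> \<longrightarrow> (\<exists>N0. \<forall>N\<ge>N0. local_form_factor_at Y n N \<Gamma> M \<epsilon>))"

lemma local_form_factor_atE:
  assumes "local_form_factor_at Y n N \<Gamma> M \<epsilon>"
    and "dual_form (Y N) \<Gamma> t" "finite \<Phi>" "card \<Phi> \<le> M" "\<And>\<phi>. \<phi> \<in> \<Phi> \<Longrightarrow> bop (Y N) real_line \<Gamma> \<phi>"
    and "finite W" "card W \<le> M" "\<And>w. w \<in> W \<Longrightarrow> bop (dual_space (Y N)) real_line \<Gamma> w"
  obtains R S l where "bop (Y N) (Y n) 1 R" "bop (Y n) (Y N) 1 S"
    "\<And>x. x \<in> vecs (Y n) \<Longrightarrow> R (S x) = x"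
    "\<And>x \<phi>. x \<in> vecs (Y n) \<Longrightarrow> \<phi> \<in> \<Phi> \<Longrightarrow> \<bar>\<phi> (S x)\<bar> \<le> \<epsilon> * nrm (Y n) x"
    "\<And>x \<psi>. x \<in> vecs (Y n) \<Longrightarrow> \<psi> \<in> vecs (dual_space (Y n)) \<Longrightarrow>
      \<bar>t (S x) (pullback (Y N) R \<psi>) - l * \<psi> x\<bar> \<le> \<epsilon> * nrm (Y n) x * nrm (dual_space (Y n)) \<psi>"
    "\<And>w \<psi>. \<psi> \<in> vecs (dual_space (Y n)) \<Longrightarrow> w \<in> W \<Longrightarrow> \<bar>w (pullback (Y N) R \<psi>)\<bar> \<le> \<epsilon> * nrm (dual_space (Y n)) \<psi>"
proof -
  have "\<exists>R S l. bop (Y N) (Y n) 1 R \<and> bop (Y n) (Y N) 1 S \<and>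
        (\<forall>x\<in>vecs (Y n). R (S x) = x \<and> (\<forall>\<phi>\<in>\<Phi>. \<bar>\<phi> (S x)\<bar> \<le> \<epsilon> * nrm (Y n) x)) \<and>
        (\<forall>\<psi>\<in>vecs (dual_space (Y n)).
          (\<forall>x\<in>vecs (Y n). \<bar>t (S x) (pullback (Y N) R \<psi>) - l * \<psi> x\<bar> \<le> \<epsilon> * nrm (Y n) x * nrm (dual_space (Y n)) \<psi>) \<and>
          (\<forall>w\<in>W. \<bar>w (pullback (Y N) R \<psi>)\<bar> \<le> \<epsilon> * nrm (dual_space (Y n)) \<psi>))"
    by (rule assms(1)[unfolded local_form_factor_at_def, THEN spec, THEN spec, THEN spec, THEN mp])
       (intro conjI ballI assms(2-))
  then obtain R S l where RS: "bop (Y N) (Y n) 1 R" "bop (Y n) (Y N) 1 S"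
    and 1: "\<forall>x\<in>vecs (Y n). R (S x) = x \<and> (\<forall>\<phi>\<in>\<Phi>. \<bar>\<phi> (S x)\<bar> \<le> \<epsilon> * nrm (Y n) x)"
    and 2: "\<forall>\<psi>\<in>vecs (dual_space (Y n)).
          (\<forall>x\<in>vecs (Y n). \<bar>t (S x) (pullback (Y N) R \<psi>) - l * \<psi> x\<bar> \<le> \<epsilon> * nrm (Y n) x * nrm (dual_space (Y n)) \<psi>) \<and>
          (\<forall>w\<in>W. \<bar>w (pullback (Y N) R \<psi>)\<bar> \<le> \<epsilon> * nrm (dual_space (Y n)) \<psi>)"
    by (elim exE conjE) (rule that)
  show thesis
    by (rule that[OF RS, of l]) (use 1 2 in blast)+
qed

text \<open>Apply the form version to the form \<phi>(T x); the vectors to be killed act as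
  evaluations on the dual. Scalar estimates against all functionals are turned into norm estimates
  by \<open>norm_le_of_functionals\<close>.\<close>

lemma local_factor_of_forms:
  assumes Y: "\<And>n. normed_sp (Y n)" and fd: "\<And>n. fdim (Y n)" and G: "local_form_factor Y"
  shows "local_factor Y"
  unfolding local_factor_def
proof (intro allI impI)
  fix n M and \<Gamma> \<epsilon> :: real assume "0 < \<epsilon>"
  interpret Y: normed_sp_loc "Y n" for n by standard (rule Y)
  obtain D where D: "0 < D" "\<And>y \<delta>. y \<in> vecs (Y n) \<Longrightarrow> 0 \<le> \<delta> \<Longrightarrow>
    \<forall>\<psi>\<in>vecs (dual_space (Y n)). \<bar>\<psi> y\<bar> \<le> \<delta> * nrm (dual_space (Y n)) \<psi> \<Longrightarrow> nrm (Y n) y \<le> \<delta> * D"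
    using norm_le_of_functionals[OF Y[of n] fd[of n]] by blast
  \<comment> \<open>The maximum with 1 lets the same \<epsilon> / ?D serve the estimates that lose
    \<open>D\<close> and those that do not.\<close>
  let ?D = "max D 1"
  have \<epsilon>': "0 < \<epsilon> / ?D" using \<open>0 < \<epsilon>\<close> by simp
  have \<epsilon>D: "\<epsilon> / ?D * D \<le> \<epsilon>" "\<epsilon> / ?D \<le> \<epsilon>"
    using \<open>0 < \<epsilon>\<close> D(1) by (auto simp: field_simps max_def)
  obtain N0 where N0: "\<And>N. N0 \<le> N \<Longrightarrow> local_form_factor_at Y n N \<Gamma> M (\<epsilon> / ?D)"
    using G \<epsilon>' unfolding local_form_factor_def by blast
  have "local_factor_at Y n N \<Gamma> M \<epsilon>" if N: "N0 \<le> N" for N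
    unfolding local_factor_at_def
  proof (intro allI impI, elim conjE)
    fix T V \<Phi>
    assume T: "bop (Y N) (Y N) \<Gamma> T" and V: "finite V" "card V \<le> M" "\<forall>v\<in>V. v \<in> vecs (Y N) \<and> nrm (Y N) v \<le> \<Gamma>"
      and \<Phi>: "finite \<Phi>" "card \<Phi> \<le> M" "\<forall>\<phi>\<in>\<Phi>. bop (Y N) real_line \<Gamma> \<phi>"
    note dual = dual_bop[OF Y]
    have form: "dual_form (Y N) \<Gamma> (\<lambda>x \<phi>. \<phi> (T x))"
      unfolding dual_form_def
    proof (intro conjI ballI)
      fix \<phi> assume "\<phi> \<in> vecs (dual_space (Y N))"
      from bop_comp[OF T dual[OF this]]
      show "bop (Y N) real_line (\<Gamma> * nrm (dual_space (Y N)) \<phi>) (\<lambda>x. \<phi> (T x))"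
        by (simp add: mult.commute)
    qed (auto intro!: bop_dual_eval Y bopD[OF T])
    have W: "finite ((\<lambda>v \<phi>. \<phi> v :: real) ` V)" "card ((\<lambda>v \<phi>. \<phi> v :: real) ` V) \<le> M"
      using V(1,2) card_image_le[OF V(1), of "\<lambda>v \<phi>. \<phi> v :: real"] by (auto intro: order_trans)
    have W': "bop (dual_space (Y N)) real_line \<Gamma> w" if "w \<in> (\<lambda>v \<phi>. \<phi> v) ` V" for w
      using that V(3) by (auto intro!: bop_dual_eval Y)
    obtain R S l where R: "bop (Y N) (Y n) 1 R" and S: "bop (Y n) (Y N) 1 S"
      and RS: "\<And>x. x \<in> vecs (Y n) \<Longrightarrow> R (S x) = x"
      and S\<Phi>: "\<And>x \<phi>. x \<in> vecs (Y n) \<Longrightarrow> \<phi> \<in> \<Phi> \<Longrightarrow> \<bar>\<phi> (S x)\<bar> \<le> \<epsilon> / ?D * nrm (Y n) x"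
      and t: "\<And>x \<psi>. x \<in> vecs (Y n) \<Longrightarrow> \<psi> \<in> vecs (dual_space (Y n)) \<Longrightarrow>
        \<bar>pullback (Y N) R \<psi> (T (S x)) - l * \<psi> x\<bar> \<le> \<epsilon> / ?D * nrm (Y n) x * nrm (dual_space (Y n)) \<psi>"
      and w: "\<And>w \<psi>. \<psi> \<in> vecs (dual_space (Y n)) \<Longrightarrow> w \<in> (\<lambda>v \<phi>. \<phi> v) ` V \<Longrightarrow>
        \<bar>w (pullback (Y N) R \<psi>)\<bar> \<le> \<epsilon> / ?D * nrm (dual_space (Y n)) \<psi>"
      by (rule local_form_factor_atE[OF N0[OF N] form \<Phi>(1,2) _ W W']) (use \<Phi>(3) in blast, blast, rule that)
    have "nrm (Y n) (R (T (S x)) - l *\<^sub>R x) \<le> \<epsilon> * nrm (Y n) x" if x: "x \<in> vecs (Y n)" for x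
    proof -
      have mem: "S x \<in> vecs (Y N)" "T (S x) \<in> vecs (Y N)" "R (T (S x)) \<in> vecs (Y n)"
        using bopD(2)[OF S x] bopD(2)[OF T] bopD(2)[OF R] by auto
      have "nrm (Y n) (R (T (S x)) - l *\<^sub>R x) \<le> \<epsilon> / ?D * nrm (Y n) x * D"
      proof (rule D(2)[OF _ _ ballI])
        fix \<psi> assume \<psi>: "\<psi> \<in> vecs (dual_space (Y n))"
        have "\<psi> (R (T (S x)) - l *\<^sub>R x) = pullback (Y N) R \<psi> (T (S x)) - l * \<psi> x"
          using bop_diff_apply[OF dual[OF \<psi>] Y mem(3) Y.scale_mem[OF x]] bopD(4)[OF dual[OF \<psi>] x] mem
          by (simp add: pullback_apply)
        then show "\<bar>\<psi> (R (T (S x)) - l *\<^sub>R x)\<bar> \<le> \<epsilon> / ?D * nrm (Y n) x * nrm (dual_space (Y n)) \<psi>"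
          using t[OF x \<psi>] by simp
      qed (use mem x \<open>0 < \<epsilon>\<close> in auto)
      also have "\<dots> = (\<epsilon> / ?D * D) * nrm (Y n) x"
        by (simp only: mult_ac)
      also have "\<dots> \<le> \<epsilon> * nrm (Y n) x"
        using \<epsilon>D(1) x by (intro mult_right_mono) auto
      finally show ?thesis .
    qed
    moreover have "nrm (Y n) (R v) \<le> \<epsilon>" if v: "v \<in> V" for v
    proof -
      have vm: "v \<in> vecs (Y N)" "R v \<in> vecs (Y n)"
        using V(3) v bopD(2)[OF R] by auto
      have "nrm (Y n) (R v) \<le> \<epsilon> / ?D * D"
      proof (rule D(2)[OF _ _ ballI])
        fix \<psi> assume \<psi>: "\<psi> \<in> vecs (dual_space (Y n))"
        show "\<bar>\<psi> (R v)\<bar> \<le> \<epsilon> / ?D * nrm (dual_space (Y n)) \<psi>"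
          using w[OF \<psi> imageI[OF v]] vm by (simp add: pullback_apply)
      qed (use vm \<epsilon>' in auto)
      then show ?thesis using \<epsilon>D(1) by simp
    qed
    moreover have "\<bar>\<phi> (S x)\<bar> \<le> \<epsilon> * nrm (Y n) x" if "x \<in> vecs (Y n)" "\<phi> \<in> \<Phi>" for x \<phi>
      using S\<Phi>[OF that] mult_right_mono[OF \<epsilon>D(2) Y.nrm_nonneg[OF that(1)]] by simp
    ultimately show "\<exists>R S l. bop (Y N) (Y n) 1 R \<and> bop (Y n) (Y N) 1 S \<and>
        (\<forall>x\<in>vecs (Y n). R (S x) = x \<and> nrm (Y n) (R (T (S x)) - l *\<^sub>R x) \<le> \<epsilon> * nrm (Y n) x \<and>
           (\<forall>\<phi>\<in>\<Phi>. \<bar>\<phi> (S x)\<bar> \<le> \<epsilon> * nrm (Y n) x)) \<and>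
        (\<forall>v\<in>V. nrm (Y n) (R v) \<le> \<epsilon>)"
      using R S RS by blast
  qed
  then show "\<exists>N0. \<forall>N\<ge>N0. local_factor_at Y n N \<Gamma> M \<epsilon>"
    by blast
qed

text \<open>Apply the form version to (T \<phi>)(x), so that T need not be recognised as an adjoint.
  The roles are exchanged: the adjoint of the projection \<open>R\<close> is the embedding of the
  dual spaces, the adjoint of \<open>S\<close> the projection. The elements of \<open>V\<close> are
  themselves functionals on \<open>Y N\<close>, and those of \<open>W\<close> functionals on its
  dual.\<close>

lemma local_factor_dual_of_forms:
  assumes Y: "\<And>n. normed_sp (Y n)" and G: "local_form_factor Y"
  shows "local_factor (\<lambda>n. dual_space (Y n))"
  unfolding local_factor_def
proof (intro allI impI)
  fix n M and \<Gamma> \<epsilon> :: real assume "0 < \<epsilon>"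
  interpret Y: normed_sp_loc "Y n" for n by standard (rule Y)
  interpret D: normed_sp_loc "dual_space (Y n)" for n by standard (rule normed_sp_dual[OF Y])
  obtain N0 where N0: "\<And>N. N0 \<le> N \<Longrightarrow> local_form_factor_at Y n N \<Gamma> M \<epsilon>"
    using G \<open>0 < \<epsilon>\<close> unfolding local_form_factor_def by blast
  have "local_factor_at (\<lambda>n. dual_space (Y n)) n N \<Gamma> M \<epsilon>" if N: "N0 \<le> N" for N
    unfolding local_factor_at_def
  proof (intro allI impI, elim conjE)
    fix T V W
    assume T: "bop (dual_space (Y N)) (dual_space (Y N)) \<Gamma> T" and V: "finite V" "card V \<le> M"
        "\<forall>v\<in>V. v \<in> vecs (dual_space (Y N)) \<and> nrm (dual_space (Y N)) v \<le> \<Gamma>"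
      and W: "finite W" "card W \<le> M" "\<forall>w\<in>W. bop (dual_space (Y N)) real_line \<Gamma> w"
    note dual = dual_bop[OF Y]
    have form: "dual_form (Y N) \<Gamma> (\<lambda>x \<phi>. T \<phi> x)"
      unfolding dual_form_def
    proof (intro conjI ballI)
      show "0 \<le> \<Gamma>" by (rule bopD(1)[OF T])
    next
      fix \<phi> assume \<phi>: "\<phi> \<in> vecs (dual_space (Y N))"
      show "bop (Y N) real_line (\<Gamma> * nrm (dual_space (Y N)) \<phi>) (T \<phi>)"
        by (rule bop_mono[OF dual[OF bopD(2)[OF T \<phi>]] bopD(5)[OF T \<phi>] Y])
    next
      fix x assume x: "x \<in> vecs (Y N)"
      show "bop (dual_space (Y N)) real_line (\<Gamma> * nrm (Y N) x) (\<lambda>\<phi>. T \<phi> x)"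
        using bop_comp[OF T bop_dual_eval[OF Y x order_refl]] by (simp add: mult.commute)
    qed
    have V': "bop (Y N) real_line \<Gamma> v" if "v \<in> V" for v
      using V(3) that by (intro bop_mono[OF dual _ Y]) auto
    obtain R S l where R: "bop (Y N) (Y n) 1 R" and S: "bop (Y n) (Y N) 1 S"
      and RS: "\<And>x. x \<in> vecs (Y n) \<Longrightarrow> R (S x) = x"
      and SV: "\<And>x \<phi>. x \<in> vecs (Y n) \<Longrightarrow> \<phi> \<in> V \<Longrightarrow> \<bar>\<phi> (S x)\<bar> \<le> \<epsilon> * nrm (Y n) x"
      and t: "\<And>x \<psi>. x \<in> vecs (Y n) \<Longrightarrow> \<psi> \<in> vecs (dual_space (Y n)) \<Longrightarrow>
        \<bar>T (pullback (Y N) R \<psi>) (S x) - l * \<psi> x\<bar> \<le> \<epsilon> * nrm (Y n) x * nrm (dual_space (Y n)) \<psi>"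
      and w: "\<And>w \<psi>. \<psi> \<in> vecs (dual_space (Y n)) \<Longrightarrow> w \<in> W \<Longrightarrow>
        \<bar>w (pullback (Y N) R \<psi>)\<bar> \<le> \<epsilon> * nrm (dual_space (Y n)) \<psi>"
      by (rule local_form_factor_atE[OF N0[OF N] form V(1,2) V' W(1,2)]) (assumption, use W(3) in blast, rule that)
    let ?S = "pullback (Y n) S" and ?R = "pullback (Y N) R"
    have S': "bop (dual_space (Y N)) (dual_space (Y n)) 1 ?S" and R': "bop (dual_space (Y n)) (dual_space (Y N)) 1 ?R"
      by (rule bop_pullback[OF Y Y S], rule bop_pullback[OF Y Y R])
    have "?S (?R \<psi>) = \<psi>" if "\<psi> \<in> vecs (dual_space (Y n))" for \<psi>
      using that bopD(2)[OF S] RS by (auto simp: fun_eq_iff pullback_def dual_space_def)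
    moreover have "nrm (dual_space (Y n)) (?S (T (?R \<psi>)) - l *\<^sub>R \<psi>) \<le> \<epsilon> * nrm (dual_space (Y n)) \<psi>"
      if \<psi>: "\<psi> \<in> vecs (dual_space (Y n))" for \<psi>
    proof -
      have "?S (T (?R \<psi>)) - l *\<^sub>R \<psi> \<in> vecs (dual_space (Y n))"
        using \<psi> bopD(2)[OF S'] bopD(2)[OF R'] bopD(2)[OF T] by (intro D.diff_mem D.scale_mem) auto
      then have m: "bop (Y n) real_line (nrm (dual_space (Y n)) (?S (T (?R \<psi>)) - l *\<^sub>R \<psi>)) (?S (T (?R \<psi>)) - l *\<^sub>R \<psi>)"
          "\<And>x. x \<notin> vecs (Y n) \<Longrightarrow> (?S (T (?R \<psi>)) - l *\<^sub>R \<psi>) x = 0"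
        by (rule dual) (use \<psi> in \<open>simp add: pullback_def dual_space_def\<close>)
      have "bop (Y n) real_line (\<epsilon> * nrm (dual_space (Y n)) \<psi>) (?S (T (?R \<psi>)) - l *\<^sub>R \<psi>)"
        unfolding bop_def
      proof (intro conjI ballI allI)
        show "0 \<le> \<epsilon> * nrm (dual_space (Y n)) \<psi>" using \<open>0 < \<epsilon>\<close> \<psi> by simp
        fix x assume "x \<in> vecs (Y n)"
        then show "nrm real_line ((?S (T (?R \<psi>)) - l *\<^sub>R \<psi>) x) \<le> \<epsilon> * nrm (dual_space (Y n)) \<psi> * nrm (Y n) x"
          using t[OF _ \<psi>, of x] by (simp add: pullback_apply mult_ac)
      qed (use bopD[OF m(1)] in auto)
      then show ?thesis
        by (rule dualI(2)[OF Y]) (rule m(2))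
    qed
    moreover have "nrm (dual_space (Y n)) (?S v) \<le> \<epsilon>" if v: "v \<in> V" for v
    proof -
      have m: "?S v \<in> vecs (dual_space (Y n))"
        using V(3) v bopD(2)[OF S'] by blast
      have "bop (Y n) real_line \<epsilon> (?S v)"
        unfolding bop_def
      proof (intro conjI ballI allI)
        fix x assume "x \<in> vecs (Y n)"
        then show "nrm real_line (?S v x) \<le> \<epsilon> * nrm (Y n) x"
          using SV[OF _ v, of x] by (simp add: pullback_apply)
      qed (use bopD[OF dual[OF m]] \<open>0 < \<epsilon>\<close> in auto)
      then show ?thesis
        by (rule dualI(2)[OF Y]) (simp add: pullback_def)
    qed
    ultimately show "\<exists>R S l. bop (dual_space (Y N)) (dual_space (Y n)) 1 R \<and> bop (dual_space (Y n)) (dual_space (Y N)) 1 S \<and>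
        (\<forall>x\<in>vecs (dual_space (Y n)). R (S x) = x \<and>
           nrm (dual_space (Y n)) (R (T (S x)) - l *\<^sub>R x) \<le> \<epsilon> * nrm (dual_space (Y n)) x \<and>
           (\<forall>\<phi>\<in>W. \<bar>\<phi> (S x)\<bar> \<le> \<epsilon> * nrm (dual_space (Y n)) x)) \<and>
        (\<forall>v\<in>V. nrm (dual_space (Y n)) (R v) \<le> \<epsilon>)"
      using S' R' w by blast
  qed
  then show "\<exists>N0. \<forall>N\<ge>N0. local_factor_at (\<lambda>n. dual_space (Y n)) n N \<Gamma> M \<epsilon>"
    by blast
qed

section \<open>Coefficient representation of the Hardy spaces\<close>

text \<open>\<open>code I\<close> is 2^length I plus the binary value of \<open>I\<close>, so the
  difference is the usual index of a dyadic interval. The leading digit reappears as the shift by 1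
  in \<open>ivl_iff\<close>.\<close>

definition ivl :: "bool list \<Rightarrow> real set" where
  "ivl I = {real (code I - 2 ^ length I) / 2 ^ length I ..< (real (code I - 2 ^ length I) + 1) / 2 ^ length I}"

lemma ivl_iff: "z \<in> ivl I \<longleftrightarrow> \<lfloor>2 ^ length I * (z + 1)\<rfloor> = int (code I)"
proof -
  have c: "real (code I - 2 ^ length I) = real (code I) - 2 ^ length I"
    using code_bounds[of I] by (simp add: of_nat_diff)
  have "z \<in> ivl I \<longleftrightarrow> real (code I) - 2 ^ length I \<le> 2 ^ length I * z \<and> 2 ^ length I * z < real (code I) - 2 ^ length I + 1"
    unfolding ivl_def c by (simp add: field_simps)
  also have "\<dots> \<longleftrightarrow> \<lfloor>2 ^ length I * (z + 1)\<rfloor> = int (code I)"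
    unfolding floor_eq_iff by (auto simp: distrib_left)
  finally show ?thesis .
qed

lemma ivl_dyadic: "ivl I \<in> dyadic"
  unfolding ivl_def dyadic_def using code_bounds[of I] by fastforce

lemma ivl_measure: "measure lborel (ivl I) = 1 / 2 ^ length I"
  unfolding ivl_def by (rule dyadic_measure)

lemma ivl_unit: "ivl I \<subseteq> {0..<1}"
proof
  fix z assume z: "z \<in> ivl I"
  define P where "P = (2::real) ^ length I"
  have P: "0 < P" by (simp add: P_def)
  have "real (2 ^ length I) \<le> real (code I)" "real (code I + 1) \<le> real (2 ^ Suc (length I))"
    using code_bounds[of I] unfolding of_nat_le_iff by simp_all
  then have c: "P \<le> real (code I)" "real (code I) + 1 \<le> 2 * P"
    by (simp_all add: P_def)
  have "real (code I) \<le> P * (z + 1)" "P * (z + 1) < real (code I) + 1"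
    using z unfolding ivl_iff floor_eq_iff P_def by auto
  then have "P * 1 \<le> P * (z + 1)" "P * (z + 1) < P * 2"
    using order_trans[OF c(1)] less_le_trans[OF _ c(2)] by (simp_all only: mult_1_right mult.commute[of P 2])
  then have "1 \<le> z + 1" "z + 1 < 2"
    using P by (simp_all only: mult_le_cancel_left_pos mult_less_cancel_left_pos)
  then show "z \<in> {0..<1}" by simp
qed

lemma code_surj: "code ` Lv m = {2 ^ m..<2 ^ Suc m}"
proof (rule card_subset_eq)
  show "code ` Lv m \<subseteq> {2 ^ m..<2 ^ Suc m}"
    using code_bounds by (auto simp del: power_Suc)
  have "inj_on code (Lv m)"
    using code_inj by (auto intro: inj_onI)
  then show "card (code ` Lv m) = card {2 ^ m..<2 ^ Suc m :: nat}"
    by (simp add: card_image)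
qed simp

lemma ex_leaf:
  assumes "z \<in> {0..<1}"
  obtains x where "x \<in> Lv m" "z \<in> ivl x"
proof -
  let ?k = "\<lfloor>2 ^ m * (z + 1)\<rfloor>"
  have "2 ^ m * 1 \<le> 2 ^ m * (z + 1)" "2 ^ m * (z + 1) < 2 ^ m * 2"
    using assms by (intro mult_left_mono mult_strict_left_mono; simp)+
  then have "2 ^ m \<le> ?k" "?k < 2 ^ Suc m"
    by (simp_all add: le_floor_iff floor_less_iff)
  then have "nat ?k \<in> {2 ^ m..<2 ^ Suc m}"
    by (simp add: nat_less_iff le_nat_iff del: power_Suc)
  then obtain x where x: "x \<in> Lv m" "code x = nat ?k"
    using code_surj[of m] by (metis imageE)
  moreover have "z \<in> ivl x"
  proof -
    have "0 \<le> ?k"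
      by (rule order_trans[OF _ \<open>2 ^ m \<le> ?k\<close>]) simp
    then show ?thesis
      using x nat_0_le[of ?k] by (simp only: ivl_iff Lv_iff)
  qed
  ultimately show thesis using that by blast
qed

lemma ivl_mem_unique: "z \<in> ivl I \<Longrightarrow> z \<in> ivl J \<Longrightarrow> length I = length J \<Longrightarrow> I = J"
  using code_inj by (auto simp: ivl_iff)

lemma ivl_snoc: "ivl (I @ [b]) \<subseteq> ivl I"
proof
  fix z assume "z \<in> ivl (I @ [b])"
  then have *: "\<lfloor>2 * (2 ^ length I * (z + 1))\<rfloor> = 2 * int (code I) + of_bool b"
    by (simp add: ivl_iff code_snoc mult.assoc)
  have "real_of_int (2 * int (code I) + of_bool b) \<le> 2 * (2 ^ length I * (z + 1))"
    "2 * (2 ^ length I * (z + 1)) < real_of_int (2 * int (code I) + of_bool b) + 1"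
    using * unfolding floor_eq_iff by auto
  then show "z \<in> ivl I"
    unfolding ivl_iff floor_eq_iff by (cases b) auto
qed

lemma ivl_append: "ivl (I @ J) \<subseteq> ivl I"
proof (induction J rule: rev_induct)
  case (snoc b J)
  then show ?case
    using ivl_snoc[of "I @ J" b] by auto
qed simp

lemma ivl_take_iff:
  assumes "z \<in> ivl x" "length I \<le> length x"
  shows "z \<in> ivl I \<longleftrightarrow> I = take (length I) x"
proof -
  have "z \<in> ivl (take (length I) x)"
    using assms(1) ivl_append[of "take (length I) x" "drop (length I) x"] by auto
  then show ?thesis
    using assms(2) ivl_mem_unique[of z I "take (length I) x"] by auto
qed

lemma inj_ivl: "ivl I = ivl J \<Longrightarrow> I = J"
proof -
  assume eq: "ivl I = ivl J"
  have "(2::real) ^ length I = 2 ^ length J"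
    using ivl_measure[of I] ivl_measure[of J] unfolding eq by simp
  then have "length I = length J" by simp
  moreover have "real (code I - 2 ^ length I) / 2 ^ length I \<in> ivl I"
    unfolding ivl_def by (simp add: divide_strict_right_mono)
  ultimately show "I = J"
    using ivl_mem_unique[of _ I J] eq by simp
qed

lemma dyadic_upto_eq: "dyadic_upto n = ivl ` idx n"
proof (intro equalityI subsetI)
  fix A assume "A \<in> dyadic_upto n"
  then obtain k m where A: "A = {real k / 2 ^ m ..< (real k + 1) / 2 ^ m}" "k < 2 ^ m" and m: "1 / 2 ^ n \<le> measure lborel A"
    by (auto simp: dyadic_upto_def dyadic_def)
  have "(2::real) ^ m \<le> 2 ^ n"
    using m unfolding A(1) dyadic_measure by (simp add: field_simps)
  then have "m \<le> n" by simp
  have "2 ^ m + k \<in> code ` Lv m"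
    unfolding code_surj using A(2) by simp
  then obtain I where I: "length I = m" "code I = 2 ^ m + k"
    by (auto simp: image_iff)
  then show "A \<in> ivl ` idx n"
    using \<open>m \<le> n\<close> by (intro image_eqI[of _ _ I]) (simp_all add: ivl_def A(1))
next
  fix A assume "A \<in> ivl ` idx n"
  then show "A \<in> dyadic_upto n"
    using ivl_dyadic by (auto simp: dyadic_upto_def ivl_measure field_simps)
qed

text \<open>The leaf intervals partition {0..<1} while the norm integrates over {0..1}; the second
  assumption accounts for the end point 1.\<close>

lemma step_function_integral:
  fixes f :: "real \<Rightarrow> real"
  assumes f: "\<And>x z. x \<in> Lv N \<Longrightarrow> z \<in> ivl x \<Longrightarrow> f z = u x" and 0: "\<And>z. z \<notin> {0..<1} \<Longrightarrow> f z = 0"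
  shows "(LINT z:{0..1}|lborel. f z) = (\<Sum>x\<in>Lv N. u x) / 2 ^ N"
proof -
  have eq: "indicator {0..1} z *\<^sub>R f z = (\<Sum>x\<in>Lv N. u x * indicator (ivl x) z)" for z
  proof (cases "z \<in> {0..<1}")
    case True
    then obtain w where w: "w \<in> Lv N" "z \<in> ivl w" by (rule ex_leaf)
    have "(\<Sum>x\<in>Lv N. u x * indicator (ivl x) z) = (\<Sum>x\<in>Lv N. if x = w then u w else 0)"
    proof (intro sum.cong refl)
      fix x assume "x \<in> Lv N"
      then have "z \<in> ivl x \<longleftrightarrow> x = w"
        using w ivl_mem_unique[of z x w] by auto
      then show "u x * indicator (ivl x) z = (if x = w then u w else 0)"
        by (simp add: indicator_def)
    qed
    then show ?thesis
      using w f[OF w] True by simp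
  next
    case False
    then have "z \<notin> ivl x" for x
      using ivl_unit by blast
    then have "(\<Sum>x\<in>Lv N. u x * indicator (ivl x) z) = 0"
      by (simp add: indicator_def)
    then show ?thesis
      using 0[OF False] by simp
  qed
  have int: "integrable lborel (\<lambda>z. u x * indicator (ivl x) z)" for x
    unfolding ivl_def by (intro integrable_mult_right integrable_real_indicator) (simp_all add: divide_right_mono)
  have "(LINT z:{0..1}|lborel. f z) = (\<Sum>x\<in>Lv N. LINT z|lborel. u x * indicator (ivl x) z)"
    unfolding set_lebesgue_integral_def eq using int by (rule Bochner_Integration.integral_sum)
  also have "\<dots> = (\<Sum>x\<in>Lv N. u x / 2 ^ N)"
    by (intro sum.cong refl) (simp add: ivl_measure)
  finally show ?thesis
    by (simp add: sum_divide_distrib)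
qed

section \<open>Synthesis from coefficients and the Hardy norm\<close>

definition syn :: "nat \<Rightarrow> (bool list \<Rightarrow> bool list \<Rightarrow> real) \<Rightarrow> real \<Rightarrow> real \<Rightarrow> real" where
  "syn N a = (\<Sum>(K, L)\<in>idx N \<times> idx N. a K L *\<^sub>R haar2 (ivl K) (ivl L))"

definition haar_coeffs :: "(real \<Rightarrow> real \<Rightarrow> real) \<Rightarrow> bool list \<Rightarrow> bool list \<Rightarrow> real" where
  "haar_coeffs f K L = haar_coeff f (ivl K) (ivl L)"

lemma syn_reindex:
  "syn N a = (\<Sum>(I, J)\<in>dyadic_upto N \<times> dyadic_upto N. a (inv ivl I) (inv ivl J) *\<^sub>R haar2 I J)"
proof -
  have inv: "inv ivl (ivl K) = K" for K
    using inj_ivl by (intro inv_f_f injI)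
  have inj: "inj_on (map_prod ivl ivl) (idx N \<times> idx N)"
    using inj_ivl by (auto intro!: inj_onI)
  have im: "dyadic_upto N \<times> dyadic_upto N = map_prod ivl ivl ` (idx N \<times> idx N)"
    unfolding dyadic_upto_eq by auto
  show ?thesis
    unfolding im syn_def sum.reindex[OF inj] by (intro sum.cong refl) (auto simp: inv)
qed

lemma dyadic_upto_subset: "finite (dyadic_upto N \<times> dyadic_upto N)" "dyadic_upto N \<times> dyadic_upto N \<subseteq> dyadic \<times> dyadic"
  unfolding dyadic_upto_eq using ivl_dyadic by auto

lemma haar_coeffs_syn: "haar_coeffs (syn N a) K L = (if K \<in> idx N \<and> L \<in> idx N then a K L else 0)"
proof -
  have inv: "inv ivl (ivl K) = K" for K
    using inj_ivl by (intro inv_f_f injI)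
  have mem: "ivl K \<in> dyadic_upto N \<longleftrightarrow> K \<in> idx N" for K
    using inj_ivl unfolding dyadic_upto_eq by blast
  show ?thesis
    unfolding haar_coeffs_def syn_reindex haar_coeff_sum[OF dyadic_upto_subset ivl_dyadic ivl_dyadic]
    by (simp add: inv mem del: idx_iff)
qed

lemma linear_syn: "linear (syn N)"
  by (rule linearI) (simp_all add: syn_def case_prod_unfold scaleR_add_left sum.distrib scaleR_sum_right)

lemma syn_cong: "(\<And>K L. K \<in> idx N \<Longrightarrow> L \<in> idx N \<Longrightarrow> a K L = b K L) \<Longrightarrow> syn N a = syn N b"
  unfolding syn_def by (intro sum.cong refl) auto

lemma haar_square: "(haar (ivl K) z)\<^sup>2 = indicator (ivl K) z"
  by (simp add: haar_def indicator_def)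

definition square_fun :: "nat \<Rightarrow> (bool list \<Rightarrow> bool list \<Rightarrow> real) \<Rightarrow> real \<Rightarrow> real \<Rightarrow> real" where
  "square_fun N a z w = (\<Sum>(I, J)\<in>dyadic_upto N \<times> dyadic_upto N.
     \<bar>a (inv ivl I) (inv ivl J)\<bar>\<^sup>2 * (haar2 I J z w)\<^sup>2)"

text \<open>Squared Haar functions are indicators, and an interval of level at most \<open>N\<close>
  contains a given point of the leaf \<open>x\<close> exactly if it is an ancestor of
  \<open>x\<close>. So the square function is constant on products of leaf intervals.\<close>

lemma square_fun_leaves:
  shows "x \<in> Lv N \<Longrightarrow> y \<in> Lv N \<Longrightarrow> z \<in> ivl x \<Longrightarrow> w \<in> ivl y \<Longrightarrow> square_fun N a z w = sq2 N a x y"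
    and "z \<notin> {0..<1} \<or> w \<notin> {0..<1} \<Longrightarrow> square_fun N a z w = 0"
proof -
  have inv: "inv ivl (ivl K) = K" for K
    using inj_ivl by (intro inv_f_f injI)
  have inj: "inj_on (map_prod ivl ivl) (idx N \<times> idx N)"
    using inj_ivl by (auto intro!: inj_onI)
  have im: "dyadic_upto N \<times> dyadic_upto N = map_prod ivl ivl ` (idx N \<times> idx N)"
    unfolding dyadic_upto_eq by auto
  have S: "square_fun N a z w = (\<Sum>(K, L)\<in>idx N \<times> idx N. (a K L)\<^sup>2 * (indicator (ivl K) z * indicator (ivl L) w))"
    unfolding square_fun_def im sum.reindex[OF inj]
    by (intro sum.cong refl) (auto simp: inv haar2_def power_mult_distrib haar_square)
  show "square_fun N a z w = 0" if "z \<notin> {0..<1} \<or> w \<notin> {0..<1}"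
  proof -
    have z0: "indicator (ivl K) z * indicator (ivl L) w = (0::real)" for K L
      using that ivl_unit[of K] ivl_unit[of L] by (auto simp: indicator_def)
    show ?thesis
      unfolding S z0 by simp
  qed
  assume x: "x \<in> Lv N" and y: "y \<in> Lv N" and z: "z \<in> ivl x" and w: "w \<in> ivl y"
  let ?t = "\<lambda>(i, j). (take i x, take j y)"
  have inj': "inj_on ?t ({..N} \<times> {..N})"
  proof (rule inj_onI)
    fix s s' assume s: "s \<in> {..N} \<times> {..N}" "s' \<in> {..N} \<times> {..N}" and "?t s = ?t s'"
    then have eq: "take (fst s) x = take (fst s') x" "take (snd s) y = take (snd s') y"
      by (auto simp: case_prod_unfold)
    from arg_cong[OF eq(1), of length] have "fst s = fst s'"
      using s x by (auto simp: min_def split: if_splits)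
    moreover from arg_cong[OF eq(2), of length] have "snd s = snd s'"
      using s y by (auto simp: min_def split: if_splits)
    ultimately show "s = s'"
      by (rule prod_eqI)
  qed
  have "square_fun N a z w = (\<Sum>(K, L)\<in>?t ` ({..N} \<times> {..N}). (a K L)\<^sup>2)"
    unfolding S
  proof (rule sum.mono_neutral_cong_right[OF _ _ ballI])
    show "?t ` ({..N} \<times> {..N}) \<subseteq> idx N \<times> idx N" using x y by auto
    fix KL assume KL: "KL \<in> idx N \<times> idx N - ?t ` ({..N} \<times> {..N})"
    obtain K L where e: "KL = (K, L)" by force
    have "\<not> (K = take (length K) x \<and> L = take (length L) y)"
    proof
      assume "K = take (length K) x \<and> L = take (length L) y"
      then have "KL = ?t (length K, length L)" by (simp add: e)
      moreover have "(length K, length L) \<in> {..N} \<times> {..N}"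
        using KL e by auto
      ultimately have "KL \<in> ?t ` ({..N} \<times> {..N})" by (rule image_eqI)
      then show False using KL by blast
    qed
    then show "(case KL of (K, L) \<Rightarrow> (a K L)\<^sup>2 * (indicator (ivl K) z * indicator (ivl L) w)) = 0"
      using ivl_take_iff[OF z, of K] ivl_take_iff[OF w, of L] x y KL e by (auto simp: indicator_def)
  next
    fix KL assume "KL \<in> ?t ` ({..N} \<times> {..N})"
    then obtain i j where e: "KL = (take i x, take j y)" "i \<le> N" "j \<le> N" by auto
    then show "(case KL of (K, L) \<Rightarrow> (a K L)\<^sup>2 * (indicator (ivl K) z * indicator (ivl L) w)) = (case KL of (K, L) \<Rightarrow> (a K L)\<^sup>2)"
      using ivl_take_iff[OF z, of "take i x"] ivl_take_iff[OF w, of "take j y"] x y by (simp add: indicator_def)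
  qed simp
  also have "\<dots> = sq2 N a x y"
    unfolding sum.reindex[OF inj'] sq2_def sum.cartesian_product by (intro sum.cong refl) auto
  finally show "square_fun N a z w = sq2 N a x y" .
qed

text \<open>In each variable the integrand is a step function of level \<open>N\<close>, so both
  integrals are means over leaves; what remains is the bookkeeping of the exponents q / 2 and p /
  q.\<close>

lemma (in mixed_exponents) hardy_norm_syn: "hardy_norm p q (syn N a) = cnorm p q N a"
proof -
  let ?u = "\<lambda>x. (\<Sum>y\<in>Lv N. sqf N a x y powr q) / 2 ^ N"
  have sq: "sq2 N a x y powr (q / 2) = sqf N a x y powr q" for x y
    unfolding sqf_sq2 using q by (simp add: powr_half_sqrt[symmetric] powr_powr sq2_def sum_nonneg)
  have inner: "(LINT w:{0..1}|lborel. square_fun N a z w powr (q / 2)) = ?u x" if "x \<in> Lv N" "z \<in> ivl x" for x z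
    unfolding sq[symmetric] using that by (intro step_function_integral) (simp_all add: square_fun_leaves del: Lv_iff)
  have inner0: "(LINT w:{0..1}|lborel. square_fun N a z w powr (q / 2)) = 0" if "z \<notin> {0..<1}" for z
    using that by (simp add: square_fun_leaves(2))
  have pq: "?u x powr (p / q) = pm q (Lv N) (sqf N a x) powr p" for x
    unfolding pm_def using q by (simp add: powr_powr sum_nonneg)
  have "(LINT z:{0..1}|lborel. (LINT w:{0..1}|lborel. square_fun N a z w powr (q / 2)) powr (p / q))
      = (\<Sum>x\<in>Lv N. pm q (Lv N) (sqf N a x) powr p) / 2 ^ N"
    unfolding pq[symmetric] using p q
    by (intro step_function_integral) (simp_all add: inner inner0 del: Lv_iff)
  then show ?thesis
    unfolding syn_reindex hardy_norm_sum[OF dyadic_upto_subset] square_fun_def[symmetric] cnorm_def pm_def[of p] by simp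
qed

lemma vecs_hardy_space: "vecs (hardy_space p q N) = range (syn N)"
proof
  let ?G = "{haar2 I J | I J. I \<in> dyadic_upto N \<and> J \<in> dyadic_upto N}"
  have "haar2 I J \<in> range (syn N)" if "I \<in> dyadic_upto N" "J \<in> dyadic_upto N" for I J
  proof -
    obtain K L where KL: "K \<in> idx N" "L \<in> idx N" "I = ivl K" "J = ivl L"
      using \<open>I \<in> dyadic_upto N\<close> \<open>J \<in> dyadic_upto N\<close> unfolding dyadic_upto_eq by blast
    have "syn N (tens (ind {K}) (ind {L})) = (\<Sum>z\<in>idx N \<times> idx N. if z = (K, L) then haar2 I J else 0)"
      unfolding syn_def by (intro sum.cong refl) (auto simp: tens_def ind_def KL)
    then have "syn N (tens (ind {K}) (ind {L})) = haar2 I J"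
      using KL by simp
    then show ?thesis by (metis rangeI)
  qed
  then have "?G \<subseteq> range (syn N)" by blast
  then show "vecs (hardy_space p q N) \<subseteq> range (syn N)"
    unfolding hardy_space_def using linear_subspace_image[OF linear_syn subspace_UNIV, of N]
    by (simp add: span_minimal)
  show "range (syn N) \<subseteq> vecs (hardy_space p q N)"
  proof
    fix f assume "f \<in> range (syn N)"
    then obtain a where f: "f = syn N a" by blast
    have "syn N a \<in> span ?G"
      unfolding syn_reindex
      by (rule span_sum) (auto intro: span_scale span_base)
    then show "f \<in> vecs (hardy_space p q N)"
      by (simp add: f hardy_space_def)
  qed
qed

section \<open>Local factorization of the Hardy spaces\<close>

lemma syn_mem: "syn N a \<in> vecs (hardy_space p q N)"
  by (simp add: vecs_hardy_space)

lemma syn_coeffs: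
  assumes "f \<in> vecs (hardy_space p q N)"
  shows "syn N (haar_coeffs f) = f"
proof -
  obtain a where a: "f = syn N a"
    using assms by (auto simp: vecs_hardy_space)
  show ?thesis
    unfolding a by (rule syn_cong) (simp add: haar_coeffs_syn)
qed

lemma haar_coeffs_add:
  assumes "f \<in> vecs (hardy_space p q N)" "g \<in> vecs (hardy_space p q N)"
  shows "haar_coeffs (f + g) = haar_coeffs f + haar_coeffs g"
proof -
  obtain a b where ab: "f = syn N a" "g = syn N b"
    using assms by (auto simp: vecs_hardy_space)
  show ?thesis
    unfolding ab linear_add[OF linear_syn, symmetric] by (intro ext) (simp add: haar_coeffs_syn)
qed

lemma haar_coeffs_scale:
  assumes "f \<in> vecs (hardy_space p q N)"
  shows "haar_coeffs (k *\<^sub>R f) = k *\<^sub>R haar_coeffs f"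
proof -
  obtain a where a: "f = syn N a"
    using assms by (auto simp: vecs_hardy_space)
  show ?thesis
    unfolding a linear_scale[OF linear_syn, symmetric] by (intro ext) (simp add: haar_coeffs_syn)
qed

lemma pairing_cong:
  "(\<And>K L. K \<in> idx N \<Longrightarrow> L \<in> idx N \<Longrightarrow> a K L = b K L) \<Longrightarrow> pairing N a g = pairing N b g"
  unfolding pairing_def by (intro sum.cong refl) auto

lemma linear_pairing: "linear (\<lambda>a. pairing N a g)" "linear (pairing N a)"
  by (intro linearI; simp add: pairing_def distrib_left distrib_right add_divide_distrib sum.distrib
      sum_distrib_left mult_ac)+

lemma haar2_mem: "K \<in> idx N \<Longrightarrow> L \<in> idx N \<Longrightarrow> haar2 (ivl K) (ivl L) \<in> vecs (hardy_space p q N)"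
proof -
  assume "K \<in> idx N" "L \<in> idx N"
  then have "haar2 (ivl K) (ivl L) \<in> span {haar2 I J | I J. I \<in> dyadic_upto N \<and> J \<in> dyadic_upto N}"
    unfolding dyadic_upto_eq by (intro span_base) blast
  then show ?thesis
    by (simp add: hardy_space_def)
qed

lemma double_sum_diagonal_close:
  fixes A :: "'i \<Rightarrow> 'i \<Rightarrow> real"
  assumes P: "finite P" and A: "\<And>z z'. z \<in> P \<Longrightarrow> z' \<in> P \<Longrightarrow> \<bar>A z z' - (if z = z' then d z else 0)\<bar> \<le> \<epsilon>"
    and \<alpha>: "\<And>z. z \<in> P \<Longrightarrow> \<bar>\<alpha> z\<bar> \<le> a" and \<gamma>: "\<And>z. z \<in> P \<Longrightarrow> \<bar>\<gamma> z\<bar> \<le> g"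
  shows "\<bar>(\<Sum>z\<in>P. \<Sum>z'\<in>P. \<alpha> z * \<gamma> z' * A z z') - (\<Sum>z\<in>P. \<alpha> z * \<gamma> z * d z)\<bar> \<le> (real (card P))\<^sup>2 * (a * g * \<epsilon>)"
proof -
  have "(\<Sum>z\<in>P. \<alpha> z * \<gamma> z * d z) = (\<Sum>z\<in>P. \<Sum>z'\<in>P. \<alpha> z * \<gamma> z' * (if z = z' then d z else 0))"
    using P by (simp add: if_distrib[of "(*) _"] cong: if_cong)
  then have "(\<Sum>z\<in>P. \<Sum>z'\<in>P. \<alpha> z * \<gamma> z' * A z z') - (\<Sum>z\<in>P. \<alpha> z * \<gamma> z * d z)
      = (\<Sum>z\<in>P. \<Sum>z'\<in>P. \<alpha> z * \<gamma> z' * (A z z' - (if z = z' then d z else 0)))"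
    by (simp only: sum_subtractf[symmetric] right_diff_distrib)
  also have "\<bar>\<dots>\<bar> \<le> (\<Sum>z\<in>P. \<Sum>z'\<in>P. a * g * \<epsilon>)"
  proof (intro order_trans[OF sum_abs] sum_mono)
    fix z z' assume z: "z \<in> P" and z': "z' \<in> P"
    have "0 \<le> a" "0 \<le> g" using \<alpha>[OF z] \<gamma>[OF z] by linarith+
    then show "\<bar>\<alpha> z * \<gamma> z' * (A z z' - (if z = z' then d z else 0))\<bar> \<le> a * g * \<epsilon>"
      unfolding abs_mult using A[OF z z'] \<alpha>[OF z] \<gamma>[OF z'] by (intro mult_mono) auto
  qed
  also have "\<dots> = (real (card P))\<^sup>2 * (a * g * \<epsilon>)"
    by (simp add: power2_eq_square)
  finally show ?thesis .
qed

lemma abs_sum_le_card: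
  fixes \<alpha> u :: "'i \<Rightarrow> real"
  assumes "\<And>z. z \<in> P \<Longrightarrow> \<bar>\<alpha> z\<bar> \<le> a" "\<And>z. z \<in> P \<Longrightarrow> \<bar>u z\<bar> \<le> \<epsilon>"
  shows "\<bar>\<Sum>z\<in>P. \<alpha> z * u z\<bar> \<le> real (card P) * (a * \<epsilon>)"
proof -
  have "\<bar>\<Sum>z\<in>P. \<alpha> z * u z\<bar> \<le> (\<Sum>z\<in>P. a * \<epsilon>)"
  proof (intro order_trans[OF sum_abs] sum_mono)
    fix z assume z: "z \<in> P"
    then have "0 \<le> a" using assms(1)[OF z] by linarith
    then show "\<bar>\<alpha> z * u z\<bar> \<le> a * \<epsilon>"
      unfolding abs_mult using assms[OF z] by (intro mult_mono) auto
  qed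
  then show ?thesis by simp
qed

context mixed_exponents
begin

abbreviation "H \<equiv> hardy_space p q"

lemma nrm_syn: "nrm (H N) (syn N a) = cnorm p q N a"
  using hardy_norm_syn[of N a] by (simp add: hardy_space_def)

lemma nrm_coeffs: "f \<in> vecs (H N) \<Longrightarrow> nrm (H N) f = cnorm p q N (haar_coeffs f)"
  using nrm_syn[of N "haar_coeffs f"] by (simp add: syn_coeffs)

text \<open>Pair with a single Haar function, whose square function is at most 1. The constant is
  crude; it is used where constants may depend on the level.\<close>

lemma coeff_bound:
  assumes K: "K \<in> idx N" and L: "L \<in> idx N"
  shows "\<bar>a K L\<bar> \<le> 2 ^ N * 2 ^ N * cnorm p q N a"
proof -
  have "flat2 N (Lv N) (Lv N) (1 * 1) (tens (ind {K}) (ind {L}))"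
    by (intro flat2_tens flat1_ind_level[of _ "length K"] flat1_ind_level[of _ "length L"]) auto
  from pairing_flat[OF this, of a] have "\<bar>pairing N a (tens (ind {K}) (ind {L}))\<bar> \<le> cnorm p q N a"
    by simp
  moreover have "pairing N a (tens (ind {K}) (ind {L})) = a K L / 2 ^ length K / 2 ^ length L"
  proof -
    have "pairing N a (tens (ind {K}) (ind {L}))
        = (\<Sum>K'\<in>idx N. \<Sum>L'\<in>idx N. if L' = L then (if K' = K then a K L / 2 ^ length K / 2 ^ length L else 0) else 0)"
      unfolding pairing_def tens_def ind_def by (intro sum.cong refl) auto
    then show ?thesis using K L by simp
  qed
  ultimately have "\<bar>a K L\<bar> \<le> 2 ^ length K * 2 ^ length L * cnorm p q N a"
    by (simp add: abs_divide field_simps)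
  also have "\<dots> \<le> 2 ^ N * 2 ^ N * cnorm p q N a"
    using K L cnorm_nonneg by (intro mult_right_mono mult_mono power_increasing) auto
  finally show ?thesis .
qed

lemma normed_hardy: "normed_sp (H N)"
  unfolding normed_sp_def
proof (intro conjI ballI allI impI)
  have "vecs (H N) = span {haar2 I J | I J. I \<in> dyadic_upto N \<and> J \<in> dyadic_upto N}"
    by (simp add: hardy_space_def)
  then show sub: "subspace (vecs (H N))"
    by simp
  show "0 \<le> nrm (H N) f" if "f \<in> vecs (H N)" for f
    using that by (simp add: nrm_coeffs cnorm_nonneg)
  show "f = 0" if f: "f \<in> vecs (H N)" "nrm (H N) f = 0" for f
  proof -
    have "syn N (haar_coeffs f) = syn N 0"
    proof (rule syn_cong)
      fix K L assume "K \<in> idx N" "L \<in> idx N"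
      then have "\<bar>haar_coeffs f K L\<bar> \<le> 2 ^ N * 2 ^ N * cnorm p q N (haar_coeffs f)"
        by (rule coeff_bound)
      then show "haar_coeffs f K L = 0 K L"
        using f by (simp add: nrm_coeffs)
    qed
    then show ?thesis
      using linear_0[OF linear_syn] by (simp add: syn_coeffs[OF f(1)])
  qed
  show "nrm (H N) (f + g) \<le> nrm (H N) f + nrm (H N) g" if "f \<in> vecs (H N)" "g \<in> vecs (H N)" for f g
    using that subspace_add[OF sub that] cnorm_add by (simp add: nrm_coeffs haar_coeffs_add[OF that])
  show "nrm (H N) (k *\<^sub>R f) = \<bar>k\<bar> * nrm (H N) f" if "f \<in> vecs (H N)" for f k
    using that subspace_scale[OF sub that] cnorm_scale by (simp add: nrm_coeffs haar_coeffs_scale[OF that])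
qed

lemma bop_of_coeffs:
  assumes "linear \<phi>" "0 \<le> D" "\<And>a. \<bar>\<phi> a\<bar> \<le> D * cnorm p q N a"
  shows "bop (H N) real_line D (\<lambda>f. \<phi> (haar_coeffs f))"
  using assms linear_add[OF assms(1)] linear_scale[OF assms(1)]
  by (simp add: bop_def haar_coeffs_add[of _ p q N] haar_coeffs_scale[of _ p q N] nrm_coeffs)

lemma bop_syn:
  assumes A: "linear A" and "\<And>a. cnorm p q m (A a) \<le> cnorm p q N a"
  shows "bop (H N) (H m) 1 (\<lambda>f. syn m (A (haar_coeffs f)))"
  using assms(2) linear_add[OF A] linear_scale[OF A] linear_add[OF linear_syn] linear_scale[OF linear_syn]
  by (simp add: bop_def haar_coeffs_add[of _ p q N] haar_coeffs_scale[of _ p q N] nrm_coeffs[of _ N] nrm_syn syn_mem)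

lemma syn_expand: "syn N a = (\<Sum>z\<in>idx N \<times> idx N. a (fst z) (snd z) *\<^sub>R haar2 (ivl (fst z)) (ivl (snd z)))"
  by (simp add: syn_def case_prod_unfold)

lemma linear_coeff: "linear (\<lambda>a::bool list \<Rightarrow> bool list \<Rightarrow> real. a K L)"
  by (rule linearI) auto

lemma fdim_hardy: "fdim (H N)"
proof -
  let ?P = "idx N \<times> idx N"
  obtain h where h: "bij_betw h {0..<card ?P} ?P"
    using ex_bij_betw_nat_finite[of ?P] by blast
  have mem: "fst (h i) \<in> idx N" "snd (h i) \<in> idx N" if "i < card ?P" for i
    using bij_betwE[OF h] that by (auto simp: mem_Times_iff simp del: idx_iff)
  have "f = (\<Sum>i<card ?P. haar_coeffs f (fst (h i)) (snd (h i)) *\<^sub>R haar2 (ivl (fst (h i))) (ivl (snd (h i))))"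
    if f: "f \<in> vecs (H N)" for f
  proof -
    have "f = syn N (haar_coeffs f)" by (simp add: syn_coeffs[OF f])
    also have "\<dots> = (\<Sum>i<card ?P. haar_coeffs f (fst (h i)) (snd (h i)) *\<^sub>R haar2 (ivl (fst (h i))) (ivl (snd (h i))))"
      unfolding syn_expand atLeast0LessThan[symmetric] by (rule sum.reindex_bij_betw[OF h, symmetric])
    finally show ?thesis .
  qed
  then have "coord_system (H N) (card ?P) (\<lambda>i. haar2 (ivl (fst (h i))) (ivl (snd (h i))))
      (\<lambda>i f. haar_coeffs f (fst (h i)) (snd (h i))) (\<lambda>_. 2 ^ N * 2 ^ N)"
    unfolding coord_system_def using mem
    by (auto intro!: haar2_mem bop_of_coeffs[of "\<lambda>a. a _ _"] linear_coeff coeff_bound simp del: idx_iff)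
  then show ?thesis
    by (auto simp: fdim_def)
qed

text \<open>Integration against the Haar sum with coefficients \<open>g\<close>. By
  \<open>functional_coordinates\<close> every element of the dual has this form, so the dual is
  parametrised by the same coefficient arrays as the space.\<close>

definition functional :: "nat \<Rightarrow> (bool list \<Rightarrow> bool list \<Rightarrow> real) \<Rightarrow> (real \<Rightarrow> real \<Rightarrow> real) \<Rightarrow> real" where
  "functional N g = pullback (H N) haar_coeffs (\<lambda>a. pairing N a g)"

lemma functional_bound:
  assumes "0 \<le> D" "\<And>u. \<bar>pairing N u g\<bar> \<le> D * cnorm p q N u"
  shows "functional N g \<in> vecs (dual_space (H N))" "nrm (dual_space (H N)) (functional N g) \<le> D"
  unfolding functional_def
  by (rule pullback_dual[where \<psi> = "\<lambda>a. pairing N a g" and R = haar_coeffs, OF normed_hardy bop_of_coeffs[OF linear_pairing(1) assms]])+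

lemma functional_mem: "functional N g \<in> vecs (dual_space (H N))"
proof (rule functional_bound)
  let ?D = "\<Sum>K\<in>idx N. \<Sum>L\<in>idx N. 2 ^ N * 2 ^ N * \<bar>g K L\<bar>"
  show "0 \<le> ?D" by (intro sum_nonneg) auto
  fix u
  have "\<bar>pairing N u g\<bar> \<le> (\<Sum>K\<in>idx N. \<Sum>L\<in>idx N. 2 ^ N * 2 ^ N * \<bar>g K L\<bar> * cnorm p q N u)"
    unfolding pairing_def
  proof (intro order_trans[OF sum_abs] sum_mono)
    fix K L assume KL: "K \<in> idx N" "L \<in> idx N"
    have "\<bar>u K L * g K L / 2 ^ length K / 2 ^ length L\<bar> \<le> \<bar>u K L * g K L\<bar>"
      by (simp add: abs_divide field_simps mult_le_cancel_left1 flip: power_add)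
    also have "\<dots> \<le> 2 ^ N * 2 ^ N * cnorm p q N u * \<bar>g K L\<bar>"
      unfolding abs_mult using coeff_bound[OF KL, of u] by (intro mult_right_mono) auto
    finally show "\<bar>u K L * g K L / 2 ^ length K / 2 ^ length L\<bar> \<le> 2 ^ N * 2 ^ N * \<bar>g K L\<bar> * cnorm p q N u"
      by (simp only: mult_ac)
  qed
  then show "\<bar>pairing N u g\<bar> \<le> ?D * cnorm p q N u"
    by (simp only: sum_distrib_right)
qed

lemma linear_functional: "linear (functional N)"
  by (rule linearI) (auto simp: functional_def pullback_def fun_eq_iff linear_add[OF linear_pairing(2)] linear_scale[OF linear_pairing(2)])

lemma linear_bop_comp:
  assumes "bop X real_line B \<phi>" "linear F" "\<And>a. F a \<in> vecs X"
  shows "linear (\<lambda>a. \<phi> (F a))"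
  by (rule linearI) (simp_all add: linear_add[OF assms(2)] linear_scale[OF assms(2)]
      bopD(3)[OF assms(1) assms(3) assms(3)] bopD(4)[OF assms(1) assms(3)])

lemma dual_form_bilin:
  assumes t: "dual_form (H N) \<Gamma> t"
  shows "bilin (\<lambda>f g. t (syn N f) (functional N g))" "form2_bd N \<Gamma> (\<lambda>f g. t (syn N f) (functional N g))"
proof -
  have 1: "bop (H N) real_line (\<Gamma> * nrm (dual_space (H N)) (functional N g)) (\<lambda>x. t x (functional N g))" for g
    using t functional_mem by (simp add: dual_form_def)
  have 2: "bop (dual_space (H N)) real_line (\<Gamma> * nrm (H N) (syn N f)) (t (syn N f))" for f
    using t syn_mem by (simp add: dual_form_def)
  show "bilin (\<lambda>f g. t (syn N f) (functional N g))"
    unfolding bilin_def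
    using linear_bop_comp[OF 1 linear_syn syn_mem] linear_bop_comp[OF 2 linear_functional functional_mem] by auto
  have \<Gamma>: "0 \<le> \<Gamma>" using t by (simp add: dual_form_def)
  then show "form2_bd N \<Gamma> (\<lambda>f g. t (syn N f) (functional N g))"
  proof (rule form2_bdI)
    fix f g D assume D: "0 \<le> D" "\<And>u. \<bar>pairing N u g\<bar> \<le> D * cnorm p q N u"
    have "\<bar>t (syn N f) (functional N g)\<bar> \<le> \<Gamma> * cnorm p q N f * nrm (dual_space (H N)) (functional N g)"
      using bopD(5)[OF 2 functional_mem] by (simp add: nrm_syn)
    also have "\<dots> \<le> \<Gamma> * cnorm p q N f * D"
      using functional_bound(2)[OF D] \<Gamma> cnorm_nonneg by (intro mult_left_mono) auto
    finally show "\<bar>t (syn N f) (functional N g)\<bar> \<le> \<Gamma> * cnorm p q N f * D" .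
  qed
qed

lemma func2_bd_syn:
  assumes \<phi>: "bop (H N) real_line \<Gamma> \<phi>"
  shows "linear (\<lambda>f. \<phi> (syn N f)) \<and> func2_bd N \<Gamma> (\<lambda>f. \<phi> (syn N f))"
  unfolding func2_bd_def
proof (intro conjI allI impI, rule linear_bop_comp[OF \<phi> linear_syn syn_mem], elim conjE)
  fix G f assume f: "0 \<le> G" "flat2 N (Lv N) (Lv N) G f"
  have "\<bar>\<phi> (syn N f)\<bar> \<le> \<Gamma> * cnorm p q N f"
    using bopD(5)[OF \<phi> syn_mem] by (simp add: nrm_syn)
  also have "\<dots> \<le> \<Gamma> * G"
    using cnorm_flat[OF f(2,1)] bopD(1)[OF \<phi>] by (intro mult_left_mono) auto
  finally show "\<bar>\<phi> (syn N f)\<bar> \<le> \<Gamma> * G" .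
qed

lemma func2_bd_functional:
  assumes w: "bop (dual_space (H N)) real_line \<Gamma> w"
  shows "linear (\<lambda>g. w (functional N g)) \<and> func2_bd N \<Gamma> (\<lambda>g. w (functional N g))"
  unfolding func2_bd_def
proof (intro conjI allI impI, rule linear_bop_comp[OF w linear_functional functional_mem], elim conjE)
  fix G g assume g: "0 \<le> G" "flat2 N (Lv N) (Lv N) G g"
  have "\<bar>w (functional N g)\<bar> \<le> \<Gamma> * nrm (dual_space (H N)) (functional N g)"
    using bopD(5)[OF w functional_mem] by simp
  also have "\<dots> \<le> \<Gamma> * G"
    using pairing_flat[OF g(2,1)] bopD(1)[OF w] by (intro mult_left_mono functional_bound(2) g(1)) auto
  finally show "\<bar>w (functional N g)\<bar> \<le> \<Gamma> * G" .
qed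

text \<open>The factors 2^length I and 2^length J cancel the normalisation of the Haar functions in
  \<open>pairing\<close>.\<close>

lemma functional_coordinates:
  assumes \<psi>: "\<psi> \<in> vecs (dual_space (H n))" and x: "x \<in> vecs (H n)"
  shows "\<psi> x = pairing n (haar_coeffs x) (\<lambda>I J. 2 ^ length I * 2 ^ length J * \<psi> (haar2 (ivl I) (ivl J)))"
proof -
  note b = dual_bop[OF normed_hardy \<psi>]
  have m: "haar2 (ivl (fst z)) (ivl (snd z)) \<in> vecs (H n)" if "z \<in> idx n \<times> idx n" for z
    using that by (intro haar2_mem) auto
  interpret normed_sp_loc "H n" by standard (rule normed_hardy)
  have "\<psi> x = \<psi> (\<Sum>z\<in>idx n \<times> idx n. haar_coeffs x (fst z) (snd z) *\<^sub>R haar2 (ivl (fst z)) (ivl (snd z)))"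
    using syn_expand[of n "haar_coeffs x"] by (simp only: syn_coeffs[OF x])
  also have "\<dots> = (\<Sum>z\<in>idx n \<times> idx n. \<psi> (haar_coeffs x (fst z) (snd z) *\<^sub>R haar2 (ivl (fst z)) (ivl (snd z))))"
    using m by (intro bop_sum[OF b normed_hardy] scale_mem)
  also have "\<dots> = (\<Sum>z\<in>idx n \<times> idx n. haar_coeffs x (fst z) (snd z) * \<psi> (haar2 (ivl (fst z)) (ivl (snd z))))"
    using bopD(4)[OF b m] by (intro sum.cong refl) simp
  finally show ?thesis
    by (simp add: pairing_def sum.cartesian_product case_prod_unfold)
qed

text \<open>In coefficients, \<open>t\<close> becomes a form on two arrays and
  \<open>two_parameter\<close> applies. \<open>S\<close> and \<open>R\<close> come from
  \<open>lift\<close> and \<open>rest\<close>. Since these are adjoint, the adjoint of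
  \<open>R\<close> also lifts coefficient arrays, and both arguments of the form are expanded in the
  same blocks. Entrywise closeness becomes closeness in norm at the price of constants depending
  only on \<open>n\<close>.\<close>

lemma local_form_factor_hardy: "local_form_factor H"
  unfolding local_form_factor_def
proof (intro allI impI)
  fix n M and \<Gamma> \<epsilon> :: real assume \<epsilon>: "0 < \<epsilon>"
  let ?P = "idx n \<times> idx n"
  let ?e = "\<lambda>z. haar2 (ivl (fst z)) (ivl (snd z))"
  interpret Hn: normed_sp_loc "H n" by standard (rule normed_hardy)
  interpret Dn: normed_sp_loc "dual_space (H n)" by standard (rule normed_sp_dual[OF normed_hardy])
  have P: "finite ?P" by simp
  have emem: "?e z \<in> vecs (H n)" if "z \<in> ?P" for z
    using that by (intro haar2_mem) auto
  \<comment> \<open>\<open>c\<close> bounds coefficients and dual weights, \<open>\<rho>\<close> the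
    norms of the Haar functions, \<open>k\<close> counts them. The three main terms of
    \<open>m\<close> are the losses in the estimates for \<open>\<psi>\<close> and \<open>x\<close>
    together, for \<open>\<Phi>\<close> and for \<open>W\<close>; the summand 1 keeps
    \<open>m\<close> positive. All are known before \<open>N0\<close> is obtained.\<close>
  define c where "c = (2 ^ n * 2 ^ n :: real)"
  define \<rho> where "\<rho> = (\<Sum>z\<in>?P. nrm (H n) (?e z))"
  define k where "k = real (card ?P)"
  have pos: "0 \<le> c" "0 \<le> \<rho>" "0 \<le> k"
    using emem by (auto simp: c_def \<rho>_def k_def intro!: sum_nonneg)
  define m where "m = k\<^sup>2 * (c * (c * \<rho>)) + k * c + k * (c * \<rho>) + 1"
  have terms: "0 \<le> k\<^sup>2 * (c * (c * \<rho>))" "0 \<le> k * c" "0 \<le> k * (c * \<rho>)"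
    using pos by auto
  then have m: "0 < m" "k\<^sup>2 * (c * (c * \<rho>)) \<le> m" "k * c \<le> m" "k * (c * \<rho>) \<le> m"
    unfolding m_def by linarith+
  have \<delta>: "0 < \<epsilon> / m" using \<epsilon> m by simp
  have small: "u * (\<epsilon> / m) \<le> \<epsilon>" if "u \<le> m" for u
    using mult_right_mono[OF that, of "\<epsilon> / m"] \<delta> m(1) by simp
  show "\<exists>N0. \<forall>N\<ge>N0. local_form_factor_at H n N \<Gamma> M \<epsilon>"
  proof (cases "0 \<le> \<Gamma>")
    \<comment> \<open>For negative \<open>\<Gamma>\<close> there is no form to consider, as
      \<open>dual_form\<close> contains 0 \<le> \<Gamma>.\<close>
    case False
    then show ?thesis
      by (auto simp: local_form_factor_at_def dual_form_def)
  next
    case True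
    obtain N0 where N0: "\<And>N t \<Psi>. N0 \<le> N \<Longrightarrow> bilin t \<Longrightarrow> form2_bd N \<Gamma> t \<Longrightarrow> finite \<Psi> \<Longrightarrow> card \<Psi> \<le> M + M \<Longrightarrow>
      (\<And>\<psi>. \<psi> \<in> \<Psi> \<Longrightarrow> linear \<psi> \<and> func2_bd N \<Gamma> \<psi>) \<Longrightarrow>
      \<exists>B \<tau> \<kappa> C \<sigma> \<nu> l. block_system n N B \<tau> \<kappa> \<and> block_system n N C \<sigma> \<nu> \<and>
        (\<forall>I\<in>idx n. \<forall>J\<in>idx n. \<forall>I'\<in>idx n. \<forall>J'\<in>idx n.
          \<bar>t (tens (ind (B I)) (ind (C J))) (tens (ind (B I')) (ind (C J')))
            - (if I = I' \<and> J = J' then l / 2 ^ length I / 2 ^ length J else 0)\<bar> \<le> \<epsilon> / m) \<and>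
        (\<forall>\<psi>\<in>\<Psi>. \<forall>I\<in>idx n. \<forall>J\<in>idx n. \<bar>\<psi> (tens (ind (B I)) (ind (C J)))\<bar> \<le> \<epsilon> / m)"
      by (rule two_parameter[OF \<delta> True, of "M + M" n]) (erule that)
    have "local_form_factor_at H n N \<Gamma> M \<epsilon>" if N: "N0 \<le> N" for N
      unfolding local_form_factor_at_def
    proof (intro allI impI, elim conjE)
      fix t \<Phi> W
      assume t: "dual_form (H N) \<Gamma> t" and \<Phi>: "finite \<Phi>" "card \<Phi> \<le> M" "\<forall>\<phi>\<in>\<Phi>. bop (H N) real_line \<Gamma> \<phi>"
        and W: "finite W" "card W \<le> M" "\<forall>w\<in>W. bop (dual_space (H N)) real_line \<Gamma> w"
      let ?t = "\<lambda>f g. t (syn N f) (functional N g)"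
      let ?\<Phi> = "(\<lambda>\<phi> f. \<phi> (syn N f)) ` \<Phi>" and ?W = "(\<lambda>w g. w (functional N g)) ` W"
      have cards: "finite (?\<Phi> \<union> ?W)" "card (?\<Phi> \<union> ?W) \<le> M + M"
      proof -
        show "finite (?\<Phi> \<union> ?W)" using \<Phi>(1) W(1) by simp
        have "card (?\<Phi> \<union> ?W) \<le> card ?\<Phi> + card ?W" by (rule card_Un_le)
        also have "\<dots> \<le> card \<Phi> + card W" by (intro add_mono card_image_le \<Phi>(1) W(1))
        finally show "card (?\<Phi> \<union> ?W) \<le> M + M" using \<Phi>(2) W(2) by linarith
      qed
      have lin: "linear \<psi> \<and> func2_bd N \<Gamma> \<psi>" if "\<psi> \<in> ?\<Phi> \<union> ?W" for \<psi>
        using that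
      proof
        assume "\<psi> \<in> ?\<Phi>"
        then obtain \<phi> where "\<phi> \<in> \<Phi>" "\<psi> = (\<lambda>f. \<phi> (syn N f))" by blast
        then show ?thesis using \<Phi>(3) func2_bd_syn by blast
      next
        assume "\<psi> \<in> ?W"
        then obtain w where "w \<in> W" "\<psi> = (\<lambda>g. w (functional N g))" by blast
        then show ?thesis using W(3) func2_bd_functional by blast
      qed
      obtain B \<tau> \<kappa> C \<sigma> \<nu> l where blocks: "block_system n N B \<tau> \<kappa>" "block_system n N C \<sigma> \<nu>"
        and diag: "\<forall>I\<in>idx n. \<forall>J\<in>idx n. \<forall>I'\<in>idx n. \<forall>J'\<in>idx n.
          \<bar>?t (tens (ind (B I)) (ind (C J))) (tens (ind (B I')) (ind (C J')))
            - (if I = I' \<and> J = J' then l / 2 ^ length I / 2 ^ length J else 0)\<bar> \<le> \<epsilon> / m"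
        and kill: "\<forall>\<psi>\<in>?\<Phi> \<union> ?W. \<forall>I\<in>idx n. \<forall>J\<in>idx n. \<bar>\<psi> (tens (ind (B I)) (ind (C J)))\<bar> \<le> \<epsilon> / m"
      proof -
        have "\<exists>B \<tau> \<kappa> C \<sigma> \<nu> l. block_system n N B \<tau> \<kappa> \<and> block_system n N C \<sigma> \<nu> \<and>
          (\<forall>I\<in>idx n. \<forall>J\<in>idx n. \<forall>I'\<in>idx n. \<forall>J'\<in>idx n.
            \<bar>?t (tens (ind (B I)) (ind (C J))) (tens (ind (B I')) (ind (C J')))
              - (if I = I' \<and> J = J' then l / 2 ^ length I / 2 ^ length J else 0)\<bar> \<le> \<epsilon> / m) \<and>
          (\<forall>\<psi>\<in>?\<Phi> \<union> ?W. \<forall>I\<in>idx n. \<forall>J\<in>idx n. \<bar>\<psi> (tens (ind (B I)) (ind (C J)))\<bar> \<le> \<epsilon> / m)"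
          by (rule N0[OF N dual_form_bilin[OF t] cards]) (rule lin)
        then show thesis
          by (elim exE conjE) (rule that)
      qed
      interpret b: block_pair_norm n N B \<tau> \<kappa> C \<sigma> \<nu> p q
        by (intro block_pair_norm.intro block_pair.intro blocks) unfold_locales
      let ?b = "\<lambda>z. tens (ind (B (fst z))) (ind (C (snd z)))"
      have kill\<Phi>: "\<bar>\<phi> (syn N (?b z))\<bar> \<le> \<epsilon> / m" if "\<phi> \<in> \<Phi>" "z \<in> ?P" for \<phi> z
        using kill that by (simp add: ball_Un mem_Times_iff del: idx_iff)
      have killW: "\<bar>w (functional N (?b z))\<bar> \<le> \<epsilon> / m" if "w \<in> W" "z \<in> ?P" for w z
        using kill that by (simp add: ball_Un mem_Times_iff del: idx_iff)
      define S where "S = (\<lambda>f. syn N (b.lift (haar_coeffs f)))"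
      define R where "R = (\<lambda>f. syn n (b.rest (haar_coeffs f)))"
      have S: "bop (H n) (H N) 1 S"
        unfolding S_def by (rule bop_syn[OF b.linear_lift]) (simp add: b.cnorm_lift)
      have R: "bop (H N) (H n) 1 R"
        unfolding R_def by (rule bop_syn[OF b.linear_rest b.cnorm_rest])
      have rest_cong: "b.rest (haar_coeffs (syn N a)) I J = b.rest a I J" if "I \<in> idx n" "J \<in> idx n" for a I J
      proof -
        have "K \<in> idx N" if "K \<in> B I" for K using b.B.B_idx[OF \<open>I \<in> idx n\<close>] that by blast
        moreover have "L \<in> idx N" if "L \<in> C J" for L using b.C.B_idx[OF \<open>J \<in> idx n\<close>] that by blast
        ultimately show ?thesis
          by (simp add: b.rest_def haar_coeffs_syn del: idx_iff cong: sum.cong)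
      qed
      have RS: "R (S x) = x" if x: "x \<in> vecs (H n)" for x
      proof -
        have "R (S x) = syn n (haar_coeffs x)"
          unfolding R_def S_def by (rule syn_cong) (simp add: rest_cong b.rest_lift del: idx_iff)
        then show ?thesis by (simp add: syn_coeffs[OF x])
      qed
      have lift: "b.lift a = (\<Sum>z\<in>?P. a (fst z) (snd z) *\<^sub>R ?b z)" for a
        by (simp add: fun_eq_iff b.lift_def sum_fun_apply tens_def sum_distrib_left sum.cartesian_product
            case_prod_unfold mult_ac)
      have a_bd: "\<bar>haar_coeffs x (fst z) (snd z)\<bar> \<le> c * nrm (H n) x" if "x \<in> vecs (H n)" "z \<in> ?P" for x z
        using coeff_bound[of "fst z" n "snd z" "haar_coeffs x"] that by (simp add: nrm_coeffs c_def mem_Times_iff del: idx_iff)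
      have S\<Phi>: "\<bar>\<phi> (S x)\<bar> \<le> \<epsilon> * nrm (H n) x" if x: "x \<in> vecs (H n)" and \<phi>: "\<phi> \<in> \<Phi>" for x \<phi>
      proof -
        have lin\<phi>: "linear (\<lambda>f. \<phi> (syn N f))"
          using func2_bd_syn \<Phi>(3) \<phi> by blast
        have "\<phi> (S x) = (\<Sum>z\<in>?P. haar_coeffs x (fst z) (snd z) * \<phi> (syn N (?b z)))"
          unfolding S_def lift linear_sum[OF lin\<phi>] linear_scale[OF lin\<phi>] by simp
        also have "\<bar>\<dots>\<bar> \<le> k * (c * nrm (H n) x * (\<epsilon> / m))"
          unfolding k_def using kill\<Phi>[OF \<phi>] by (intro abs_sum_le_card a_bd[OF x])
        also have "\<dots> = k * c * (\<epsilon> / m) * nrm (H n) x"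
          by (simp only: mult_ac)
        also have "\<dots> \<le> \<epsilon> * nrm (H n) x"
          using x by (intro mult_right_mono small m) auto
        finally show ?thesis .
      qed
      \<comment> \<open>The coefficient array that represents \<open>\<psi>\<close> in the sense of
        \<open>functional_coordinates\<close>.\<close>
      define g where "g \<psi> = (\<lambda>I J. 2 ^ length I * 2 ^ length J * \<psi> (haar2 (ivl I) (ivl J)) :: real)" for \<psi>
      have g_bd: "\<bar>g \<psi> (fst z) (snd z)\<bar> \<le> c * \<rho> * nrm (dual_space (H n)) \<psi>"
        if \<psi>: "\<psi> \<in> vecs (dual_space (H n))" and z: "z \<in> ?P" for \<psi> z
      proof -
        have "\<bar>\<psi> (?e z)\<bar> \<le> nrm (dual_space (H n)) \<psi> * nrm (H n) (?e z)"
          using bopD(5)[OF dual_bop[OF normed_hardy \<psi>] emem[OF z]] by simp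
        also have "\<dots> \<le> nrm (dual_space (H n)) \<psi> * \<rho>"
          unfolding \<rho>_def using \<psi> z emem by (intro mult_left_mono member_le_sum) auto
        finally have "\<bar>\<psi> (?e z)\<bar> \<le> nrm (dual_space (H n)) \<psi> * \<rho>" .
        moreover have "2 ^ length (fst z) * 2 ^ length (snd z) \<le> c"
          unfolding c_def using z by (intro mult_mono power_increasing) auto
        ultimately have "2 ^ length (fst z) * 2 ^ length (snd z) * \<bar>\<psi> (?e z)\<bar> \<le> c * (nrm (dual_space (H n)) \<psi> * \<rho>)"
          using pos by (intro mult_mono) auto
        then show ?thesis
          by (simp add: g_def abs_mult mult_ac)
      qed
      \<comment> \<open>Adjointness of \<open>rest\<close> and \<open>lift\<close>: the functional
        pulled back to the large space has the lifted array as its coefficients, so it is a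
        combination of the same block functions \<open>?b z\<close>.\<close>
      have pull: "pullback (H N) R \<psi> = functional N (b.lift (g \<psi>))" if \<psi>: "\<psi> \<in> vecs (dual_space (H n))" for \<psi>
      proof
        fix y
        show "pullback (H N) R \<psi> y = functional N (b.lift (g \<psi>)) y"
        proof (cases "y \<in> vecs (H N)")
          case True
          have "\<psi> (R y) = pairing n (haar_coeffs (R y)) (g \<psi>)"
            unfolding g_def by (rule functional_coordinates[OF \<psi> bopD(2)[OF R True]])
          also have "\<dots> = pairing n (b.rest (haar_coeffs y)) (g \<psi>)"
            unfolding R_def by (rule pairing_cong) (simp add: haar_coeffs_syn)
          also have "\<dots> = pairing N (haar_coeffs y) (b.lift (g \<psi>))"
            by (rule b.pairing_rest)
          finally show ?thesis
            using True by (simp add: functional_def pullback_apply)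
        qed (simp add: functional_def pullback_def)
      qed
      have dual_t: "\<bar>t (S x) (pullback (H N) R \<psi>) - l * \<psi> x\<bar> \<le> \<epsilon> * nrm (H n) x * nrm (dual_space (H n)) \<psi>"
        if \<psi>: "\<psi> \<in> vecs (dual_space (H n))" and x: "x \<in> vecs (H n)" for x \<psi>
      proof -
        let ?\<alpha> = "\<lambda>z. haar_coeffs x (fst z) (snd z)" and ?\<gamma> = "\<lambda>z. g \<psi> (fst z) (snd z)"
        have sc: "?t (u *\<^sub>R f) (v *\<^sub>R h) = u * v * ?t f h" for u v f h
          using dual_form_bilin(1)[OF t] linear_scale[of "\<lambda>f. ?t f _"] linear_scale[of "?t _"]
          unfolding bilin_def by simp
        have 1: "t (S x) (pullback (H N) R \<psi>) = (\<Sum>z\<in>?P. \<Sum>z'\<in>?P. ?\<alpha> z * ?\<gamma> z' * ?t (?b z) (?b z'))"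
          unfolding pull[OF \<psi>] S_def lift bilin_sum[OF dual_form_bilin(1)[OF t]] sc ..
        have 2: "l * \<psi> x = (\<Sum>z\<in>?P. ?\<alpha> z * ?\<gamma> z * (l / 2 ^ length (fst z) / 2 ^ length (snd z)))"
          unfolding functional_coordinates[OF \<psi> x] pairing_def g_def
          by (simp add: sum.cartesian_product case_prod_unfold sum_distrib_left mult_ac)
        have "\<bar>t (S x) (pullback (H N) R \<psi>) - l * \<psi> x\<bar>
            \<le> (real (card ?P))\<^sup>2 * (c * nrm (H n) x * (c * \<rho> * nrm (dual_space (H n)) \<psi>) * (\<epsilon> / m))"
          unfolding 1 2
        proof (rule double_sum_diagonal_close[OF P _ a_bd[OF x] g_bd[OF \<psi>]])
          fix z z' assume z: "z \<in> ?P" and z': "z' \<in> ?P"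
          have "(if z = z' then l / 2 ^ length (fst z) / 2 ^ length (snd z) else 0)
              = (if fst z = fst z' \<and> snd z = snd z' then l / 2 ^ length (fst z) / 2 ^ length (snd z) else 0)"
            by (simp add: prod_eq_iff)
          then show "\<bar>?t (?b z) (?b z') - (if z = z' then l / 2 ^ length (fst z) / 2 ^ length (snd z) else 0)\<bar> \<le> \<epsilon> / m"
            using diag z z' by (simp add: mem_Times_iff del: idx_iff)
        qed auto
        also have "\<dots> = (k\<^sup>2 * (c * (c * \<rho>)) * (\<epsilon> / m)) * (nrm (H n) x * nrm (dual_space (H n)) \<psi>)"
          unfolding k_def by (simp only: mult_ac)
        also have "\<dots> \<le> \<epsilon> * (nrm (H n) x * nrm (dual_space (H n)) \<psi>)"
          using x \<psi> by (intro mult_right_mono small m) auto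
        finally show ?thesis
          by (simp only: mult.assoc)
      qed
      have dual_w: "\<bar>w (pullback (H N) R \<psi>)\<bar> \<le> \<epsilon> * nrm (dual_space (H n)) \<psi>"
        if \<psi>: "\<psi> \<in> vecs (dual_space (H n))" and w: "w \<in> W" for \<psi> w
      proof -
        have linw: "linear (\<lambda>g. w (functional N g))"
          using func2_bd_functional W(3) w by blast
        have "w (pullback (H N) R \<psi>) = (\<Sum>z\<in>?P. g \<psi> (fst z) (snd z) * w (functional N (?b z)))"
          unfolding pull[OF \<psi>] lift linear_sum[OF linw] linear_scale[OF linw] by simp
        also have "\<bar>\<dots>\<bar> \<le> k * (c * \<rho> * nrm (dual_space (H n)) \<psi> * (\<epsilon> / m))"
          unfolding k_def using killW[OF w] by (intro abs_sum_le_card g_bd[OF \<psi>])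
        also have "\<dots> = k * (c * \<rho>) * (\<epsilon> / m) * nrm (dual_space (H n)) \<psi>"
          by (simp only: mult_ac)
        also have "\<dots> \<le> \<epsilon> * nrm (dual_space (H n)) \<psi>"
          using \<psi> by (intro mult_right_mono small m) auto
        finally show ?thesis .
      qed
      show "\<exists>R S l. bop (H N) (H n) 1 R \<and> bop (H n) (H N) 1 S \<and>
        (\<forall>x\<in>vecs (H n). R (S x) = x \<and> (\<forall>\<phi>\<in>\<Phi>. \<bar>\<phi> (S x)\<bar> \<le> \<epsilon> * nrm (H n) x)) \<and>
        (\<forall>\<psi>\<in>vecs (dual_space (H n)).
          (\<forall>x\<in>vecs (H n). \<bar>t (S x) (pullback (H N) R \<psi>) - l * \<psi> x\<bar> \<le> \<epsilon> * nrm (H n) x * nrm (dual_space (H n)) \<psi>) \<and>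
          (\<forall>w\<in>W. \<bar>w (pullback (H N) R \<psi>)\<bar> \<le> \<epsilon> * nrm (dual_space (H n)) \<psi>))"
        by (intro exI[of _ R] exI[of _ S] exI[of _ l] conjI ballI R S RS S\<Phi> dual_t dual_w)
    qed
    then show ?thesis by blast
  qed
qed

end

text \<open>The sum in the theorem starts with the space of index 1. A threshold for the unshifted
  family remains one after the shift, because Suc N \<ge> N.\<close>

lemma local_form_factor_Suc:
  assumes "local_form_factor Y"
  shows "local_form_factor (\<lambda>n. Y (Suc n))"
  unfolding local_form_factor_def
proof (intro allI impI)
  fix n M and \<Gamma> \<epsilon> :: real assume "0 < \<epsilon>"
  then obtain N0 where "\<And>N. N0 \<le> N \<Longrightarrow> local_form_factor_at Y (Suc n) N \<Gamma> M \<epsilon>"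
    using assms unfolding local_form_factor_def by blast
  then have "\<forall>N\<ge>N0. local_form_factor_at Y (Suc n) (Suc N) \<Gamma> M \<epsilon>"
    by simp
  then show "\<exists>N0. \<forall>N\<ge>N0. local_form_factor_at (\<lambda>n. Y (Suc n)) n N \<Gamma> M \<epsilon>"
    unfolding local_form_factor_at_def by blast
qed

theorem theorem2p1:
  fixes p q \<eta> :: real and r :: ereal
  assumes "1 \<le> p" and "1 \<le> q" and "1 \<le> r" and "0 < \<eta>"
  shows "(let X = lr_sum r (\<lambda>n. hardy_space p q (Suc n)) in
           \<forall>T. bounded_op X X T \<longrightarrow>
             (\<exists>R S. bounded_op X X R \<and> bounded_op X X S \<and>
                (\<exists>H \<in> {T, \<lambda>x. x - T x}. \<forall>x\<in>vecs X. R (H (S x)) = x) \<and>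
                op_norm X X R * op_norm X X S \<le> 2 + \<eta>)) \<and>
         (let X = lr_sum r (\<lambda>n. dual_space (hardy_space p q (Suc n))) in
           \<forall>T. bounded_op X X T \<longrightarrow>
             (\<exists>R S. bounded_op X X R \<and> bounded_op X X S \<and>
                (\<exists>H \<in> {T, \<lambda>x. x - T x}. \<forall>x\<in>vecs X. R (H (S x)) = x) \<and>
                op_norm X X R * op_norm X X S \<le> 2 + \<eta>))"
proof -
  interpret mixed_exponents p q by standard fact+
  have form: "local_form_factor (\<lambda>n. H (Suc n))"
    by (rule local_form_factor_Suc[OF local_form_factor_hardy])
  note dual = normed_sp_dual[OF normed_hardy]
  interpret H: lr_family r "\<lambda>n. H (Suc n)"
    by unfold_locales (rule assms(3) normed_hardy)+
  interpret D: lr_family r "\<lambda>n. dual_space (H (Suc n))"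
    by unfold_locales (rule dual)
  show ?thesis
    unfolding Let_def
    using H.factor_through_lr_sum[OF _ assms(4) fdim_hardy local_factor_of_forms[OF normed_hardy fdim_hardy form]]
      D.factor_through_lr_sum[OF _ assms(4) fdim_dual[OF normed_hardy fdim_hardy] local_factor_dual_of_forms[OF normed_hardy form]]
    by blast
qed

end
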